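(* Let $\widetilde{\mathcal{C}}$ be a generic arrangement of $m\ge2$ full-rank $2\times2$ matrices and $\widehat{\mathcal{C}}$ a generic arrangement of $m\ge 3$ full-rank $2\times3$ matrices. Then (1) $\mathrm{EDD}(\mathcal{M}^{1,1}_{\widetilde{\mathcal{C}}})=3m-2$, and (2) $\mathrm{EDD}(\mathcal{M}^{2,1}_{\widehat{\mathcal{C}}})=\frac92m^2-\frac{19}{2}m+3$.
   Context: For an arrangement $\widetilde{\mathcal{C}}=(\widetilde C_1,\ldots,\widetilde C_m)$ of full-rank $2\times2$ complex matrices, $\mathcal{M}^{1,1}_{\widetilde{\mathcal{C}}}\subseteq(\mathbb{P}^1)^m$ is the Zariski closure of the image of $\mathbb{P}^1\ni Y\mapsto(\widetilde C_1Y,\ldots,\widetilde C_mY)$. For an arrangement $\widehat{\mathcal{C}}$ of full-rank $2\times3$ matrices, $\mathcal{M}^{2,1}_{\widehat{\mathcal{C}}}\subseteq(\mathbb{P}^1)^m$ is the Zariski closure of the image of $\mathbb{P}^2\dashrightarrow(\mathbb{P}^1)^m$, $Y\mapsto(\widehat C_1Y,\ldots,\widehat C_mY)$. For a variety $\mathcal{V}\subseteq(\mathbb{P}^1)^m$, $\mathrm{EDD}(\mathcal{V})$ is the affine Euclidean distance degree: fixing an affine chart $\mathbb{C}\subseteq\mathbb{P}^1$ in each factor and $V=\mathcal{V}\cap\mathbb{C}^m$, it is the number of complex critical points on the smooth locus of $V$ of $z\mapsto\sum_{i=1}^m(u_i-z_i)^2$ for generic $u\in\mathbb{C}^m$. "Generic"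 means outside a proper Zariski closed subset. *)

theory Defs
  imports "HOL-Analysis.Analysis"
begin

definition cspace :: "nat \<Rightarrow> (nat \<Rightarrow> complex) set" where
  "cspace n = {x. \<forall>i\<ge>n. x i = 0}"

inductive_set poly_fun :: "nat \<Rightarrow> ((nat \<Rightarrow> complex) \<Rightarrow> complex) set" for n :: nat where
  pconst: "(\<lambda>x. c) \<in> poly_fun n"
| pvar: "i < n \<Longrightarrow> (\<lambda>x. x i) \<in> poly_fun n"
| padd: "f \<in> poly_fun n \<Longrightarrow> g \<in> poly_fun n \<Longrightarrow> (\<lambda>x. f x + g x) \<in> poly_fun n"
| pmult: "f \<in> poly_fun n \<Longrightarrow> g \<in> poly_fun n \<Longrightarrow> (\<lambda>x. f x * g x) \<in> poly_fun n"

definition zariski_closed :: "nat \<Rightarrow> (nat \<Rightarrow> complex) set \<Rightarrow> bool" where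
  "zariski_closed n A \<longleftrightarrow> (\<exists>F \<subseteq> poly_fun n. A = {x \<in> cspace n. \<forall>f\<in>F. f x = 0})"

definition zariski_closure :: "nat \<Rightarrow> (nat \<Rightarrow> complex) set \<Rightarrow> (nat \<Rightarrow> complex) set" where
  "zariski_closure n S = \<Inter>{A. zariski_closed n A \<and> S \<subseteq> A}"

definition vanishing_ideal :: "nat \<Rightarrow> (nat \<Rightarrow> complex) set \<Rightarrow> ((nat \<Rightarrow> complex) \<Rightarrow> complex) set" where
  "vanishing_ideal n V = {f \<in> poly_fun n. \<forall>x\<in>V. f x = 0}"

definition partial :: "((nat \<Rightarrow> complex) \<Rightarrow> complex) \<Rightarrow> nat \<Rightarrow> (nat \<Rightarrow> complex) \<Rightarrow> complex" where
  "partial f i z = deriv (\<lambda>t. f (z(i := t))) (z i)"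

text \<open>There are k elements of I(V) whose gradients at z are linearly independent,
  i.e. the Jacobian of I(V) at z has rank at least k.\<close>
definition indep_grads :: "nat \<Rightarrow> (nat \<Rightarrow> complex) set \<Rightarrow> (nat \<Rightarrow> complex) \<Rightarrow> nat \<Rightarrow> bool" where
  "indep_grads n V z k \<longleftrightarrow>
     (\<exists>fs. (\<forall>j<k. fs j \<in> vanishing_ideal n V) \<and>
       (\<forall>c. (\<forall>i<n. (\<Sum>j<k. c j * partial (fs j) i z) = 0) \<longrightarrow> (\<forall>j<k. c j = (0::complex))))"

text \<open>Smooth points of the (irreducible) variety V: points where the Jacobian of I(V)
  attains its maximal (= generic) rank, i.e. the codimension of V.\<close>
definition smooth_point :: "nat \<Rightarrow> (nat \<Rightarrow> complex) set \<Rightarrow> (nat \<Rightarrow> complex) \<Rightarrow> bool" where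
  "smooth_point n V z \<longleftrightarrow> z \<in> V \<and> (\<forall>w\<in>V. \<forall>k. indep_grads n V w k \<longrightarrow> indep_grads n V z k)"

text \<open>Critical points of z |-> sum (u_i - z_i)^2 on the smooth locus of V:
  u - z lies in the normal space, spanned by the gradients of I(V) at z.\<close>
definition ed_crit :: "nat \<Rightarrow> (nat \<Rightarrow> complex) set \<Rightarrow> (nat \<Rightarrow> complex) \<Rightarrow> (nat \<Rightarrow> complex) \<Rightarrow> bool" where
  "ed_crit n V u z \<longleftrightarrow> smooth_point n V z \<and>
     (\<exists>(k::nat) (fs :: nat \<Rightarrow> (nat \<Rightarrow> complex) \<Rightarrow> complex) (c :: nat \<Rightarrow> complex). (\<forall>j<k. fs j \<in> vanishing_ideal n V) \<and>
        (\<forall>i<n. u i - z i = (\<Sum>j<k. c j * partial (fs j) i z)))"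

definition has_EDD :: "nat \<Rightarrow> (nat \<Rightarrow> complex) set \<Rightarrow> real \<Rightarrow> bool" where
  "has_EDD n V d \<longleftrightarrow>
     (\<exists>Z. zariski_closed n Z \<and> Z \<noteq> cspace n \<and>
        (\<forall>u \<in> cspace n - Z. finite {z. ed_crit n V u z} \<and> real (card {z. ed_crit n V u z}) = d))"

text \<open>An arrangement of m matrices of size 2 x k is encoded as a point A of C^(2km):
  entry (r,c) of the i-th matrix is A (2*k*i + k*r + c).\<close>
definition ent :: "nat \<Rightarrow> (nat \<Rightarrow> complex) \<Rightarrow> nat \<Rightarrow> nat \<Rightarrow> nat \<Rightarrow> complex" where
  "ent k A i r c = A (2*k*i + k*r + c)"

definition full_rank :: "nat \<Rightarrow> (nat \<Rightarrow> complex) \<Rightarrow> nat \<Rightarrow> bool" where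
  "full_rank k A i \<longleftrightarrow>
     (\<forall>\<alpha> \<beta>. (\<forall>c<k. \<alpha> * ent k A i 0 c + \<beta> * ent k A i 1 c = 0) \<longrightarrow> \<alpha> = 0 \<and> \<beta> = 0)"

text \<open>The multiview variety intersected with the affine chart C^m of (P^1)^m,
  where [p:q] in P^1 corresponds to p/q.  Y ranges over C^k \ {0} (representatives
  of points of P^(k-1)); only the Y at which the rational map lands in the chart are used.\<close>
definition multiview_affine :: "nat \<Rightarrow> nat \<Rightarrow> (nat \<Rightarrow> complex) \<Rightarrow> (nat \<Rightarrow> complex) set" where
  "multiview_affine k m A = zariski_closure m
     {x \<in> cspace m. \<exists>Y :: nat \<Rightarrow> complex. \<forall>i<m.
        (\<Sum>c<k. ent k A i 1 c * Y c) \<noteq> 0 \<and>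
        x i = (\<Sum>c<k. ent k A i 0 c * Y c) / (\<Sum>c<k. ent k A i 1 c * Y c)}"

definition generic_arrangement :: "nat \<Rightarrow> nat \<Rightarrow> ((nat \<Rightarrow> complex) \<Rightarrow> bool) \<Rightarrow> bool" where
  "generic_arrangement k m P \<longleftrightarrow>
     (\<exists>Z. zariski_closed (2*k*m) Z \<and> Z \<noteq> cspace (2*k*m) \<and>
        (\<forall>A \<in> cspace (2*k*m) - Z. (\<forall>i<m. full_rank k A i) \<longrightarrow> P A))"

end

theory Submission
  imports Defs "HOL-Complex_Analysis.Complex_Analysis" "Jordan_Normal_Form.Determinant"
    "HOL-Computational_Algebra.Computational_Algebra" "HOL-Computational_Algebra.Field_as_Ring"
begin

text \<open>
  Choose coordinates in which the first camera is a coordinate projection: for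
  \<open>2 \<times> 2\<close> matrices the variety becomes the curve \<open>x\<^sub>0 = q\<close>, \<open>x\<^sub>i = e\<^sub>i + s\<^sub>i / (q - y\<^sub>i)\<close>, and the critical equation
  is a polynomial in \<open>q\<close> of degree \<open>3m - 2\<close> with generically simple roots.

  For \<open>2 \<times> 3\<close> matrices it becomes the surface \<open>x\<^sub>0 = p\<close>, \<open>x\<^sub>i = e\<^sub>i + s\<^sub>i / d\<^sub>i\<close> with \<open>s\<^sub>i = \<beta>\<^sub>i p + \<gamma>\<^sub>i\<close>,
  \<open>d\<^sub>i = q - l\<^sub>i\<close>, \<open>l\<^sub>i = \<lambda>\<^sub>i p + \<mu>\<^sub>i\<close>, together with finitely many lines that carry no critical
  point for generic data. The derivative in \<open>q\<close> gives a polynomial \<open>G\<^sub>p(q)\<close> of degree \<open>3n - 2\<close>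
  (\<open>n = m - 1\<close>), the derivative in \<open>p\<close> an equation \<open>w = f(p, q)\<close>, where \<open>w\<close> is the first coordinate
  of the data. The norm \<open>\<Prod>\<^sub>q (w - f(p, q))\<close> over the roots of \<open>G\<^sub>p\<close> is a rational function
  of \<open>p\<close>; its zeros count critical points, so their number is its degree at infinity, \<open>3n - 2\<close>, plus its pole
  orders: 1 at each of the \<open>n\<close> zeros of an \<open>s\<^sub>i\<close> and 9 at each of the \<open>n(n-1)/2\<close> points with
  \<open>l\<^sub>i = l\<^sub>j\<close>. For all but countably many \<open>w\<close> the zeros are simple, and elimination along a generic
  linear projection shows that the number of solutions is constant off a hypersurface.
\<close>

text \<open>A pole order records how many roots of \<open>gp p\<close> run into a node
  \<open>l i\<close>, and how fast \<open>ff\<close> grows along them. At p = \<open>pc i\<close>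
  three do: one at distance of order \<tau> = p - \<open>pc i\<close>, where \<open>ff\<close> stays
  bounded, and two at distance of order sqrt \<tau>, where \<open>ff\<close> grows like 1/sqrt
  \<tau>; in total order 1. At p = \<open>pl i j\<close> three do, at distance of order p -
  \<open>pl i j\<close>, and \<open>ff\<close> has a pole of order 3 along each; in total order 9.
  At infinity every root grows like p and \<open>ff\<close> is asymptotic to p, so each of the 3n -
  2 roots adds one. The obstacle is that this count, for fixed cameras and fixed other data, holds
  for w outside a countable set only, which is no Zariski statement. Constancy is therefore proved
  separately: the number of distinct roots of a polynomial is lower semicontinuous in its
  parameters, so the common zeros of the two numerators have constant number off a hypersurface. One
  parameter where the number is known then determines it, and such a parameter exists because the
  complex numbers are uncountable. The common zeros include n + n(n-1)/2 spurious points on the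
  nodes, a number that is the same for all admissible cameras.\<close>

section \<open>Polynomial functions and their restrictions to lines\<close>

lemma poly_fun_uminus: "f \<in> poly_fun n \<Longrightarrow> (\<lambda>x. - f x) \<in> poly_fun n"
  using pmult[OF pconst[of "-1"]] by fastforce

lemma poly_fun_diff: "f \<in> poly_fun n \<Longrightarrow> g \<in> poly_fun n \<Longrightarrow> (\<lambda>x. f x - g x) \<in> poly_fun n"
  using padd[OF _ poly_fun_uminus] by fastforce

lemma poly_fun_power: "f \<in> poly_fun n \<Longrightarrow> (\<lambda>x. f x ^ k) \<in> poly_fun n"
  by (induction k) (auto intro: pconst pmult)

lemma poly_fun_sum: "(\<And>i. i \<in> I \<Longrightarrow> f i \<in> poly_fun n) \<Longrightarrow> (\<lambda>x. \<Sum>i\<in>I. f i x) \<in> poly_fun n"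
  by (induction I rule: infinite_finite_induct) (auto intro: pconst padd)

lemma poly_fun_prod: "(\<And>i. i \<in> I \<Longrightarrow> f i \<in> poly_fun n) \<Longrightarrow> (\<lambda>x. \<Prod>i\<in>I. f i x) \<in> poly_fun n"
  by (induction I rule: infinite_finite_induct) (auto intro: pconst pmult)

lemmas poly_fun_intros = pconst pvar padd pmult poly_fun_uminus poly_fun_diff poly_fun_power
  poly_fun_sum poly_fun_prod

lemma poly_fun_mono: "f \<in> poly_fun n \<Longrightarrow> n \<le> m \<Longrightarrow> f \<in> poly_fun m"
  by (induction rule: poly_fun.induct) (auto intro: poly_fun.intros)

lemma poly_fun_cong: "f \<in> poly_fun n \<Longrightarrow> (\<And>i. i < n \<Longrightarrow> x i = y i) \<Longrightarrow> f x = f y"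
  by (induction rule: poly_fun.induct) auto

lemma poly_fun_subst:
  assumes "f \<in> poly_fun n" "\<And>i. i < n \<Longrightarrow> g i \<in> poly_fun m"
  shows "(\<lambda>x. f (\<lambda>i. g i x)) \<in> poly_fun m"
  using assms by (induction rule: poly_fun.induct) (auto intro: poly_fun.intros)

text \<open>The bridge to one variable: on the line with \<open>x\<close> at parameter 0 and
  \<open>y\<close> at parameter 1, vanishing becomes a matter of finitely many roots.\<close>

lemma poly_fun_line:
  assumes "f \<in> poly_fun n"
  shows "\<exists>P. \<forall>t. poly P t = f (\<lambda>i. x i + t * (y i - x i))"
  using assms
proof (induction rule: poly_fun.induct)
  case (pconst c)
  show ?case by (rule exI[of _ "[:c:]"]) simp
next
  case (pvar i)
  show ?case by (rule exI[of _ "[:x i, y i - x i:]"]) simp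
next
  case (padd f g)
  then obtain P Q where "\<forall>t. poly P t = f (\<lambda>i. x i + t * (y i - x i))"
    "\<forall>t. poly Q t = g (\<lambda>i. x i + t * (y i - x i))" by blast
  then show ?case by (intro exI[of _ "P + Q"]) simp
next
  case (pmult f g)
  then obtain P Q where "\<forall>t. poly P t = f (\<lambda>i. x i + t * (y i - x i))"
    "\<forall>t. poly Q t = g (\<lambda>i. x i + t * (y i - x i))" by blast
  then show ?case by (intro exI[of _ "P * Q"]) simp
qed

text \<open>Irreducibility of affine space. Along the line joining \<open>x\<close> and
  \<open>y\<close> both restrictions are nonzero polynomials, so their product has a
  non-root.\<close>

lemma poly_fun_mult_nonzero:
  assumes f: "f \<in> poly_fun n" and g: "g \<in> poly_fun n" and "f x \<noteq> 0" "g y \<noteq> 0"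
  shows "\<exists>z. f z \<noteq> 0 \<and> g z \<noteq> 0"
proof -
  obtain P Q where P: "\<forall>t. poly P t = f (\<lambda>i. x i + t * (y i - x i))"
    and Q: "\<forall>t. poly Q t = g (\<lambda>i. x i + t * (y i - x i))"
    using poly_fun_line[OF f] poly_fun_line[OF g] by metis
  have "poly P 0 \<noteq> 0" "poly Q 1 \<noteq> 0" using P Q assms by simp_all
  then have "P * Q \<noteq> 0" by auto
  then have "finite {t. poly (P * Q) t = 0}" by (rule poly_roots_finite)
  then obtain t where "poly (P * Q) t \<noteq> 0"
    using ex_new_if_finite[OF infinite_UNIV_char_0] by (metis (mono_tags, lifting) mem_Collect_eq)
  then show ?thesis using P Q by auto
qed

section \<open>Zariski-generic properties\<close>

text \<open>A principal open set is enough to express genericity, since finitely many of them are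
  intersected by multiplying the polynomials. Points are arbitrary sequences, of which
  \<open>poly_fun n\<close> sees only the first \<open>n\<close> entries; the passage to
  \<open>cspace\<close> is made once, in \<open>zgen_zariski\<close>.\<close>

definition zgen :: "nat \<Rightarrow> ((nat \<Rightarrow> complex) \<Rightarrow> bool) \<Rightarrow> bool" where
  "zgen n P \<longleftrightarrow> (\<exists>f\<in>poly_fun n. (\<exists>x. f x \<noteq> 0) \<and> (\<forall>x. f x \<noteq> 0 \<longrightarrow> P x))"

lemma zgenI: "f \<in> poly_fun n \<Longrightarrow> f x \<noteq> 0 \<Longrightarrow> (\<And>x. f x \<noteq> 0 \<Longrightarrow> P x) \<Longrightarrow> zgen n P"
  unfolding zgen_def by blast

lemma zgen_neq: "f \<in> poly_fun n \<Longrightarrow> f x \<noteq> 0 \<Longrightarrow> zgen n (\<lambda>x. f x \<noteq> 0)"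
  unfolding zgen_def by blast

lemma zgen_neq2: "f \<in> poly_fun n \<Longrightarrow> g \<in> poly_fun n \<Longrightarrow> f x \<noteq> g x \<Longrightarrow> zgen n (\<lambda>x. f x \<noteq> g x)"
  by (rule zgenI[of "\<lambda>x. f x - g x" n x]) (auto intro: poly_fun_diff)

lemma zgen_mono: "zgen n P \<Longrightarrow> (\<And>x. P x \<Longrightarrow> Q x) \<Longrightarrow> zgen n Q"
  unfolding zgen_def by blast

lemma zgen_True: "zgen n (\<lambda>x. True)"
  by (rule zgenI[of "\<lambda>x. 1"]) (auto intro: pconst)

lemma zgen_conj: assumes "zgen n P" "zgen n Q" shows "zgen n (\<lambda>x. P x \<and> Q x)"
proof -
  obtain f x where f: "f \<in> poly_fun n" "f x \<noteq> 0" "\<And>x. f x \<noteq> 0 \<Longrightarrow> P x"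
    using assms(1) unfolding zgen_def by blast
  obtain g y where g: "g \<in> poly_fun n" "g y \<noteq> 0" "\<And>x. g x \<noteq> 0 \<Longrightarrow> Q x"
    using assms(2) unfolding zgen_def by blast
  obtain z where "f z \<noteq> 0" "g z \<noteq> 0" using poly_fun_mult_nonzero[OF f(1) g(1) f(2) g(2)] by blast
  then show ?thesis
    by (intro zgenI[of "\<lambda>x. f x * g x" n z]) (auto intro: pmult f g)
qed

lemma zgen_imp: "(A \<Longrightarrow> zgen n P) \<Longrightarrow> zgen n (\<lambda>x. A \<longrightarrow> P x)"
  by (cases A) (auto intro: zgen_mono zgen_True)

lemma zgen_ball: "finite I \<Longrightarrow> (\<And>i. i \<in> I \<Longrightarrow> zgen n (P i)) \<Longrightarrow> zgen n (\<lambda>x. \<forall>i\<in>I. P i x)"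
  by (induction I rule: finite_induct) (auto intro: zgen_mono[OF zgen_True] zgen_conj)

lemma zgen_all_less: "(\<And>i. i < (k::nat) \<Longrightarrow> zgen n (P i)) \<Longrightarrow> zgen n (\<lambda>x. \<forall>i<k. P i x)"
  using zgen_ball[OF finite_lessThan[of k], of n P] unfolding Ball_def lessThan_iff by blast

lemma zgen_ex: "zgen n P \<Longrightarrow> \<exists>x. P x"
  unfolding zgen_def by blast

lemma poly_fun_1_poly: "f \<in> poly_fun 1 \<Longrightarrow> \<exists>P. \<forall>x. poly P (x 0) = f x"
proof (induction rule: poly_fun.induct)
  case (pconst c)
  show ?case by (rule exI[of _ "[:c:]"]) simp
next
  case (pvar i)
  then show ?case by (intro exI[of _ "[:0,1:]"]) simp
next
  case (padd f g)
  then show ?case by (metis poly_add)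
next
  case (pmult f g)
  then show ?case by (metis poly_mult)
qed

lemma zgen_1_finite: assumes "zgen 1 P" shows "finite {t. \<not> P (\<lambda>_. t)}"
proof -
  obtain f x where f: "f \<in> poly_fun 1" "f x \<noteq> 0" "\<And>x. f x \<noteq> 0 \<Longrightarrow> P x"
    using assms unfolding zgen_def by blast
  obtain Q where Q: "\<forall>x. poly Q (x 0) = f x" using poly_fun_1_poly[OF f(1)] by blast
  have "Q \<noteq> 0" using Q f(2) by force
  moreover have "{t. \<not> P (\<lambda>_. t)} \<subseteq> {t. poly Q t = 0}"
  proof safe
    fix t assume "\<not> P (\<lambda>_. t)"
    then show "poly Q t = 0" using Q[rule_format, of "\<lambda>_. t"] f(3) by metis
  qed
  ultimately show ?thesis using poly_roots_finite finite_subset by blast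
qed

text \<open>A Fubini principle. If \<open>f\<close> witnesses \<open>P\<close> and
  \<open>f x\<close> is nonzero, freezing the entries of \<open>x\<close> from \<open>k\<close> on
  gives the condition on the first \<open>k\<close> entries; wherever it holds, \<open>f\<close> is
  still nonzero as a polynomial in the other entries.\<close>

lemma zgen_fix:
  assumes "zgen n P" "k \<le> n"
  shows "zgen k (\<lambda>x. zgen n (\<lambda>y. P (\<lambda>i. if i < k then x i else y i)))"
proof -
  obtain f x where f: "f \<in> poly_fun n" "f x \<noteq> 0" "\<And>x. f x \<noteq> 0 \<Longrightarrow> P x"
    using assms unfolding zgen_def by blast
  let ?g = "\<lambda>y. f (\<lambda>i. if i < k then y i else x i)"
  have "(\<lambda>y. f (\<lambda>i. (if i < k then (\<lambda>y. y i) else (\<lambda>y. x i)) y)) \<in> poly_fun k"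
    by (rule poly_fun_subst[OF f(1)]) (auto intro: poly_fun.intros)
  moreover have "(\<lambda>y. f (\<lambda>i. (if i < k then (\<lambda>y. y i) else (\<lambda>y. x i)) y)) = ?g"
    by (intro ext arg_cong[of _ _ f]) auto
  ultimately have g: "?g \<in> poly_fun k" by simp
  show ?thesis
  proof (rule zgenI[OF g, of x])
    show "f (\<lambda>i. if i < k then x i else x i) \<noteq> 0" using f(2) by simp
  next
    fix y assume y: "?g y \<noteq> 0"
    have "(\<lambda>z. f (\<lambda>i. (if i < k then (\<lambda>z. y i) else (\<lambda>z. z i)) z)) \<in> poly_fun n"
      by (rule poly_fun_subst[OF f(1)]) (auto intro: poly_fun.intros)
    moreover have "(\<lambda>z. f (\<lambda>i. (if i < k then (\<lambda>z. y i) else (\<lambda>z. z i)) z)) = (\<lambda>z. f (\<lambda>i. if i < k then y i else z i))"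
      by (intro ext arg_cong[of _ _ f]) auto
    ultimately have h: "(\<lambda>z. f (\<lambda>i. if i < k then y i else z i)) \<in> poly_fun n" by simp
    show "zgen n (\<lambda>z. P (\<lambda>i. if i < k then y i else z i))"
      by (rule zgenI[OF h, of x]) (use y f(3) in auto)
  qed
qed

section \<open>Univariate polynomials depending polynomially on parameters\<close>

text \<open>The uniform degree bound is what keeps evaluations, products and resultants of such
  families polynomial in the parameters: all sums over coefficients have a fixed finite
  range.\<close>

definition pfam :: "nat \<Rightarrow> ((nat \<Rightarrow> complex) \<Rightarrow> complex poly) \<Rightarrow> bool" where
  "pfam n F \<longleftrightarrow> (\<exists>D. \<forall>x. degree (F x) \<le> D) \<and> (\<forall>k. (\<lambda>x. coeff (F x) k) \<in> poly_fun n)"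

lemma pfam_pCons: "f \<in> poly_fun n \<Longrightarrow> pfam n F \<Longrightarrow> pfam n (\<lambda>x. pCons (f x) (F x))"
  unfolding pfam_def
proof safe
  fix D assume "\<forall>x. degree (F x) \<le> D"
  then show "\<exists>D. \<forall>x. degree (pCons (f x) (F x)) \<le> D"
    by (intro exI[of _ "Suc D"]) (metis Suc_le_mono degree_pCons_le le_trans)
next
  fix k assume "f \<in> poly_fun n" "\<forall>k. (\<lambda>x. coeff (F x) k) \<in> poly_fun n"
  then show "(\<lambda>x. coeff (pCons (f x) (F x)) k) \<in> poly_fun n" by (cases k) auto
qed

lemma pfam_const: "pfam n (\<lambda>x. P)"
  unfolding pfam_def by (auto intro: pconst)

lemma pfam_add: assumes "pfam n F" "pfam n G" shows "pfam n (\<lambda>x. F x + G x)"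
proof -
  obtain D E where "\<forall>x. degree (F x) \<le> D" "\<forall>x. degree (G x) \<le> E" using assms unfolding pfam_def by blast
  then have "\<forall>x. degree (F x + G x) \<le> max D E" by (meson degree_add_le max.coboundedI1 max.coboundedI2)
  then show ?thesis using assms unfolding pfam_def by (auto intro: padd)
qed

lemma pfam_mult: assumes "pfam n F" "pfam n G" shows "pfam n (\<lambda>x. F x * G x)"
proof -
  obtain D E where "\<forall>x. degree (F x) \<le> D" "\<forall>x. degree (G x) \<le> E" using assms unfolding pfam_def by blast
  then have "\<forall>x. degree (F x * G x) \<le> D + E" by (meson add_mono degree_mult_le le_trans)
  then show ?thesis using assms unfolding pfam_def coeff_mult by (auto intro!: poly_fun_intros)
qed

lemma pfam_power: "pfam n F \<Longrightarrow> pfam n (\<lambda>x. F x ^ k)"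
  by (induction k) (auto intro: pfam_const pfam_mult)

lemma pfam_sum: "(\<And>i. i \<in> I \<Longrightarrow> pfam n (F i)) \<Longrightarrow> pfam n (\<lambda>x. \<Sum>i\<in>I. F i x)"
  by (induction I rule: infinite_finite_induct) (auto intro: pfam_const pfam_add)

lemma pfam_prod: "(\<And>i. i \<in> I \<Longrightarrow> pfam n (F i)) \<Longrightarrow> pfam n (\<lambda>x. \<Prod>i\<in>I. F i x)"
  by (induction I rule: infinite_finite_induct) (auto intro: pfam_const pfam_mult)

lemma pfam_uminus: assumes "pfam n F" shows "pfam n (\<lambda>x. - F x)"
  using pfam_mult[OF pfam_const[of n "-1"] assms] by simp

lemma pfam_diff: "pfam n F \<Longrightarrow> pfam n G \<Longrightarrow> pfam n (\<lambda>x. F x - G x)"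
  using pfam_add[OF _ pfam_uminus] by fastforce

lemma pfam_linear: "f \<in> poly_fun n \<Longrightarrow> g \<in> poly_fun n \<Longrightarrow> pfam n (\<lambda>x. [:f x, g x:])"
  by (intro pfam_pCons pfam_const[of n 0])

lemma pfam_scalar: "f \<in> poly_fun n \<Longrightarrow> pfam n (\<lambda>x. [:f x:])"
  by (intro pfam_pCons pfam_const[of n 0])

lemma poly_altdef_le:
  assumes "degree (p::complex poly) \<le> D"
  shows "poly p x = (\<Sum>k\<le>D. coeff p k * x ^ k)"
  unfolding poly_altdef by (rule sum.mono_neutral_left) (use assms in \<open>auto simp: coeff_eq_0\<close>)

lemma pfam_coeff: "pfam n F \<Longrightarrow> (\<lambda>x. coeff (F x) k) \<in> poly_fun n"
  unfolding pfam_def by blast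

text \<open>Polynomials in n + 1 variables are polynomials in the last one with coefficients in the
  others.\<close>

lemma poly_fun_Suc_pfam:
  assumes "f \<in> poly_fun (Suc n)"
  shows "\<exists>F. pfam n F \<and> (\<forall>x. poly (F x) (x n) = f x)"
  using assms
proof (induction rule: poly_fun.induct)
  case (pconst c)
  show ?case by (rule exI[of _ "\<lambda>x. [:c:]"]) (auto intro: pfam_const)
next
  case (pvar i)
  show ?case
  proof (cases "i = n")
    case True
    then show ?thesis by (intro exI[of _ "\<lambda>x. [:0,1:]"]) (auto intro: pfam_const)
  next
    case False
    then show ?thesis using pvar
      by (intro exI[of _ "\<lambda>x. [:x i:]"]) (auto intro!: pfam_scalar poly_fun.pvar)
  qed
next
  case (padd f g)
  then obtain F G where "pfam n F" "pfam n G" "\<forall>x. poly (F x) (x n) = f x" "\<forall>x. poly (G x) (x n) = g x" by blast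
  then show ?case by (intro exI[of _ "\<lambda>x. F x + G x"]) (auto intro: pfam_add)
next
  case (pmult f g)
  then obtain F G where "pfam n F" "pfam n G" "\<forall>x. poly (F x) (x n) = f x" "\<forall>x. poly (G x) (x n) = g x" by blast
  then show ?case by (intro exI[of _ "\<lambda>x. F x * G x"]) (auto intro: pfam_mult)
qed

lemma pfam_cong: assumes "pfam n F" "\<And>i. i < n \<Longrightarrow> x i = y i" shows "F x = F y"
proof (rule poly_eqI)
  fix k show "coeff (F x) k = coeff (F y) k"
    using poly_fun_cong[OF pfam_coeff[OF assms(1), of k] assms(2)] by simp
qed

section \<open>Determinants of arrays of complex numbers given by functions\<close>

definition dt :: "nat \<Rightarrow> (nat \<Rightarrow> nat \<Rightarrow> complex) \<Rightarrow> complex" where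
  "dt n M = Determinant.det (Matrix.mat n n (\<lambda>(i,j). M i j))"

lemma dt_altdef: "dt n M = (\<Sum>p\<in>{p. p permutes {0..<n}}. signof p * (\<Prod>i=0..<n. M i (p i)))"
  unfolding dt_def by (subst Determinant.det_def') (auto intro!: sum.cong prod.cong dest: permutes_in_image)

lemma dt_poly_fun:
  assumes "\<And>i j. i < n \<Longrightarrow> j < n \<Longrightarrow> (\<lambda>x. M x i j) \<in> poly_fun m"
  shows "(\<lambda>x. dt n (M x)) \<in> poly_fun m"
  unfolding dt_altdef
  by (intro poly_fun_sum pmult pconst poly_fun_prod assms) (auto dest: permutes_in_image)

lemma dt_transpose: "dt n (\<lambda>i j. M j i) = dt n M"
proof -
  have "Matrix.mat n n (\<lambda>(i,j). M j i) = transpose_mat (Matrix.mat n n (\<lambda>(i,j). M i j))"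
    by (rule eq_matI) auto
  then show ?thesis unfolding dt_def using Determinant.det_transpose[of "Matrix.mat n n (\<lambda>(i,j). M i j)" n] by simp
qed

lemma dt_mult: "dt n (\<lambda>i j. \<Sum>k<n. A i k * B k j) = dt n A * dt n B"
proof -
  have "Matrix.mat n n (\<lambda>(i,j). \<Sum>k<n. A i k * B k j)
      = Matrix.mat n n (\<lambda>(i,j). A i j) * Matrix.mat n n (\<lambda>(i,j). B i j)"
    by (rule eq_matI) (auto simp: scalar_prod_def atLeast0LessThan intro!: sum.cong)
  then show ?thesis unfolding dt_def by (simp add: Determinant.det_mult[of _ n])
qed

lemma dt_eq_0_iff: "dt n M = 0 \<longleftrightarrow> (\<exists>v. (\<exists>j<n. v j \<noteq> 0) \<and> (\<forall>i<n. (\<Sum>j<n. M i j * v j) = 0))"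
proof -
  have "dt n M = 0 \<longleftrightarrow> (\<exists>v. v \<in> carrier_vec n \<and> v \<noteq> 0\<^sub>v n \<and> Matrix.mat n n (\<lambda>(i,j). M i j) *\<^sub>v v = 0\<^sub>v n)"
    unfolding dt_def by (rule det_0_iff_vec_prod_zero_field) simp
  also have "\<dots> \<longleftrightarrow> (\<exists>v. (\<exists>j<n. v j \<noteq> 0) \<and> (\<forall>i<n. (\<Sum>j<n. M i j * v j) = 0))"
  proof
    assume "\<exists>v. v \<in> carrier_vec n \<and> v \<noteq> 0\<^sub>v n \<and> Matrix.mat n n (\<lambda>(i,j). M i j) *\<^sub>v v = 0\<^sub>v n"
    then obtain v where v: "v \<in> carrier_vec n" "v \<noteq> 0\<^sub>v n" "Matrix.mat n n (\<lambda>(i,j). M i j) *\<^sub>v v = 0\<^sub>v n" by blast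
    have "\<exists>j<n. Matrix.vec_index v j \<noteq> 0" using v(1,2) by (auto simp: Matrix.vec_eq_iff)
    moreover have "(\<Sum>j<n. M i j * Matrix.vec_index v j) = 0" if "i < n" for i
    proof -
      have "Matrix.vec_index (Matrix.mat n n (\<lambda>(i,j). M i j) *\<^sub>v v) i = 0" using v(3) that by simp
      then show ?thesis using that v(1) by (simp add: scalar_prod_def atLeast0LessThan)
    qed
    ultimately show "\<exists>v. (\<exists>j<n. v j \<noteq> 0) \<and> (\<forall>i<n. (\<Sum>j<n. M i j * v j) = 0)" by blast
  next
    assume "\<exists>v. (\<exists>j<n. v j \<noteq> 0) \<and> (\<forall>i<n. (\<Sum>j<n. M i j * v j) = 0)"
    then obtain v where v: "\<exists>j<n. v j \<noteq> 0" "\<forall>i<n. (\<Sum>j<n. M i j * v j) = 0" by blast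
    show "\<exists>v. v \<in> carrier_vec n \<and> v \<noteq> 0\<^sub>v n \<and> Matrix.mat n n (\<lambda>(i,j). M i j) *\<^sub>v v = 0\<^sub>v n"
    proof (intro exI[of _ "Matrix.vec n v"] conjI)
      show "Matrix.vec n v \<noteq> 0\<^sub>v n" using v(1) by (auto simp: Matrix.vec_eq_iff)
      show "Matrix.mat n n (\<lambda>(i,j). M i j) *\<^sub>v Matrix.vec n v = 0\<^sub>v n"
        using v(2) by (auto simp: Matrix.vec_eq_iff scalar_prod_def atLeast0LessThan)
    qed simp
  qed
  finally show ?thesis .
qed

lemma dt_eq_0_iff_left: "dt n M = 0 \<longleftrightarrow> (\<exists>v. (\<exists>i<n. v i \<noteq> 0) \<and> (\<forall>j<n. (\<Sum>i<n. v i * M i j) = 0))"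
proof -
  have "(\<Sum>i<n. v i * M i j) = (\<Sum>i<n. M i j * v i)" for v j
    by (rule sum.cong) (auto simp: mult.commute)
  then show ?thesis using dt_eq_0_iff[of n "\<lambda>i j. M j i"] by (simp only: dt_transpose[of n M])
qed

lemma dt_scale_cols: "dt n (\<lambda>i j. M i j * c j) = dt n M * (\<Prod>j<n. c j)"
proof -
  have "dt n (\<lambda>i j. c i * M j i) = (\<Prod>j<n. c j) * dt n (\<lambda>i j. M j i)"
    unfolding dt_altdef by (simp add: prod.distrib sum_distrib_left atLeast0LessThan mult_ac)
  then show ?thesis
    using dt_transpose[of n "\<lambda>i j. M i j * c j"] dt_transpose[of n M] by (simp add: mult.commute)
qed

lemma dt_block:
  assumes "\<And>i j. i < b \<Longrightarrow> j < a \<Longrightarrow> M (a + i) j = 0"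
  shows "dt (a + b) M = dt a M * dt b (\<lambda>i j. M (a + i) (a + j))"
proof -
  have "Matrix.mat (a + b) (a + b) (\<lambda>(i,j). M i j) =
    four_block_mat (Matrix.mat a a (\<lambda>(i,j). M i j)) (Matrix.mat a b (\<lambda>(i,j). M i (a + j)))
      (0\<^sub>m b a) (Matrix.mat b b (\<lambda>(i,j). M (a + i) (a + j)))"
  proof (rule eq_matI, goal_cases)
    case (1 i j)
    then show ?case using assms[of "i - a" j] by (auto simp: four_block_mat_def)
  qed auto
  then show ?thesis unfolding dt_def
    by (simp add: det_four_block_mat_lower_left_zero[of _ a _ b])
qed

lemma dt_lower_triangular:
  assumes "\<And>i j. i < j \<Longrightarrow> j < n \<Longrightarrow> M i j = 0"
  shows "dt n M = (\<Prod>i<n. M i i)"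
proof -
  have "dt n M = prod_list (diag_mat (Matrix.mat n n (\<lambda>(i,j). M i j)))"
    unfolding dt_def by (rule det_lower_triangular[of n]) (auto simp: assms)
  also have "\<dots> = (\<Prod>i<n. M i i)"
    by (auto simp: prod_list_diag_prod atLeast0LessThan intro!: prod.cong)
  finally show ?thesis .
qed

text \<open>Injectivity of a matrix spreads from one parameter value to generic ones: pairing with the
  conjugate transpose of the matrix at the special value gives a Gram determinant there.\<close>

lemma zgen_injective:
  fixes r c :: nat
  assumes M: "\<And>i j. i < r \<Longrightarrow> j < c \<Longrightarrow> (\<lambda>x. M x i j) \<in> poly_fun n"
    and inj: "\<And>v. \<forall>i<r. (\<Sum>j<c. M z i j * v j) = 0 \<Longrightarrow> \<forall>j<c. v j = 0"
  shows "zgen n (\<lambda>x. \<forall>v. (\<forall>i<r. (\<Sum>j<c. M x i j * v j) = 0) \<longrightarrow> (\<forall>j<c. v j = 0))"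
proof -
  let ?f = "\<lambda>x. dt c (\<lambda>j k. \<Sum>i<r. cnj (M z i j) * M x i k)"
  have *: "(\<Sum>k<c. (\<Sum>i<r. cnj (M z i j) * M x i k) * v k) = (\<Sum>i<r. cnj (M z i j) * (\<Sum>k<c. M x i k * v k))"
    for x j v
    unfolding sum_distrib_left sum_distrib_right mult.assoc by (rule sum.swap)
  show ?thesis
  proof (rule zgenI[of ?f n z])
    show "?f \<in> poly_fun n"
    proof (rule dt_poly_fun, rule poly_fun_sum)
      fix j k i assume "j < c" "k < c" "i \<in> {..<r}"
      then show "(\<lambda>x. cnj (M z i j) * M x i k) \<in> poly_fun n"
        by (intro pmult pconst M) simp_all
    qed
    show "?f z \<noteq> 0"
    proof
      assume "?f z = 0"
      then obtain v where v: "\<exists>j<c. v j \<noteq> 0"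
        "\<forall>j<c. (\<Sum>k<c. (\<Sum>i<r. cnj (M z i j) * M z i k) * v k) = 0"
        unfolding dt_eq_0_iff by blast
      let ?y = "\<lambda>i. \<Sum>k<c. M z i k * v k"
      \<comment> \<open>For \<open>v\<close> in the kernel of the Gram matrix, pairing with the
        conjugate of \<open>v\<close> gives the squared norm of the image of \<open>v\<close> under
        \<open>M z\<close>, so that image is 0.\<close>
      have "(\<Sum>j<c. cnj (v j) * (\<Sum>i<r. cnj (M z i j) * ?y i))
          = (\<Sum>j<c. \<Sum>i<r. cnj (v j) * cnj (M z i j) * ?y i)"
        by (simp only: sum_distrib_left mult.assoc)
      also have "\<dots> = (\<Sum>i<r. \<Sum>j<c. cnj (v j) * cnj (M z i j) * ?y i)" by (rule sum.swap)
      also have "\<dots> = (\<Sum>i<r. cnj (?y i) * ?y i)"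
      proof (rule sum.cong[OF refl])
        fix i
        have "cnj (?y i) = (\<Sum>j<c. cnj (v j) * cnj (M z i j))"
          unfolding cnj_sum complex_cnj_mult by (rule sum.cong[OF refl mult.commute])
        then show "(\<Sum>j<c. cnj (v j) * cnj (M z i j) * ?y i) = cnj (?y i) * ?y i"
          by (simp only: sum_distrib_right)
      qed
      finally have "(\<Sum>i<r. cnj (?y i) * ?y i) = (\<Sum>j<c. cnj (v j) * (\<Sum>i<r. cnj (M z i j) * ?y i))" by simp
      also have "\<dots> = 0"
      proof (rule sum.neutral, rule ballI)
        fix j assume "j \<in> {..<c}"
        then have "(\<Sum>i<r. cnj (M z i j) * ?y i) = 0" using v(2)[rule_format, of j] unfolding * by blast
        then show "cnj (v j) * (\<Sum>i<r. cnj (M z i j) * ?y i) = 0" by (simp only: mult_zero_right)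
      qed
      finally have "complex_of_real (\<Sum>i<r. (cmod (?y i))\<^sup>2) = 0"
        unfolding of_real_sum complex_norm_square mult.commute[of _ "cnj _"] .
      then have "(\<Sum>i<r. (cmod (?y i))\<^sup>2) = 0" by (simp only: of_real_eq_0_iff)
      then have "\<forall>i\<in>{..<r}. (cmod (?y i))\<^sup>2 = 0"
        by (rule sum_nonneg_eq_0_iff[THEN iffD1, rotated 2]) (rule finite_lessThan, rule zero_le_power2)
      then have "\<forall>i<r. ?y i = 0" by simp
      then show False using inj v(1) by blast
    qed
    fix x assume fx: "?f x \<noteq> 0"
    show "\<forall>v. (\<forall>i<r. (\<Sum>j<c. M x i j * v j) = 0) \<longrightarrow> (\<forall>j<c. v j = 0)"
    proof (intro allI impI)
      fix v j assume v: "\<forall>i<r. (\<Sum>j<c. M x i j * v j) = 0" and j: "j < c"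
      have "\<forall>j<c. (\<Sum>k<c. (\<Sum>i<r. cnj (M z i j) * M x i k) * v k) = 0"
      proof (unfold *, intro allI impI sum.neutral ballI)
        fix j i assume "i \<in> {..<r}"
        then show "cnj (M z i j) * (\<Sum>k<c. M x i k * v k) = 0" using v by (simp only: lessThan_iff mult_zero_right)
      qed
      then show "v j = 0" using fx j unfolding dt_eq_0_iff by blast
    qed
  qed
qed

section \<open>Counting distinct roots by linear algebra\<close>

lemma sum_order_degree_complex:
  fixes p :: "complex poly"
  assumes "p \<noteq> 0"
  shows "(\<Sum>x | poly p x = 0. order x p) = degree p"
proof -
  have "degree p = size (proots p)" by (simp add: size_proots_complex)
  also have "\<dots> = (\<Sum>x\<in>set_mset (proots p). count (proots p) x)"
    by (rule size_multiset_overloaded_eq)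
  also have "\<dots> = (\<Sum>x | poly p x = 0. order x p)"
    using assms by (intro sum.cong) auto
  finally show ?thesis by simp
qed

lemma sum_lessThan_add: "(\<Sum>j<a+b. f j) = (\<Sum>j<a. f j) + (\<Sum>j<b. f (a + j :: nat) :: 'a :: comm_monoid_add)"
  by (induction b) (simp_all add: add_ac)

text \<open>Dividing by d = gcd(p, p') leaves the squarefree part \<open>q\<close>, whose degree is
  the number of distinct roots. The cofactors give the relation q p' - e p = 0, the shortest one
  between p and p'.\<close>

lemma poly_decomp_roots:
  fixes p :: "complex poly"
  assumes "p \<noteq> 0"
  obtains q d e where "p = q * d" "pderiv p = e * d" "degree q = card {x. poly p x = 0}" "d \<noteq> 0"
    "e = 0 \<or> degree e < degree q"
proof (cases "pderiv p = 0")
  case True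
  then have "degree p = 0" by (simp add: pderiv_eq_0_iff)
  then obtain c where c: "p = [:c:]" by (rule degree_eq_zeroE)
  with assms have "{x. poly p x = 0} = {}" by simp
  then show ?thesis using that[of 1 p 0] True assms by simp
next
  case False
  define d where "d = gcd p (pderiv p)"
  obtain q e where qe: "p = q * d" "pderiv p = e * d"
    using d_def by (metis dvd_def gcd_dvd1 gcd_dvd2 mult.commute)
  obtain r s where "d = r * p + s * pderiv p"
    using bezout_coefficients_fst_snd[of p "pderiv p"] d_def by metis
  from poly_squarefree_decomp_order2[OF False qe this]
  have ord: "order a q = (if order a p = 0 then 0 else 1)" for a by blast
  have d0: "d \<noteq> 0" and q0: "q \<noteq> 0" using qe assms by auto
  have roots: "poly q x = 0 \<longleftrightarrow> poly p x = 0" for x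
    using ord[of x] q0 assms by (simp add: order_root split: if_splits)
  have "degree q = (\<Sum>x\<in>{x. poly q x = 0}. order x q)"
    by (simp add: sum_order_degree_complex q0)
  also have "\<dots> = (\<Sum>x\<in>{x. poly q x = 0}. 1)"
    using q0 ord by (intro sum.cong) (auto simp: order_root split: if_splits)
  finally have "degree q = card {x. poly p x = 0}" using roots by simp
  moreover have "e = 0 \<or> degree e < degree q"
  proof (rule disjI2)
    have "degree (pderiv p) < degree p" using False
      by (metis degree_0 degree_pderiv diff_less gr0I less_numeral_extra(1) pderiv_eq_0_iff)
    then show "degree e < degree q" using qe d0 q0 False by (auto simp: degree_mult_eq)
  qed
  ultimately show ?thesis using that[of q d e] qe d0 by simp
qed

text \<open>The least degree of \<open>T\<close> in a nontrivial relation T R' + S R = 0 is the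
  degree of R / gcd(R, R'), that is, the number of distinct roots. Having at least \<open>K\<close>
  roots thus becomes injectivity of a linear map whose entries are coefficients of R and R'.\<close>

lemma card_roots_ge_iff:
  fixes R :: "complex poly"
  assumes "R \<noteq> 0" "K \<ge> 1"
  shows "K \<le> card {t. poly R t = 0} \<longleftrightarrow>
    (\<forall>T S. degree T < K \<and> (S = 0 \<or> degree S + 1 < K) \<and> T * pderiv R + S * R = 0 \<longrightarrow> T = 0 \<and> S = 0)"
proof
  assume K: "K \<le> card {t. poly R t = 0}"
  show "\<forall>T S. degree T < K \<and> (S = 0 \<or> degree S + 1 < K) \<and> T * pderiv R + S * R = 0 \<longrightarrow> T = 0 \<and> S = 0"
  proof (intro allI impI, elim conjE)
    fix T S assume T: "degree T < K" and TS: "T * pderiv R + S * R = 0"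
    have R': "pderiv R \<noteq> 0"
    proof
      assume "pderiv R = 0"
      then have "degree R = 0" by (simp add: pderiv_eq_0_iff)
      then obtain c where "R = [:c:]" by (rule degree_eq_zeroE)
      then have "{t. poly R t = 0} = {}" using assms by auto
      then show False using K assms by simp
    qed
    have "T = 0"
    proof (rule ccontr)
      assume T0: "T \<noteq> 0"
      \<comment> \<open>Differentiation lowers the order at a root by exactly one, so the relation
        forces \<open>T\<close> to make up the missing order at every root of
        \<open>R\<close>.\<close>
      have "poly T r = 0" if r: "poly R r = 0" for r
      proof -
        have o: "order r R = Suc (order r (pderiv R))"
          by (rule order_pderiv[OF assms(1) r])
        have eq: "T * pderiv R = - (S * R)" using TS by (simp add: add_eq_0_iff2)
        then have "S \<noteq> 0" using T0 R' by auto
        then have "order r (S * R) = order r S + order r R" using assms by (intro order_mult) auto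
        moreover have "order r (T * pderiv R) = order r T + order r (pderiv R)"
          using T0 R' by (intro order_mult) auto
        moreover have "order r (- (S * R)) = order r (S * R)" by (simp add: order_uminus)
        ultimately have "order r T + order r (pderiv R) = order r S + order r R" using eq by metis
        then have "order r T \<noteq> 0" using o by linarith
        then show ?thesis by (simp add: order_root)
      qed
      then have "card {t. poly R t = 0} \<le> card {t. poly T t = 0}"
        by (intro card_mono poly_roots_finite T0) auto
      also have "\<dots> \<le> degree T" by (rule card_poly_roots_bound[OF T0])
      finally show False using T K by simp
    qed
    then show "T = 0 \<and> S = 0" using TS assms by auto
  qed
next
  assume *: "\<forall>T S. degree T < K \<and> (S = 0 \<or> degree S + 1 < K) \<and> T * pderiv R + S * R = 0 \<longrightarrow> T = 0 \<and> S = 0"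
  obtain q d e where qde: "R = q * d" "pderiv R = e * d" "degree q = card {x. poly R x = 0}" "d \<noteq> 0"
    "e = 0 \<or> degree e < degree q" using poly_decomp_roots[OF assms(1)] .
  show "K \<le> card {t. poly R t = 0}"
  proof (rule ccontr)
    assume "\<not> ?thesis"
    then have "degree q < K" using qde(3) by simp
    moreover have "- e = 0 \<or> degree (- e) + 1 < K" using qde(5) calculation by auto
    moreover have "q * pderiv R + (- e) * R = 0" using qde(1,2) by (simp add: algebra_simps)
    ultimately have "q = 0" using * by blast
    then show False using qde(1) assms by simp
  qed
qed

lemma degree_sum_monom_less: "(\<Sum>j<K. monom (v j) j) = 0 \<or> degree (\<Sum>j<K. monom (v j :: complex) j) < K"
proof (cases "K = 0")
  case False
  have "degree (\<Sum>j<K. monom (v j) j) \<le> K - 1"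
    by (rule degree_sum_le) (auto intro: order_trans[OF degree_monom_le])
  then show ?thesis using False by linarith
qed simp

lemma sum_monom_coeff: "degree p < K \<or> p = 0 \<Longrightarrow> (\<Sum>j<K. monom (coeff p j) j) = p"
  by (rule poly_eqI) (auto simp: coeff_sum if_distrib sum.delta coeff_eq_0 cong: if_cong)

lemma coeff_sum_monom_lessThan: "coeff (\<Sum>j<K. monom (v j) j) i = (if i < K then v i else 0)"
  by (auto simp: coeff_sum if_distrib sum.delta cong: if_cong)

text \<open>Lower semicontinuity of the number of distinct roots: \<open>card_roots_ge_iff\<close>
  turns the bound into injectivity of (T, S) \<mapsto> T R' + S R, and \<open>zgen_injective\<close>
  spreads injectivity from \<open>z\<close>. The degree of \<open>R x\<close> may vary with
  \<open>x\<close>.\<close>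

lemma zgen_card_roots:
  assumes R: "pfam n R" and R0: "R z \<noteq> 0" and K: "K \<le> card {t. poly (R z) t = 0}"
  shows "zgen n (\<lambda>x. R x \<noteq> 0 \<and> K \<le> card {t. poly (R x) t = 0})"
proof (cases "K = 0")
  case True
  obtain k where "coeff (R z) k \<noteq> 0" using R0 by (auto simp: poly_eq_iff)
  then show ?thesis using True by (intro zgenI[OF pfam_coeff[OF R, of k], of z]) auto
next
  case False
  obtain D where D: "\<And>x. degree (R x) \<le> D" using R unfolding pfam_def by blast
  have nz: "zgen n (\<lambda>x. R x \<noteq> 0)"
  proof -
    obtain k where "coeff (R z) k \<noteq> 0" using R0 by (auto simp: poly_eq_iff)
    then show ?thesis by (intro zgenI[OF pfam_coeff[OF R, of k], of z]) auto
  qed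
  have K1: "K \<ge> 1" using False by simp
  \<comment> \<open>Images of the basis: \<open>K\<close> monomials for \<open>T\<close>, then K - 1
    monomials for \<open>S\<close>, whose degree is allowed one less.\<close>
  define P where "P = (\<lambda>x j. if j < K then monom 1 j * pderiv (R x) else monom 1 (j - K) * R x)"
  define C where "C = K + (K - 1)"
  define T where "T = (\<lambda>v::nat \<Rightarrow> complex. \<Sum>j<K. monom (v j) j)"
  define S where "S = (\<lambda>v::nat \<Rightarrow> complex. \<Sum>j<K-1. monom (v (K + j)) j)"
  have sumP: "(\<Sum>j<C. Polynomial.smult (v j) (P x j)) = T v * pderiv (R x) + S v * R x" for x v
  proof -
    have "(\<Sum>j<C. Polynomial.smult (v j) (P x j)) = (\<Sum>j<K. Polynomial.smult (v j) (P x j)) + (\<Sum>j<K-1. Polynomial.smult (v (K + j)) (P x (K + j)))"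
      unfolding C_def by (rule sum_lessThan_add)
    also have "(\<Sum>j<K. Polynomial.smult (v j) (P x j)) = T v * pderiv (R x)"
      unfolding T_def sum_distrib_right
      by (rule sum.cong) (simp_all only: P_def lessThan_iff if_True mult_smult_left[symmetric] smult_monom mult_1_right)
    also have "(\<Sum>j<K-1. Polynomial.smult (v (K + j)) (P x (K + j))) = S v * R x"
      unfolding S_def sum_distrib_right
      by (rule sum.cong) (simp_all only: P_def not_add_less1 if_False add_diff_cancel_left' mult_smult_left[symmetric] smult_monom mult_1_right)
    finally show ?thesis .
  qed
  have sumP_coeff: "(\<Sum>j<C. coeff (P x j) i * v j) = coeff (T v * pderiv (R x) + S v * R x) i" for x v i
    unfolding sumP[symmetric] coeff_sum by (simp add: mult.commute)
  have pf: "(\<lambda>x. coeff (P x j) i) \<in> poly_fun n" for i j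
    using pfam_coeff[OF R]
    by (cases "j < K"; cases "i < j"; cases "i < j - K")
      (auto simp: P_def coeff_monom_mult coeff_pderiv intro!: poly_fun_intros)
  have degP: "coeff (T v * pderiv (R x) + S v * R x) i = 0" if "i \<ge> D + K" for x v i
  proof (rule coeff_eq_0)
    have 1: "degree (T v) < K" using degree_sum_monom_less[where K = K and v = v] False unfolding T_def by auto
    have 2: "degree (S v) < K" using degree_sum_monom_less[where K = "K - 1" and v = "\<lambda>j. v (K + j)"] False unfolding S_def by auto
    have "degree (pderiv (R x)) \<le> D" using D[of x] by (simp add: degree_pderiv le_diff_conv)
    then have "degree (T v * pderiv (R x)) < D + K" using degree_mult_le[of "T v" "pderiv (R x)"] 1 by linarith
    moreover have "degree (S v * R x) < D + K" using degree_mult_le[of "S v" "R x"] 2 D[of x] by linarith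
    ultimately show "degree (T v * pderiv (R x) + S v * R x) < i"
      using degree_add_le_max[of "T v * pderiv (R x)" "S v * R x"] that by linarith
  qed
  have inj_iff: "(\<forall>v. (\<forall>i<D+K. (\<Sum>j<C. coeff (P x j) i * v j) = 0) \<longrightarrow> (\<forall>j<C. v j = 0))
      \<longleftrightarrow> K \<le> card {t. poly (R x) t = 0}" if "R x \<noteq> 0" for x
  proof -
    have eq: "(\<forall>i<D+K. (\<Sum>j<C. coeff (P x j) i * v j) = 0) \<longleftrightarrow> T v * pderiv (R x) + S v * R x = 0" for v
          proof
      assume *: "\<forall>i<D+K. (\<Sum>j<C. coeff (P x j) i * v j) = 0"
      show "T v * pderiv (R x) + S v * R x = 0"
      proof (rule poly_eqI)
        fix i show "coeff (T v * pderiv (R x) + S v * R x) i = coeff 0 i"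
          using * degP[of i v x] unfolding sumP_coeff by (cases "i < D + K") auto
      qed
    next
      assume "T v * pderiv (R x) + S v * R x = 0"
      then show "\<forall>i<D+K. (\<Sum>j<C. coeff (P x j) i * v j) = 0" unfolding sumP_coeff by simp
    qed
    have zz: "T v = 0 \<and> S v = 0 \<longleftrightarrow> (\<forall>j<C. v j = 0)" for v
    proof
      assume "T v = 0 \<and> S v = 0"
      then have "coeff (T v) i = 0" "coeff (S v) i = 0" for i by auto
      then have "(if i < K then v i else 0) = 0" "(if i < K - 1 then v (K + i) else 0) = 0" for i
        unfolding T_def S_def coeff_sum_monom_lessThan by blast+
      then have 1: "i < K \<Longrightarrow> v i = 0" "i < K - 1 \<Longrightarrow> v (K + i) = 0" for i by presburger+
      show "\<forall>j<C. v j = 0"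
      proof (intro allI impI)
        fix j assume "j < C"
        then show "v j = 0" using 1(1)[of j] 1(2)[of "j - K"] unfolding C_def by (cases "j < K") auto
      qed
    next
      assume "\<forall>j<C. v j = 0"
      then show "T v = 0 \<and> S v = 0" unfolding T_def S_def C_def by simp
    qed
    show ?thesis
    proof
      assume L: "\<forall>v. (\<forall>i<D+K. (\<Sum>j<C. coeff (P x j) i * v j) = 0) \<longrightarrow> (\<forall>j<C. v j = 0)"
      show "K \<le> card {t. poly (R x) t = 0}"
      proof (rule card_roots_ge_iff[OF that K1, THEN iffD2], intro allI impI)
        fix t s assume ts: "degree t < K \<and> (s = 0 \<or> degree s + 1 < K) \<and> t * pderiv (R x) + s * R x = 0"
        define v where "v = (\<lambda>j. if j < K then coeff t j else coeff s (j - K))"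
        have "T v = (\<Sum>j<K. monom (coeff t j) j)" unfolding T_def by (rule sum.cong) (auto simp: v_def)
        then have 1: "T v = t" using sum_monom_coeff[of t K] ts by simp
        have "S v = (\<Sum>j<K-1. monom (coeff s j) j)" unfolding S_def by (rule sum.cong) (auto simp: v_def)
        moreover have "degree s < K - 1 \<or> s = 0" using ts by auto
        ultimately have 2: "S v = s" using sum_monom_coeff[of s "K - 1"] by simp
        have "T v * pderiv (R x) + S v * R x = 0" using ts unfolding 1 2 by blast
        then have "\<forall>j<C. v j = 0" using L eq[of v] by blast
        then show "t = 0 \<and> s = 0" using zz[of v] 1 2 by blast
      qed
    next
      assume L: "K \<le> card {t. poly (R x) t = 0}"
      show "\<forall>v. (\<forall>i<D+K. (\<Sum>j<C. coeff (P x j) i * v j) = 0) \<longrightarrow> (\<forall>j<C. v j = 0)"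
      proof (intro allI impI)
        fix v j assume v: "\<forall>i<D+K. (\<Sum>j<C. coeff (P x j) i * v j) = 0" and j: "j < C"
        have "T v * pderiv (R x) + S v * R x = 0" using eq[of v] v by blast
        moreover have "degree (T v) < K"
          using degree_sum_monom_less[where K = K and v = v] False unfolding T_def by auto
        moreover have "S v = 0 \<or> degree (S v) + 1 < K"
          using degree_sum_monom_less[where K = "K - 1" and v = "\<lambda>j. v (K + j)"] unfolding S_def by auto
        ultimately have "T v = 0 \<and> S v = 0"
          using card_roots_ge_iff[OF that K1] L by blast
        then show "v j = 0" using zz[of v] j by blast
      qed
    qed
  qed
  have "zgen n (\<lambda>x. \<forall>v. (\<forall>i<D+K. (\<Sum>j<C. coeff (P x j) i * v j) = 0) \<longrightarrow> (\<forall>j<C. v j = 0))"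
    by (rule zgen_injective[where z = z and M = "\<lambda>x i j. coeff (P x j) i"]) (use pf inj_iff[OF R0] K in auto)
  from zgen_conj[OF nz this] show ?thesis
    by (rule zgen_mono) (use inj_iff in blast)
qed

subsection \<open>Sylvester resultants with formal degrees\<close>

definition sylv :: "nat \<Rightarrow> complex poly \<Rightarrow> complex poly \<Rightarrow> nat \<Rightarrow> complex poly" where
  "sylv a g h i = (if i < a then monom 1 i * h else monom 1 (i - a) * g)"

text \<open>The degrees \<open>a\<close> and \<open>b\<close> are prescribed rather than read off,
  so that the determinant remains polynomial in parameters at which leading coefficients
  vanish.\<close>

definition res :: "nat \<Rightarrow> nat \<Rightarrow> complex poly \<Rightarrow> complex poly \<Rightarrow> complex" where
  "res a b g h = dt (a + b) (\<lambda>i k. coeff (sylv a g h i) k)"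

lemma res_poly_fun:
  assumes "pfam n g" "pfam n h"
  shows "(\<lambda>x. res a b (g x) (h x)) \<in> poly_fun n"
  unfolding res_def
proof (rule dt_poly_fun)
  fix i k
  have "pfam n (\<lambda>x. sylv a (g x) (h x) i)"
    unfolding sylv_def using assms by (cases "i < a") (auto intro: pfam_mult pfam_const)
  then show "(\<lambda>x. coeff (sylv a (g x) (h x) i) k) \<in> poly_fun n" by (rule pfam_coeff)
qed

lemma degree_sylv:
  assumes "degree g \<le> a" "degree h \<le> b" "i < a + b"
  shows "degree (sylv a g h i) < a + b"
proof (cases "i < a")
  case True
  have "degree (monom 1 i * h) \<le> i + b"
    using degree_mult_le[of "monom 1 i" h] assms(2) degree_monom_le[of "1::complex" i] by linarith
  then show ?thesis using True by (simp add: sylv_def)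
next
  case False
  have "degree (monom 1 (i - a) * g) \<le> (i - a) + a"
    using degree_mult_le[of "monom 1 (i - a)" g] assms(1) degree_monom_le[of "1::complex" "i - a"] by linarith
  then show ?thesis using False assms(3) by (simp add: sylv_def)
qed

lemma poly_as_sum_less:
  assumes "degree (p::complex poly) < N"
  shows "poly p z = (\<Sum>k<N. coeff p k * z ^ k)"
  using poly_altdef_le[of p "N - 1" z] assms by (simp add: lessThan_Suc_atMost[symmetric])

lemma poly_sylv: "poly (sylv a g h i) z = (if i < a then z ^ i * poly h z else z ^ (i - a) * poly g z)"
  by (simp add: sylv_def poly_monom)

text \<open>The powers of a common root form a kernel vector of the Sylvester matrix.\<close>

lemma res_eq_0_if_root:
  assumes "degree g \<le> a" "degree h \<le> b" "poly g q = 0" "poly h q = 0" "a + b > 0"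
  shows "res a b g h = 0"
  unfolding res_def dt_eq_0_iff
proof (intro exI[of _ "\<lambda>k. q ^ k"] conjI allI impI)
  show "\<exists>j<a+b. q ^ j \<noteq> 0" using assms(5) by (intro exI[of _ 0]) simp
  fix i assume "i < a + b"
  then have "(\<Sum>k<a+b. coeff (sylv a g h i) k * q ^ k) = poly (sylv a g h i) q"
    using poly_as_sum_less[OF degree_sylv] assms by metis
  then show "(\<Sum>k<a+b. coeff (sylv a g h i) k * q ^ k) = 0" using assms by (simp add: poly_sylv)
qed

lemma coprime_if_no_common_root:
  fixes g h :: "complex poly"
  assumes "\<And>q. \<not> (poly g q = 0 \<and> poly h q = 0)"
  shows "coprime g h"
proof (rule coprimeI)
  fix d assume d: "d dvd g" "d dvd h"
  have "degree d = 0"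
  proof (rule ccontr)
    assume "degree d \<noteq> 0"
    then have "\<not> constant (poly d)" by (simp add: constant_degree)
    then obtain q where "poly d q = 0" using fundamental_theorem_of_algebra by blast
    then show False using d assms by (metis dvd_def mult_zero_left poly_mult)
  qed
  then obtain c where c: "d = [:c:]" by (rule degree_eq_zeroE)
  have "c \<noteq> 0"
  proof
    assume "c = 0"
    then have "g = 0" "h = 0" using d c by auto
    then show False using assms[of 0] by simp
  qed
  then show "is_unit d" using c by (simp add: is_unit_pCons_iff)
qed

text \<open>A left kernel vector is a relation T h + S g = 0 with deg T < a and deg S < b. If g and
  h were coprime, the one of full formal degree would divide its cofactor of smaller degree. The
  hypothesis on leading coefficients excludes a common zero at infinity.\<close>

lemma res_eq_0_imp_root:
  assumes g: "degree g \<le> a" and h: "degree h \<le> b" and lc: "coeff g a \<noteq> 0 \<or> coeff h b \<noteq> 0"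
    and r: "res a b g h = 0"
  shows "\<exists>q. poly g q = 0 \<and> poly h q = 0"
proof (rule ccontr)
  assume "\<nexists>q. poly g q = 0 \<and> poly h q = 0"
  then have cop: "coprime g h" by (intro coprime_if_no_common_root) blast
  obtain v where v: "\<exists>i<a+b. v i \<noteq> 0" "\<forall>j<a+b. (\<Sum>i<a+b. v i * coeff (sylv a g h i) j) = 0"
    using r unfolding res_def dt_eq_0_iff_left by blast
  define T where "T = (\<Sum>i<a. monom (v i) i)"
  define S where "S = (\<Sum>i<b. monom (v (a + i)) i)"
  have T: "T * h = (\<Sum>i<a. Polynomial.smult (v i) (sylv a g h i))"
    unfolding T_def sum_distrib_right
    by (rule sum.cong) (simp_all only: sylv_def lessThan_iff if_True mult_smult_left[symmetric] smult_monom mult_1_right)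
  have S: "S * g = (\<Sum>i<b. Polynomial.smult (v (a + i)) (sylv a g h (a + i)))"
    unfolding S_def sum_distrib_right
    by (rule sum.cong) (simp_all only: sylv_def not_add_less1 if_False add_diff_cancel_left'
        mult_smult_left[symmetric] smult_monom mult_1_right)
  have "T * h + S * g = (\<Sum>i<a+b. Polynomial.smult (v i) (sylv a g h i))"
    unfolding sum_lessThan_add T S ..
  also have "\<dots> = 0"
  proof (rule poly_eqI)
    fix j
    show "coeff (\<Sum>i<a+b. Polynomial.smult (v i) (sylv a g h i)) j = coeff 0 j"
    proof (cases "j < a + b")
      case True
      then show ?thesis using v(2) by (simp add: coeff_sum)
    next
      case False
      then have "coeff (sylv a g h i) j = 0" if "i < a + b" for i
        using degree_sylv[OF g h that] by (intro coeff_eq_0) simp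
      then show ?thesis by (simp add: coeff_sum)
    qed
  qed
  finally have TS: "T * h + S * g = 0" .
  then have eq: "T * h = - (S * g)" by (simp add: add_eq_0_iff2)
  have dT: "T = 0 \<or> degree T < a" unfolding T_def by (rule degree_sum_monom_less)
  have dS: "S = 0 \<or> degree S < b" unfolding S_def by (rule degree_sum_monom_less[of "\<lambda>i. v (a + i)"])
  have "T = 0 \<and> S = 0"
  proof (cases "coeff h b = 0")
    case False
    then have hb: "degree h = b" "h \<noteq> 0" using h le_degree[of h b] by auto
    have "h dvd - (S * g)" using dvd_triv_right[of h T] unfolding eq .
    then have "h dvd S * g" by (simp only: dvd_minus_iff)
    then have "h dvd S" using cop by (simp only: coprime_dvd_mult_left_iff coprime_commute[of h g])
    then have "S = 0" using dS hb dvd_imp_degree_le[of h S] by linarith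
    then show ?thesis using eq hb by simp
  next
    case True
    then have "coeff g a \<noteq> 0" using lc by simp
    then have ga: "degree g = a" "g \<noteq> 0" using g le_degree[of g a] by auto
    have "g dvd T * h" unfolding eq dvd_minus_iff by (rule dvd_triv_right)
    then have "g dvd T" using cop by (simp only: coprime_dvd_mult_left_iff)
    then have "T = 0" using dT ga dvd_imp_degree_le[of g T] by linarith
    then show ?thesis using eq ga by simp
  qed
  then have "coeff T i = 0" "coeff S i = 0" for i by auto
  then have *: "(if i < a then v i else 0) = 0" "(if i < b then v (a + i) else 0) = 0" for i
    unfolding T_def S_def coeff_sum_monom_lessThan by blast+
  obtain i where i: "i < a + b" "v i \<noteq> 0" using v(1) by blast
  show False
  proof (cases "i < a")
    case True
    then show False using *(1)[of i] i by simp
  next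
    case False
    then have "i - a < b" "a + (i - a) = i" using i by simp_all
    then show False using *(2)[of "i - a"] i(2) by simp
  qed
qed

lemma dt_vandermonde_nz:
  assumes "inj_on z {..<n}"
  shows "dt n (\<lambda>k l. z l ^ k) \<noteq> 0"
proof
  assume "dt n (\<lambda>k l. z l ^ k) = 0"
  then obtain v where v: "\<exists>i<n. v i \<noteq> 0" "\<forall>l<n. (\<Sum>k<n. v k * z l ^ k) = 0"
    unfolding dt_eq_0_iff_left by blast
  define p where "p = (\<Sum>k<n. monom (v k) k)"
  have "p = 0"
  proof (rule ccontr)
    assume "p \<noteq> 0"
    then have "card {x. poly p x = 0} \<le> degree p" by (rule card_poly_roots_bound)
    also have "degree p < n" using degree_sum_monom_less[of v n] \<open>p \<noteq> 0\<close> unfolding p_def by auto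
    also have "n = card (z ` {..<n})" using assms by (simp add: card_image)
    also have "\<dots> \<le> card {x. poly p x = 0}"
      using v(2) \<open>p \<noteq> 0\<close> by (intro card_mono poly_roots_finite) (auto simp: p_def poly_sum poly_monom)
    finally show False by simp
  qed
  then have "coeff p i = 0" for i by simp
  then show False using v(1) unfolding p_def coeff_sum_monom_lessThan by metis
qed

text \<open>The matrix product of the Sylvester matrix with a Vandermonde matrix whose first nodes are
  the roots of the first polynomial is block triangular; the constant is found from the case that
  the second polynomial is 1.\<close>

lemma res_prod:
  assumes g: "degree g \<le> a" and h: "degree h \<le> b" and Q: "finite Q" "card Q = a" "\<And>q. q \<in> Q \<Longrightarrow> poly g q = 0"
  shows "res a b g h = coeff g a ^ b * (\<Prod>q\<in>Q. poly h q)"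
proof -
  obtain y where y: "bij_betw y {..<a} Q"
    using ex_bij_betw_nat_finite[OF Q(1)] Q(2) by (auto simp: atLeast0LessThan)
  \<comment> \<open>Further nodes away from the roots of \<open>g\<close> make the Vandermonde
    matrix square and invertible.\<close>
  obtain B where B: "finite B" "card B = b" "B \<inter> Q = {}"
  proof -
    have "infinite (UNIV - Q :: complex set)" using Q(1) infinite_UNIV_char_0 by (simp add: Diff_infinite_finite)
    then obtain B where "finite B" "card B = b" "B \<subseteq> UNIV - Q" using infinite_arbitrarily_large by blast
    then show ?thesis using that by blast
  qed
  obtain y' where y': "bij_betw y' {..<b} B"
    using ex_bij_betw_nat_finite[OF B(1)] B(2) by (auto simp: atLeast0LessThan)
  define z where "z = (\<lambda>l. if l < a then y l else y' (l - a))"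
  have inj: "inj_on z {..<a+b}"
  proof (rule inj_onI)
    fix i j assume ij: "i \<in> {..<a+b}" "j \<in> {..<a+b}" "z i = z j"
    have yQ: "k < a \<Longrightarrow> y k \<in> Q" for k using y by (auto simp: bij_betw_def)
    have yB: "k < b \<Longrightarrow> y' k \<in> B" for k using y' by (auto simp: bij_betw_def)
    show "i = j"
    proof (cases "i < a"; cases "j < a")
      assume "i < a" "j < a"
      then show ?thesis using ij y by (auto simp: z_def bij_betw_def inj_on_def)
    next
      assume *: "i < a" "\<not> j < a"
      then have "y i = y' (j - a)" "j - a < b" using ij by (auto simp: z_def)
      then show ?thesis using yQ[OF *(1)] yB[of "j - a"] B(3) by auto
    next
      assume *: "\<not> i < a" "j < a"
      then have "y' (i - a) = y j" "i - a < b" using ij by (auto simp: z_def)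
      then show ?thesis using yQ[OF *(2)] yB[of "i - a"] B(3) by auto
    next
      assume *: "\<not> i < a" "\<not> j < a"
      then have "y' (i - a) = y' (j - a)" "i - a < b" "j - a < b" using ij by (auto simp: z_def)
      then have "i - a = j - a" using y' by (auto simp: bij_betw_def inj_on_def)
      then show ?thesis using * by simp
    qed
  qed
  define V where "V = dt (a + b) (\<lambda>k l. z l ^ k)"
  define V1 where "V1 = dt a (\<lambda>k l. z l ^ k)"
  define W where "W = dt b (\<lambda>i l. z (a + l) ^ i * poly g (z (a + l)))"
  have main: "res a b g h * V = V1 * (\<Prod>q\<in>Q. poly h q) * W" if h: "degree h \<le> b" for h
  proof -
    have "res a b g h * V = dt (a + b) (\<lambda>i l. \<Sum>k<a+b. coeff (sylv a g h i) k * z l ^ k)"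
      unfolding res_def V_def by (rule dt_mult[symmetric])
    also have "\<dots> = dt (a + b) (\<lambda>i l. poly (sylv a g h i) (z l))"
      unfolding dt_altdef
    proof (intro sum.cong prod.cong refl arg_cong2[of _ _ _ _ "(*)"])
      fix p i assume "i \<in> {0..<a+b}"
      then show "(\<Sum>k<a+b. coeff (sylv a g h i) k * z (p i) ^ k) = poly (sylv a g h i) (z (p i))"
        using poly_as_sum_less[OF degree_sylv[OF g h, of i]] by simp
    qed
    also have "\<dots> = dt a (\<lambda>i l. poly (sylv a g h i) (z l)) * dt b (\<lambda>i l. poly (sylv a g h (a + i)) (z (a + l)))"
    proof (rule dt_block)
      fix i l assume "l < a"
      then have "poly g (z l) = 0" using y Q(3) by (auto simp: z_def bij_betw_def)
      then show "poly (sylv a g h (a + i)) (z l) = 0" by (simp add: poly_sylv)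
    qed
    also have "dt b (\<lambda>i l. poly (sylv a g h (a + i)) (z (a + l))) = W"
      unfolding W_def by (simp add: poly_sylv)
    also have "dt a (\<lambda>i l. poly (sylv a g h i) (z l)) = dt a (\<lambda>i l. z l ^ i * poly h (z l))"
      unfolding dt_altdef by (intro sum.cong prod.cong refl arg_cong2[of _ _ _ _ "(*)"]) (simp add: poly_sylv)
    also have "\<dots> = V1 * (\<Prod>l<a. poly h (z l))"
      unfolding V1_def by (rule dt_scale_cols)
    also have "(\<Prod>l<a. poly h (z l)) = (\<Prod>q\<in>Q. poly h q)"
      using prod.reindex_bij_betw[OF y, of "poly h"] by (simp add: z_def)
    finally show ?thesis .
  qed
  have "res a b g 1 = (\<Prod>i<a+b. coeff (sylv a g 1 i) i)"
    unfolding res_def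
  proof (rule dt_lower_triangular)
    fix i j assume ij: "i < j" "j < a + b"
    show "coeff (sylv a g 1 i) j = 0"
    proof (cases "i < a")
      case False
      then have "j - (i - a) > degree g" using ij g by linarith
      then show ?thesis using False by (simp add: sylv_def coeff_monom_mult coeff_eq_0)
    qed (use ij in \<open>simp add: sylv_def\<close>)
  qed
  also have "\<dots> = (\<Prod>i<a. 1) * (\<Prod>i<b. coeff g a)"
  proof -
    have "(\<Prod>i<a+b. f i) = (\<Prod>i<a. f i) * (\<Prod>i<b. f (a + i))" for f :: "nat \<Rightarrow> complex"
      by (induction b) (simp_all add: mult_ac)
    then show ?thesis by (simp add: sylv_def coeff_monom_mult)
  qed
  finally have "res a b g 1 = coeff g a ^ b" by simp
  with main[of 1] have "coeff g a ^ b * V = V1 * W" by simp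
  with main[OF h] have "res a b g h * V = (coeff g a ^ b * (\<Prod>q\<in>Q. poly h q)) * V" by (simp add: mult_ac)
  moreover have "V \<noteq> 0" unfolding V_def by (rule dt_vandermonde_nz[OF inj])
  ultimately show ?thesis by simp
qed

subsection \<open>Roots of converging polynomials\<close>

text \<open>A form without division of P'/P = \<Sum> 1/(s - r): if every root has distance at least
  \<delta> from \<open>s\<close>, then |P'(s)/P(s)| is at most deg P / \<delta>. The induction
  splits off one root at a time.\<close>

lemma pderiv_bound_by_root_distance:
  fixes P :: "complex poly"
  assumes "P \<noteq> 0" "\<And>r. poly P r = 0 \<Longrightarrow> \<delta> \<le> cmod (r - s)" "\<delta> \<ge> 0"
  shows "\<delta> * cmod (poly (pderiv P) s) \<le> degree P * cmod (poly P s)"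
  using assms(1,2)
proof (induction "degree P" arbitrary: P)
  case 0
  then have "pderiv P = 0" by (simp add: pderiv_eq_0_iff)
  then show ?case by simp
next
  case (Suc d)
  then have "\<not> constant (poly P)" by (simp add: constant_degree)
  then obtain r where r: "poly P r = 0" using fundamental_theorem_of_algebra by blast
  then obtain Q where Q: "P = [:-r, 1:] * Q" using poly_eq_0_iff_dvd by (metis dvd_def)
  have Q0: "Q \<noteq> 0" using Q Suc.prems by auto
  then have dQ: "degree P = Suc (degree Q)" unfolding Q by (subst degree_mult_eq) auto
  have IH: "\<delta> * cmod (poly (pderiv Q) s) \<le> degree Q * cmod (poly Q s)"
    using Suc.hyps Suc.prems dQ Q Q0 by (intro Suc.hyps(1)) auto
  have r': "\<delta> \<le> cmod (s - r)" using Suc.prems(2)[OF r] by (simp add: norm_minus_commute)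
  have "poly (pderiv P) s = poly Q s + (s - r) * poly (pderiv Q) s"
    unfolding Q pderiv_mult poly_add poly_mult by (simp add: pderiv_pCons algebra_simps)
  then have "\<delta> * cmod (poly (pderiv P) s) \<le> \<delta> * (cmod (poly Q s) + cmod (s - r) * cmod (poly (pderiv Q) s))"
    using assms(3) by (intro mult_left_mono) (metis norm_mult norm_triangle_ineq)+
  also have "\<dots> = \<delta> * cmod (poly Q s) + cmod (s - r) * (\<delta> * cmod (poly (pderiv Q) s))" by (simp add: algebra_simps)
  also have "\<dots> \<le> cmod (s - r) * cmod (poly Q s) + cmod (s - r) * (degree Q * cmod (poly Q s))"
    using r' IH by (intro add_mono mult_right_mono mult_left_mono) auto
  also have "\<dots> = degree P * cmod (poly P s)"
    unfolding dQ by (simp add: Q norm_mult algebra_simps) (simp flip: norm_mult add: algebra_simps)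
  finally show ?case .
qed

text \<open>The previous bound with \<delta> the distance to the nearest root. It serves as a
  quantitative implicit function theorem that needs only a bound on the degree.\<close>

lemma root_near:
  fixes P :: "complex poly"
  assumes "degree P \<le> d" "poly (pderiv P) s \<noteq> 0"
  shows "\<exists>r. poly P r = 0 \<and> cmod (r - s) * cmod (poly (pderiv P) s) \<le> d * cmod (poly P s)"
proof -
  have P0: "P \<noteq> 0" using assms by auto
  have "degree P \<noteq> 0" using assms(2) by (auto simp: pderiv_eq_0_iff[symmetric])
  then have "\<not> constant (poly P)" by (simp add: constant_degree)
  then have ne: "{r. poly P r = 0} \<noteq> {}" using fundamental_theorem_of_algebra by blast
  have fin: "finite {r. poly P r = 0}" using P0 by (rule poly_roots_finite)
  obtain r where r: "poly P r = 0" "\<And>r'. poly P r' = 0 \<Longrightarrow> cmod (r - s) \<le> cmod (r' - s)"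
    using ex_is_arg_min_if_finite[OF fin ne, of "\<lambda>r. cmod (r - s)"]
    by (auto simp: is_arg_min_linorder)
  have "cmod (r - s) * cmod (poly (pderiv P) s) \<le> degree P * cmod (poly P s)"
    by (rule pderiv_bound_by_root_distance[OF P0]) (use r(2) in auto)
  also have "\<dots> \<le> d * cmod (poly P s)" using assms(1) by (intro mult_right_mono) auto
  finally show ?thesis using r(1) by blast
qed

text \<open>The degree may drop in the limit, as it does for the rescaled polynomials near special
  points; the surplus roots then escape to infinity.\<close>

definition plim :: "'b filter \<Rightarrow> ('b \<Rightarrow> complex poly) \<Rightarrow> complex poly \<Rightarrow> bool" where
  "plim F g g0 \<longleftrightarrow> (\<exists>d. \<forall>x. degree (g x) \<le> d) \<and> (\<forall>k. ((\<lambda>x. coeff (g x) k) \<longlongrightarrow> coeff g0 k) F)"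

lemma plim_const: "plim F (\<lambda>x. P) P"
  unfolding plim_def by auto

lemma plim_pCons: "(f \<longlongrightarrow> c) F \<Longrightarrow> plim F g g0 \<Longrightarrow> plim F (\<lambda>x. pCons (f x) (g x)) (pCons c g0)"
  unfolding plim_def
proof safe
  fix D assume "\<forall>x. degree (g x) \<le> D"
  then show "\<exists>D. \<forall>x. degree (pCons (f x) (g x)) \<le> D"
    by (intro exI[of _ "Suc D"]) (metis Suc_le_mono degree_pCons_le le_trans)
next
  fix k assume "(f \<longlongrightarrow> c) F" "\<forall>k. ((\<lambda>x. coeff (g x) k) \<longlongrightarrow> coeff g0 k) F"
  then show "((\<lambda>x. coeff (pCons (f x) (g x)) k) \<longlongrightarrow> coeff (pCons c g0) k) F" by (cases k) auto
qed

lemma plim_add: assumes "plim F f f0" "plim F g g0" shows "plim F (\<lambda>x. f x + g x) (f0 + g0)"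
proof -
  obtain D E where "\<forall>x. degree (f x) \<le> D" "\<forall>x. degree (g x) \<le> E" using assms unfolding plim_def by blast
  then have "\<forall>x. degree (f x + g x) \<le> max D E" by (meson degree_add_le max.coboundedI1 max.coboundedI2)
  then show ?thesis using assms unfolding plim_def by (auto intro: tendsto_add)
qed

lemma plim_mult: assumes "plim F f f0" "plim F g g0" shows "plim F (\<lambda>x. f x * g x) (f0 * g0)"
proof -
  obtain D E where "\<forall>x. degree (f x) \<le> D" "\<forall>x. degree (g x) \<le> E" using assms unfolding plim_def by blast
  then have "\<forall>x. degree (f x * g x) \<le> D + E" by (meson add_mono degree_mult_le le_trans)
  then show ?thesis using assms unfolding plim_def coeff_mult by (auto intro!: tendsto_sum tendsto_mult)
qed

lemma plim_power: "plim F f f0 \<Longrightarrow> plim F (\<lambda>x. f x ^ k) (f0 ^ k)"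
  by (induction k) (auto intro: plim_const plim_mult)

lemma plim_sum: "(\<And>i. i \<in> I \<Longrightarrow> plim F (f i) (f0 i)) \<Longrightarrow> plim F (\<lambda>x. \<Sum>i\<in>I. f i x) (\<Sum>i\<in>I. f0 i)"
  by (induction I rule: infinite_finite_induct) (auto intro: plim_const plim_add)

lemma plim_prod: "(\<And>i. i \<in> I \<Longrightarrow> plim F (f i) (f0 i)) \<Longrightarrow> plim F (\<lambda>x. \<Prod>i\<in>I. f i x) (\<Prod>i\<in>I. f0 i)"
  by (induction I rule: infinite_finite_induct) (auto intro: plim_const plim_mult)

lemma plim_linear: "(f \<longlongrightarrow> c) F \<Longrightarrow> (g \<longlongrightarrow> e) F \<Longrightarrow> plim F (\<lambda>x. [:f x, g x:]) [:c, e:]"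
  by (intro plim_pCons plim_const)

lemma plim_scalar: "(f \<longlongrightarrow> c) F \<Longrightarrow> plim F (\<lambda>x. [:f x:]) [:c:]"
  by (intro plim_pCons plim_const)

lemma plim_poly:
  assumes "plim F g g0" "(r \<longlongrightarrow> r0) F"
  shows "((\<lambda>x. poly (g x) (r x)) \<longlongrightarrow> poly g0 r0) F"
proof -
  obtain d where d: "\<And>x. degree (g x) \<le> d" using assms unfolding plim_def by blast
  define D where "D = max d (degree g0)"
  have "degree (g x) \<le> D" for x using d[of x] unfolding D_def by simp
  then have "(\<lambda>x. poly (g x) (r x)) = (\<lambda>x. \<Sum>k\<le>D. coeff (g x) k * r x ^ k)"
    by (intro ext poly_altdef_le)
  moreover have "poly g0 r0 = (\<Sum>k\<le>D. coeff g0 k * r0 ^ k)" by (rule poly_altdef_le) (simp add: D_def)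
  moreover have "((\<lambda>x. \<Sum>k\<le>D. coeff (g x) k * r x ^ k) \<longlongrightarrow> (\<Sum>k\<le>D. coeff g0 k * r0 ^ k)) F"
    using assms unfolding plim_def by (intro tendsto_intros) auto
  ultimately show ?thesis by simp
qed

lemma plim_pderiv: assumes "plim F g g0" shows "plim F (\<lambda>x. pderiv (g x)) (pderiv g0)"
proof -
  obtain d where d: "\<And>x. degree (g x) \<le> d" using assms unfolding plim_def by blast
  have "degree (pderiv (g x)) \<le> d" for x using d[of x] by (simp add: degree_pderiv le_diff_conv)
  then show ?thesis using assms unfolding plim_def coeff_pderiv by (auto intro!: tendsto_mult)
qed

text \<open>Only simple roots of the limit are followed. The root given by \<open>root_near\<close>
  lies within d |g(s)| / |g'(s)| of \<open>s\<close>, and this bound tends to 0 along the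
  filter.\<close>

lemma plim_root:
  assumes g: "plim F g g0" and s: "poly g0 s = 0" "poly (pderiv g0) s \<noteq> 0"
  shows "\<exists>r. (\<forall>\<^sub>F x in F. poly (g x) (r x) = 0) \<and> (r \<longlongrightarrow> s) F"
proof -
  obtain d where d: "\<And>x. degree (g x) \<le> d" using assms unfolding plim_def by blast
  define r where "r = (\<lambda>x. SOME r. poly (g x) r = 0 \<and> cmod (r - s) * cmod (poly (pderiv (g x)) s) \<le> d * cmod (poly (g x) s))"
  have lim1: "((\<lambda>x. poly (pderiv (g x)) s) \<longlongrightarrow> poly (pderiv g0) s) F"
    by (rule plim_poly[OF plim_pderiv[OF g]]) simp
  have lim2: "((\<lambda>x. poly (g x) s) \<longlongrightarrow> 0) F"
    using plim_poly[OF g, of "\<lambda>_. s" s] s(1) by simp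
  have ev: "\<forall>\<^sub>F x in F. poly (pderiv (g x)) s \<noteq> 0"
    using tendsto_imp_eventually_ne[OF lim1 s(2)] .
  have *: "poly (g x) (r x) = 0 \<and> cmod (r x - s) * cmod (poly (pderiv (g x)) s) \<le> d * cmod (poly (g x) s)"
    if "poly (pderiv (g x)) s \<noteq> 0" for x
    unfolding r_def by (rule someI_ex, rule root_near[OF d that])
  have "((\<lambda>x. d * cmod (poly (g x) s) / cmod (poly (pderiv (g x)) s)) \<longlongrightarrow> d * cmod 0 / cmod (poly (pderiv g0) s)) F"
    by (intro tendsto_intros lim1 lim2) (use s in simp)
  then have lim3: "((\<lambda>x. d * cmod (poly (g x) s) / cmod (poly (pderiv (g x)) s)) \<longlongrightarrow> 0) F" by simp
  have "((\<lambda>x. r x - s) \<longlongrightarrow> 0) F"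
  proof (rule Lim_null_comparison[OF _ lim3])
    show "\<forall>\<^sub>F x in F. norm (r x - s) \<le> d * cmod (poly (g x) s) / cmod (poly (pderiv (g x)) s)"
      using ev by eventually_elim (use * in \<open>simp add: field_simps\<close>)
  qed
  then have "(r \<longlongrightarrow> s) F" by (simp add: LIM_zero_iff)
  moreover have "\<forall>\<^sub>F x in F. poly (g x) (r x) = 0" using ev by eventually_elim (use * in blast)
  ultimately show ?thesis by blast
qed

lemma card_roots_simple:
  fixes p :: "complex poly"
  assumes "p \<noteq> 0" "\<And>q. poly p q = 0 \<Longrightarrow> poly (pderiv p) q \<noteq> 0"
  shows "card {q. poly p q = 0} = degree p"
proof -
  have "order q p = 1" if "poly p q = 0" for q
    using order_pderiv[OF assms(1) that] assms(2)[OF that] by (simp add: order_root)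
  then have "(\<Sum>x | poly p x = 0. order x p) = (\<Sum>x | poly p x = 0. 1)" by (intro sum.cong) auto
  then show ?thesis using sum_order_degree_complex[OF assms(1)] by simp
qed

lemma simple_roots_if_card:
  fixes p :: "complex poly"
  assumes "p \<noteq> 0" "degree p \<le> card {q. poly p q = 0}" "poly p q = 0"
  shows "poly (pderiv p) q \<noteq> 0"
proof
  assume q: "poly (pderiv p) q = 0"
  have fin: "finite {x. poly p x = 0}" using assms(1) by (rule poly_roots_finite)
  have ge: "order x p \<ge> 1" if "poly p x = 0" for x
    using that assms(1) by (simp add: order_root Suc_le_eq)
  have "pderiv p \<noteq> 0"
  proof
    assume "pderiv p = 0"
    then have "degree p = 0" by (simp add: pderiv_eq_0_iff)
    then obtain c where "p = [:c:]" by (rule degree_eq_zeroE)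
    then show False using assms(1,3) by simp
  qed
  then have "order q (pderiv p) \<ge> 1" using q by (simp add: order_root Suc_le_eq)
  then have o2: "order q p > 1" using order_pderiv[OF assms(1,3)] by simp
  have "card {x. poly p x = 0} = (\<Sum>x | poly p x = 0. 1)" by (rule card_eq_sum)
  also have "\<dots> < (\<Sum>x | poly p x = 0. order x p)"
  proof (rule sum_strict_mono_ex1[OF fin])
    show "\<forall>x\<in>{x. poly p x = 0}. 1 \<le> order x p" using ge by blast
    show "\<exists>x\<in>{x. poly p x = 0}. 1 < order x p" using o2 assms(3) by blast
  qed
  also have "\<dots> = degree p" by (rule sum_order_degree_complex[OF assms(1)])
  finally show False using assms(2) by simp
qed

subsection \<open>Orders from asymptotics\<close>

text \<open>Stated for an arbitrary filter and an arbitrary null function, so that it applies to p -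
  z at a point and to 1/p at infinity.\<close>

lemma power_quotient_limit:
  assumes F: "(e \<longlongrightarrow> (0::complex)) F" "F \<noteq> bot" "\<forall>\<^sub>F x in F. e x \<noteq> 0"
    and L: "((\<lambda>x. e x ^ A / e x ^ B) \<longlongrightarrow> L) F" "L \<noteq> 0"
  shows "A = B"
proof (rule ccontr)
  assume "A \<noteq> B"
  then consider "A > B" | "B > A" by linarith
  then show False
  proof cases
    case 1
    have "((\<lambda>x. e x ^ (A - B)) \<longlongrightarrow> 0 ^ (A - B)) F" by (intro tendsto_intros F)
    then have "((\<lambda>x. e x ^ (A - B)) \<longlongrightarrow> 0) F" using 1 by (simp add: power_0_left)
    moreover have "\<forall>\<^sub>F x in F. e x ^ (A - B) = e x ^ A / e x ^ B"
      using F(3) by eventually_elim (use 1 in \<open>simp add: power_diff\<close>)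
    ultimately have "((\<lambda>x. e x ^ A / e x ^ B) \<longlongrightarrow> 0) F" by (rule Lim_transform_eventually)
    then show False using tendsto_unique[OF F(2) L(1)] L(2) by simp
  next
    case 2
    have "((\<lambda>x. (e x ^ A / e x ^ B) * e x ^ (B - A)) \<longlongrightarrow> L * 0 ^ (B - A)) F" by (intro tendsto_intros F L)
    then have "((\<lambda>x. (e x ^ A / e x ^ B) * e x ^ (B - A)) \<longlongrightarrow> 0) F" using 2 by (simp add: power_0_left)
    moreover have "\<forall>\<^sub>F x in F. (e x ^ A / e x ^ B) * e x ^ (B - A) = 1"
      using F(3) by eventually_elim (use 2 in \<open>simp add: power_diff\<close>)
    ultimately have "((\<lambda>x. 1::complex) \<longlongrightarrow> 0) F" by (rule Lim_transform_eventually)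
    then show False using tendsto_unique[OF F(2) _ tendsto_const] by fastforce
  qed
qed

lemma quotient_cancel:
  fixes f r e c :: complex
  assumes "t * r = c * (u * e) * f" "r \<noteq> 0" "e \<noteq> 0" "c \<noteq> 0" "u \<noteq> 0"
  shows "(f * k / l) * (c * e) / r = (t * k) / (u * l)"
proof -
  have "f = t * r / (c * (u * e))" using assms by (subst assms(1)) simp
  then have "(f * k / l) * (c * e) / r = ((c * e * r) * (t * k)) / ((c * e * r) * (u * l))"
    by (simp only: times_divide_eq_left times_divide_eq_right divide_divide_eq_left divide_divide_eq_right mult_ac)
  then show ?thesis using assms by simp
qed

text \<open>After splitting off the powers of p - z, all remaining factors have finite nonzero
  limits, so the exponents on both sides agree. The two exponents \<open>k\<close> and
  \<open>l\<close> describe a pole and a zero of \<open>F\<close> within the natural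
  numbers.\<close>

lemma order_limit:
  fixes R E :: "complex poly"
  assumes R: "R \<noteq> 0" and E: "E \<noteq> 0" and c: "c \<noteq> 0"
    and eq: "\<forall>\<^sub>F p in at z. poly R p = c * poly E p * F p"
    and L: "((\<lambda>p. F p * (p - z) ^ k / (p - z) ^ l) \<longlongrightarrow> L) (at z)" "L \<noteq> 0"
  shows "order z R + k = order z E + l"
proof -
  obtain R1 where R1: "R = [:-z, 1:] ^ order z R * R1" "\<not> [:-z, 1:] dvd R1" using order_decomp[OF R] by blast
  obtain E1 where E1: "E = [:-z, 1:] ^ order z E * E1" "\<not> [:-z, 1:] dvd E1" using order_decomp[OF E] by blast
  have nz: "poly R1 z \<noteq> 0" "poly E1 z \<noteq> 0" using R1(2) E1(2) by (simp_all add: poly_eq_0_iff_dvd)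
  have pR: "poly R p = (p - z) ^ order z R * poly R1 p" for p by (subst R1(1)) simp
  have pE: "poly E p = (p - z) ^ order z E * poly E1 p" for p by (subst E1(1)) simp
  have limR1: "(poly R1 \<longlongrightarrow> poly R1 z) (at z)" by (rule poly_isCont[unfolded isCont_def])
  have limE1: "(poly E1 \<longlongrightarrow> poly E1 z) (at z)" by (rule poly_isCont[unfolded isCont_def])
  have "((\<lambda>p. (F p * (p - z) ^ k / (p - z) ^ l) * (c * poly E1 p) / poly R1 p) \<longlongrightarrow> L * (c * poly E1 z) / poly R1 z) (at z)"
    by (intro tendsto_intros L limR1 limE1 nz)
  moreover have "\<forall>\<^sub>F p in at z. (F p * (p - z) ^ k / (p - z) ^ l) * (c * poly E1 p) / poly R1 p =
      (p - z) ^ (order z R + k) / (p - z) ^ (order z E + l)"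
    using eq tendsto_imp_eventually_ne[OF limR1 nz(1)] tendsto_imp_eventually_ne[OF limE1 nz(2)]
      eventually_neq_at_within[of z z UNIV]
  proof eventually_elim
    case (elim p)
    then show ?case using c unfolding power_add
      by (intro quotient_cancel) (simp_all flip: pR pE)
  qed
  ultimately have lim: "((\<lambda>p. (p - z) ^ (order z R + k) / (p - z) ^ (order z E + l)) \<longlongrightarrow> L * (c * poly E1 z) / poly R1 z) (at z)"
    by (rule Lim_transform_eventually)
  show ?thesis
  proof (rule power_quotient_limit[OF _ _ _ lim])
    show "((\<lambda>p. p - z) \<longlongrightarrow> 0) (at z)" by (rule LIM_offset_zero_cancel) simp
    show "\<forall>\<^sub>F x in at z. x - z \<noteq> 0" using eventually_neq_at_within[of z z UNIV] by simp
    show "L * (c * poly E1 z) / poly R1 z \<noteq> 0" using L(2) c nz by simp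
  qed simp
qed

text \<open>The same comparison of exponents at infinity, with 1/p as the local parameter.\<close>

lemma degree_limit:
  fixes R E :: "complex poly"
  assumes R: "R \<noteq> 0" and E: "E \<noteq> 0" and c: "c \<noteq> 0"
    and eq: "\<forall>\<^sub>F p in at_infinity. poly R p = c * poly E p * F p"
    and L: "((\<lambda>p. F p / p ^ l) \<longlongrightarrow> L) at_infinity" "L \<noteq> 0"
  shows "degree R = degree E + l"
proof -
  have limR: "((\<lambda>p. poly R p / p ^ degree R) \<longlongrightarrow> lead_coeff R) at_infinity" by (rule poly_divide_tendsto_aux)
  have limE: "((\<lambda>p. poly E p / p ^ degree E) \<longlongrightarrow> lead_coeff E) at_infinity" by (rule poly_divide_tendsto_aux)
  have nz: "lead_coeff R \<noteq> 0" "lead_coeff E \<noteq> 0" using R E by auto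
  have inf: "\<forall>\<^sub>F p in at_infinity. p \<noteq> (0::complex)"
    by (auto simp: eventually_at_infinity intro!: exI[of _ 1])
  have "((\<lambda>p. (F p / p ^ l) * (c * (poly E p / p ^ degree E)) / (poly R p / p ^ degree R)) \<longlongrightarrow>
      L * (c * lead_coeff E) / lead_coeff R) at_infinity"
    by (intro tendsto_intros L limR limE nz)
  moreover have "\<forall>\<^sub>F p in at_infinity. (F p / p ^ l) * (c * (poly E p / p ^ degree E)) / (poly R p / p ^ degree R) =
     (1 / p) ^ (degree E + l) / (1 / p) ^ degree R"
    using eq inf tendsto_imp_eventually_ne[OF limR nz(1)] tendsto_imp_eventually_ne[OF limE nz(2)]
  proof eventually_elim
    case (elim p)
    then have "poly R p \<noteq> 0" "poly E p \<noteq> 0" by auto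
    then have "F p = poly R p / (c * poly E p)" using elim(1) c by simp
    then show ?case using elim(2) c \<open>poly R p \<noteq> 0\<close> \<open>poly E p \<noteq> 0\<close>
      by (simp add: power_add power_one_over)
  qed
  ultimately have lim: "((\<lambda>p. (1 / p) ^ (degree E + l) / (1 / p) ^ degree R) \<longlongrightarrow> L * (c * lead_coeff E) / lead_coeff R) at_infinity"
    by (rule Lim_transform_eventually)
  have "degree E + l = degree R"
  proof (rule power_quotient_limit[OF _ _ _ lim])
    show "((\<lambda>p. 1 / p) \<longlongrightarrow> (0::complex)) at_infinity"
      using tendsto_inverse_0[where 'a = complex] by (simp add: divide_inverse)
    show "\<forall>\<^sub>F x in at_infinity. 1 / x \<noteq> (0::complex)" using inf by eventually_elim simp
    show "L * (c * lead_coeff E) / lead_coeff R \<noteq> 0" using L(2) c nz by simp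
    show "at_infinity \<noteq> (bot :: complex filter)" by (rule trivial_limit_at_infinity)
  qed
  then show ?thesis by simp
qed

subsection \<open>Numerators of sums of fractions with cubed denominators\<close>

text \<open>The numerator of \<Sum> c_i / d_i^3 over the common denominator, see
  \<open>Nf_divide\<close>. As a ring expression it applies to polynomials as well as to their
  values, and it still makes sense where some d_i vanishes.\<close>

definition Nf :: "nat set \<Rightarrow> (nat \<Rightarrow> 'a) \<Rightarrow> (nat \<Rightarrow> 'a) \<Rightarrow> 'a :: comm_ring_1" where
  "Nf I c d = (\<Sum>i\<in>I. c i * (\<Prod>j\<in>I-{i}. d j ^ 3))"

lemma Nf_cong:
  assumes "\<And>i. i \<in> I \<Longrightarrow> c i = c' i" "\<And>i. i \<in> I \<Longrightarrow> d i = d' i"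
  shows "Nf I c d = Nf I c' d'"
  unfolding Nf_def by (intro sum.cong refl arg_cong2[where f = "(*)"] prod.cong) (simp_all add: assms)

lemma Nf_insert:
  assumes "finite I" "i \<notin> I"
  shows "Nf (insert i I) c d = c i * (\<Prod>j\<in>I. d j ^ 3) + d i ^ 3 * Nf I c d"
proof -
  have "(\<Sum>k\<in>I. c k * (\<Prod>j\<in>insert i I-{k}. d j ^ 3)) = d i ^ 3 * Nf I c d"
    unfolding Nf_def sum_distrib_left
  proof (rule sum.cong[OF refl])
    fix k assume "k \<in> I"
    then have "insert i I - {k} = insert i (I - {k})" using assms by auto
    then show "c k * (\<Prod>j\<in>insert i I-{k}. d j ^ 3) = d i ^ 3 * (c k * (\<Prod>j\<in>I-{k}. d j ^ 3))"
      using assms by (simp add: mult_ac)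
  qed
  moreover have "insert i I - {i} = I" using assms by auto
  ultimately show ?thesis using assms unfolding Nf_def by simp
qed

lemma Nf_remove:
  assumes "finite I" "i \<in> I"
  shows "Nf I c d = c i * (\<Prod>j\<in>I-{i}. d j ^ 3) + d i ^ 3 * Nf (I - {i}) c d"
  using Nf_insert[of "I - {i}" i c d] assms by (simp add: insert_absorb)

lemma Nf_divide:
  fixes c d :: "nat \<Rightarrow> 'a :: field"
  assumes "finite I" "\<And>i. i \<in> I \<Longrightarrow> d i \<noteq> 0"
  shows "Nf I c d = (\<Prod>j\<in>I. d j ^ 3) * (\<Sum>i\<in>I. c i / d i ^ 3)"
  unfolding Nf_def sum_distrib_left
proof (rule sum.cong[OF refl])
  fix i assume "i \<in> I"
  then show "c i * (\<Prod>j\<in>I-{i}. d j ^ 3) = (\<Prod>j\<in>I. d j ^ 3) * (c i / d i ^ 3)"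
    using assms by (simp add: prod.remove[of I i])
qed

text \<open>The homogeneity behind the substitution q = p x at infinity: the c_i have weight 2 and
  the d_i weight 1.\<close>

lemma Nf_scale:
  assumes "finite I" "I \<noteq> {}"
  shows "Nf I (\<lambda>i. x\<^sup>2 * c i) (\<lambda>i. x * d i) = x ^ (2 + 3 * (card I - 1)) * Nf I c d"
  unfolding Nf_def sum_distrib_left
proof (rule sum.cong[OF refl])
  fix i assume "i \<in> I"
  then have "(\<Prod>j\<in>I-{i}. (x * d j) ^ 3) = x ^ (3 * (card I - 1)) * (\<Prod>j\<in>I-{i}. d j ^ 3)"
    using assms by (simp add: power_mult_distrib prod.distrib power_mult)
  then show "x\<^sup>2 * c i * (\<Prod>j\<in>I-{i}. (x * d j) ^ 3) = x ^ (2 + 3 * (card I - 1)) * (c i * (\<Prod>j\<in>I-{i}. d j ^ 3))"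
    by (simp only: power_add mult_ac)
qed

lemma poly_Nf: "poly (Nf I c d) q = Nf I (\<lambda>i. poly (c i) q) (\<lambda>i. poly (d i) q)"
  by (simp add: Nf_def poly_sum poly_prod)

lemma pfam_Nf:
  assumes "\<And>i. i \<in> I \<Longrightarrow> pfam n (c i)" "\<And>i. i \<in> I \<Longrightarrow> pfam n (d i)"
  shows "pfam n (\<lambda>x. Nf I (\<lambda>i. c i x) (\<lambda>i. d i x))"
  unfolding Nf_def by (intro pfam_sum pfam_mult pfam_prod pfam_power assms) auto

lemma plim_Nf:
  assumes "\<And>i. i \<in> I \<Longrightarrow> plim F (c i) (c0 i)" "\<And>i. i \<in> I \<Longrightarrow> plim F (d i) (d0 i)"
  shows "plim F (\<lambda>x. Nf I (\<lambda>i. c i x) (\<lambda>i. d i x)) (Nf I c0 d0)"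
  unfolding Nf_def by (intro plim_sum plim_mult plim_prod plim_power assms) auto

lemma degree_prod_cube_le:
  assumes "finite I" "\<And>i. i \<in> I \<Longrightarrow> degree (d i :: complex poly) \<le> 1"
  shows "degree (\<Prod>i\<in>I. d i ^ 3) \<le> 3 * card I"
proof -
  have "degree (\<Prod>i\<in>I. d i ^ 3) \<le> (\<Sum>i\<in>I. degree (d i ^ 3))"
    using degree_prod_sum_le[OF assms(1), of "\<lambda>i. d i ^ 3"] by (simp add: o_def)
  also have "\<dots> \<le> (\<Sum>i\<in>I. 3)"
  proof (rule sum_mono)
    fix i assume "i \<in> I"
    then show "degree (d i ^ 3) \<le> 3" using degree_power_le[of "d i" 3] assms(2)[of i] by linarith
  qed
  finally show ?thesis by simp
qed

lemma degree_Nf: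
  assumes "finite I" "\<And>i. i \<in> I \<Longrightarrow> degree (c i :: complex poly) \<le> k" "\<And>i. i \<in> I \<Longrightarrow> degree (d i) \<le> 1"
  shows "degree (Nf I c d) \<le> k + 3 * (card I - 1)"
  unfolding Nf_def
proof (rule degree_sum_le[OF assms(1)])
  fix i assume i: "i \<in> I"
  have "degree (\<Prod>j\<in>I-{i}. d j ^ 3) \<le> 3 * card (I - {i})"
    by (rule degree_prod_cube_le) (use assms in auto)
  then show "degree (c i * (\<Prod>j\<in>I-{i}. d j ^ 3)) \<le> k + 3 * (card I - 1)"
    using degree_mult_le[of "c i" "\<Prod>j\<in>I-{i}. d j ^ 3"] assms(2)[OF i] assms(1) i by simp
qed

text \<open>The numerator of \<Sum> (w_i d_i - t_i) / d_i^3 with d_i = q - l_i. The critical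
  equation in q has w_i = s_i v_i and t_i = s_i^2, but its limits at special points are of this
  shape with other weights, for instance the sums of those of two cameras whose nodes merge.\<close>

definition Kp :: "nat set \<Rightarrow> (nat \<Rightarrow> complex) \<Rightarrow> (nat \<Rightarrow> complex) \<Rightarrow> (nat \<Rightarrow> complex) \<Rightarrow> complex poly" where
  "Kp I w t l = Nf I (\<lambda>i. [:- (w i * l i) - t i, w i:]) (\<lambda>i. [:- l i, 1:])"

lemma poly_Kp: "poly (Kp I w t l) q = Nf I (\<lambda>i. w i * (q - l i) - t i) (\<lambda>i. q - l i)"
  unfolding Kp_def poly_Nf by (rule Nf_cong) (simp_all add: algebra_simps)

lemma Kp_cong:
  assumes "\<And>i. i \<in> I \<Longrightarrow> w i = w' i" "\<And>i. i \<in> I \<Longrightarrow> t i = t' i" "\<And>i. i \<in> I \<Longrightarrow> l i = l' i"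
  shows "Kp I w t l = Kp I w' t' l'"
  unfolding Kp_def by (rule Nf_cong) (simp_all add: assms)

lemma degree_Kp: "finite I \<Longrightarrow> degree (Kp I w t l) \<le> 1 + 3 * (card I - 1)"
  unfolding Kp_def by (rule degree_Nf) auto

lemma coeff_prod_monic:
  assumes "finite I"
  shows "degree (\<Prod>j\<in>I. [:- l j, 1::complex:] ^ 3) = 3 * card I \<and> coeff (\<Prod>j\<in>I. [:- l j, 1:] ^ 3) (3 * card I) = 1"
proof -
  have d: "degree (\<Prod>j\<in>I. [:- l j, 1:] ^ 3) = 3 * card I"
    by (subst degree_prod_eq_sum_degree) (auto simp: degree_power_eq)
  moreover have "lead_coeff (\<Prod>j\<in>I. [:- l j, 1:] ^ 3) = 1"
    by (simp add: lead_coeff_prod lead_coeff_power)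
  ultimately show ?thesis by metis
qed

lemma coeff_Kp:
  assumes "finite I"
  shows "coeff (Kp I w t l) (1 + 3 * (card I - 1)) = (\<Sum>i\<in>I. w i)"
  unfolding Kp_def Nf_def coeff_sum
proof (rule sum.cong[OF refl])
  fix i assume "i \<in> I"
  then have c: "card (I - {i}) = card I - 1" using assms by simp
  define m where "m = (\<Prod>j\<in>I-{i}. [:- l j, 1:] ^ 3)"
  have m: "degree m = 3 * (card I - 1)" "coeff m (3 * (card I - 1)) = 1"
    using coeff_prod_monic[of "I - {i}" l] assms unfolding m_def c by auto
  have "coeff m (Suc (3 * (card I - 1))) = 0" by (rule coeff_eq_0) (simp add: m)
  then have "coeff ([:- (w i * l i) - t i, w i:] * m) (Suc (3 * (card I - 1))) = w i"
    using m(2) by simp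
  then show "coeff ([:- (w i * l i) - t i, w i:] * (\<Prod>j\<in>I-{i}. [:- l j, 1:] ^ 3)) (1 + 3 * (card I - 1)) = w i"
    unfolding m_def by simp
qed

lemma poly_Kp_node:
  assumes "finite I" "i \<in> I"
  shows "poly (Kp I w t l) (l i) = - t i * (\<Prod>j\<in>I-{i}. (l i - l j) ^ 3)"
  unfolding poly_Kp by (subst Nf_remove[OF assms]) simp

lemma poly_Kp_node_nz:
  assumes "finite I" "i \<in> I" "inj_on l I" "t i \<noteq> 0"
  shows "poly (Kp I w t l) (l i) \<noteq> 0"
  unfolding poly_Kp_node[OF assms(1,2)] using assms by (auto simp: inj_on_def)

text \<open>A Bertini argument: a double root \<open>q\<close> of x A + B is a zero of the Wronskian
  A B' - A' B, and it determines x = - B(q)/A(q).\<close>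

lemma pencil_simple:
  fixes A B :: "complex poly"
  assumes "A * pderiv B - pderiv A * B \<noteq> 0" "\<And>q. poly A q = 0 \<Longrightarrow> poly B q \<noteq> 0"
  shows "finite {x. \<exists>q. poly (Polynomial.smult x A + B) q = 0 \<and> poly (pderiv (Polynomial.smult x A + B)) q = 0}"
proof (rule finite_subset)
  let ?W = "A * pderiv B - pderiv A * B"
  show "finite ((\<lambda>q. - poly B q / poly A q) ` {q. poly ?W q = 0})"
    using poly_roots_finite[OF assms(1)] by (rule finite_imageI)
  show "{x. \<exists>q. poly (Polynomial.smult x A + B) q = 0 \<and> poly (pderiv (Polynomial.smult x A + B)) q = 0}
      \<subseteq> (\<lambda>q. - poly B q / poly A q) ` {q. poly ?W q = 0}"
  proof (rule subsetI, elim CollectE exE conjE)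
    fix x q
    assume 1: "poly (Polynomial.smult x A + B) q = 0" and 2: "poly (pderiv (Polynomial.smult x A + B)) q = 0"
    have B: "poly B q = - x * poly A q" using 1 by (simp add: add_eq_0_iff)
    have B': "poly (pderiv B) q = - x * poly (pderiv A) q"
      using 2 by (simp add: pderiv_add pderiv_smult add_eq_0_iff)
    have A: "poly A q \<noteq> 0"
    proof
      assume *: "poly A q = 0"
      then show False using assms(2)[OF *] B by simp
    qed
    have "poly ?W q = 0" by (simp add: B B')
    moreover have "x = - poly B q / poly A q" using A B by simp
    ultimately show "x \<in> (\<lambda>q. - poly B q / poly A q) ` {q. poly ?W q = 0}" by blast
  qed
qed

text \<open>Varying the single weight at node \<open>k\<close> gives a pencil x A + B. At that node
  A has a simple zero and B does not vanish, so the Wronskian is nonzero; a nonzero \<open>x\<close>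
  is also the coefficient of top degree.\<close>

lemma Kp_generic_roots:
  assumes I: "finite I" "k \<in> I" "inj_on l I" "\<And>i. i \<in> I \<Longrightarrow> t i \<noteq> 0"
  shows "\<exists>x. x \<noteq> 0 \<and> Kp I (\<lambda>i. if i = k then x else 0) t l \<noteq> 0 \<and>
    card {q. poly (Kp I (\<lambda>i. if i = k then x else 0) t l) q = 0} = 1 + 3 * (card I - 1)"
proof -
  define A where "A = [:- l k, 1:] * (\<Prod>j\<in>I-{k}. [:- l j, 1:] ^ 3)"
  define B where "B = Kp I (\<lambda>i. 0) t l"
  have eq: "Kp I (\<lambda>i. if i = k then x else 0) t l = Polynomial.smult x A + B" for x
  proof -
    have "poly (Kp I (\<lambda>i. if i = k then x else 0) t l) = poly (Polynomial.smult x A + B)"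
    proof
      fix q
      have "Nf (I - {k}) (\<lambda>i. (if i = k then x else 0) * (q - l i) - t i) (\<lambda>i. q - l i)
          = Nf (I - {k}) (\<lambda>i. 0 * (q - l i) - t i) (\<lambda>i. q - l i)"
        by (rule Nf_cong) auto
      then show "poly (Kp I (\<lambda>i. if i = k then x else 0) t l) q = poly (Polynomial.smult x A + B) q"
        unfolding B_def poly_add poly_Kp poly_smult A_def
        by (simp add: Nf_remove[OF I(1,2)] poly_prod algebra_simps)
    qed
    then show ?thesis by (simp add: poly_eq_poly_eq_iff)
  qed
  have Bnode: "poly B (l j) \<noteq> 0" if "j \<in> I" for j
    unfolding B_def by (rule poly_Kp_node_nz) (use I that in auto)
  have Aroot: "\<exists>j\<in>I. q = l j" if "poly A q = 0" for q
    using that I by (auto simp: A_def poly_prod)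
  have "poly (A * pderiv B - pderiv A * B) (l k) \<noteq> 0"
  proof -
    have "poly A (l k) = 0" by (simp add: A_def)
    moreover have "poly (pderiv A) (l k) = (\<Prod>j\<in>I-{k}. (l k - l j) ^ 3)"
      unfolding A_def pderiv_mult by (simp add: pderiv_pCons poly_prod)
    moreover have "(\<Prod>j\<in>I-{k}. (l k - l j) ^ 3) \<noteq> 0" using I by (auto simp: inj_on_def)
    ultimately show ?thesis using Bnode[OF I(2)] by simp
  qed
  then have "A * pderiv B - pderiv A * B \<noteq> 0" by (metis poly_0)
  from pencil_simple[OF this] have "finite (insert 0 {x. \<exists>q. poly (Polynomial.smult x A + B) q = 0 \<and> poly (pderiv (Polynomial.smult x A + B)) q = 0})"
    using Aroot Bnode by blast
  from ex_new_if_finite[OF infinite_UNIV_char_0 this] obtain x where x: "x \<noteq> 0"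
    "\<And>q. poly (Polynomial.smult x A + B) q = 0 \<Longrightarrow> poly (pderiv (Polynomial.smult x A + B)) q \<noteq> 0" by auto
  let ?P = "Kp I (\<lambda>i. if i = k then x else 0) t l"
  have c: "coeff ?P (1 + 3 * (card I - 1)) = x"
    unfolding coeff_Kp[OF I(1)] using I by simp
  then have "?P \<noteq> 0" using x(1) by auto
  moreover have "degree ?P = 1 + 3 * (card I - 1)"
    using degree_Kp[OF I(1)] c x(1) le_degree[of ?P "1 + 3 * (card I - 1)"] by (intro antisym) auto
  moreover have "card {q. poly ?P q = 0} = degree ?P"
    by (rule card_roots_simple) (use calculation x(2) in \<open>auto simp: eq\<close>)
  ultimately show ?thesis using x(1) by (intro exI[of _ x]) simp
qed

subsection \<open>Branches of the roots of a family of polynomials\<close>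

text \<open>The roots are known one at a time, each eventually along the filter. Since there are
  \<open>a\<close> distinct ones and the degree is at most \<open>a\<close>, none is
  missing.\<close>

lemma branches:
  assumes J: "finite J" "card J = a" and deg: "\<And>x. degree (g x :: complex poly) \<le> a"
    and nz: "\<forall>\<^sub>F x in F. g x \<noteq> 0"
    and root: "\<And>k. k \<in> J \<Longrightarrow> \<forall>\<^sub>F x in F. poly (g x) (r k x) = 0"
    and dist: "\<And>k k'. k \<in> J \<Longrightarrow> k' \<in> J \<Longrightarrow> k \<noteq> k' \<Longrightarrow> \<forall>\<^sub>F x in F. r k x \<noteq> r k' x"
  shows "\<forall>\<^sub>F x in F. inj_on (\<lambda>k. r k x) J \<and> {q. poly (g x) q = 0} = (\<lambda>k. r k x) ` J"
proof -
  have "\<forall>\<^sub>F x in F. \<forall>k\<in>J. poly (g x) (r k x) = 0"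
    using root J(1) by (simp add: eventually_ball_finite_distrib)
  moreover have "\<forall>\<^sub>F x in F. \<forall>k\<in>J. \<forall>k'\<in>J. k \<noteq> k' \<longrightarrow> r k x \<noteq> r k' x"
    using J(1) dist by (intro eventually_ball_finite ballI) (auto intro: eventually_mono)
  ultimately show ?thesis using nz
  proof eventually_elim
    case (elim x)
    have inj: "inj_on (\<lambda>k. r k x) J" using elim(2) by (auto simp: inj_on_def)
    have fin: "finite {q. poly (g x) q = 0}" using elim(3) by (rule poly_roots_finite)
    have "(\<lambda>k. r k x) ` J = {q. poly (g x) q = 0}"
    proof (rule card_subset_eq[OF fin])
      show "(\<lambda>k. r k x) ` J \<subseteq> {q. poly (g x) q = 0}" using elim(1) by auto
      then have "card ((\<lambda>k. r k x) ` J) \<le> card {q. poly (g x) q = 0}" by (rule card_mono[OF fin])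
      moreover have "card {q. poly (g x) q = 0} \<le> a"
        using card_poly_roots_bound[OF elim(3)] deg[of x] by linarith
      ultimately show "card ((\<lambda>k. r k x) ` J) = card {q. poly (g x) q = 0}"
        using J(2) card_image[OF inj] by simp
    qed
    then show ?case using inj by simp
  qed
qed

lemma pfam1_coeff:
  assumes "pfam 1 (\<lambda>x. g (x 0))"
  shows "\<exists>P. \<forall>p. coeff (g p) k = poly P p"
proof -
  obtain P where P: "\<forall>x::nat \<Rightarrow> complex. poly P (x 0) = coeff (g (x 0)) k"
    using poly_fun_1_poly[OF pfam_coeff[OF assms, of k]] by blast
  then show ?thesis using P[rule_format, of "\<lambda>_. y" for y] by (intro exI[of _ P]) simp
qed

lemma plim_pfam1:
  assumes "pfam 1 (\<lambda>x. g (x 0))" "F \<le> nhds z"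
  shows "plim F g (g z)"
  unfolding plim_def
proof (intro conjI allI)
  obtain D where D: "\<And>x :: nat \<Rightarrow> complex. degree (g (x 0)) \<le> D" using assms unfolding pfam_def by blast
  show "\<exists>d. \<forall>x. degree (g x) \<le> d" using D[of "\<lambda>_. y" for y] by auto
  fix k
  obtain P where P: "coeff (g p) k = poly P p" for p
    using pfam1_coeff[OF assms(1), of k] by blast
  moreover have "(poly P \<longlongrightarrow> poly P z) F"
    using tendsto_mono[OF assms(2), of "poly P" "poly P z"] poly_isCont[of z P]
    by (simp add: isCont_def tendsto_nhds_iff)
  ultimately show "((\<lambda>x. coeff (g x) k) \<longlongrightarrow> coeff (g z) k) F" by (simp only: P)
qed

text \<open>With g_z = (q - r(z)) S(q), the equation g_p(r(p)) = 0 reads (r(p) - r(z)) S(r(p)) = -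
  (g_p - g_z)(r(p)). Dividing by p - z exhibits the limit of the difference quotient.\<close>

lemma branch_has_derivative:
  assumes g: "pfam 1 (\<lambda>x. g (x 0))" and r: "(r \<longlongrightarrow> r z) (at z)" "\<forall>\<^sub>F p in at z. poly (g p) (r p) = 0"
    and rz: "poly (g z) (r z) = 0" "poly (pderiv (g z)) (r z) \<noteq> 0"
  shows "\<exists>D. (r has_field_derivative D) (at z)"
proof -
  obtain d where d: "\<And>p. degree (g p) \<le> d"
  proof -
    obtain D where D: "\<And>x :: nat \<Rightarrow> complex. degree (g (x 0)) \<le> D" using g unfolding pfam_def by blast
    then show ?thesis using that[of D] D[of "\<lambda>_. y" for y] by simp
  qed
  have "\<forall>k. \<exists>P. \<forall>p. coeff (g p) k = poly P p" using pfam1_coeff[OF g] by blast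
  then obtain P where "\<forall>k p. coeff (g p) k = poly (P k) p" by (rule choice[THEN exE])
  then have P: "\<And>k p. coeff (g p) k = poly (P k) p" by blast
  obtain S where S: "g z = [:- r z, 1:] * S" using rz(1) unfolding poly_eq_0_iff_dvd by (rule dvdE)
  have Sr: "poly S (r z) \<noteq> 0" using rz(2) unfolding S pderiv_mult by (simp add: pderiv_pCons)
  have limS: "((\<lambda>p. poly S (r p)) \<longlongrightarrow> poly S (r z)) (at z)"
    using r(1) by (intro isCont_tendsto_compose[OF _ r(1)]) simp
  let ?q = "\<lambda>p. \<Sum>k\<le>d. ((poly (P k) p - poly (P k) z) / (p - z)) * r p ^ k"
  have limq: "(?q \<longlongrightarrow> (\<Sum>k\<le>d. poly (pderiv (P k)) z * r z ^ k)) (at z)"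
    using poly_DERIV[unfolded has_field_derivative_iff] by (intro tendsto_intros r(1)) blast
  have ev: "\<forall>\<^sub>F p in at z. - ?q p / poly S (r p) = (r p - r z) / (p - z)"
    using r(2) tendsto_imp_eventually_ne[OF limS Sr] eventually_neq_at_within[of z z UNIV]
  proof eventually_elim
    case (elim p)
    have "poly (g z) (r p) = (r p - r z) * poly S (r p)"
      by (subst S) (simp add: algebra_simps)
    moreover have "poly (g p) (r p) = (\<Sum>k\<le>d. poly (P k) p * r p ^ k)"
      using poly_altdef_le[OF d, of p] P by simp
    moreover have "poly (g z) (r p) = (\<Sum>k\<le>d. poly (P k) z * r p ^ k)"
      using poly_altdef_le[OF d, of z] P by simp
    ultimately have "(r p - r z) * poly S (r p) = - (\<Sum>k\<le>d. (poly (P k) p - poly (P k) z) * r p ^ k)"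
      using elim(1) by (simp add: sum_subtractf left_diff_distrib)
    moreover have "(\<Sum>k\<le>d. (poly (P k) p - poly (P k) z) * r p ^ k) = ?q p * (p - z)"
      using elim(3) by (simp add: sum_distrib_right)
    ultimately have "(r p - r z) * poly S (r p) = - (?q p) * (p - z)" by simp
    then have "- ?q p / poly S (r p) = ((r p - r z) * poly S (r p)) / ((p - z) * poly S (r p))"
      using elim(3) by simp
    then show ?case using elim(2) by simp
  qed
  have "((\<lambda>p. - ?q p / poly S (r p)) \<longlongrightarrow> - (\<Sum>k\<le>d. poly (pderiv (P k)) z * r z ^ k) / poly S (r z)) (at z)"
    by (intro tendsto_divide tendsto_minus limq limS Sr)
  then have "((\<lambda>p. (r p - r z) / (p - z)) \<longlongrightarrow> - (\<Sum>k\<le>d. poly (pderiv (P k)) z * r z ^ k) / poly S (r z)) (at z)"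
    using ev by (rule Lim_transform_eventually)
  then show ?thesis unfolding has_field_derivative_iff by blast
qed

text \<open>All \<open>a\<close> roots at \<open>z\<close> are simple. For nearby parameters each of
  the disjoint discs around them contains a root, and by counting exactly one, so the choice of a
  root in each disc is unambiguous.\<close>

lemma holomorphic_branches:
  assumes g: "pfam 1 (\<lambda>x. g (x 0))" and deg: "\<And>p. degree (g p) \<le> a"
    and nz: "g z \<noteq> 0" and card: "card {q. poly (g z) q = 0} = a" and U: "open U" "z \<in> U"
  shows "\<exists>\<epsilon>>0. \<exists>r. ball z \<epsilon> \<subseteq> U \<and> (\<forall>k. poly (g z) k = 0 \<longrightarrow> r k holomorphic_on ball z \<epsilon>) \<and>
     (\<forall>p\<in>ball z \<epsilon>. g p \<noteq> 0 \<and> inj_on (\<lambda>k. r k p) {q. poly (g z) q = 0} \<and>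
        {q. poly (g p) q = 0} = (\<lambda>k. r k p) ` {q. poly (g z) q = 0})"
proof -
  define Z where "Z = {q. poly (g z) q = 0}"
  have finZ: "finite Z" unfolding Z_def using nz by (rule poly_roots_finite)
  have simple: "poly (pderiv (g p)) q \<noteq> 0" if "g p \<noteq> 0" "card {q. poly (g p) q = 0} = a" "poly (g p) q = 0" for p q
    using simple_roots_if_card[OF that(1) _ that(3)] that(2) deg[of p] by simp
  obtain \<rho> where \<rho>: "\<rho> > 0" "\<And>k k'. k \<in> Z \<Longrightarrow> k' \<in> Z \<Longrightarrow> k \<noteq> k' \<Longrightarrow> ball k \<rho> \<inter> ball k' \<rho> = {}"
  proof (cases "Z = {} \<or> (\<exists>k. Z = {k})")
    case True
    then show ?thesis using that[of 1] by auto
  next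
    case False
    define D where "D = (\<lambda>(k,k'). dist k k') ` {(k,k'). k \<in> Z \<and> k' \<in> Z \<and> k \<noteq> k'}"
    have "finite {(k,k'). k \<in> Z \<and> k' \<in> Z \<and> k \<noteq> k'}"
      by (rule finite_subset[of _ "Z \<times> Z"]) (use finZ in auto)
    then have finD: "finite D" unfolding D_def by (rule finite_imageI)
    have "D \<noteq> {}" using False unfolding D_def by blast
    have pos: "Min D > 0" using finD \<open>D \<noteq> {}\<close> by (subst Min_gr_iff) (auto simp: D_def)
    show ?thesis
    proof (rule that[of "Min D / 2"])
      fix k k' assume k: "k \<in> Z" "k' \<in> Z" "k \<noteq> k'"
      then have "dist k k' \<in> D" unfolding D_def by force
      then have "Min D \<le> dist k k'" using finD by simp
      then show "ball k (Min D / 2) \<inter> ball k' (Min D / 2) = {}" by (intro disjoint_ballI) simp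
    qed (use pos in simp)
  qed
  have ex: "\<forall>\<^sub>F p in nhds z. \<exists>q. poly (g p) q = 0 \<and> q \<in> ball k \<rho>" if k: "k \<in> Z" for k
  proof -
    have "plim (nhds z) g (g z)" by (rule plim_pfam1[OF g]) simp
    moreover have k0: "poly (g z) k = 0" using k unfolding Z_def by simp
    ultimately obtain r where r: "\<forall>\<^sub>F p in nhds z. poly (g p) (r p) = 0" "(r \<longlongrightarrow> k) (nhds z)"
      using plim_root[OF _ k0 simple[OF nz card k0]] by blast
    have "\<forall>\<^sub>F p in nhds z. r p \<in> ball k \<rho>"
      using topological_tendstoD[OF r(2), of "ball k \<rho>"] \<rho>(1) by simp
    then show ?thesis using r(1) by eventually_elim blast
  qed
  have nzev: "\<forall>\<^sub>F p in nhds z. g p \<noteq> 0"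
  proof -
    obtain k where k: "coeff (g z) k \<noteq> 0" using nz by (auto simp: poly_eq_iff)
    have "plim (nhds z) g (g z)" by (rule plim_pfam1[OF g]) simp
    then have "((\<lambda>p. coeff (g p) k) \<longlongrightarrow> coeff (g z) k) (nhds z)" unfolding plim_def by blast
    from tendsto_imp_eventually_ne[OF this k] show ?thesis by eventually_elim auto
  qed
  have "\<forall>\<^sub>F p in nhds z. \<forall>k\<in>Z. \<exists>q. poly (g p) q = 0 \<and> q \<in> ball k \<rho>"
    using ex finZ by (simp add: eventually_ball_finite_distrib)
  then have "\<forall>\<^sub>F p in nhds z. (\<forall>k\<in>Z. \<exists>q. poly (g p) q = 0 \<and> q \<in> ball k \<rho>) \<and> g p \<noteq> 0 \<and> p \<in> U"
    using nzev eventually_nhds_in_open[OF U] by eventually_elim blast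
  then obtain \<epsilon> where \<epsilon>: "\<epsilon> > 0"
    "\<And>p. dist p z < \<epsilon> \<Longrightarrow> (\<forall>k\<in>Z. \<exists>q. poly (g p) q = 0 \<and> q \<in> ball k \<rho>) \<and> g p \<noteq> 0 \<and> p \<in> U"
    unfolding eventually_nhds_metric by blast
  define r where "r = (\<lambda>k p. SOME q. poly (g p) q = 0 \<and> q \<in> ball k \<rho>)"
  have rp: "poly (g p) (r k p) = 0 \<and> r k p \<in> ball k \<rho>" if "p \<in> ball z \<epsilon>" "k \<in> Z" for p k
  proof -
    have "dist p z < \<epsilon>" using that(1) by (simp add: dist_commute)
    then have "\<exists>q. poly (g p) q = 0 \<and> q \<in> ball k \<rho>" using \<epsilon>(2) that(2) by blast
    then show ?thesis unfolding r_def by (rule someI_ex)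
  qed
  have gp: "g p \<noteq> 0" "p \<in> U" if "p \<in> ball z \<epsilon>" for p using \<epsilon>(2)[of p] that by (auto simp: dist_commute)
  have inj: "inj_on (\<lambda>k. r k p) Z" if "p \<in> ball z \<epsilon>" for p
  proof (rule inj_onI, rule ccontr)
    fix k k' assume "k \<in> Z" "k' \<in> Z" "r k p = r k' p" "k \<noteq> k'"
    then show False using rp[OF that, of k] rp[OF that, of k'] \<rho>(2)[of k k'] by auto
  qed
  have roots: "{q. poly (g p) q = 0} = (\<lambda>k. r k p) ` Z" if p: "p \<in> ball z \<epsilon>" for p
  proof -
    have fin: "finite {q. poly (g p) q = 0}" using gp[OF p] by (intro poly_roots_finite)
    have sub: "(\<lambda>k. r k p) ` Z \<subseteq> {q. poly (g p) q = 0}" using rp[OF p] by auto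
    have "card ((\<lambda>k. r k p) ` Z) = a" using card_image[OF inj[OF p]] card unfolding Z_def by simp
    moreover have "card {q. poly (g p) q = 0} \<le> a"
      using card_poly_roots_bound[of "g p"] gp[OF p] deg[of p] by linarith
    moreover have "card ((\<lambda>k. r k p) ` Z) \<le> card {q. poly (g p) q = 0}" by (rule card_mono[OF fin sub])
    ultimately show ?thesis using card_subset_eq[OF fin sub] by simp
  qed
  have holo: "r k holomorphic_on ball z \<epsilon>" if k: "k \<in> Z" for k
  proof (rule holomorphic_onI)
    fix p1 assume p1: "p1 \<in> ball z \<epsilon>"
    have card1: "card {q. poly (g p1) q = 0} = a"
      unfolding roots[OF p1] using card_image[OF inj[OF p1]] card unfolding Z_def by simp
    have simple1: "poly (pderiv (g p1)) (r k p1) \<noteq> 0"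
      using simple[OF gp(1)[OF p1] card1] rp[OF p1 k] by blast
    have "plim (at p1) g (g p1)" by (rule plim_pfam1[OF g]) (simp add: at_within_le_nhds)
    from plim_root[OF this conjunct1[OF rp[OF p1 k]] simple1]
    obtain s where s: "\<forall>\<^sub>F p in at p1. poly (g p) (s p) = 0" "(s \<longlongrightarrow> r k p1) (at p1)" by blast
    have inball: "\<forall>\<^sub>F p in at p1. p \<in> ball z \<epsilon>"
      using p1 by (intro eventually_at_in_open') auto
    have "\<forall>\<^sub>F p in at p1. s p \<in> ball k \<rho>"
      using topological_tendstoD[OF s(2), of "ball k \<rho>"] rp[OF p1 k] by simp
    \<comment> \<open>The branch converging to \<open>r k p1\<close> stays in the disc of
      \<open>k\<close>, where \<open>r k p\<close> is the only root; this transfers continuity to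
      the chosen function.\<close>
    then have ev: "\<forall>\<^sub>F p in at p1. s p = r k p"
      using s(1) inball
    proof eventually_elim
      case (elim p)
      then have "s p \<in> (\<lambda>k. r k p) ` Z" using roots[OF elim(3)] by blast
      then obtain k' where k': "k' \<in> Z" "s p = r k' p" by blast
      have "k' = k"
      proof (rule ccontr)
        assume "k' \<noteq> k"
        then show False using \<rho>(2)[OF k'(1) k] rp[OF elim(3) k'(1)] k'(2) elim(1) by auto
      qed
      then show ?case using k' by simp
    qed
    have lim: "(r k \<longlongrightarrow> r k p1) (at p1)" using s(2) ev by (rule Lim_transform_eventually)
    have "\<forall>\<^sub>F p in at p1. poly (g p) (r k p) = 0"
      using inball by eventually_elim (use rp k in blast)
    from branch_has_derivative[OF g lim this conjunct1[OF rp[OF p1 k]] simple1]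
    obtain D where "(r k has_field_derivative D) (at p1)" by blast
    then have "r k field_differentiable at p1" unfolding field_differentiable_def by (rule exI)
    then show "r k field_differentiable at p1 within ball z \<epsilon>" by (rule field_differentiable_at_within)
  qed
  show ?thesis
  proof (intro exI[of _ \<epsilon>] exI[of _ r] conjI allI impI ballI \<epsilon>(1))
    show "ball z \<epsilon> \<subseteq> U" using gp(2) by blast
    fix k assume "poly (g z) k = 0"
    then show "r k holomorphic_on ball z \<epsilon>" using holo by (simp add: Z_def)
  next
    fix p assume p: "p \<in> ball z \<epsilon>"
    show "g p \<noteq> 0" by (rule gp(1)[OF p])
    show "inj_on (\<lambda>k. r k p) {q. poly (g z) q = 0}" using inj[OF p] unfolding Z_def .
    show "{q. poly (g p) q = 0} = (\<lambda>k. r k p) ` {q. poly (g z) q = 0}" using roots[OF p] unfolding Z_def .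
  qed
qed

lemma plim_Kp:
  assumes "\<And>i. i \<in> I \<Longrightarrow> (w i \<longlongrightarrow> w0 i) F" "\<And>i. i \<in> I \<Longrightarrow> (t i \<longlongrightarrow> t0 i) F"
    "\<And>i. i \<in> I \<Longrightarrow> (l i \<longlongrightarrow> l0 i) F"
  shows "plim F (\<lambda>x. Kp I (\<lambda>i. w i x) (\<lambda>i. t i x) (\<lambda>i. l i x)) (Kp I w0 t0 l0)"
  unfolding Kp_def by (intro plim_Nf plim_linear tendsto_intros assms)

lemma tendsto_eventually_neq:
  assumes "(f \<longlongrightarrow> A) F" "(g \<longlongrightarrow> B) F" "A \<noteq> (B :: complex)"
  shows "\<forall>\<^sub>F x in F. f x \<noteq> g x"
proof -
  have "((\<lambda>x. f x - g x) \<longlongrightarrow> A - B) F" by (intro tendsto_diff assms)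
  then have "\<forall>\<^sub>F x in F. f x - g x \<noteq> 0" by (rule tendsto_imp_eventually_ne) (use assms in simp)
  then show ?thesis by eventually_elim simp
qed

lemma eventually_at_not_in_finite:
  assumes "finite S"
  shows "\<forall>\<^sub>F p in at (z::complex). p \<notin> S"
proof -
  have "open (- (S - {z}))" using assms by (intro open_Compl finite_imp_closed) simp
  then have "\<forall>\<^sub>F p in nhds z. p \<in> - (S - {z})" by (rule eventually_nhds_in_open) simp
  then show ?thesis unfolding eventually_at_filter by eventually_elim auto
qed

lemma eventually_at_infinity_not_in_finite:
  assumes "finite S"
  shows "\<forall>\<^sub>F p in at_infinity. p \<notin> (S :: complex set)"
proof -
  obtain B where "\<forall>x\<in>S. norm x \<le> B" using finite_imp_bounded[OF assms] unfolding bounded_iff by blast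
  then show ?thesis unfolding eventually_at_infinity by (intro exI[of _ "B + 1"]) force
qed

section \<open>The two critical equations of the surface\<close>

text \<open>(p, q) are affine coordinates of the plane and \<open>n\<close> counts the cameras after
  the first. \<open>v i\<close> is the datum of such a camera minus the offset \<open>e i\<close>;
  the datum of the first camera is the separate variable \<open>w\<close>.\<close>

locale cams =
  fixes n :: nat and be ga la mu v :: "nat \<Rightarrow> complex"
begin

definition s where "s i p = be i * p + ga i"
definition l where "l i p = la i * p + mu i"
text \<open>The derivative of the squared distance in q, cleared of denominators and up to a
  constant: a camera contributes (v_i - s_i/d_i) s_i / d_i^2 with d_i = q - l_i.\<close>

definition gp where "gp p = Kp {..<n} (\<lambda>i. s i p * v i) (\<lambda>i. (s i p)\<^sup>2) (\<lambda>i. l i p)"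
definition hp where "hp w p = Polynomial.smult (w - p) (\<Prod>i<n. [:- l i p, 1:] ^ 3) +
  Nf {..<n} (\<lambda>i. [:- (v i * l i p) - s i p, v i:] * [:la i * s i p - be i * l i p, be i:]) (\<lambda>i. [:- l i p, 1:])"
text \<open>The residual v_i - s_i/d of a camera times the p-derivative (be_i d + la_i s_i) / d^2 of
  its coordinate.\<close>

definition tm where "tm i p d = (v i * d - s i p) * (be i * d + la i * s i p) / d ^ 3"
definition ff where "ff p q = p - (\<Sum>i<n. tm i p (q - l i p))"
definition pc where "pc i = - ga i / be i"
definition pl where "pl i j = (mu j - mu i) / (la i - la j)"
definition nonsp where "nonsp p \<longleftrightarrow> (\<forall>i<n. s i p \<noteq> 0) \<and> inj_on (\<lambda>i. l i p) {..<n}"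
text \<open>Up to sign the factor by which the resultant exceeds the norm of w - \<open>ff\<close>,
  see \<open>RR_eq\<close>. In this form it is visibly polynomial in p.\<close>

definition EE where "EE p = (\<Prod>i<n. poly (gp p) (l i p) ^ 3)"
definition RR where "RR w p = res (3 * n - 2) (3 * n) (gp p) (hp w p)"
definition sols where "sols w = {(p, q). (\<forall>i<n. q \<noteq> l i p) \<and> poly (gp p) q = 0 \<and> poly (hp w p) q = 0}"

end

text \<open>Genericity of the cameras. The zeros \<open>pc i\<close> of \<open>s i\<close> and the
  points \<open>pl i j\<close> with \<open>l i = l j\<close> are pairwise distinct, so each local
  analysis meets one degeneration at a time. \<open>sq_pl\<close> is the leading coefficient of the
  cubic that governs the roots near \<open>pl i j\<close>.\<close>

locale tcams = cams +
  assumes n2: "n \<ge> 2"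
    and be_nz: "\<And>i. i < n \<Longrightarrow> be i \<noteq> 0"
    and la_inj: "\<And>i j. i < n \<Longrightarrow> j < n \<Longrightarrow> i \<noteq> j \<Longrightarrow> la i \<noteq> la j"
    and pc_inj: "\<And>i j. i < n \<Longrightarrow> j < n \<Longrightarrow> i \<noteq> j \<Longrightarrow> pc i \<noteq> pc j"
    and s_pl: "\<And>i j k. i < j \<Longrightarrow> j < n \<Longrightarrow> k < n \<Longrightarrow> s k (pl i j) \<noteq> 0"
    and pl_inj: "\<And>i j k m. i < j \<Longrightarrow> j < n \<Longrightarrow> k < m \<Longrightarrow> m < n \<Longrightarrow> pl i j = pl k m \<Longrightarrow> i = k \<and> j = m"
    and sq_pl: "\<And>i j. i < j \<Longrightarrow> j < n \<Longrightarrow> (s i (pl i j))\<^sup>2 + (s j (pl i j))\<^sup>2 \<noteq> 0"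
begin

lemma s_pc:
  assumes "i < n"
  shows "s i p = be i * (p - pc i)"
proof -
  have "be i * pc i = - ga i" using be_nz[OF assms] unfolding pc_def by simp
  then show ?thesis unfolding s_def right_diff_distrib by simp
qed

lemma s_zero_iff: "i < n \<Longrightarrow> s i p = 0 \<longleftrightarrow> p = pc i"
  using be_nz[of i] s_pc[of i p] by simp

lemma l_diff:
  assumes "i < n" "j < n" "i \<noteq> j"
  shows "l i p - l j p = (la i - la j) * (p - pl i j)"
proof -
  have "(la i - la j) * pl i j = mu j - mu i" using la_inj[OF assms] unfolding pl_def by simp
  then show ?thesis unfolding l_def right_diff_distrib by (simp add: algebra_simps)
qed

lemma l_eq_iff: "i < n \<Longrightarrow> j < n \<Longrightarrow> i \<noteq> j \<Longrightarrow> l i p = l j p \<longleftrightarrow> p = pl i j"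
  using l_diff[of i j p] la_inj[of i j] by auto

lemma pl_sym: "pl i j = pl j i"
  unfolding pl_def by (metis minus_diff_eq minus_divide_divide)

lemma pc_neq_pl: "i < n \<Longrightarrow> j < n \<Longrightarrow> k < n \<Longrightarrow> j \<noteq> k \<Longrightarrow> pc i \<noteq> pl j k"
  using s_pl[of j k i] s_pl[of k j i] s_zero_iff[of i "pl j k"] pl_sym[of j k] by (metis linorder_neqE_nat)

end

text \<open>Genericity of the data. Each limit of \<open>gp p\<close>, rescaled at infinity and
  divided by the cube of the node factor at \<open>pc i\<close> and \<open>pl i j\<close>, has as
  many distinct roots as its degree bound allows, so every root that stays away from the node
  continues as a branch. The bound drops from 3n - 2 to 3n - 5 because three roots do run into the
  node.\<close>

locale gcams = tcams +
  assumes v_nz: "\<And>i. i < n \<Longrightarrow> v i \<noteq> 0"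
    and inf_roots: "Kp {..<n} (\<lambda>i. be i * v i) (\<lambda>i. (be i)\<^sup>2) la \<noteq> 0"
      "3 * n - 2 \<le> card {q. poly (Kp {..<n} (\<lambda>i. be i * v i) (\<lambda>i. (be i)\<^sup>2) la) q = 0}"
    and c_roots: "\<And>i. i < n \<Longrightarrow> Kp ({..<n} - {i}) (\<lambda>j. s j (pc i) * v j) (\<lambda>j. (s j (pc i))\<^sup>2) (\<lambda>j. l j (pc i)) \<noteq> 0"
      "\<And>i. i < n \<Longrightarrow> 3 * n - 5 \<le> card {q. poly (Kp ({..<n} - {i}) (\<lambda>j. s j (pc i) * v j) (\<lambda>j. (s j (pc i))\<^sup>2) (\<lambda>j. l j (pc i))) q = 0}"
      "\<And>i. i < n \<Longrightarrow> poly (Kp ({..<n} - {i}) (\<lambda>j. s j (pc i) * v j) (\<lambda>j. (s j (pc i))\<^sup>2) (\<lambda>j. l j (pc i))) (l i (pc i)) \<noteq> 0"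
    and l_roots: "\<And>i j. i < j \<Longrightarrow> j < n \<Longrightarrow>
        Kp ({..<n} - {j}) (\<lambda>k. s k (pl i j) * v k + (if k = i then s j (pl i j) * v j else 0))
           (\<lambda>k. (s k (pl i j))\<^sup>2 + (if k = i then (s j (pl i j))\<^sup>2 else 0)) (\<lambda>k. l k (pl i j)) \<noteq> 0"
      "\<And>i j. i < j \<Longrightarrow> j < n \<Longrightarrow> 3 * n - 5 \<le> card {q. poly (
        Kp ({..<n} - {j}) (\<lambda>k. s k (pl i j) * v k + (if k = i then s j (pl i j) * v j else 0))
           (\<lambda>k. (s k (pl i j))\<^sup>2 + (if k = i then (s j (pl i j))\<^sup>2 else 0)) (\<lambda>k. l k (pl i j))) q = 0}"
begin

definition Sp where "Sp = pc ` {..<n} \<union> (\<lambda>(i,j). pl i j) ` {(i,j). i < j \<and> j < n}"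

lemma finite_pairs: "finite {(i,j). i < j \<and> j < (n::nat)}"
  by (rule finite_subset[of _ "{..<n} \<times> {..<n}"]) auto

lemma finite_Sp: "finite Sp"
  unfolding Sp_def using finite_pairs by simp

lemma nonsp_iff: "nonsp p \<longleftrightarrow> p \<notin> Sp"
proof
  assume p: "nonsp p"
  show "p \<notin> Sp"
  proof
    assume "p \<in> Sp"
    then consider i where "i < n" "p = pc i" | i j where "i < j" "j < n" "p = pl i j" unfolding Sp_def by auto
    then show False
    proof cases
      case 1
      then show False using p s_zero_iff[of i p] unfolding nonsp_def by blast
    next
      case 2
      then have "l i p = l j p" using l_eq_iff[of i j p] by simp
      then show False using p 2 unfolding nonsp_def inj_on_def by auto
    qed
  qed
next
  assume p: "p \<notin> Sp"
  have "s i p \<noteq> 0" if "i < n" for i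
    using p s_zero_iff[OF that, of p] that unfolding Sp_def by auto
  moreover have "i = j" if "i < n" "j < n" "l i p = l j p" for i j
  proof (rule ccontr)
    assume "i \<noteq> j"
    then have *: "p = pl i j" using l_eq_iff[of i j p] that by blast
    consider "i < j" | "j < i" using \<open>i \<noteq> j\<close> by linarith
    then have "p \<in> (\<lambda>(i,j). pl i j) ` {(i,j). i < j \<and> j < n}"
    proof cases
      case 1
      then show ?thesis using * that by (intro image_eqI[of _ _ "(i, j)"]) auto
    next
      case 2
      then show ?thesis using * that by (intro image_eqI[of _ _ "(j, i)"]) (auto simp: pl_sym)
    qed
    then show False using p unfolding Sp_def by blast
  qed
  ultimately show "nonsp p" unfolding nonsp_def inj_on_def by auto
qed

lemma gp_node: "nonsp p \<Longrightarrow> i < n \<Longrightarrow> poly (gp p) (l i p) \<noteq> 0"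
  unfolding gp_def by (rule poly_Kp_node_nz[where l = "\<lambda>i. l i p"]) (auto simp: nonsp_def)

lemma gp_nz: "nonsp p \<Longrightarrow> gp p \<noteq> 0"
  using gp_node[of p 0] n2 by auto

lemma card_arith: "1 + 3 * (card {..<n} - 1) = 3 * n - 2"
  unfolding card_lessThan using n2 by arith

lemma card_arith':
  assumes "i < n"
  shows "1 + 3 * (card ({..<n} - {i}) - 1) = 3 * n - 5"
proof -
  have "card ({..<n} - {i}) = n - 1" using assms by simp
  then show ?thesis using n2 by arith
qed

lemma degree_gp: "degree (gp p) \<le> 3 * n - 2"
  unfolding gp_def card_arith[symmetric] by (rule degree_Kp) simp

lemma poly_hp:
  assumes "\<And>i. i < n \<Longrightarrow> q \<noteq> l i p"
  shows "poly (hp w p) q = (\<Prod>i<n. (q - l i p) ^ 3) * (w - ff p q)"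
proof -
  have "poly (Nf {..<n} (\<lambda>i. [:- (v i * l i p) - s i p, v i:] * [:la i * s i p - be i * l i p, be i:]) (\<lambda>i. [:- l i p, 1:])) q
     = Nf {..<n} (\<lambda>i. (v i * (q - l i p) - s i p) * (be i * (q - l i p) + la i * s i p)) (\<lambda>i. q - l i p)"
    unfolding poly_Nf by (rule Nf_cong) (simp_all add: algebra_simps)
  also have "\<dots> = (\<Prod>i<n. (q - l i p) ^ 3) * (\<Sum>i<n. tm i p (q - l i p))"
    unfolding tm_def by (rule Nf_divide) (use assms in auto)
  finally show ?thesis
    unfolding hp_def ff_def by (simp add: poly_prod algebra_simps)
qed

lemma degree_hp: "degree (hp w p) \<le> 3 * n"
  unfolding hp_def
proof (rule degree_add_le)
  have "degree (\<Prod>i<n. [:- l i p, 1:] ^ 3) \<le> 3 * n" using degree_prod_cube_le[of "{..<n}"] by simp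
  then show "degree (Polynomial.smult (w - p) (\<Prod>i<n. [:- l i p, 1:] ^ 3)) \<le> 3 * n"
    using degree_smult_le le_trans by blast
  have "degree (Nf {..<n} (\<lambda>i. [:- (v i * l i p) - s i p, v i:] * [:la i * s i p - be i * l i p, be i:]) (\<lambda>i. [:- l i p, 1:])) \<le> 2 + 3 * (card {..<n} - 1)"
  proof (rule degree_Nf)
    fix i
    have "degree [:- (v i * l i p) - s i p, v i:] \<le> 1" "degree [:la i * s i p - be i * l i p, be i:] \<le> 1" by auto
    then show "degree ([:- (v i * l i p) - s i p, v i:] * [:la i * s i p - be i * l i p, be i:]) \<le> 2"
      using degree_mult_le[of "[:- (v i * l i p) - s i p, v i:]" "[:la i * s i p - be i * l i p, be i:]"] by linarith
  qed auto
  then show "degree (Nf {..<n} (\<lambda>i. [:- (v i * l i p) - s i p, v i:] * [:la i * s i p - be i * l i p, be i:]) (\<lambda>i. [:- l i p, 1:])) \<le> 3 * n"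
    using n2 by simp
qed

text \<open>By \<open>res_prod\<close> the resultant is a product over the roots of
  \<open>gp p\<close>. Exchanging the products over roots and cameras turns the factors (q - l_i)^3
  of \<open>hp\<close> into values of \<open>gp p\<close> at the nodes.\<close>

lemma RR_eq:
  assumes p: "nonsp p" and card: "card {q. poly (gp p) q = 0} = 3 * n - 2"
  shows "RR w p = (-1) ^ ((3 * n - 2) * (3 * n)) * EE p * (\<Prod>q | poly (gp p) q = 0. w - ff p q)"
proof -
  let ?Q = "{q. poly (gp p) q = 0}" and ?a = "3 * n - 2"
  have fin: "finite ?Q" using gp_nz[OF p] by (rule poly_roots_finite)
  have "card ?Q \<le> degree (gp p)" by (rule card_poly_roots_bound[OF gp_nz[OF p]])
  then have deg: "degree (gp p) = ?a" using card degree_gp[of p] by linarith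
  have "rsquarefree (gp p)"
    unfolding rsquarefree_roots using simple_roots_if_card[OF gp_nz[OF p]] card deg by auto
  from complex_poly_decompose_rsquarefree[OF this]
  have "gp p = Polynomial.smult (lead_coeff (gp p)) (\<Prod>z\<in>?Q. [:-z, 1:])" ..
  then have gpx: "poly (gp p) x = poly (Polynomial.smult (lead_coeff (gp p)) (\<Prod>z\<in>?Q. [:-z, 1:])) x" for x
    by (rule arg_cong)
  have dec: "poly (gp p) x = coeff (gp p) ?a * (\<Prod>q\<in>?Q. x - q)" for x
  proof -
    have "poly (Polynomial.smult (lead_coeff (gp p)) (\<Prod>z\<in>?Q. [:-z, 1:])) x = lead_coeff (gp p) * (\<Prod>q\<in>?Q. x - q)"
      by (simp add: poly_prod)
    with gpx[of x] show ?thesis unfolding deg by (rule trans)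
  qed
  have "RR w p = coeff (gp p) ?a ^ (3 * n) * (\<Prod>q\<in>?Q. poly (hp w p) q)"
    unfolding RR_def by (rule res_prod[OF degree_gp degree_hp fin card]) simp
  also have "(\<Prod>q\<in>?Q. poly (hp w p) q) = (\<Prod>q\<in>?Q. (\<Prod>i<n. (q - l i p) ^ 3) * (w - ff p q))"
  proof (rule prod.cong[OF refl])
    fix q assume "q \<in> ?Q"
    then have "q \<noteq> l i p" if "i < n" for i using gp_node[OF p that] by auto
    then show "poly (hp w p) q = (\<Prod>i<n. (q - l i p) ^ 3) * (w - ff p q)" by (rule poly_hp)
  qed
  also have "\<dots> = (\<Prod>i<n. \<Prod>q\<in>?Q. (q - l i p) ^ 3) * (\<Prod>q\<in>?Q. w - ff p q)"
    unfolding prod.distrib by (subst prod.swap) simp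
  also have "(\<Prod>i<n. \<Prod>q\<in>?Q. (q - l i p) ^ 3) = (\<Prod>i<n. (-1) ^ (?a * 3) * (\<Prod>q\<in>?Q. l i p - q) ^ 3)"
  proof (rule prod.cong[OF refl])
    fix i
    have "(\<Prod>q\<in>?Q. (q - l i p) ^ 3) = (\<Prod>q\<in>?Q. (- 1) * (l i p - q)) ^ 3"
      by (simp add: prod_power_distrib)
    also have "\<dots> = (-1) ^ (?a * 3) * (\<Prod>q\<in>?Q. l i p - q) ^ 3"
      unfolding prod.distrib prod_constant card by (simp only: power_mult_distrib power_mult)
    finally show "(\<Prod>q\<in>?Q. (q - l i p) ^ 3) = (-1) ^ (?a * 3) * (\<Prod>q\<in>?Q. l i p - q) ^ 3" .
  qed
  also have "\<dots> = (-1) ^ (?a * (3 * n)) * (\<Prod>i<n. (\<Prod>q\<in>?Q. l i p - q) ^ 3)"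
    by (simp add: prod.distrib power_mult[symmetric] mult_ac)
  finally have "RR w p = (-1) ^ (?a * (3 * n)) * (coeff (gp p) ?a ^ (3 * n) * (\<Prod>i<n. (\<Prod>q\<in>?Q. l i p - q) ^ 3)) * (\<Prod>q\<in>?Q. w - ff p q)"
    by (simp only: mult_ac)
  also have "coeff (gp p) ?a ^ (3 * n) * (\<Prod>i<n. (\<Prod>q\<in>?Q. l i p - q) ^ 3) = EE p"
  proof -
    have "poly (gp p) (l i p) ^ 3 = coeff (gp p) ?a ^ 3 * (\<Prod>q\<in>?Q. l i p - q) ^ 3" for i
      by (simp only: dec[of "l i p"] power_mult_distrib)
    then have "EE p = (\<Prod>i<n. coeff (gp p) ?a ^ 3 * (\<Prod>q\<in>?Q. l i p - q) ^ 3)"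
      unfolding EE_def by (simp only:)
    then show ?thesis by (simp only: prod.distrib prod_constant card_lessThan power_mult)
  qed
  finally show ?thesis .
qed

text \<open>The factors of the product may be rescaled by \<open>e\<close> to have finite nonzero limits.\<close>

lemma local_product:
  assumes J: "finite J" "card J = 3 * n - 2" and ns: "\<forall>\<^sub>F p in F. nonsp p"
    and root: "\<forall>k\<in>J. \<forall>\<^sub>F p in F. poly (gp p) (r k p) = 0"
    and dist: "\<forall>k\<in>J. \<forall>k'\<in>J. k \<noteq> k' \<longrightarrow> (\<forall>\<^sub>F p in F. r k p \<noteq> r k' p)"
    and lim: "\<forall>k\<in>J. ((\<lambda>p. (w - ff p (r k p)) * e k p) \<longlongrightarrow> L k) F"
  shows "\<forall>\<^sub>F p in F. card {q. poly (gp p) q = 0} = 3 * n - 2 \<and>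
      RR w p = (-1) ^ ((3 * n - 2) * (3 * n)) * EE p * (\<Prod>k\<in>J. w - ff p (r k p))"
    and "((\<lambda>p. (\<Prod>k\<in>J. w - ff p (r k p)) * (\<Prod>k\<in>J. e k p)) \<longlongrightarrow> (\<Prod>k\<in>J. L k)) F"
proof -
  have "\<forall>\<^sub>F p in F. inj_on (\<lambda>k. r k p) J \<and> {q. poly (gp p) q = 0} = (\<lambda>k. r k p) ` J"
  proof (rule branches[OF J degree_gp])
    show "\<forall>\<^sub>F p in F. gp p \<noteq> 0" using ns by eventually_elim (rule gp_nz)
  qed (use root dist in blast)+
  then show "\<forall>\<^sub>F p in F. card {q. poly (gp p) q = 0} = 3 * n - 2 \<and>
      RR w p = (-1) ^ ((3 * n - 2) * (3 * n)) * EE p * (\<Prod>k\<in>J. w - ff p (r k p))"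
    using ns
  proof eventually_elim
    case (elim p)
    then have c: "card {q. poly (gp p) q = 0} = 3 * n - 2" using card_image[of "\<lambda>k. r k p" J] J(2) by simp
    have "(\<Prod>q | poly (gp p) q = 0. w - ff p q) = (\<Prod>k\<in>J. w - ff p (r k p))"
      using elim(1) by (simp add: prod.reindex)
    then show ?case using RR_eq[OF elim(2) c, of w] c by simp
  qed
  have "((\<lambda>p. \<Prod>k\<in>J. (w - ff p (r k p)) * e k p) \<longlongrightarrow> (\<Prod>k\<in>J. L k)) F"
    by (intro tendsto_prod) (use lim in blast)
  then show "((\<lambda>p. (\<Prod>k\<in>J. w - ff p (r k p)) * (\<Prod>k\<in>J. e k p)) \<longlongrightarrow> (\<Prod>k\<in>J. L k)) F"
    by (simp only: prod.distrib)
qed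

text \<open>Each \<open>e k\<close> compensates the growth of one factor. Only the product of them
  has to be a power of p - z, so a single one may be a square root.\<close>

lemma order_at:
  assumes R: "\<And>p. poly R p = RR w p" "R \<noteq> 0" and E: "\<And>p. poly E p = EE p" "E \<noteq> 0"
    and J: "finite J" "card J = 3 * n - 2"
    and root: "\<forall>k\<in>J. \<forall>\<^sub>F p in at z. poly (gp p) (r k p) = 0"
    and dist: "\<forall>k\<in>J. \<forall>k'\<in>J. k \<noteq> k' \<longrightarrow> (\<forall>\<^sub>F p in at z. r k p \<noteq> r k' p)"
    and lim: "\<forall>k\<in>J. ((\<lambda>p. (w - ff p (r k p)) * e k p) \<longlongrightarrow> L k) (at z)"
    and L: "\<forall>k\<in>J. L k \<noteq> 0"
    and e: "\<And>p. (\<Prod>k\<in>J. e k p) = (p - z) ^ m / (p - z) ^ m'"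
  shows "order z R + m = order z E + m'"
proof (rule order_limit[where c = "(-1) ^ ((3 * n - 2) * (3 * n))" and F = "\<lambda>p. \<Prod>k\<in>J. w - ff p (r k p)"])
  have ns: "\<forall>\<^sub>F p in at z. nonsp p" unfolding nonsp_iff by (rule eventually_at_not_in_finite[OF finite_Sp])
  note lp = local_product[where r = r and w = w and e = e and L = L, OF J ns root dist lim]
  show "\<forall>\<^sub>F p in at z. poly R p = (-1) ^ ((3 * n - 2) * (3 * n)) * poly E p * (\<Prod>k\<in>J. w - ff p (r k p))"
    using lp(1) by eventually_elim (simp add: R E)
  show "((\<lambda>p. (\<Prod>k\<in>J. w - ff p (r k p)) * (p - z) ^ m / (p - z) ^ m') \<longlongrightarrow> (\<Prod>k\<in>J. L k)) (at z)"
    using lp(2) by (simp add: e)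
  show "(\<Prod>k\<in>J. L k) \<noteq> 0" using L J(1) by simp
qed (use R E in simp_all)

lemma tendsto_s: "(f \<longlongrightarrow> z) F \<Longrightarrow> ((\<lambda>p. s i (f p)) \<longlongrightarrow> s i z) F"
  unfolding s_def by (intro tendsto_intros)

lemma tendsto_l: "(f \<longlongrightarrow> z) F \<Longrightarrow> ((\<lambda>p. l i (f p)) \<longlongrightarrow> l i z) F"
  unfolding l_def by (intro tendsto_intros)

lemma tendsto_tm:
  assumes "(f \<longlongrightarrow> z) F" "(d \<longlongrightarrow> d0) F" "d0 \<noteq> 0"
  shows "((\<lambda>p. tm i (f p) (d p)) \<longlongrightarrow> tm i z d0) F"
  unfolding tm_def using assms(3) by (intro tendsto_intros tendsto_s assms) simp

lemma tendsto_ff: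
  assumes "(f \<longlongrightarrow> z) F" "(r \<longlongrightarrow> k) F" "\<And>i. i < n \<Longrightarrow> k \<noteq> l i z"
  shows "((\<lambda>p. ff (f p) (r p)) \<longlongrightarrow> ff z k) F"
  unfolding ff_def by (intro tendsto_diff assms tendsto_sum tendsto_tm tendsto_l) (use assms(3) in auto)

lemma gp_pfam: "pfam 1 (\<lambda>x. gp (x 0))"
  unfolding gp_def Kp_def s_def l_def
  by (intro pfam_Nf pfam_linear poly_fun_intros) auto

lemma plim_gp: "plim (at z) gp (gp z)"
  by (rule plim_pfam1[OF gp_pfam]) (simp add: at_within_le_nhds)

subsection \<open>Behaviour at infinity\<close>

lemma tm_scale:
  assumes "p \<noteq> 0" "s i p = p * S"
  shows "tm i p (p * D) = ((v i * D - S) * (be i * D + la i * S) / D ^ 3) / p"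
proof -
  have "(v i * (p * D) - s i p) * (be i * (p * D) + la i * s i p) = p * p * ((v i * D - S) * (be i * D + la i * S))"
    unfolding assms(2) by (simp add: algebra_simps)
  moreover have "(p * D) ^ 3 = p * p * (D ^ 3 * p)" by (simp add: power3_eq_cube mult_ac)
  ultimately show ?thesis using assms(1) unfolding tm_def by (simp only: mult_divide_mult_cancel_left_if divide_divide_eq_left mult_eq_0_iff if_False simp_thms)
qed

lemma scale_aux: "(p * S) * V * (p * x - p * L) - (p * S)\<^sup>2 = p\<^sup>2 * (S * V * (x - L) - S\<^sup>2)" for p S V x L :: complex
  by (simp add: algebra_simps power2_eq_square)

text \<open>Substituting q = p x turns \<open>gp p\<close> into a power of p times a polynomial
  \<open>Q p\<close> in x that converges to \<open>K\<close>. So the roots are asymptotic to p k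
  with k a root of \<open>K\<close>; there each \<open>tm\<close> is of order 1/p and (w -
  \<open>ff\<close>)/p tends to -1.\<close>

lemma infinity_limit:
  shows "\<exists>J r e L. finite J \<and> card J = 3 * n - 2 \<and>
     (\<forall>k\<in>J. \<forall>\<^sub>F p in at_infinity. poly (gp p) (r k p) = 0) \<and>
     (\<forall>k\<in>J. \<forall>k'\<in>J. k \<noteq> k' \<longrightarrow> (\<forall>\<^sub>F p in at_infinity. r k p \<noteq> r k' p)) \<and>
     (\<forall>k\<in>J. ((\<lambda>p. (w - ff p (r k p)) * e k p) \<longlongrightarrow> L k) at_infinity \<and> L k \<noteq> 0) \<and>
     (\<forall>p. (\<Prod>k\<in>J. e k p) = 1 / p ^ (3 * n - 2)) \<and> J \<subseteq> (UNIV :: complex set)"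
proof -
  define K where "K = Kp {..<n} (\<lambda>i. be i * v i) (\<lambda>i. (be i)\<^sup>2) la"
  define J where "J = {q. poly K q = 0}"
  have K0: "K \<noteq> 0" unfolding K_def by (rule inf_roots)
  have finJ: "finite J" unfolding J_def using K0 by (rule poly_roots_finite)
  have degK: "degree K \<le> 3 * n - 2" unfolding K_def card_arith[symmetric] by (rule degree_Kp) simp
  have cardJ: "card J = 3 * n - 2"
    using inf_roots(2) card_poly_roots_bound[OF K0] degK unfolding J_def K_def by linarith
  have simple: "poly (pderiv K) k \<noteq> 0" if "k \<in> J" for k
    by (rule simple_roots_if_card[OF K0]) (use cardJ degK that in \<open>auto simp: J_def\<close>)
  have node: "k \<noteq> la i" if "k \<in> J" "i < n" for k i
  proof -
    have "poly K (la i) \<noteq> 0" unfolding K_def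
      by (rule poly_Kp_node_nz) (use that(2) be_nz la_inj in \<open>auto simp: inj_on_def\<close>)
    then show ?thesis using that(1) unfolding J_def by auto
  qed
  have inf0: "\<forall>\<^sub>F p in at_infinity. p \<noteq> (0::complex)"
    using eventually_at_infinity_not_in_finite[of "{0}"] by simp
  have inv: "((\<lambda>p. 1 / p) \<longlongrightarrow> (0::complex)) at_infinity"
    using tendsto_inverse_0[where 'a = complex] by (simp add: divide_inverse)
  have lin: "((\<lambda>p. (a * p + b) / p) \<longlongrightarrow> a) at_infinity" for a b :: complex
  proof -
    have "((\<lambda>p. a + b * (1 / p)) \<longlongrightarrow> a + b * 0) at_infinity" by (intro tendsto_intros inv)
    then have "((\<lambda>p. a + b * (1 / p)) \<longlongrightarrow> a) at_infinity" by simp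
    moreover have "\<forall>\<^sub>F p in at_infinity. a + b * (1 / p) = (a * p + b) / p"
      using inf0 by eventually_elim (simp add: add_divide_distrib)
    ultimately show ?thesis by (rule Lim_transform_eventually)
  qed
  have limS: "((\<lambda>p. s i p / p) \<longlongrightarrow> be i) at_infinity" for i unfolding s_def by (rule lin)
  have limL: "((\<lambda>p. l i p / p) \<longlongrightarrow> la i) at_infinity" for i unfolding l_def by (rule lin)
  define Q where "Q = (\<lambda>p. Kp {..<n} (\<lambda>i. s i p / p * v i) (\<lambda>i. (s i p / p)\<^sup>2) (\<lambda>i. l i p / p))"
  have limQ: "plim at_infinity Q K"
    unfolding Q_def K_def by (intro plim_Kp tendsto_intros limS limL)
  have QG: "poly (gp p) (p * x) = p ^ (2 + 3 * (n - 1)) * poly (Q p) x" if "p \<noteq> 0" for p x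
  proof -
    have "poly (gp p) (p * x) = Nf {..<n} (\<lambda>i. p\<^sup>2 * (s i p / p * v i * (x - l i p / p) - (s i p / p)\<^sup>2)) (\<lambda>i. p * (x - l i p / p))"
      unfolding gp_def poly_Kp
    proof (rule Nf_cong)
      fix i
      have p: "p * (s i p / p) = s i p" "p * (l i p / p) = l i p" using that by simp_all
      show "s i p * v i * (p * x - l i p) - (s i p)\<^sup>2 = p\<^sup>2 * (s i p / p * v i * (x - l i p / p) - (s i p / p)\<^sup>2)"
        using scale_aux[of p "s i p / p" "v i" x "l i p / p"] unfolding p .
      show "p * x - l i p = p * (x - l i p / p)" unfolding right_diff_distrib p ..
    qed
    also have "\<dots> = p ^ (2 + 3 * (card {..<n} - 1)) * poly (Q p) x"
      unfolding Q_def poly_Kp by (rule Nf_scale) (use n2 in \<open>auto simp: lessThan_empty_iff\<close>)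
    finally show ?thesis unfolding card_lessThan .
  qed
  have "\<forall>k\<in>J. \<exists>r. (\<forall>\<^sub>F p in at_infinity. poly (Q p) (r p) = 0) \<and> (r \<longlongrightarrow> k) at_infinity"
    using plim_root[OF limQ _ simple] unfolding J_def by blast
  then obtain r where "\<forall>k\<in>J. (\<forall>\<^sub>F p in at_infinity. poly (Q p) (r k p) = 0) \<and> (r k \<longlongrightarrow> k) at_infinity"
    by (rule bchoice[THEN exE])
  then have r: "\<And>k. k \<in> J \<Longrightarrow> \<forall>\<^sub>F p in at_infinity. poly (Q p) (r k p) = 0" "\<And>k. k \<in> J \<Longrightarrow> (r k \<longlongrightarrow> k) at_infinity"
    by blast+
  have "((\<lambda>p. (w - ff p (p * r k p)) * (1 / p)) \<longlongrightarrow> - 1) at_infinity" if k: "k \<in> J" for k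
  proof -
    let ?D = "\<lambda>i p. r k p - l i p / p"
    let ?T = "\<lambda>i p. (v i * ?D i p - s i p / p) * (be i * ?D i p + la i * (s i p / p)) / ?D i p ^ 3"
    have "((\<lambda>p. ?T i p) \<longlongrightarrow> (v i * (k - la i) - be i) * (be i * (k - la i) + la i * be i) / (k - la i) ^ 3) at_infinity" if "i < n" for i
      using node[OF k that] by (intro tendsto_intros limS limL r(2) k) auto
    then have "((\<lambda>p. w * (1 / p) - 1 + (\<Sum>i<n. ?T i p) * ((1 / p) * (1 / p))) \<longlongrightarrow>
       w * 0 - 1 + (\<Sum>i<n. (v i * (k - la i) - be i) * (be i * (k - la i) + la i * be i) / (k - la i) ^ 3) * (0 * 0)) at_infinity"
      by (intro tendsto_add tendsto_diff tendsto_mult tendsto_sum inv tendsto_const) auto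
    then have "((\<lambda>p. w * (1 / p) - 1 + (\<Sum>i<n. ?T i p) * ((1 / p) * (1 / p))) \<longlongrightarrow> -1) at_infinity" by simp
    moreover have "\<forall>\<^sub>F p in at_infinity. w * (1 / p) - 1 + (\<Sum>i<n. ?T i p) * ((1 / p) * (1 / p)) = (w - ff p (p * r k p)) * (1 / p)"
      using inf0
    proof eventually_elim
      case (elim p)
      have "tm i p (p * r k p - l i p) = ?T i p / p" for i
      proof -
        have "p * r k p - l i p = p * ?D i p" using elim unfolding right_diff_distrib by simp
        moreover have "s i p = p * (s i p / p)" using elim by simp
        ultimately show ?thesis using tm_scale[OF elim, of i "s i p / p" "?D i p"] by metis
      qed
      then have "ff p (p * r k p) = p - (\<Sum>i<n. ?T i p) / p" unfolding ff_def by (simp only: sum_divide_distrib)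
      moreover have "w * (1 / p) - 1 + S * ((1 / p) * (1 / p)) = (w - (p - S / p)) * (1 / p)" for S
        using elim by (simp add: diff_divide_distrib add_divide_distrib)
      ultimately show ?case by (simp only:)
    qed
    ultimately show ?thesis by (rule Lim_transform_eventually)
  qed
  moreover have "\<forall>\<^sub>F p in at_infinity. poly (gp p) (p * r k p) = 0" if "k \<in> J" for k
    using inf0 r(1)[OF that] by eventually_elim (simp add: QG)
  moreover have "\<forall>\<^sub>F p in at_infinity. p * r k p \<noteq> p * r k' p" if "k \<in> J" "k' \<in> J" "k \<noteq> k'" for k k'
    using inf0 tendsto_eventually_neq[OF r(2)[OF that(1)] r(2)[OF that(2)] that(3)] by eventually_elim simp
  ultimately show ?thesis
    using finJ cardJ
    by (intro exI[of _ J] exI[of _ "\<lambda>k p. p * r k p"] exI[of _ "\<lambda>k p. 1 / p"] exI[of _ "\<lambda>k. -1"])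
      (auto simp: power_one_over)
qed

lemma degree_at_infinity:
  assumes R: "\<And>p. poly R p = RR w p" "R \<noteq> 0" and E: "\<And>p. poly E p = EE p" "E \<noteq> 0"
  shows "degree R = degree E + (3 * n - 2)"
proof -
  obtain J :: "complex set" and r e L where J: "finite J" "card J = 3 * n - 2"
    and root: "\<forall>k\<in>J. \<forall>\<^sub>F p in at_infinity. poly (gp p) (r k p) = 0"
    and dist: "\<forall>k\<in>J. \<forall>k'\<in>J. k \<noteq> k' \<longrightarrow> (\<forall>\<^sub>F p in at_infinity. r k p \<noteq> r k' p)"
    and lim: "\<forall>k\<in>J. ((\<lambda>p. (w - ff p (r k p)) * e k p) \<longlongrightarrow> L k) at_infinity"
    and L: "\<forall>k\<in>J. L k \<noteq> 0"
    and e: "\<forall>p. (\<Prod>k\<in>J. e k p) = 1 / p ^ (3 * n - 2)"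
    using infinity_limit[of w] by (elim exE conjE) blast
  have ns: "\<forall>\<^sub>F p in at_infinity. nonsp p" unfolding nonsp_iff by (rule eventually_at_infinity_not_in_finite[OF finite_Sp])
  note lp = local_product[where r = r and w = w and e = e and L = L, OF J ns root dist lim]
  show ?thesis
  proof (rule degree_limit[where c = "(-1) ^ ((3 * n - 2) * (3 * n))" and F = "\<lambda>p. \<Prod>k\<in>J. w - ff p (r k p)"])
    show "\<forall>\<^sub>F p in at_infinity. poly R p = (-1) ^ ((3 * n - 2) * (3 * n)) * poly E p * (\<Prod>k\<in>J. w - ff p (r k p))"
      using lp(1) by eventually_elim (simp add: R E)
    show "((\<lambda>p. (\<Prod>k\<in>J. w - ff p (r k p)) / p ^ (3 * n - 2)) \<longlongrightarrow> (\<Prod>k\<in>J. L k)) at_infinity"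
      using lp(2) by (simp add: e)
    show "(\<Prod>k\<in>J. L k) \<noteq> 0" using L J(1) by simp
  qed (use R E in simp_all)
qed

text \<open>Points near infinity witness that the resultant and its denominator are nonzero
  polynomials and that \<open>gp p\<close> attains the full number of distinct roots.\<close>

lemma good_and_RR_nz:
  "\<exists>p. nonsp p \<and> card {q. poly (gp p) q = 0} = 3 * n - 2 \<and> RR w p \<noteq> 0 \<and> EE p \<noteq> 0"
proof -
  obtain J :: "complex set" and r e L where J: "finite J" "card J = 3 * n - 2"
    and root: "\<forall>k\<in>J. \<forall>\<^sub>F p in at_infinity. poly (gp p) (r k p) = 0"
    and dist: "\<forall>k\<in>J. \<forall>k'\<in>J. k \<noteq> k' \<longrightarrow> (\<forall>\<^sub>F p in at_infinity. r k p \<noteq> r k' p)"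
    and lim: "\<forall>k\<in>J. ((\<lambda>p. (w - ff p (r k p)) * e k p) \<longlongrightarrow> L k) at_infinity"
    and L: "\<forall>k\<in>J. L k \<noteq> 0"
    and e: "\<forall>p. (\<Prod>k\<in>J. e k p) = 1 / p ^ (3 * n - 2)"
    using infinity_limit[of w] by (elim exE conjE) blast
  have ns: "\<forall>\<^sub>F p in at_infinity. nonsp p" unfolding nonsp_iff by (rule eventually_at_infinity_not_in_finite[OF finite_Sp])
  note lp = local_product[where r = r and w = w and e = e and L = L, OF J ns root dist lim]
  have "(\<Prod>k\<in>J. L k) \<noteq> 0" using L J(1) by simp
  from tendsto_imp_eventually_ne[OF lp(2) this] lp(1) ns
  have "\<forall>\<^sub>F p in at_infinity. nonsp p \<and> card {q. poly (gp p) q = 0} = 3 * n - 2 \<and> RR w p \<noteq> 0 \<and> EE p \<noteq> 0"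
  proof eventually_elim
    case (elim p)
    then have "EE p \<noteq> 0" unfolding EE_def using gp_node by auto
    then show ?case using elim by auto
  qed
  then show ?thesis using eventually_happens'[OF trivial_limit_at_infinity] by blast
qed

end

section \<open>Local analysis at the zeros of the \<open>s i\<close>\<close>

text \<open>Branches with different limits are separated at scale one; those that converge to the
  same node \<open>b\<close> are separated after division by \<open>h\<close>.\<close>

lemma two_scale_distinct:
  fixes r :: "'k \<Rightarrow> complex \<Rightarrow> complex"
  assumes a: "\<forall>k\<in>J. ((\<lambda>p. r k p - b p) \<longlongrightarrow> a k) F"
    and c: "\<forall>k\<in>J. a k = 0 \<longrightarrow> ((\<lambda>p. (r k p - b p) / h p) \<longlongrightarrow> c k) F"
    and inj: "\<forall>k\<in>J. \<forall>k'\<in>J. k \<noteq> k' \<longrightarrow> a k \<noteq> a k' \<or> (a k = 0 \<and> a k' = 0 \<and> c k \<noteq> c k')"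
  shows "\<forall>k\<in>J. \<forall>k'\<in>J. k \<noteq> k' \<longrightarrow> (\<forall>\<^sub>F p in F. r k p \<noteq> r k' p)"
proof (intro ballI impI)
  fix k k' assume k: "k \<in> J" "k' \<in> J" "k \<noteq> k'"
  from inj k consider "a k \<noteq> a k'" | "a k = 0" "a k' = 0" "c k \<noteq> c k'" by blast
  then show "\<forall>\<^sub>F p in F. r k p \<noteq> r k' p"
  proof cases
    case 1
    have "\<forall>\<^sub>F p in F. r k p - b p \<noteq> r k' p - b p"
      by (rule tendsto_eventually_neq[OF _ _ 1]) (use a k in blast)+
    then show ?thesis by eventually_elim simp
  next
    case 2
    have "\<forall>\<^sub>F p in F. (r k p - b p) / h p \<noteq> (r k' p - b p) / h p"
      by (rule tendsto_eventually_neq[OF _ _ 2(3)]) (use c k 2 in blast)+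
    then show ?thesis by eventually_elim auto
  qed
qed

text \<open>At d = t x and s = b t the fraction is seemingly of order 1/t, but the equation
  satisfied by \<open>x\<close> makes v x - b of order t. Hence \<open>tm\<close> stays bounded
  along the root nearest to the node.\<close>

lemma scaled_fraction_1:
  fixes b v x A t B la :: complex
  assumes "b * (v * x - b) * A + t * (x ^ 3 * B) = 0" "t \<noteq> 0" "x \<noteq> 0" "A \<noteq> 0"
  shows "(v * (t * x) - b * t) * (b * (t * x) + la * (b * t)) / (t * x) ^ 3 = - (B / A) * (x + la)"
proof -
  have "b * (v * x - b) * A = - (t * (x ^ 3 * B))" using assms(1) by (simp add: add_eq_0_iff2)
  then have N: "b * (v * x - b) = - (t * (x ^ 3 * B)) / A"
    using assms(4) by (metis nonzero_mult_div_cancel_right)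
  have "(v * (t * x) - b * t) * (b * (t * x) + la * (b * t)) = t * t * (b * (v * x - b)) * (x + la)"
    by (simp add: algebra_simps)
  also have "\<dots> = (t * x) ^ 3 * (- (B / A) * (x + la))"
    unfolding N by (simp add: power3_eq_cube mult_ac)
  finally show ?thesis using assms(2,3) by simp
qed

lemma scaled_fraction_2:
  fixes b v x e la :: complex
  assumes "e \<noteq> 0"
  shows "e * ((v * (e * x) - b * e\<^sup>2) * (b * (e * x) + la * (b * e\<^sup>2)) / (e * x) ^ 3) = (v * x - b * e) * (b * x + la * b * e) / x ^ 3"
proof -
  have "e * ((v * (e * x) - b * e\<^sup>2) * (b * (e * x) + la * (b * e\<^sup>2))) = e ^ 3 * ((v * x - b * e) * (b * x + la * b * e))"
    by (simp add: algebra_simps power2_eq_square power3_eq_cube)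
  then show ?thesis using assms
    by (simp only: times_divide_eq_right power_mult_distrib mult_divide_mult_cancel_left_if power_eq_0_iff if_False simp_thms)
qed

context cams
begin

text \<open>The contribution of the cameras in \<open>I\<close> at the rescaled position q = l_i + h
  x, written as polynomials in x. Both become constants as h tends to 0.\<close>

definition Ap where "Ap i I h p = (\<Prod>j\<in>I. [:l i p - l j p, h:] ^ 3)"
definition Bp where "Bp i I h p = Nf I (\<lambda>j. [:s j p * v j * (l i p - l j p) - (s j p)\<^sup>2, s j p * v j * h:]) (\<lambda>j. [:l i p - l j p, h:])"

lemma poly_Ap: "poly (Ap i I h p) x = (\<Prod>j\<in>I. (l i p + h * x - l j p) ^ 3)"
  unfolding Ap_def by (simp add: poly_prod algebra_simps)

lemma poly_Bp: "poly (Bp i I h p) x = Nf I (\<lambda>j. s j p * v j * (l i p + h * x - l j p) - (s j p)\<^sup>2) (\<lambda>j. l i p + h * x - l j p)"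
  unfolding Bp_def poly_Nf by (rule Nf_cong) (simp_all add: algebra_simps)

end

context gcams
begin

lemma plim_Ap:
  assumes "(h \<longlongrightarrow> 0) (at z)"
  shows "plim (at z) (\<lambda>p. Ap i I (h p) p) [:\<Prod>j\<in>I. (l i z - l j z) ^ 3:]"
proof -
  have "plim (at z) (\<lambda>p. Ap i I (h p) p) (Ap i I 0 z)"
    unfolding Ap_def by (intro plim_prod plim_power plim_linear tendsto_diff tendsto_l tendsto_ident_at assms)
  also have "Ap i I 0 z = [:\<Prod>j\<in>I. (l i z - l j z) ^ 3:]"
  proof -
    have "poly (Ap i I 0 z) = poly [:\<Prod>j\<in>I. (l i z - l j z) ^ 3:]"
      by (rule ext) (simp add: poly_Ap)
    then show ?thesis by (simp only: poly_eq_poly_eq_iff)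
  qed
  finally show ?thesis .
qed

lemma plim_Bp:
  assumes "(h \<longlongrightarrow> 0) (at z)"
  shows "plim (at z) (\<lambda>p. Bp i I (h p) p) [:Nf I (\<lambda>j. s j z * v j * (l i z - l j z) - (s j z)\<^sup>2) (\<lambda>j. l i z - l j z):]"
proof -
  have "plim (at z) (\<lambda>p. Bp i I (h p) p) (Bp i I 0 z)"
    unfolding Bp_def
    by (intro plim_Nf plim_linear tendsto_diff tendsto_mult tendsto_power tendsto_const tendsto_l tendsto_s tendsto_ident_at assms)
  also have "Bp i I 0 z = [:Nf I (\<lambda>j. s j z * v j * (l i z - l j z) - (s j z)\<^sup>2) (\<lambda>j. l i z - l j z):]"
  proof -
    have "poly (Bp i I 0 z) = poly [:Nf I (\<lambda>j. s j z * v j * (l i z - l j z) - (s j z)\<^sup>2) (\<lambda>j. l i z - l j z):]"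
      by (rule ext) (simp add: poly_Bp)
    then show ?thesis by (simp only: poly_eq_poly_eq_iff)
  qed
  finally show ?thesis .
qed

lemma poly_gp_split:
  assumes "i < n"
  shows "poly (gp p) q = (s i p * v i * (q - l i p) - (s i p)\<^sup>2) * (\<Prod>j\<in>{..<n}-{i}. (q - l j p) ^ 3)
    + (q - l i p) ^ 3 * poly (Kp ({..<n}-{i}) (\<lambda>j. s j p * v j) (\<lambda>j. (s j p)\<^sup>2) (\<lambda>j. l j p)) q"
  unfolding gp_def poly_Kp by (rule Nf_remove) (use assms in auto)

lemma ff_split: "i < n \<Longrightarrow> ff p q = p - tm i p (q - l i p) - (\<Sum>j\<in>{..<n}-{i}. tm j p (q - l j p))"
  unfolding ff_def by (simp add: sum.remove[of "{..<n}" i])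

lemma triple_root_times:
  assumes K: "\<And>q. poly g q = (q - c) ^ 3 * poly K q" and k: "poly K k = 0" "poly (pderiv K) k \<noteq> 0" "k \<noteq> c"
  shows "poly g k = 0" "poly (pderiv g) k \<noteq> (0::complex)"
proof -
  have "poly g = poly ([:-c, 1:] ^ 3 * K)" by (rule ext) (simp add: K)
  then have g: "g = [:-c, 1:] ^ 3 * K" by (simp only: poly_eq_poly_eq_iff)
  show "poly g k = 0" by (simp add: K k)
  show "poly (pderiv g) k \<noteq> 0" unfolding g pderiv_mult by (simp add: k)
qed

text \<open>At z = \<open>pc i\<close> the polynomial \<open>gp z\<close> is (q - l_i)^3 K(q), and
  the 3n - 5 roots of K persist. Of the other three, one is at distance about (be_i/v_i)(p - z) from
  the node and has bounded \<open>ff\<close>; two are at distance proportional to sqrt(p - z) and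
  contribute one inverse square root each. The excluded w are those for which a finite limit of w -
  \<open>ff\<close> would be 0.\<close>

lemma order_pc:
  assumes i: "i < n"
  shows "\<exists>W. finite W \<and> (\<forall>w. w \<notin> W \<longrightarrow>
     (\<forall>R E. (\<forall>p. poly R p = RR w p) \<and> R \<noteq> 0 \<and> (\<forall>p. poly E p = EE p) \<and> E \<noteq> 0 \<longrightarrow> order (pc i) R + 1 = order (pc i) E) \<and>
     (\<forall>q. (\<forall>j<n. q \<noteq> l j (pc i)) \<and> poly (gp (pc i)) q = 0 \<longrightarrow> w \<noteq> ff (pc i) q))"
proof -
  define z where "z = pc i"
  define I where "I = {..<n} - {i}"
  have finI: "finite I" unfolding I_def by simp
  have sz: "s i z = 0" using s_zero_iff[OF i] z_def by simp
  have sp: "s i p = be i * (p - z)" for p using s_pc[OF i] z_def by simp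
  have sj: "s j z \<noteq> 0" if "j \<in> I" for j
    using that s_zero_iff[of j z] pc_inj[of i j] i unfolding I_def z_def by auto
  have lz: "l j z \<noteq> l k z" if "j < n" "k < n" "j \<noteq> k" for j k
    using l_eq_iff[OF that] pc_neq_pl[OF i that] z_def by simp
  define K where "K = Kp I (\<lambda>j. s j z * v j) (\<lambda>j. (s j z)\<^sup>2) (\<lambda>j. l j z)"
  define Z where "Z = {q. poly K q = 0}"
  have K: "K \<noteq> 0" "3 * n - 5 \<le> card Z" "poly K (l i z) \<noteq> 0"
    using c_roots[OF i] unfolding K_def Z_def I_def z_def by auto
  have degK: "degree K \<le> 3 * n - 5"
    unfolding K_def card_arith'[OF i, symmetric] I_def by (rule degree_Kp) simp
  have finZ: "finite Z" unfolding Z_def using K(1) by (rule poly_roots_finite)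
  have cardZ: "card Z = 3 * n - 5"
    using K(2) card_poly_roots_bound[OF K(1)] degK unfolding Z_def by linarith
  have simple: "poly (pderiv K) k \<noteq> 0" if "k \<in> Z" for k
    by (rule simple_roots_if_card[OF K(1)]) (use cardZ degK that in \<open>auto simp: Z_def\<close>)
  have node: "k \<noteq> l j z" if "k \<in> Z" "j < n" for k j
  proof (cases "j = i")
    case True
    then show ?thesis using K(3) that(1) unfolding Z_def by auto
  next
    case False
    then have "poly K (l j z) \<noteq> 0" unfolding K_def
      by (intro poly_Kp_node_nz[where l = "\<lambda>j. l j z"]) (use that(2) lz sj in \<open>auto simp: inj_on_def I_def\<close>)
    then show ?thesis using that(1) unfolding Z_def by auto
  qed
  have gpz: "poly (gp z) q = (q - l i z) ^ 3 * poly K q" for q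
    unfolding poly_gp_split[OF i] K_def I_def by (simp add: sz)
  define P0 where "P0 = (\<Prod>j\<in>I. (l i z - l j z) ^ 3)"
  have P0: "P0 \<noteq> 0" unfolding P0_def using finI lz i by (auto simp: I_def)
  define K0 where "K0 = Nf I (\<lambda>j. s j z * v j * (l i z - l j z) - (s j z)\<^sup>2) (\<lambda>j. l i z - l j z)"
  have K0: "K0 \<noteq> 0" using K(3) unfolding K_def K0_def poly_Kp .
  have b0: "be i \<noteq> 0" and v0: "v i \<noteq> 0" using be_nz[OF i] v_nz[OF i] by auto
  \<comment> \<open>The jump of the square root is harmless: only \<eta>^2 = p - z and \<eta>
    \<rightarrow> 0 matter.\<close>
  define \<eta> where "\<eta> = (\<lambda>p. csqrt (p - z))"
  have \<eta>2: "(\<eta> p)\<^sup>2 = p - z" for p unfolding \<eta>_def by simp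
  have \<tau>0: "((\<lambda>p. p - z) \<longlongrightarrow> 0) (at z)" by (rule LIM_offset_zero_cancel) simp
  have \<eta>0: "(\<eta> \<longlongrightarrow> 0) (at z)"
  proof (rule tendsto_norm_zero_cancel)
    have "((\<lambda>p. sqrt (cmod (p - z))) \<longlongrightarrow> sqrt (cmod 0)) (at z)" by (intro tendsto_intros \<tau>0)
    then show "((\<lambda>p. cmod (\<eta> p)) \<longlongrightarrow> 0) (at z)" unfolding \<eta>_def by (simp add: norm_csqrt)
  qed
  have ne: "\<forall>\<^sub>F p in at z. p \<noteq> z" by (rule eventually_neq_at_within)
  \<comment> \<open>Limits of the rescaled roots. At scale p - z the limit equation is v x = be. At
    scale \<eta> it is x (be v P0 + K0 x^2) = 0 with nonzero roots \<sigma>1 and -\<sigma>1; its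
    root 0 belongs to the branch already found at the finer scale.\<close>
  define \<sigma>0 where "\<sigma>0 = be i / v i"
  define \<sigma>1 where "\<sigma>1 = csqrt (- (be i * v i * P0) / K0)"
  have \<sigma>0: "\<sigma>0 \<noteq> 0" "v i * \<sigma>0 = be i" unfolding \<sigma>0_def using b0 v0 by auto
  have \<sigma>1sq: "\<sigma>1\<^sup>2 * K0 = - (be i * v i * P0)" unfolding \<sigma>1_def using K0 by simp
  have \<sigma>1: "\<sigma>1 \<noteq> 0" using \<sigma>1sq b0 v0 P0 by auto
  have "\<forall>k\<in>Z. \<exists>r. (\<forall>\<^sub>F p in at z. poly (gp p) (r p) = 0) \<and> (r \<longlongrightarrow> k) (at z)"
  proof
    fix k assume k: "k \<in> Z"
    show "\<exists>r. (\<forall>\<^sub>F p in at z. poly (gp p) (r p) = 0) \<and> (r \<longlongrightarrow> k) (at z)"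
      by (rule plim_root[OF plim_gp]; rule triple_root_times[OF gpz]) (use simple[OF k] node[OF k i] k in \<open>auto simp: Z_def\<close>)
  qed
  then obtain r1 where "\<forall>k\<in>Z. (\<forall>\<^sub>F p in at z. poly (gp p) (r1 k p) = 0) \<and> (r1 k \<longlongrightarrow> k) (at z)"
    by (rule bchoice[THEN exE])
  then have r1: "\<And>k. k \<in> Z \<Longrightarrow> \<forall>\<^sub>F p in at z. poly (gp p) (r1 k p) = 0" "\<And>k. k \<in> Z \<Longrightarrow> (r1 k \<longlongrightarrow> k) (at z)"
    by blast+
  define Q2 where "Q2 = (\<lambda>p. [:be i:] * ([:- be i, v i:] * Ap i I (p - z) p) + [:p - z:] * ([:0,0,0,1:] * Bp i I (p - z) p))"
  have Q2: "poly (Q2 p) x = be i * (v i * x - be i) * poly (Ap i I (p - z) p) x + (p - z) * (x ^ 3 * poly (Bp i I (p - z) p) x)" for p x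
    unfolding Q2_def by (simp add: algebra_simps power3_eq_cube)
  have gQ2: "poly (gp p) (l i p + (p - z) * x) = (p - z)\<^sup>2 * poly (Q2 p) x" for p x
    unfolding poly_gp_split[OF i] Q2 poly_Ap poly_Bp I_def[symmetric] poly_Kp sp
    by (simp add: algebra_simps power2_eq_square power3_eq_cube)
  have "plim (at z) Q2 ([:be i:] * ([:- be i, v i:] * [:P0:]) + [:0:] * ([:0,0,0,1:] * [:K0:]))"
    unfolding Q2_def P0_def K0_def
    by (intro plim_add plim_mult plim_const plim_scalar plim_Ap plim_Bp \<tau>0)
  then have "plim (at z) Q2 [:- (be i * be i * P0), be i * v i * P0:]" by (simp add: mult_ac)
  from plim_root[OF this, of \<sigma>0] obtain r2 where r2: "\<forall>\<^sub>F p in at z. poly (Q2 p) (r2 p) = 0" "(r2 \<longlongrightarrow> \<sigma>0) (at z)"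
    using \<sigma>0 b0 v0 P0 by (auto simp: pderiv_pCons algebra_simps)
  define Q3 where "Q3 = (\<lambda>p. [:be i:] * ([:- (be i * \<eta> p), v i:] * Ap i I (\<eta> p) p) + [:0,0,0,1:] * Bp i I (\<eta> p) p)"
  have Q3: "poly (Q3 p) x = be i * (v i * x - be i * \<eta> p) * poly (Ap i I (\<eta> p) p) x + x ^ 3 * poly (Bp i I (\<eta> p) p) x" for p x
    unfolding Q3_def by (simp add: algebra_simps power3_eq_cube)
  have gQ3: "poly (gp p) (l i p + \<eta> p * x) = (\<eta> p) ^ 3 * poly (Q3 p) x" for p x
    unfolding poly_gp_split[OF i] Q3 poly_Ap poly_Bp I_def[symmetric] poly_Kp sp \<eta>2[symmetric]
    by (simp add: algebra_simps power2_eq_square power3_eq_cube)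
  have "plim (at z) Q3 ([:be i:] * ([:- (be i * 0), v i:] * [:P0:]) + [:0,0,0,1:] * [:K0:])"
    unfolding Q3_def P0_def K0_def
    by (intro plim_add plim_mult plim_const plim_linear plim_Ap plim_Bp tendsto_intros \<eta>0)
  then have limQ3: "plim (at z) Q3 [:0, be i * v i * P0, 0, K0:]" by (simp add: mult_ac)
  have "\<forall>x\<in>{\<sigma>1, -\<sigma>1}. \<exists>r. (\<forall>\<^sub>F p in at z. poly (Q3 p) (r p) = 0) \<and> (r \<longlongrightarrow> x) (at z)"
  proof
    fix x assume "x \<in> {\<sigma>1, -\<sigma>1}"
    then have x: "x\<^sup>2 * K0 = - (be i * v i * P0)" using \<sigma>1sq by auto
    show "\<exists>r. (\<forall>\<^sub>F p in at z. poly (Q3 p) (r p) = 0) \<and> (r \<longlongrightarrow> x) (at z)"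
    proof (rule plim_root[OF limQ3])
      have "poly [:0, be i * v i * P0, 0, K0:] x = x * (be i * v i * P0 + x\<^sup>2 * K0)"
        by (simp add: algebra_simps power2_eq_square)
      then show "poly [:0, be i * v i * P0, 0, K0:] x = 0" unfolding x by simp
      have "poly (pderiv [:0, be i * v i * P0, 0, K0:]) x = be i * v i * P0 + 3 * (x\<^sup>2 * K0)"
        by (simp add: pderiv_pCons algebra_simps power2_eq_square)
      then show "poly (pderiv [:0, be i * v i * P0, 0, K0:]) x \<noteq> 0" unfolding x using b0 v0 P0 by simp
    qed
  qed
  then obtain r3 where "\<forall>x\<in>{\<sigma>1, -\<sigma>1}. (\<forall>\<^sub>F p in at z. poly (Q3 p) (r3 x p) = 0) \<and> (r3 x \<longlongrightarrow> x) (at z)"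
    by (rule bchoice[THEN exE])
  then have r3: "\<And>x. x \<in> {\<sigma>1, -\<sigma>1} \<Longrightarrow> \<forall>\<^sub>F p in at z. poly (Q3 p) (r3 x p) = 0"
    "\<And>x. x \<in> {\<sigma>1, -\<sigma>1} \<Longrightarrow> (r3 x \<longlongrightarrow> x) (at z)" by blast+
  \<comment> \<open>The first component of an index is the kind of branch: 0 for the roots of
    \<open>K\<close>, 1 for the root at distance of order p - z, 2 for the pair at distance of order
    \<eta>.\<close>
  define J where "J = {0::nat} \<times> Z \<union> {(1, 0)} \<union> {2} \<times> {\<sigma>1, -\<sigma>1}"
  define r where "r = (\<lambda>(k::nat, x) p. if k = 0 then r1 x p else if k = 1 then l i p + (p - z) * r2 p else l i p + \<eta> p * r3 x p)"
  define e where "e = (\<lambda>(k::nat, x::complex) p. if k = 2 then \<eta> p else 1)"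
  have Jcases: "(\<exists>x\<in>Z. k = (0, x)) \<or> k = (1, 0) \<or> (\<exists>x\<in>{\<sigma>1, -\<sigma>1}. k = (2, x))" if "k \<in> J" for k
    using that unfolding J_def by auto
  have finJ: "finite J" unfolding J_def using finZ by simp
  have \<sigma>1n: "\<sigma>1 \<noteq> - \<sigma>1" using \<sigma>1 by simp
  have cardJ: "card J = 3 * n - 2"
  proof -
    have "card J = card ({0::nat} \<times> Z) + card {(1::nat, 0::complex)} + card ({2::nat} \<times> {\<sigma>1, -\<sigma>1})"
      unfolding J_def using finZ by (subst card_Un_disjoint; (subst card_Un_disjoint)?) auto
    also have "\<dots> = 3 * n - 5 + 1 + 2" using cardZ \<sigma>1n by (simp add: card_cartesian_product)
    finally show ?thesis using n2 by simp
  qed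
  have prode: "(\<Prod>k\<in>J. e k p) = (p - z) ^ 1 / (p - z) ^ 0" for p
  proof -
    have "(\<Prod>k\<in>J. e k p) = (\<Prod>k\<in>{2} \<times> {\<sigma>1, -\<sigma>1}. e k p)"
      by (rule prod.mono_neutral_right[OF finJ]) (auto simp: J_def e_def)
    also have "{2} \<times> {\<sigma>1, -\<sigma>1} = {(2::nat, \<sigma>1), (2, - \<sigma>1)}" by auto
    also have "(\<Prod>k\<in>{(2::nat, \<sigma>1), (2, - \<sigma>1)}. e k p) = (\<eta> p)\<^sup>2"
      using \<sigma>1n by (simp add: e_def power2_eq_square)
    finally show ?thesis by (simp add: \<eta>2)
  qed
  have roots: "\<forall>k\<in>J. \<forall>\<^sub>F p in at z. poly (gp p) (r k p) = 0"
  proof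
    fix k assume "k \<in> J"
    then show "\<forall>\<^sub>F p in at z. poly (gp p) (r k p) = 0"
    proof (elim Jcases[THEN disjE] disjE bexE)
      fix x assume "x \<in> Z" "k = (0, x)"
      then show ?thesis using r1(1)[of x] by (simp add: r_def)
    next
      assume "k = (1, 0)"
      then show ?thesis using r2(1) by (auto simp: r_def gQ2 elim!: eventually_mono)
    next
      fix x assume "x \<in> {\<sigma>1, -\<sigma>1}" "k = (2, x)"
      then show ?thesis using r3(1)[of x] by (auto simp: r_def gQ3 elim!: eventually_mono)
    qed
  qed
  define a where "a = (\<lambda>(k::nat, x). if k = 0 then x - l i z else 0)"
  define c where "c = (\<lambda>(k::nat, x::complex). if k = 1 then 0 else x)"
  have lil: "((\<lambda>p. l i p) \<longlongrightarrow> l i z) (at z)" by (rule tendsto_l[OF tendsto_ident_at])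
  have dist: "\<forall>k\<in>J. \<forall>k'\<in>J. k \<noteq> k' \<longrightarrow> (\<forall>\<^sub>F p in at z. r k p \<noteq> r k' p)"
  proof (rule two_scale_distinct[where b = "\<lambda>p. l i p" and h = \<eta> and a = a and c = c])
    show "\<forall>k\<in>J. ((\<lambda>p. r k p - l i p) \<longlongrightarrow> a k) (at z)"
    proof
      fix k assume "k \<in> J"
      then show "((\<lambda>p. r k p - l i p) \<longlongrightarrow> a k) (at z)"
      proof (elim Jcases[THEN disjE] disjE bexE)
        fix x assume "x \<in> Z" "k = (0, x)"
        then show ?thesis using tendsto_diff[OF r1(2)[of x] lil] by (simp add: r_def a_def)
      next
        assume "k = (1, 0)"
        then show ?thesis using tendsto_mult[OF \<tau>0 r2(2)] by (simp add: r_def a_def)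
      next
        fix x assume "x \<in> {\<sigma>1, -\<sigma>1}" "k = (2, x)"
        then show ?thesis using tendsto_mult[OF \<eta>0 r3(2)[of x]] by (simp add: r_def a_def)
      qed
    qed
    show "\<forall>k\<in>J. a k = 0 \<longrightarrow> ((\<lambda>p. (r k p - l i p) / \<eta> p) \<longlongrightarrow> c k) (at z)"
    proof (intro ballI impI)
      fix k assume "k \<in> J" and ak: "a k = 0"
      then show "((\<lambda>p. (r k p - l i p) / \<eta> p) \<longlongrightarrow> c k) (at z)"
      proof (elim Jcases[THEN disjE] disjE bexE)
        fix x assume "x \<in> Z" "k = (0, x)"
        then show ?thesis using ak node[of x i] i by (simp add: a_def)
      next
        assume k: "k = (1, 0)"
        have "((\<lambda>p. \<eta> p * r2 p) \<longlongrightarrow> 0 * \<sigma>0) (at z)" by (intro tendsto_mult \<eta>0 r2(2))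
        moreover have "\<forall>\<^sub>F p in at z. \<eta> p * r2 p = (r k p - l i p) / \<eta> p"
          using ne
        proof eventually_elim
          case (elim p)
          then have "\<eta> p \<noteq> 0" using \<eta>2[of p] by auto
          then show ?case by (simp add: k r_def \<eta>2[symmetric] power2_eq_square)
        qed
        ultimately have "((\<lambda>p. (r k p - l i p) / \<eta> p) \<longlongrightarrow> 0 * \<sigma>0) (at z)" by (rule Lim_transform_eventually)
        then show ?thesis by (simp add: c_def k)
      next
        fix x assume x: "x \<in> {\<sigma>1, -\<sigma>1}" and k: "k = (2, x)"
        have "\<forall>\<^sub>F p in at z. r3 x p = (r k p - l i p) / \<eta> p"
          using ne
        proof eventually_elim
          case (elim p)
          then have "\<eta> p \<noteq> 0" using \<eta>2[of p] by auto
          then show ?case by (simp add: k r_def)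
        qed
        then have "((\<lambda>p. (r k p - l i p) / \<eta> p) \<longlongrightarrow> x) (at z)" by (rule Lim_transform_eventually[OF r3(2)[OF x]])
        then show ?thesis by (simp add: c_def k)
      qed
    qed
    show "\<forall>k\<in>J. \<forall>k'\<in>J. k \<noteq> k' \<longrightarrow> a k \<noteq> a k' \<or> (a k = 0 \<and> a k' = 0 \<and> c k \<noteq> c k')"
      using node[OF _ i] \<sigma>1 \<sigma>1n unfolding J_def a_def c_def by (auto simp: split_beta)
  qed
  \<comment> \<open>The limit of \<open>ff\<close> along the branch of kind 1, where
    \<open>scaled_fraction_1\<close> evaluates the critical term.\<close>
  define L2 where "L2 = z + K0 / P0 * (\<sigma>0 + la i) - (\<Sum>j\<in>I. tm j z (l i z - l j z))"
  define W where "W = insert L2 (ff z ` Z)"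
  have finW: "finite W" unfolding W_def using finZ by simp
  have limrest: "((\<lambda>p. \<Sum>j\<in>I. tm j p (l i p + h p - l j p)) \<longlongrightarrow> (\<Sum>j\<in>I. tm j z (l i z - l j z))) (at z)"
    if "(h \<longlongrightarrow> 0) (at z)" for h
  proof (rule tendsto_sum)
    fix j assume j: "j \<in> I"
    have "((\<lambda>p. l i p + h p - l j p) \<longlongrightarrow> l i z + 0 - l j z) (at z)"
      by (intro tendsto_intros tendsto_l that)
    then have "((\<lambda>p. l i p + h p - l j p) \<longlongrightarrow> l i z - l j z) (at z)" by simp
    then show "((\<lambda>p. tm j p (l i p + h p - l j p)) \<longlongrightarrow> tm j z (l i z - l j z)) (at z)"
      by (rule tendsto_tm[OF tendsto_ident_at]) (use lz[of i j] i j in \<open>auto simp: I_def\<close>)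
  qed
  have h2: "((\<lambda>p. (p - z) * r2 p) \<longlongrightarrow> 0) (at z)" using tendsto_mult[OF \<tau>0 r2(2)] by simp
  have main: "order z R + 1 = order z E"
    if w: "w \<notin> W" and RE: "\<forall>p. poly R p = RR w p" "R \<noteq> 0" "\<forall>p. poly E p = EE p" "E \<noteq> 0" for w R E
  proof -
    define L where "L = (\<lambda>(k::nat, x). if k = 0 then w - ff z x else if k = 1 then w - L2 else v i * be i / x)"
    have lim: "\<forall>k\<in>J. ((\<lambda>p. (w - ff p (r k p)) * e k p) \<longlongrightarrow> L k) (at z)"
    proof
      fix k assume "k \<in> J"
      then show "((\<lambda>p. (w - ff p (r k p)) * e k p) \<longlongrightarrow> L k) (at z)"
      proof (elim Jcases[THEN disjE] disjE bexE)
        fix x assume x: "x \<in> Z" and k: "k = (0, x)"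
        have "((\<lambda>p. w - ff p (r1 x p)) \<longlongrightarrow> w - ff z x) (at z)"
          by (intro tendsto_diff tendsto_const tendsto_ff tendsto_ident_at r1(2) x node) auto
        then show ?thesis by (simp add: k r_def e_def L_def)
      next
        assume k: "k = (1, 0)"
        have A: "((\<lambda>p. poly (Ap i I (p - z) p) (r2 p)) \<longlongrightarrow> P0) (at z)"
          using plim_poly[OF plim_Ap[OF \<tau>0, of i I] r2(2)] unfolding P0_def by simp
        have B: "((\<lambda>p. poly (Bp i I (p - z) p) (r2 p)) \<longlongrightarrow> K0) (at z)"
          using plim_poly[OF plim_Bp[OF \<tau>0, of i I] r2(2)] unfolding K0_def by simp
        have "((\<lambda>p. w - (p + poly (Bp i I (p - z) p) (r2 p) / poly (Ap i I (p - z) p) (r2 p) * (r2 p + la i)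
            - (\<Sum>j\<in>I. tm j p (l i p + (p - z) * r2 p - l j p)))) \<longlongrightarrow> w - L2) (at z)"
          unfolding L2_def by (intro tendsto_intros A B r2(2) P0 limrest h2)
        moreover have "\<forall>\<^sub>F p in at z. w - (p + poly (Bp i I (p - z) p) (r2 p) / poly (Ap i I (p - z) p) (r2 p) * (r2 p + la i)
            - (\<Sum>j\<in>I. tm j p (l i p + (p - z) * r2 p - l j p))) = (w - ff p (r k p)) * e k p"
          using ne r2(1) tendsto_imp_eventually_ne[OF r2(2) \<sigma>0(1)] tendsto_imp_eventually_ne[OF A P0]
        proof eventually_elim
          case (elim p)
          have "tm i p ((p - z) * r2 p) = - (poly (Bp i I (p - z) p) (r2 p) / poly (Ap i I (p - z) p) (r2 p)) * (r2 p + la i)"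
            unfolding tm_def sp
            by (rule scaled_fraction_1) (use elim in \<open>auto simp: Q2\<close>)
          then show ?case by (simp add: k r_def e_def ff_split[OF i] I_def)
        qed
        ultimately show ?thesis by (simp add: k L_def Lim_transform_eventually)
      next
        fix x assume x: "x \<in> {\<sigma>1, -\<sigma>1}" and k: "k = (2, x)"
        have x0: "x \<noteq> 0" using x \<sigma>1 by auto
        have h3: "((\<lambda>p. \<eta> p * r3 x p) \<longlongrightarrow> 0) (at z)" using tendsto_mult[OF \<eta>0 r3(2)[OF x]] by simp
        have "((\<lambda>p. \<eta> p * (w - p) + (v i * r3 x p - be i * \<eta> p) * (be i * r3 x p + la i * be i * \<eta> p) / r3 x p ^ 3
            + \<eta> p * (\<Sum>j\<in>I. tm j p (l i p + \<eta> p * r3 x p - l j p))) \<longlongrightarrow>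
           0 * (w - z) + (v i * x - be i * 0) * (be i * x + la i * be i * 0) / x ^ 3 + 0 * (\<Sum>j\<in>I. tm j z (l i z - l j z))) (at z)"
          by (intro tendsto_intros \<eta>0 r3(2) x limrest h3) (use x0 in simp)
        also have "0 * (w - z) + (v i * x - be i * 0) * (be i * x + la i * be i * 0) / x ^ 3 + 0 * (\<Sum>j\<in>I. tm j z (l i z - l j z)) = L k"
          using x0 by (simp add: L_def k power3_eq_cube)
        finally have lim3: "((\<lambda>p. \<eta> p * (w - p) + (v i * r3 x p - be i * \<eta> p) * (be i * r3 x p + la i * be i * \<eta> p) / r3 x p ^ 3
            + \<eta> p * (\<Sum>j\<in>I. tm j p (l i p + \<eta> p * r3 x p - l j p))) \<longlongrightarrow> L k) (at z)" .
        have "\<forall>\<^sub>F p in at z. \<eta> p * (w - p) + (v i * r3 x p - be i * \<eta> p) * (be i * r3 x p + la i * be i * \<eta> p) / r3 x p ^ 3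
            + \<eta> p * (\<Sum>j\<in>I. tm j p (l i p + \<eta> p * r3 x p - l j p)) = (w - ff p (r k p)) * e k p"
          using ne
        proof eventually_elim
          case (elim p)
          then have "\<eta> p \<noteq> 0" using \<eta>2[of p] by auto
          then have "\<eta> p * tm i p (\<eta> p * r3 x p) = (v i * r3 x p - be i * \<eta> p) * (be i * r3 x p + la i * be i * \<eta> p) / r3 x p ^ 3"
            unfolding tm_def sp \<eta>2[symmetric] by (rule scaled_fraction_2)
          then show ?case by (simp add: k r_def e_def ff_split[OF i] I_def algebra_simps)
        qed
        then show ?thesis by (rule Lim_transform_eventually[OF lim3])
      qed
    qed
    have L: "\<forall>k\<in>J. L k \<noteq> 0"
      using w \<sigma>1 b0 v0 unfolding J_def L_def W_def by auto
    have "order z R + 1 = order z E + 0"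
      by (rule order_at[OF spec[OF RE(1)] RE(2) spec[OF RE(3)] RE(4) finJ cardJ roots dist lim L prode])
    then show ?thesis by (simp only: add_0_right)
  qed
  have fiber: "w \<noteq> ff z q" if "w \<notin> W" "\<forall>j<n. q \<noteq> l j z" "poly (gp z) q = 0" for w q
    using that gpz[of q] i unfolding W_def Z_def by auto
  show ?thesis unfolding z_def[symmetric]
  proof (intro exI[of _ W] conjI finW allI impI; elim conjE)
    fix w R E assume "w \<notin> W" "\<forall>p. poly R p = RR w p" "R \<noteq> 0" "\<forall>p. poly E p = EE p" "E \<noteq> 0"
    then show "order z R + 1 = order z E" by (rule main)
  next
    fix w q assume "w \<notin> W" "\<forall>j<n. q \<noteq> l j z" "poly (gp z) q = 0"
    then show "w \<noteq> ff z q" by (rule fiber)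
  qed
qed

end

section \<open>Local analysis at the coincidences \<open>l i = l j\<close>\<close>

lemma scaled_sum_identity:
  fixes T x y :: complex
  shows "(a * (T * x) - b) * ((T * y) ^ 3 * P) + (T * x) ^ 3 * ((c * (T * y) - d) * P + (T * y) ^ 3 * N)
    = T ^ 3 * (((a * (T * x) - b) * y ^ 3 + (c * (T * y) - d) * x ^ 3) * P + T ^ 3 * (x ^ 3 * y ^ 3 * N))"
  unfolding power_mult_distrib by (simp add: algebra_simps)

context gcams
begin

lemma poly_gp_split2:
  assumes "i < n" "j < n" "i \<noteq> j"
  shows "poly (gp p) q = (s i p * v i * (q - l i p) - (s i p)\<^sup>2) * ((q - l j p) ^ 3 * (\<Prod>k\<in>{..<n}-{i}-{j}. (q - l k p) ^ 3))
    + (q - l i p) ^ 3 * ((s j p * v j * (q - l j p) - (s j p)\<^sup>2) * (\<Prod>k\<in>{..<n}-{i}-{j}. (q - l k p) ^ 3)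
      + (q - l j p) ^ 3 * Nf ({..<n}-{i}-{j}) (\<lambda>k. s k p * v k * (q - l k p) - (s k p)\<^sup>2) (\<lambda>k. q - l k p))"
proof -
  have j: "j \<in> {..<n} - {i}" using assms by auto
  show ?thesis unfolding poly_gp_split[OF assms(1)] poly_Kp
    by (subst Nf_remove[of "{..<n} - {i}" j], simp, rule j, subst prod.remove[of "{..<n} - {i}" j], simp, rule j, rule refl)
qed

text \<open>At z = \<open>pl i j\<close> the nodes of two cameras merge, their weights add up in
  \<open>K\<close>, and again \<open>gp z\<close> is (q - l_i)^3 K(q). The other three roots are q =
  l_i + (p - z) x with x near a root of the cubic \<open>C\<close>. Both denominators are then of
  order p - z, so w - \<open>ff\<close> has a pole of order 3 along each of the three
  branches.\<close>

lemma order_pl: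
  assumes ij: "i < j" "j < n"
  shows "\<exists>W. finite W \<and> (\<forall>w. w \<notin> W \<longrightarrow>
     (\<forall>R E. (\<forall>p. poly R p = RR w p) \<and> R \<noteq> 0 \<and> (\<forall>p. poly E p = EE p) \<and> E \<noteq> 0 \<longrightarrow> order (pl i j) R + 9 = order (pl i j) E) \<and>
     (\<forall>q. (\<forall>k<n. q \<noteq> l k (pl i j)) \<and> poly (gp (pl i j)) q = 0 \<longrightarrow> w \<noteq> ff (pl i j) q))"
proof -
  have i: "i < n" and j: "j < n" and inj: "i \<noteq> j" using ij by auto
  define z where "z = pl i j"
  define I where "I = {..<n} - {i} - {j}"
  have finI: "finite I" unfolding I_def by simp
  define \<delta> where "\<delta> = la i - la j"
  have \<delta>0: "\<delta> \<noteq> 0" using la_inj[OF i j inj] unfolding \<delta>_def by simp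
  have lij: "l i p - l j p = \<delta> * (p - z)" for p using l_diff[OF i j inj] unfolding \<delta>_def z_def .
  have lijz: "l j z = l i z" using lij[of z] by simp
  have sz: "s k z \<noteq> 0" if "k < n" for k using s_pl[OF ij that] z_def by simp
  have lz: "l k z \<noteq> l k' z" if H: "k < n" "k' < n" "k \<noteq> k'" "{k, k'} \<noteq> {i, j}" for k k'
  proof
    assume "l k z = l k' z"
    then have e: "z = pl k k'" using l_eq_iff[OF H(1-3)] by simp
    consider "k < k'" | "k' < k" using H(3) by linarith
    then show False
    proof cases
      case 1
      then show False using pl_inj[OF ij 1 H(2)] e H(4) unfolding z_def by auto
    next
      case 2
      then show False using pl_inj[OF ij 2 H(1)] e H(4) pl_sym[of k k'] unfolding z_def by auto
    qed
  qed
  define K where "K = Kp ({..<n} - {j}) (\<lambda>k. s k z * v k + (if k = i then s j z * v j else 0))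
           (\<lambda>k. (s k z)\<^sup>2 + (if k = i then (s j z)\<^sup>2 else 0)) (\<lambda>k. l k z)"
  define Z where "Z = {q. poly K q = 0}"
  have K: "K \<noteq> 0" "3 * n - 5 \<le> card Z" using l_roots[OF ij] unfolding K_def Z_def z_def by auto
  have degK: "degree K \<le> 3 * n - 5"
    unfolding K_def card_arith'[OF j, symmetric] by (rule degree_Kp) simp
  have finZ: "finite Z" unfolding Z_def using K(1) by (rule poly_roots_finite)
  have cardZ: "card Z = 3 * n - 5"
    using K(2) card_poly_roots_bound[OF K(1)] degK unfolding Z_def by linarith
  have simple: "poly (pderiv K) k \<noteq> 0" if "k \<in> Z" for k
    by (rule simple_roots_if_card[OF K(1)]) (use cardZ degK that in \<open>auto simp: Z_def\<close>)
  have sq: "(s i z)\<^sup>2 + (s j z)\<^sup>2 \<noteq> 0" using sq_pl[OF ij] z_def by simp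
  have node': "poly K (l k z) \<noteq> 0" if k: "k < n" "k \<noteq> j" for k
    unfolding K_def
  proof (rule poly_Kp_node_nz[where l = "\<lambda>k. l k z"])
    show "inj_on (\<lambda>k. l k z) ({..<n} - {j})"
    proof (rule inj_onI, rule ccontr)
      fix a b assume "a \<in> {..<n} - {j}" "b \<in> {..<n} - {j}" "l a z = l b z" "a \<noteq> b"
      moreover have "{a, b} \<noteq> {i, j}"
      proof
        assume "{a, b} = {i, j}"
        then have "j \<in> {a, b}" by simp
        then show False using \<open>a \<in> {..<n} - {j}\<close> \<open>b \<in> {..<n} - {j}\<close> by auto
      qed
      ultimately show False using lz[of a b] by auto
    qed
    show "(s k z)\<^sup>2 + (if k = i then (s j z)\<^sup>2 else 0) \<noteq> 0" using sq sz[OF k(1)] by auto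
  qed (use k in auto)
  have node: "x \<noteq> l k z" if "x \<in> Z" "k < n" for x k
  proof (cases "k = j")
    case True
    then show ?thesis using node'[OF i inj] that(1) lijz unfolding Z_def by auto
  next
    case False
    then show ?thesis using node'[OF that(2)] that(1) unfolding Z_def by auto
  qed
  have Kval: "poly K q = ((s i z * v i + s j z * v j) * (q - l i z) - ((s i z)\<^sup>2 + (s j z)\<^sup>2)) * (\<Prod>k\<in>I. (q - l k z) ^ 3)
     + (q - l i z) ^ 3 * Nf I (\<lambda>k. s k z * v k * (q - l k z) - (s k z)\<^sup>2) (\<lambda>k. q - l k z)" for q
  proof -
    have I': "{..<n} - {j} - {i} = I" unfolding I_def by auto
    have "Nf I (\<lambda>k. (s k z * v k + (if k = i then s j z * v j else 0)) * (q - l k z) - ((s k z)\<^sup>2 + (if k = i then (s j z)\<^sup>2 else 0))) (\<lambda>k. q - l k z)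
      = Nf I (\<lambda>k. s k z * v k * (q - l k z) - (s k z)\<^sup>2) (\<lambda>k. q - l k z)"
      by (rule Nf_cong) (auto simp: I_def)
    moreover have "Nf ({..<n} - {j}) c d = c i * (\<Prod>j\<in>I. d j ^ 3) + d i ^ 3 * Nf I c d" for c d :: "nat \<Rightarrow> complex"
      using Nf_remove[of "{..<n} - {j}" i c d] i inj by (simp add: I')
    ultimately show ?thesis unfolding K_def poly_Kp by simp
  qed
  have gpz: "poly (gp z) q = (q - l i z) ^ 3 * poly K q" for q
    unfolding poly_gp_split2[OF i j inj] Kval I_def[symmetric] lijz by (simp add: algebra_simps)
  define P0 where "P0 = (\<Prod>k\<in>I. (l i z - l k z) ^ 3)"
  have P0: "P0 \<noteq> 0" unfolding P0_def
  proof -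
    have "l i z - l k z \<noteq> 0" if "k \<in> I" for k
      using lz[of i k] i that inj by (auto simp: I_def doubleton_eq_iff)
    then show "(\<Prod>k\<in>I. (l i z - l k z) ^ 3) \<noteq> 0" using finI by simp
  qed
  define K0 where "K0 = Nf I (\<lambda>j. s j z * v j * (l i z - l j z) - (s j z)\<^sup>2) (\<lambda>j. l i z - l j z)"
  have \<tau>0: "((\<lambda>p. p - z) \<longlongrightarrow> 0) (at z)" by (rule LIM_offset_zero_cancel) simp
  have ne: "\<forall>\<^sub>F p in at z. p \<noteq> z" by (rule eventually_neq_at_within)
  have "\<forall>k\<in>Z. \<exists>r. (\<forall>\<^sub>F p in at z. poly (gp p) (r p) = 0) \<and> (r \<longlongrightarrow> k) (at z)"
  proof
    fix k assume k: "k \<in> Z"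
    show "\<exists>r. (\<forall>\<^sub>F p in at z. poly (gp p) (r p) = 0) \<and> (r \<longlongrightarrow> k) (at z)"
      by (rule plim_root[OF plim_gp]; rule triple_root_times[OF gpz]) (use simple[OF k] node[OF k i] k in \<open>auto simp: Z_def\<close>)
  qed
  then obtain r1 where "\<forall>k\<in>Z. (\<forall>\<^sub>F p in at z. poly (gp p) (r1 k p) = 0) \<and> (r1 k \<longlongrightarrow> k) (at z)"
    by (rule bchoice[THEN exE])
  then have r1: "\<And>k. k \<in> Z \<Longrightarrow> \<forall>\<^sub>F p in at z. poly (gp p) (r1 k p) = 0" "\<And>k. k \<in> Z \<Longrightarrow> (r1 k \<longlongrightarrow> k) (at z)"
    by blast+
  define Si where "Si = s i z"
  define Sj where "Sj = s j z"
  have S0: "Si \<noteq> 0" "Sj \<noteq> 0" "Si\<^sup>2 + Sj\<^sup>2 \<noteq> 0" using sz[OF i] sz[OF j] sq unfolding Si_def Sj_def by auto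
  \<comment> \<open>With d_i = (p - z) x and d_j = (p - z)(x + \<delta>), the lowest-order part of
    \<open>gp\<close> near the node is - s_i^2 d_j^3 - s_j^2 d_i^3 times a constant.\<close>
  define C where "C = [:Si\<^sup>2 * \<delta> ^ 3, 3 * (Si\<^sup>2 * \<delta>\<^sup>2), 3 * (Si\<^sup>2 * \<delta>), Si\<^sup>2 + Sj\<^sup>2:]"
  have C: "poly C x = Si\<^sup>2 * (x + \<delta>) ^ 3 + Sj\<^sup>2 * x ^ 3" for x
    unfolding C_def by (simp add: algebra_simps power3_eq_cube power2_eq_square)
  have C': "poly (pderiv C) x = 3 * (Si\<^sup>2 * (x + \<delta>)\<^sup>2 + Sj\<^sup>2 * x\<^sup>2)" for x
    unfolding C_def by (simp add: pderiv_pCons algebra_simps power2_eq_square)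
  have C0: "C \<noteq> 0" and degC: "degree C = 3" using S0 unfolding C_def by auto
  define ZC where "ZC = {x. poly C x = 0}"
  have ZC0: "x \<noteq> 0" "x + \<delta> \<noteq> 0" if "x \<in> ZC" for x
  proof -
    have e: "Si\<^sup>2 * (x + \<delta>) ^ 3 + Sj\<^sup>2 * x ^ 3 = 0" using that C unfolding ZC_def by simp
    show "x \<noteq> 0" using e S0 \<delta>0 by auto
    show "x + \<delta> \<noteq> 0"
    proof
      assume "x + \<delta> = 0"
      then have "x = 0" using e S0 by simp
      then show False using \<open>x \<noteq> 0\<close> by simp
    qed
  qed
  \<comment> \<open>The combination C - (x + \<delta>) C'/3 equals - Sj^2 x^2 \<delta>, which does
    not vanish at a root of \<open>C\<close>.\<close>
  have simpleC: "poly (pderiv C) x \<noteq> 0" if "poly C x = 0" for x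
  proof
    assume "poly (pderiv C) x = 0"
    then have a: "Si\<^sup>2 * (x + \<delta>)\<^sup>2 = - (Sj\<^sup>2 * x\<^sup>2)" unfolding C' by (simp add: add_eq_0_iff2)
    have "Si\<^sup>2 * (x + \<delta>) ^ 3 + Sj\<^sup>2 * x ^ 3 = (Si\<^sup>2 * (x + \<delta>)\<^sup>2) * (x + \<delta>) + Sj\<^sup>2 * x ^ 3"
      by (simp add: power3_eq_cube power2_eq_square mult_ac)
    also have "\<dots> = - (Sj\<^sup>2 * x\<^sup>2 * \<delta>)" unfolding a by (simp add: algebra_simps power3_eq_cube power2_eq_square)
    finally have "Sj\<^sup>2 * x\<^sup>2 * \<delta> = 0" using that C by simp
    then show False using S0 \<delta>0 ZC0[of x] that unfolding ZC_def by simp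
  qed
  have finZC: "finite ZC" unfolding ZC_def using C0 by (rule poly_roots_finite)
  have cardZC: "card ZC = 3" unfolding ZC_def using card_roots_simple[OF C0 simpleC] degC by simp
  define Q where "Q = (\<lambda>p. ([:- (s i p)\<^sup>2, s i p * v i * (p - z):] * [:\<delta>, 1:] ^ 3
      + [:s j p * v j * ((p - z) * \<delta>) - (s j p)\<^sup>2, s j p * v j * (p - z):] * [:0, 1:] ^ 3) * Ap i I (p - z) p
      + [:(p - z) ^ 3:] * ([:0, 1:] ^ 3 * [:\<delta>, 1:] ^ 3 * Bp i I (p - z) p))"
  have Q: "poly (Q p) x = ((s i p * v i * ((p - z) * x) - (s i p)\<^sup>2) * (x + \<delta>) ^ 3
      + (s j p * v j * ((p - z) * (x + \<delta>)) - (s j p)\<^sup>2) * x ^ 3) * poly (Ap i I (p - z) p) x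
      + (p - z) ^ 3 * (x ^ 3 * (x + \<delta>) ^ 3 * poly (Bp i I (p - z) p) x)" for p x
  proof -
    have "poly [:- (s i p)\<^sup>2, s i p * v i * (p - z):] x = s i p * v i * ((p - z) * x) - (s i p)\<^sup>2" by simp
    moreover have "poly [:s j p * v j * ((p - z) * \<delta>) - (s j p)\<^sup>2, s j p * v j * (p - z):] x
        = s j p * v j * ((p - z) * (x + \<delta>)) - (s j p)\<^sup>2" by (simp add: distrib_left mult_ac)
    moreover have "poly [:\<delta>, 1:] x = x + \<delta>" "poly [:0, 1:] x = x" "poly [:(p - z) ^ 3:] x = (p - z) ^ 3" by simp_all
    ultimately show ?thesis unfolding Q_def poly_add poly_mult poly_power by (simp only:)
  qed
  have gQ: "poly (gp p) (l i p + (p - z) * x) = (p - z) ^ 3 * poly (Q p) x" for p x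
  proof -
    have d: "l i p + (p - z) * x - l i p = (p - z) * x" "l i p + (p - z) * x - l j p = (p - z) * (x + \<delta>)"
      using lij[of p] by (simp_all add: algebra_simps)
    show ?thesis unfolding poly_gp_split2[OF i j inj] d Q poly_Ap poly_Bp I_def[symmetric]
      by (rule scaled_sum_identity)
  qed
  define Q0 where "Q0 = ([:- Si\<^sup>2, Si * v i * 0:] * [:\<delta>, 1:] ^ 3
      + [:Sj * v j * (0 * \<delta>) - Sj\<^sup>2, Sj * v j * 0:] * [:0, 1:] ^ 3) * [:P0:] + [:0 ^ 3:] * ([:0, 1:] ^ 3 * [:\<delta>, 1:] ^ 3 * [:K0:])"
  have tsi: "((\<lambda>p. s k p) \<longlongrightarrow> s k z) (at z)" for k by (rule tendsto_s[OF tendsto_ident_at])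
  have "plim (at z) Q Q0"
    unfolding Q_def Q0_def P0_def K0_def Si_def Sj_def
    by (intro plim_add plim_mult plim_power plim_const plim_linear plim_scalar plim_Ap plim_Bp
        tendsto_diff tendsto_mult tendsto_power tendsto_minus tendsto_const tsi \<tau>0)
  also have "Q0 = Polynomial.smult (- P0) C"
  proof -
    have "poly Q0 = poly (Polynomial.smult (- P0) C)"
      by (rule ext) (simp add: Q0_def C algebra_simps)
    then show ?thesis by (simp only: poly_eq_poly_eq_iff)
  qed
  finally have limQ: "plim (at z) Q (Polynomial.smult (- P0) C)" .
  have "\<forall>x\<in>ZC. \<exists>r. (\<forall>\<^sub>F p in at z. poly (Q p) (r p) = 0) \<and> (r \<longlongrightarrow> x) (at z)"
  proof
    fix x assume x: "x \<in> ZC"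
    show "\<exists>r. (\<forall>\<^sub>F p in at z. poly (Q p) (r p) = 0) \<and> (r \<longlongrightarrow> x) (at z)"
      by (rule plim_root[OF limQ]) (use x P0 simpleC[of x] in \<open>auto simp: ZC_def pderiv_smult pderiv_minus\<close>)
  qed
  then obtain r2 where "\<forall>x\<in>ZC. (\<forall>\<^sub>F p in at z. poly (Q p) (r2 x p) = 0) \<and> (r2 x \<longlongrightarrow> x) (at z)"
    by (rule bchoice[THEN exE])
  then have r2: "\<And>x. x \<in> ZC \<Longrightarrow> \<forall>\<^sub>F p in at z. poly (Q p) (r2 x p) = 0"
    "\<And>x. x \<in> ZC \<Longrightarrow> (r2 x \<longlongrightarrow> x) (at z)" by blast+
  define J where "J = {0::nat} \<times> Z \<union> {1} \<times> ZC"
  define r where "r = (\<lambda>(k::nat, x) p. if k = 0 then r1 x p else l i p + (p - z) * r2 x p)"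
  define e where "e = (\<lambda>(k::nat, x::complex) p. if k = 1 then (p - z) ^ 3 else 1)"
  have Jcases: "(\<exists>x\<in>Z. k = (0, x)) \<or> (\<exists>x\<in>ZC. k = (1, x))" if "k \<in> J" for k
    using that unfolding J_def by auto
  have finJ: "finite J" unfolding J_def using finZ finZC by simp
  have cardJ: "card J = 3 * n - 2"
  proof -
    have "card J = card ({0::nat} \<times> Z) + card ({1::nat} \<times> ZC)"
      unfolding J_def using finZ finZC by (subst card_Un_disjoint) auto
    also have "\<dots> = 3 * n - 5 + 3" using cardZ cardZC by (simp add: card_cartesian_product)
    finally show ?thesis using n2 by simp
  qed
  have prode: "(\<Prod>k\<in>J. e k p) = (p - z) ^ 9 / (p - z) ^ 0" for p
  proof -
    have "(\<Prod>k\<in>J. e k p) = (\<Prod>k\<in>{1} \<times> ZC. e k p)"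
      by (rule prod.mono_neutral_right[OF finJ]) (auto simp: J_def e_def)
    also have "\<dots> = (\<Prod>k\<in>{1::nat} \<times> ZC. (p - z) ^ 3)" by (rule prod.cong) (auto simp: e_def)
    also have "\<dots> = ((p - z) ^ 3) ^ 3" by (simp add: card_cartesian_product cardZC)
    finally show ?thesis by (simp flip: power_mult)
  qed
  have roots: "\<forall>k\<in>J. \<forall>\<^sub>F p in at z. poly (gp p) (r k p) = 0"
  proof
    fix k assume "k \<in> J"
    then show "\<forall>\<^sub>F p in at z. poly (gp p) (r k p) = 0"
    proof (elim Jcases[THEN disjE] bexE)
      fix x assume "x \<in> Z" "k = (0, x)"
      then show ?thesis using r1(1)[of x] by (simp add: r_def)
    next
      fix x assume "x \<in> ZC" "k = (1, x)"
      then show ?thesis using r2(1)[of x] by (auto simp: r_def gQ elim!: eventually_mono)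
    qed
  qed
  define a where "a = (\<lambda>(k::nat, x). if k = 0 then x - l i z else 0)"
  define c where "c = (\<lambda>(k::nat, x::complex). x)"
  have lil: "((\<lambda>p. l i p) \<longlongrightarrow> l i z) (at z)" by (rule tendsto_l[OF tendsto_ident_at])
  have dist: "\<forall>k\<in>J. \<forall>k'\<in>J. k \<noteq> k' \<longrightarrow> (\<forall>\<^sub>F p in at z. r k p \<noteq> r k' p)"
  proof (rule two_scale_distinct[where b = "\<lambda>p. l i p" and h = "\<lambda>p. p - z" and a = a and c = c])
    show "\<forall>k\<in>J. ((\<lambda>p. r k p - l i p) \<longlongrightarrow> a k) (at z)"
    proof
      fix k assume "k \<in> J"
      then show "((\<lambda>p. r k p - l i p) \<longlongrightarrow> a k) (at z)"
      proof (elim Jcases[THEN disjE] bexE)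
        fix x assume "x \<in> Z" "k = (0, x)"
        then show ?thesis using tendsto_diff[OF r1(2)[of x] lil] by (simp add: r_def a_def)
      next
        fix x assume "x \<in> ZC" "k = (1, x)"
        then show ?thesis using tendsto_mult[OF \<tau>0 r2(2)[of x]] by (simp add: r_def a_def)
      qed
    qed
    show "\<forall>k\<in>J. a k = 0 \<longrightarrow> ((\<lambda>p. (r k p - l i p) / (p - z)) \<longlongrightarrow> c k) (at z)"
    proof (intro ballI impI)
      fix k assume "k \<in> J" and ak: "a k = 0"
      then show "((\<lambda>p. (r k p - l i p) / (p - z)) \<longlongrightarrow> c k) (at z)"
      proof (elim Jcases[THEN disjE] bexE)
        fix x assume "x \<in> Z" "k = (0, x)"
        then show ?thesis using ak node[of x i] i by (simp add: a_def)
      next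
        fix x assume x: "x \<in> ZC" and k: "k = (1, x)"
        have "\<forall>\<^sub>F p in at z. r2 x p = (r k p - l i p) / (p - z)"
          using ne by eventually_elim (simp add: k r_def)
        then have "((\<lambda>p. (r k p - l i p) / (p - z)) \<longlongrightarrow> x) (at z)" by (rule Lim_transform_eventually[OF r2(2)[OF x]])
        then show ?thesis by (simp add: c_def k)
      qed
    qed
    show "\<forall>k\<in>J. \<forall>k'\<in>J. k \<noteq> k' \<longrightarrow> a k \<noteq> a k' \<or> (a k = 0 \<and> a k' = 0 \<and> c k \<noteq> c k')"
      using node[OF _ i] unfolding J_def a_def c_def by (auto simp: split_beta)
  qed
  define W where "W = ff z ` Z"
  have finW: "finite W" unfolding W_def using finZ by simp
  have limrest: "((\<lambda>p. \<Sum>k\<in>I. tm k p (l i p + h p - l k p)) \<longlongrightarrow> (\<Sum>k\<in>I. tm k z (l i z - l k z))) (at z)"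
    if "(h \<longlongrightarrow> 0) (at z)" for h
  proof (rule tendsto_sum)
    fix k assume k: "k \<in> I"
    have "((\<lambda>p. l i p + h p - l k p) \<longlongrightarrow> l i z + 0 - l k z) (at z)"
      by (intro tendsto_intros tendsto_l that)
    then have "((\<lambda>p. l i p + h p - l k p) \<longlongrightarrow> l i z - l k z) (at z)" by simp
    then show "((\<lambda>p. tm k p (l i p + h p - l k p)) \<longlongrightarrow> tm k z (l i z - l k z)) (at z)"
      by (rule tendsto_tm[OF tendsto_ident_at]) (use lz[of i k] i k inj in \<open>auto simp: I_def doubleton_eq_iff\<close>)
  qed
  have ff2: "ff p q = p - tm i p (q - l i p) - tm j p (q - l j p) - (\<Sum>k\<in>I. tm k p (q - l k p))" for p q
    unfolding ff_split[OF i] I_def using j inj by (subst sum.remove[of "{..<n} - {i}" j]) auto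
  have main: "order z R + 9 = order z E"
    if w: "w \<notin> W" and RE: "\<forall>p. poly R p = RR w p" "R \<noteq> 0" "\<forall>p. poly E p = EE p" "E \<noteq> 0" for w R E
  proof -
    define L where "L = (\<lambda>(k::nat, x). if k = 0 then w - ff z x else - (Si * (la i * Si)) / x ^ 3 + - (Sj * (la j * Sj)) / (x + \<delta>) ^ 3)"
    have lim: "\<forall>k\<in>J. ((\<lambda>p. (w - ff p (r k p)) * e k p) \<longlongrightarrow> L k) (at z)"
    proof
      fix k assume "k \<in> J"
      then show "((\<lambda>p. (w - ff p (r k p)) * e k p) \<longlongrightarrow> L k) (at z)"
      proof (elim Jcases[THEN disjE] bexE)
        fix x assume x: "x \<in> Z" and k: "k = (0, x)"
        have "((\<lambda>p. w - ff p (r1 x p)) \<longlongrightarrow> w - ff z x) (at z)"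
          by (intro tendsto_diff tendsto_const tendsto_ff tendsto_ident_at r1(2) x node) auto
        then show ?thesis by (simp add: k r_def e_def L_def)
      next
        fix x assume x: "x \<in> ZC" and k: "k = (1, x)"
        have h3: "((\<lambda>p. (p - z) * r2 x p) \<longlongrightarrow> 0) (at z)" using tendsto_mult[OF \<tau>0 r2(2)[OF x]] by simp
        let ?F = "\<lambda>p. (p - z) ^ 3 * (w - p) + (v i * ((p - z) * r2 x p) - s i p) * (be i * ((p - z) * r2 x p) + la i * s i p) / r2 x p ^ 3
            + (v j * ((p - z) * (r2 x p + \<delta>)) - s j p) * (be j * ((p - z) * (r2 x p + \<delta>)) + la j * s j p) / (r2 x p + \<delta>) ^ 3
            + (p - z) ^ 3 * (\<Sum>k\<in>I. tm k p (l i p + (p - z) * r2 x p - l k p))"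
        have "(?F \<longlongrightarrow> 0 ^ 3 * (w - z) + (v i * (0 * x) - s i z) * (be i * (0 * x) + la i * s i z) / x ^ 3
            + (v j * (0 * (x + \<delta>)) - s j z) * (be j * (0 * (x + \<delta>)) + la j * s j z) / (x + \<delta>) ^ 3
            + 0 ^ 3 * (\<Sum>k\<in>I. tm k z (l i z - l k z))) (at z)"
          using ZC0[OF x]
          by (intro tendsto_add tendsto_mult tendsto_divide tendsto_power tendsto_diff tendsto_const tendsto_ident_at tsi \<tau>0 r2(2) x limrest h3) auto
        then have lim3: "(?F \<longlongrightarrow> L k) (at z)" by (simp add: L_def k Si_def Sj_def)
        have "\<forall>\<^sub>F p in at z. ?F p = (w - ff p (r k p)) * e k p"
          using ne
        proof eventually_elim
          case (elim p)
          have d: "l i p + (p - z) * r2 x p - l i p = (p - z) * r2 x p" "l i p + (p - z) * r2 x p - l j p = (p - z) * (r2 x p + \<delta>)"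
            using lij[of p] by (simp_all add: algebra_simps)
          have t: "(p - z) ^ 3 * tm k p ((p - z) * y) = (v k * ((p - z) * y) - s k p) * (be k * ((p - z) * y) + la k * s k p) / y ^ 3" for k y
            unfolding tm_def power_mult_distrib using elim by simp
          have "(w - ff p (r k p)) * e k p = (p - z) ^ 3 * (w - p) + (p - z) ^ 3 * tm i p ((p - z) * r2 x p)
              + (p - z) ^ 3 * tm j p ((p - z) * (r2 x p + \<delta>)) + (p - z) ^ 3 * (\<Sum>k\<in>I. tm k p (l i p + (p - z) * r2 x p - l k p))"
          proof -
            have rk: "r k p = l i p + (p - z) * r2 x p" and ek: "e k p = (p - z) ^ 3" by (simp_all add: k r_def e_def)
            have "(w - (p - A - B - S)) * T = T * (w - p) + T * A + T * B + T * S" for A B S T :: complex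
              by (simp add: algebra_simps)
            then show ?thesis unfolding rk ek ff2 d .
          qed
          then show ?case unfolding t by simp
        qed
        then show ?thesis by (rule Lim_transform_eventually[OF lim3])
      qed
    qed
    \<comment> \<open>The singular parts of the two cameras must not cancel: at a root x of
      \<open>C\<close> their sum is - Si^2 \<delta> / x^3, nonzero because \<open>la i\<close> and
      \<open>la j\<close> differ.\<close>
    have L: "\<forall>k\<in>J. L k \<noteq> 0"
    proof
      fix k assume "k \<in> J"
      then show "L k \<noteq> 0"
      proof (elim Jcases[THEN disjE] bexE)
        fix x assume "x \<in> Z" "k = (0, x)"
        then show ?thesis using w unfolding W_def L_def by auto
      next
        fix x assume x: "x \<in> ZC" and k: "k = (1, x)"
        have e: "Sj\<^sup>2 * x ^ 3 = - (Si\<^sup>2 * (x + \<delta>) ^ 3)" using x C[of x] unfolding ZC_def by (simp add: add_eq_0_iff)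
        have "L k * (x ^ 3 * (x + \<delta>) ^ 3) = - (Si * (la i * Si)) / x ^ 3 * (x ^ 3 * (x + \<delta>) ^ 3) + - (Sj * (la j * Sj)) / (x + \<delta>) ^ 3 * (x ^ 3 * (x + \<delta>) ^ 3)"
        proof -
          have "L k = - (Si * (la i * Si)) / x ^ 3 + - (Sj * (la j * Sj)) / (x + \<delta>) ^ 3" unfolding L_def k by simp
          then show ?thesis by (simp only: distrib_right)
        qed
        also have "\<dots> = - (Si\<^sup>2 * la i * (x + \<delta>) ^ 3) - la j * (Sj\<^sup>2 * x ^ 3)"
          using ZC0[OF x] by (simp add: power2_eq_square)
        also have "\<dots> = - (Si\<^sup>2 * \<delta> * (x + \<delta>) ^ 3)" unfolding e \<delta>_def by (simp add: algebra_simps)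
        finally show ?thesis using S0 \<delta>0 ZC0[OF x] by auto
      qed
    qed
    have "order z R + 9 = order z E + 0"
      by (rule order_at[OF spec[OF RE(1)] RE(2) spec[OF RE(3)] RE(4) finJ cardJ roots dist lim L prode])
    then show ?thesis by (simp only: add_0_right)
  qed
  have fiber: "w \<noteq> ff z q" if "w \<notin> W" "\<forall>k<n. q \<noteq> l k z" "poly (gp z) q = 0" for w q
    using that gpz[of q] i unfolding W_def Z_def by auto
  show ?thesis unfolding z_def[symmetric]
  proof (intro exI[of _ W] conjI finW allI impI; elim conjE)
    fix w R E assume "w \<notin> W" "\<forall>p. poly R p = RR w p" "R \<noteq> 0" "\<forall>p. poly E p = EE p" "E \<noteq> 0"
    then show "order z R + 9 = order z E" by (rule main)
  next
    fix w q assume "w \<notin> W" "\<forall>k<n. q \<noteq> l k z" "poly (gp z) q = 0"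
    then show "w \<noteq> ff z q" by (rule fiber)
  qed
qed

end

section \<open>Simple zeros of the norm for all but countably many w\<close>

lemma pfam_poly:
  assumes "pfam n F" "f \<in> poly_fun n"
  shows "(\<lambda>x. poly (F x) (f x)) \<in> poly_fun n"
proof -
  obtain D where "\<And>x. degree (F x) \<le> D" using assms unfolding pfam_def by blast
  then have "(\<lambda>x. poly (F x) (f x)) = (\<lambda>x. \<Sum>k\<le>D. coeff (F x) k * f x ^ k)"
    by (intro ext poly_altdef_le)
  also have "\<dots> \<in> poly_fun n" by (intro poly_fun_sum pmult poly_fun_power assms pfam_coeff)
  finally show ?thesis .
qed

lemma fsigma_ball: "fsigma (ball (z::complex) \<epsilon>)"
proof -
  have "ball z \<epsilon> = (\<Union>n::nat. cball z (\<epsilon> - inverse (Suc n)))"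
  proof (intro equalityI subsetI)
    fix x assume "x \<in> ball z \<epsilon>"
    then have "0 < \<epsilon> - dist z x" by simp
    from reals_Archimedean[OF this] obtain n where "inverse (Suc n) < \<epsilon> - dist z x" by blast
    then have "x \<in> cball z (\<epsilon> - inverse (Suc n))" by simp
    then show "x \<in> (\<Union>n::nat. cball z (\<epsilon> - inverse (Suc n)))" by blast
  next
    fix x assume "x \<in> (\<Union>n::nat. cball z (\<epsilon> - inverse (Suc n)))"
    then obtain n :: nat where n: "dist z x \<le> \<epsilon> - inverse (Suc n)" by auto
    have "inverse (real (Suc n)) > 0" by simp
    then show "x \<in> ball z \<epsilon>" using n unfolding mem_ball by linarith
  qed
  also have "fsigma \<dots>" by (rule fsigma.intros) (rule closed_cball)
  finally show ?thesis .
qed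

text \<open>A nonconstant derivative has countably many zeros. A constant one either has none or is
  0, and then the function has a single value.\<close>

lemma countable_critical_values:
  assumes "f holomorphic_on ball z \<epsilon>"
  shows "countable (f ` {x \<in> ball z \<epsilon>. deriv f x = 0})"
proof (cases "deriv f constant_on ball z \<epsilon>")
  case False
  have fs: "fsigma (ball z \<epsilon>)" by (rule fsigma_ball)
  have "countable {x \<in> ball z \<epsilon>. deriv f x = 0}"
    by (rule holomorphic_countable_zeros[OF holomorphic_deriv[OF assms open_ball] open_ball connected_ball fs False])
  then show ?thesis by (rule countable_image)
next
  case True
  then obtain c where c: "\<And>x. x \<in> ball z \<epsilon> \<Longrightarrow> deriv f x = c" unfolding constant_on_def by blast
  show ?thesis
  proof (cases "c = 0")
    case False
    then have "{x \<in> ball z \<epsilon>. deriv f x = 0} = {}" using c by auto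
    then show ?thesis by (simp only: image_empty countable_empty)
  next
    case True
    have "\<exists>b. \<forall>x\<in>ball z \<epsilon>. f x = b"
    proof (rule has_field_derivative_zero_constant)
      fix x assume x: "x \<in> ball z \<epsilon>"
      have "(f has_field_derivative deriv f x) (at x)" by (rule holomorphic_derivI[OF assms open_ball x])
      then show "(f has_field_derivative 0) (at x within ball z \<epsilon>)"
        using c[OF x] True by (simp add: has_field_derivative_at_within)
    qed simp
    then obtain b where "\<forall>x\<in>ball z \<epsilon>. f x = b" by blast
    then have "f ` {x \<in> ball z \<epsilon>. deriv f x = 0} \<subseteq> {b}" by auto
    then show ?thesis by (rule countable_subset) simp
  qed
qed

context gcams
begin

lemma holomorphic_ff:
  assumes "r holomorphic_on S" "\<And>x i. x \<in> S \<Longrightarrow> i < n \<Longrightarrow> r x \<noteq> l i x"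
  shows "(\<lambda>x. ff x (r x)) holomorphic_on S"
  unfolding ff_def tm_def s_def l_def
  by (intro holomorphic_intros assms(1)) (use assms(2) in \<open>auto simp: l_def\<close>)

definition good where "good p \<longleftrightarrow> nonsp p \<and> card {q. poly (gp p) q = 0} = 3 * n - 2"

lemma good_branches:
  assumes "good z"
  shows "\<exists>\<epsilon> r. \<epsilon> > 0 \<and> (\<forall>k\<in>{q. poly (gp z) q = 0}. (\<lambda>x. ff x (r k x)) holomorphic_on ball z \<epsilon>) \<and>
     (\<forall>p\<in>ball z \<epsilon>. inj_on (\<lambda>k. r k p) {q. poly (gp z) q = 0} \<and>
        {q. poly (gp p) q = 0} = (\<lambda>k. r k p) ` {q. poly (gp z) q = 0})"
proof -
  have ns: "nonsp z" and card: "card {q. poly (gp z) q = 0} = 3 * n - 2" using assms unfolding good_def by auto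
  have op: "open (- Sp)" using finite_Sp by (intro open_Compl finite_imp_closed)
  have zS: "z \<in> - Sp" using ns nonsp_iff by simp
  from holomorphic_branches[OF gp_pfam degree_gp gp_nz[OF ns] card op zS]
  obtain \<epsilon> r where e: "\<epsilon> > 0" "ball z \<epsilon> \<subseteq> - Sp" "\<forall>k. poly (gp z) k = 0 \<longrightarrow> r k holomorphic_on ball z \<epsilon>"
    "\<forall>p\<in>ball z \<epsilon>. gp p \<noteq> 0 \<and> inj_on (\<lambda>k. r k p) {q. poly (gp z) q = 0} \<and>
        {q. poly (gp p) q = 0} = (\<lambda>k. r k p) ` {q. poly (gp z) q = 0}" by blast
  have "(\<lambda>x. ff x (r k x)) holomorphic_on ball z \<epsilon>" if k: "k \<in> {q. poly (gp z) q = 0}" for k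
  proof (rule holomorphic_ff)
    show "r k holomorphic_on ball z \<epsilon>" using e(3) k by blast
    fix x i assume x: "x \<in> ball z \<epsilon>" and i: "i < n"
    have "nonsp x" using e(2) x nonsp_iff by auto
    moreover have "poly (gp x) (r k x) = 0" using e(4) x k by blast
    ultimately show "r k x \<noteq> l i x" using gp_node[of x i] i by auto
  qed
  then show ?thesis using e(1,4) by blast
qed

text \<open>By Lindelof countably many discs carrying holomorphic branches cover the good points;
  \<open>W\<close> collects the critical values of \<open>ff\<close> along all these branches. For w
  outside \<open>W\<close> every branch that meets w does so with nonzero derivative, so the order
  counts the branches.\<close>

lemma order_good:
  "\<exists>W. countable W \<and> (\<forall>w z R E. w \<notin> W \<and> good z \<and> (\<forall>p. poly R p = RR w p) \<and> R \<noteq> 0 \<and> (\<forall>p. poly E p = EE p) \<and> E \<noteq> 0 \<longrightarrow>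
      order z R = order z E + card {q. poly (gp z) q = 0 \<and> ff z q = w})"
proof -
  define rts where "rts = (\<lambda>p. {q. poly (gp p) q = 0})"
  have "\<forall>z\<in>Collect good. \<exists>er. fst er > 0 \<and> (\<forall>k\<in>rts z. (\<lambda>x. ff x (snd er k x)) holomorphic_on ball z (fst er)) \<and>
     (\<forall>p\<in>ball z (fst er). inj_on (\<lambda>k. snd er k p) (rts z) \<and> rts p = (\<lambda>k. snd er k p) ` rts z)"
  proof
    fix z assume "z \<in> Collect good"
    then obtain \<epsilon> r where er: "\<epsilon> > 0 \<and> (\<forall>k\<in>rts z. (\<lambda>x. ff x (r k x)) holomorphic_on ball z \<epsilon>) \<and>
     (\<forall>p\<in>ball z \<epsilon>. inj_on (\<lambda>k. r k p) (rts z) \<and> rts p = (\<lambda>k. r k p) ` rts z)"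
      using good_branches[of z] unfolding rts_def by blast
    show "\<exists>er. fst er > 0 \<and> (\<forall>k\<in>rts z. (\<lambda>x. ff x (snd er k x)) holomorphic_on ball z (fst er)) \<and>
     (\<forall>p\<in>ball z (fst er). inj_on (\<lambda>k. snd er k p) (rts z) \<and> rts p = (\<lambda>k. snd er k p) ` rts z)"
      by (rule exI[of _ "(\<epsilon>, r)"]) (unfold fst_conv snd_conv, rule er)
  qed
  then obtain er where er: "\<forall>z\<in>Collect good. fst (er z) > 0 \<and> (\<forall>k\<in>rts z. (\<lambda>x. ff x (snd (er z) k x)) holomorphic_on ball z (fst (er z))) \<and>
     (\<forall>p\<in>ball z (fst (er z)). inj_on (\<lambda>k. snd (er z) k p) (rts z) \<and> rts p = (\<lambda>k. snd (er z) k p) ` rts z)"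
    by (rule bchoice[THEN exE])
  define eps where "eps = (\<lambda>z. fst (er z))"
  define rr where "rr = (\<lambda>z. snd (er z))"
  have e0: "eps z > 0" if "good z" for z using er that unfolding eps_def by blast
  have hol: "(\<lambda>x. ff x (rr z k x)) holomorphic_on ball z (eps z)" if "good z" "k \<in> rts z" for z k
    using er that unfolding eps_def rr_def by blast
  have inj: "inj_on (\<lambda>k. rr z k p) (rts z)" "rts p = (\<lambda>k. rr z k p) ` rts z" if "good z" "p \<in> ball z (eps z)" for z p
    using er that unfolding eps_def rr_def by blast+
  obtain \<F> where F: "\<F> \<subseteq> (\<lambda>z. ball z (eps z)) ` Collect good" "countable \<F>"
    "\<Union>\<F> = \<Union>((\<lambda>z. ball z (eps z)) ` Collect good)"
    using Lindelof[of "(\<lambda>z. ball z (eps z)) ` Collect good"] by (metis (no_types, lifting) imageE open_ball)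
  then obtain P where P: "countable P" "P \<subseteq> Collect good" "\<F> = (\<lambda>z. ball z (eps z)) ` P"
    using countable_subset_image[of \<F> "\<lambda>z. ball z (eps z)" "Collect good"] by auto
  define W where "W = (\<Union>z\<in>P. \<Union>k\<in>rts z. (\<lambda>x. ff x (rr z k x)) ` {x \<in> ball z (eps z). deriv (\<lambda>x. ff x (rr z k x)) x = 0})"
  have fin: "finite (rts z)" if "good z" for z
    unfolding rts_def using that gp_nz by (intro poly_roots_finite) (simp add: good_def)
  have "countable W"
    unfolding W_def
  proof (intro countable_UN P(1))
    fix z k assume zk: "z \<in> P" "k \<in> rts z"
    then have "good z" using P(2) by blast
    then show "countable ((\<lambda>x. ff x (rr z k x)) ` {x \<in> ball z (eps z). deriv (\<lambda>x. ff x (rr z k x)) x = 0})"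
      by (intro countable_critical_values hol zk)
  next
    fix z assume "z \<in> P"
    then show "countable (rts z)" using fin P(2) countable_finite by blast
  qed
  moreover have main: "order z1 R = order z1 E + card {q. poly (gp z1) q = 0 \<and> ff z1 q = w}"
    if w: "w \<notin> W" and z1: "good z1" and RE: "\<forall>p. poly R p = RR w p" "R \<noteq> 0" "\<forall>p. poly E p = EE p" "E \<noteq> 0" for w z1 R E
  proof -
    have "z1 \<in> ball z1 (eps z1)" using e0[OF z1] by simp
    then have "z1 \<in> \<Union>\<F>" using F(3) z1 by blast
    then obtain z where z: "z \<in> P" "z1 \<in> ball z (eps z)" unfolding P(3) by blast
    have gz: "good z" using z(1) P(2) by blast
    define J where "J = rts z"
    define g where "g = (\<lambda>k x. ff x (rr z k x))"
    \<comment> \<open>A branch with value w at \<open>z1\<close> is divided by p - z1, which leaves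
      minus its derivative in the limit.\<close>
    define e where "e = (\<lambda>k p. if g k z1 = w then 1 / (p - z1) else 1)"
    define L where "L = (\<lambda>k. if g k z1 = w then - deriv (g k) z1 else w - g k z1)"
    have finJ: "finite J" unfolding J_def by (rule fin[OF gz])
    have cardJ: "card J = 3 * n - 2" using gz unfolding J_def rts_def good_def by blast
    have ev: "\<forall>\<^sub>F p in at z1. p \<in> ball z (eps z)"
      using z(2) by (intro eventually_at_in_open') auto
    have dg: "(g k has_field_derivative deriv (g k) z1) (at z1)" if "k \<in> J" for k
      unfolding g_def by (rule holomorphic_derivI[OF hol open_ball z(2)]) (use gz that in \<open>simp_all add: J_def\<close>)
    have roots: "\<forall>k\<in>J. \<forall>\<^sub>F p in at z1. poly (gp p) (rr z k p) = 0"
    proof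
      fix k assume k: "k \<in> J"
      show "\<forall>\<^sub>F p in at z1. poly (gp p) (rr z k p) = 0"
        using ev
      proof eventually_elim
        case (elim p)
        have "rr z k p \<in> rts p" using inj(2)[OF gz elim] k unfolding J_def by blast
        then show ?case unfolding rts_def by simp
      qed
    qed
    have dist: "\<forall>k\<in>J. \<forall>k'\<in>J. k \<noteq> k' \<longrightarrow> (\<forall>\<^sub>F p in at z1. rr z k p \<noteq> rr z k' p)"
    proof (intro ballI impI)
      fix k k' assume k: "k \<in> J" "k' \<in> J" "k \<noteq> k'"
      show "\<forall>\<^sub>F p in at z1. rr z k p \<noteq> rr z k' p"
        using ev
      proof eventually_elim
        case (elim p)
        show ?case using inj(1)[OF gz elim] k unfolding J_def inj_on_def by blast
      qed
    qed
    have lim: "\<forall>k\<in>J. ((\<lambda>p. (w - ff p (rr z k p)) * e k p) \<longlongrightarrow> L k) (at z1)"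
    proof
      fix k assume k: "k \<in> J"
      show "((\<lambda>p. (w - ff p (rr z k p)) * e k p) \<longlongrightarrow> L k) (at z1)"
      proof (cases "g k z1 = w")
        case True
        have "((\<lambda>p. - ((g k p - g k z1) / (p - z1))) \<longlongrightarrow> - deriv (g k) z1) (at z1)"
          using dg[OF k] unfolding has_field_derivative_iff by (rule tendsto_minus)
        moreover have "- ((g k p - g k z1) / (p - z1)) = (w - ff p (rr z k p)) * e k p" for p
          using True unfolding e_def g_def by (simp add: diff_divide_distrib)
        ultimately show ?thesis using True unfolding L_def by simp
      next
        case False
        have "isCont (g k) z1" using dg[OF k] by (rule DERIV_isCont)
        then have "((\<lambda>p. w - g k p) \<longlongrightarrow> w - g k z1) (at z1)"
          unfolding isCont_def by (intro tendsto_diff tendsto_const)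
        then show ?thesis using False unfolding L_def e_def g_def by simp
      qed
    qed
    have L: "\<forall>k\<in>J. L k \<noteq> 0"
    proof
      fix k assume k: "k \<in> J"
      show "L k \<noteq> 0"
      proof (cases "g k z1 = w")
        case True
        have "deriv (g k) z1 \<noteq> 0"
        proof
          assume d: "deriv (g k) z1 = 0"
          have "w \<in> (\<lambda>x. ff x (rr z k x)) ` {x \<in> ball z (eps z). deriv (\<lambda>x. ff x (rr z k x)) x = 0}"
            by (rule image_eqI[of _ _ z1]) (use True d z(2) in \<open>simp_all add: g_def\<close>)
          then have "w \<in> W" unfolding W_def using z(1) k unfolding J_def by blast
          then show False using w by blast
        qed
        then show ?thesis using True unfolding L_def by simp
      qed (simp add: L_def)
    qed
    define m where "m = card {k\<in>J. g k z1 = w}"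
    have prode: "(\<Prod>k\<in>J. e k p) = (p - z1) ^ 0 / (p - z1) ^ m" for p
    proof -
      have "(\<Prod>k\<in>J. e k p) = (\<Prod>k\<in>{k\<in>J. g k z1 = w}. e k p)"
        by (rule prod.mono_neutral_right[OF finJ]) (auto simp: e_def)
      also have "\<dots> = (\<Prod>k\<in>{k\<in>J. g k z1 = w}. 1 / (p - z1))" by (rule prod.cong) (auto simp: e_def)
      finally show ?thesis unfolding m_def by (simp add: power_one_over)
    qed
    have o: "order z1 R + 0 = order z1 E + m"
      by (rule order_at[OF spec[OF RE(1)] RE(2) spec[OF RE(3)] RE(4) finJ cardJ roots dist lim L prode])
    have m: "m = card {q. poly (gp z1) q = 0 \<and> ff z1 q = w}"
    proof -
      have "{q. poly (gp z1) q = 0 \<and> ff z1 q = w} = (\<lambda>k. rr z k z1) ` {k\<in>J. g k z1 = w}"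
        using inj(2)[OF gz z(2)] unfolding rts_def J_def g_def by auto
      moreover have "inj_on (\<lambda>k. rr z k z1) {k\<in>J. g k z1 = w}"
        using inj(1)[OF gz z(2)] unfolding J_def by (rule inj_on_subset) auto
      ultimately show ?thesis unfolding m_def by (simp add: card_image)
    qed
    show ?thesis using o unfolding m add_0_right .
  qed
  ultimately show ?thesis
  proof (intro exI[of _ W] conjI allI impI; (elim conjE)?)
    fix w z R E assume "w \<notin> W" "good z" "\<forall>p. poly R p = RR w p" "R \<noteq> 0" "\<forall>p. poly E p = EE p" "E \<noteq> 0"
    then show "order z R = order z E + card {q. poly (gp z) q = 0 \<and> ff z q = w}" by (rule main)
  qed
qed

lemma finite_not_good: "finite {p. nonsp p \<and> \<not> good p}"
proof -
  obtain p where "nonsp p" "card {q. poly (gp p) q = 0} = 3 * n - 2" using good_and_RR_nz by blast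
  then have "zgen 1 (\<lambda>x. gp (x 0) \<noteq> 0 \<and> 3 * n - 2 \<le> card {q. poly (gp (x 0)) q = 0})"
    by (intro zgen_card_roots[where z = "\<lambda>_. p"] gp_pfam gp_nz) simp_all
  from zgen_1_finite[OF this] show ?thesis
  proof (rule rev_finite_subset, safe)
    fix x assume x: "nonsp x" "\<not> good x" "3 * n - 2 \<le> card {q. poly (gp x) q = 0}"
    have "card {q. poly (gp x) q = 0} \<le> 3 * n - 2"
      using card_poly_roots_bound[OF gp_nz[OF x(1)]] degree_gp[of x] by linarith
    then show False using x unfolding good_def by simp
  qed
qed

lemma smult_conv_mult: "Polynomial.smult c p = [:c:] * p"
  by simp

lemma hp_pfam: "pfam 1 (\<lambda>x. hp w (x 0))"
  unfolding hp_def s_def l_def smult_conv_mult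
  by (intro pfam_add pfam_mult pfam_scalar pfam_prod pfam_power pfam_Nf pfam_linear poly_fun_intros) auto

lemma RR_poly: "\<exists>R. \<forall>p. poly R p = RR w p"
proof -
  have "(\<lambda>x. RR w (x 0)) \<in> poly_fun 1" unfolding RR_def by (intro res_poly_fun gp_pfam hp_pfam)
  from poly_fun_1_poly[OF this] obtain R where R: "\<forall>x::nat \<Rightarrow> complex. poly R (x 0) = RR w (x 0)" by blast
  then show ?thesis using R[rule_format, of "\<lambda>_. p" for p] by blast
qed

lemma EE_poly: "\<exists>E. \<forall>p. poly E p = EE p"
proof -
  have "(\<lambda>x. EE (x 0)) \<in> poly_fun 1" unfolding EE_def l_def
    by (intro poly_fun_prod poly_fun_power pfam_poly gp_pfam poly_fun_intros) auto
  from poly_fun_1_poly[OF this] obtain R where R: "\<forall>x::nat \<Rightarrow> complex. poly R (x 0) = EE (x 0)" by blast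
  then show ?thesis using R[rule_format, of "\<lambda>_. p" for p] by blast
qed

lemma coeff_hp: "coeff (hp w p) (3 * n) = w - p"
proof -
  have "degree (Nf {..<n} (\<lambda>i. [:- (v i * l i p) - s i p, v i:] * [:la i * s i p - be i * l i p, be i:]) (\<lambda>i. [:- l i p, 1:])) \<le> 2 + 3 * (card {..<n} - 1)"
  proof (rule degree_Nf)
    fix i
    have "degree [:- (v i * l i p) - s i p, v i:] \<le> 1" "degree [:la i * s i p - be i * l i p, be i:] \<le> 1" by auto
    then show "degree ([:- (v i * l i p) - s i p, v i:] * [:la i * s i p - be i * l i p, be i:]) \<le> 2"
      using degree_mult_le[of "[:- (v i * l i p) - s i p, v i:]" "[:la i * s i p - be i * l i p, be i:]"] by linarith
  qed auto
  then have "degree (Nf {..<n} (\<lambda>i. [:- (v i * l i p) - s i p, v i:] * [:la i * s i p - be i * l i p, be i:]) (\<lambda>i. [:- l i p, 1:])) < 3 * n"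
    using n2 unfolding card_lessThan by linarith
  then show ?thesis
    using conjunct2[OF coeff_prod_monic[of "{..<n}" "\<lambda>i. l i p"]] unfolding hp_def by (simp add: coeff_eq_0)
qed

text \<open>The coefficient of \<open>hp\<close> in its formal degree 3n is w - p; together with w
  \<noteq> p this excludes a common zero at infinity.\<close>

lemma RR_nz:
  assumes "nonsp p" "w \<noteq> p" "\<And>q. poly (gp p) q = 0 \<Longrightarrow> w \<noteq> ff p q"
  shows "RR w p \<noteq> 0"
proof
  assume "RR w p = 0"
  then have "\<exists>q. poly (gp p) q = 0 \<and> poly (hp w p) q = 0"
    unfolding RR_def by (intro res_eq_0_imp_root[OF degree_gp degree_hp]) (use assms(2) coeff_hp in auto)
  then obtain q where q: "poly (gp p) q = 0" "poly (hp w p) q = 0" by blast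
  have ql: "q \<noteq> l i p" if "i < n" for i using gp_node[OF assms(1) that] q by auto
  have "w - ff p q \<noteq> 0" using assms(3)[OF q(1)] by simp
  then show False using poly_hp[of q p w] ql q(2) by simp
qed

lemma sols_fiber:
  "(p, q) \<in> sols w \<longleftrightarrow> (\<forall>i<n. q \<noteq> l i p) \<and> poly (gp p) q = 0 \<and> ff p q = w"
  using poly_hp[of q p w] unfolding sols_def by auto

text \<open>A degree count. R exceeds E by 3n - 2 in degree; all zeros of E are special points,
  where the orders of R fall short of those of E by 1 or 9; at every other point the order of R is
  the number of solutions above it.\<close>

theorem card_sols:
  "\<exists>W. countable W \<and> (\<forall>w. w \<notin> W \<longrightarrow> finite (sols w) \<and>
     card (sols w) = 3 * n - 2 + n + 9 * card {(i,j). i < j \<and> j < n})"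
proof -
  define Pr where "Pr = {(i,j). i < j \<and> j < n}"
  obtain W1 where W1: "\<forall>i\<in>{..<n}. finite (W1 i) \<and> (\<forall>w. w \<notin> W1 i \<longrightarrow>
     (\<forall>R E. (\<forall>p. poly R p = RR w p) \<and> R \<noteq> 0 \<and> (\<forall>p. poly E p = EE p) \<and> E \<noteq> 0 \<longrightarrow> order (pc i) R + 1 = order (pc i) E) \<and>
     (\<forall>q. (\<forall>j<n. q \<noteq> l j (pc i)) \<and> poly (gp (pc i)) q = 0 \<longrightarrow> w \<noteq> ff (pc i) q))"
    using bchoice[of "{..<n}"] order_pc by (metis (no_types, lifting) lessThan_iff)
  obtain W2 where W2: "\<forall>ij\<in>Pr. finite (W2 ij) \<and> (\<forall>w. w \<notin> W2 ij \<longrightarrow>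
     (\<forall>R E. (\<forall>p. poly R p = RR w p) \<and> R \<noteq> 0 \<and> (\<forall>p. poly E p = EE p) \<and> E \<noteq> 0 \<longrightarrow> order (pl (fst ij) (snd ij)) R + 9 = order (pl (fst ij) (snd ij)) E) \<and>
     (\<forall>q. (\<forall>k<n. q \<noteq> l k (pl (fst ij) (snd ij))) \<and> poly (gp (pl (fst ij) (snd ij))) q = 0 \<longrightarrow> w \<noteq> ff (pl (fst ij) (snd ij)) q))"
  proof -
    have "\<forall>ij\<in>Pr. \<exists>W. finite W \<and> (\<forall>w. w \<notin> W \<longrightarrow>
     (\<forall>R E. (\<forall>p. poly R p = RR w p) \<and> R \<noteq> 0 \<and> (\<forall>p. poly E p = EE p) \<and> E \<noteq> 0 \<longrightarrow> order (pl (fst ij) (snd ij)) R + 9 = order (pl (fst ij) (snd ij)) E) \<and>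
     (\<forall>q. (\<forall>k<n. q \<noteq> l k (pl (fst ij) (snd ij))) \<and> poly (gp (pl (fst ij) (snd ij))) q = 0 \<longrightarrow> w \<noteq> ff (pl (fst ij) (snd ij)) q))"
    proof
      fix ij assume ij: "ij \<in> Pr"
      show "\<exists>W. finite W \<and> (\<forall>w. w \<notin> W \<longrightarrow>
     (\<forall>R E. (\<forall>p. poly R p = RR w p) \<and> R \<noteq> 0 \<and> (\<forall>p. poly E p = EE p) \<and> E \<noteq> 0 \<longrightarrow> order (pl (fst ij) (snd ij)) R + 9 = order (pl (fst ij) (snd ij)) E) \<and>
     (\<forall>q. (\<forall>k<n. q \<noteq> l k (pl (fst ij) (snd ij))) \<and> poly (gp (pl (fst ij) (snd ij))) q = 0 \<longrightarrow> w \<noteq> ff (pl (fst ij) (snd ij)) q))"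
        by (rule order_pl) (use ij in \<open>auto simp: Pr_def\<close>)
    qed
    from bchoice[OF this] show ?thesis by (elim exE) (rule that)
  qed
  obtain W3 where W3: "countable W3" "\<forall>w z R E. w \<notin> W3 \<and> good z \<and> (\<forall>p. poly R p = RR w p) \<and> R \<noteq> 0 \<and> (\<forall>p. poly E p = EE p) \<and> E \<noteq> 0 \<longrightarrow>
      order z R = order z E + card {q. poly (gp z) q = 0 \<and> ff z q = w}" using order_good by blast
  \<comment> \<open>Over the finitely many nonspecial p at which \<open>gp p\<close> lacks some of
    its 3n - 2 distinct roots, no solution is permitted; inserting p itself makes
    \<open>RR_nz\<close> applicable.\<close>
  define W4 where "W4 = (\<Union>p\<in>{p. nonsp p \<and> \<not> good p}. insert p (ff p ` {q. poly (gp p) q = 0}))"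
  have finPr: "finite Pr" unfolding Pr_def by (rule finite_pairs)
  have finW4: "finite W4" unfolding W4_def
    by (intro finite_UN_I finite_not_good finite.insertI finite_imageI poly_roots_finite gp_nz) auto
  define W where "W = (\<Union>i\<in>{..<n}. W1 i) \<union> (\<Union>ij\<in>Pr. W2 ij) \<union> W3 \<union> W4"
  have "countable W" unfolding W_def
    using W1 W2 W3(1) finW4 finPr by (intro countable_Un countable_UN) (auto intro: countable_finite)
  moreover have "finite (sols w) \<and> card (sols w) = 3 * n - 2 + n + 9 * card Pr" if w: "w \<notin> W" for w
  proof -
    have w1: "w \<notin> W1 i" if "i < n" for i using w that unfolding W_def by blast
    have w2: "w \<notin> W2 ij" if "ij \<in> Pr" for ij using w that unfolding W_def by blast
    have w3: "w \<notin> W3" and w4: "w \<notin> W4" using w unfolding W_def by blast+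
    obtain R where R: "\<forall>p. poly R p = RR w p" using RR_poly by blast
    obtain E where E: "\<forall>p. poly E p = EE p" using EE_poly by blast
    obtain p0 where p0: "RR w p0 \<noteq> 0" "EE p0 \<noteq> 0" using good_and_RR_nz[of w] by blast
    have R0: "R \<noteq> 0" and E0: "E \<noteq> 0" using p0 R E by auto
    have Ens: "order p E = 0" if "nonsp p" for p
    proof -
      have "EE p \<noteq> 0" unfolding EE_def using gp_node[OF that] by auto
      then show ?thesis using E by (intro order_0I) simp
    qed
    define m where "m = (\<lambda>p. card {q. (p, q) \<in> sols w})"
    have fib: "{q. (p, q) \<in> sols w} = {q. poly (gp p) q = 0 \<and> ff p q = w}" if "nonsp p" for p
      unfolding sols_fiber using gp_node[OF that] by auto
    have nsp: "order p R = m p" if p: "nonsp p" for p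
    proof (cases "good p")
      case True
      then have "order p R = order p E + card {q. poly (gp p) q = 0 \<and> ff p q = w}"
        using W3(2) w3 R R0 E E0 by blast
      then show ?thesis unfolding m_def fib[OF p] using Ens[OF p] by simp
    next
      case False
      then have wp: "w \<noteq> p" "\<And>q. poly (gp p) q = 0 \<Longrightarrow> w \<noteq> ff p q" using w4 p unfolding W4_def by blast+
      have "RR w p \<noteq> 0" by (rule RR_nz[OF p wp])
      then have "order p R = 0" using R by (intro order_0I) simp
      moreover have "{q. (p, q) \<in> sols w} = {}" unfolding fib[OF p] using wp(2) by blast
      ultimately show ?thesis unfolding m_def by simp
    qed
    have spc: "order (pc i) R + 1 = order (pc i) E \<and> (\<forall>q. (pc i, q) \<notin> sols w)" if i: "i < n" for i
    proof -
      from i have "i \<in> {..<n}" by simp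
      from W1[rule_format, OF this] w1[OF i] have "\<forall>R E. (\<forall>p. poly R p = RR w p) \<and> R \<noteq> 0 \<and> (\<forall>p. poly E p = EE p) \<and> E \<noteq> 0 \<longrightarrow> order (pc i) R + 1 = order (pc i) E"
        and *: "\<forall>q. (\<forall>j<n. q \<noteq> l j (pc i)) \<and> poly (gp (pc i)) q = 0 \<longrightarrow> w \<noteq> ff (pc i) q" by blast+
      then have "order (pc i) R + 1 = order (pc i) E" using R R0 E E0 by blast
      moreover have "(pc i, q) \<notin> sols w" for q using * unfolding sols_fiber by blast
      ultimately show ?thesis by blast
    qed
    have spl: "order (pl i j) R + 9 = order (pl i j) E \<and> (\<forall>q. (pl i j, q) \<notin> sols w)" if ij: "(i, j) \<in> Pr" for i j
    proof -
      from W2[rule_format, OF ij] w2[OF ij] have "\<forall>R E. (\<forall>p. poly R p = RR w p) \<and> R \<noteq> 0 \<and> (\<forall>p. poly E p = EE p) \<and> E \<noteq> 0 \<longrightarrow> order (pl i j) R + 9 = order (pl i j) E"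
        and *: "\<forall>q. (\<forall>k<n. q \<noteq> l k (pl i j)) \<and> poly (gp (pl i j)) q = 0 \<longrightarrow> w \<noteq> ff (pl i j) q"
        unfolding fst_conv snd_conv by blast+
      then have "order (pl i j) R + 9 = order (pl i j) E" using R R0 E E0 by blast
      moreover have "(pl i j, q) \<notin> sols w" for q using * unfolding sols_fiber by blast
      ultimately show ?thesis by blast
    qed
    have fibSp: "{q. (p, q) \<in> sols w} = {}" if "p \<in> Sp" for p
      using that spc spl unfolding Sp_def Pr_def by auto
    define S where "S = {p. poly R p = 0} - Sp"
    have finR: "finite {p. poly R p = 0}" using R0 by (rule poly_roots_finite)
    have finS: "finite S" unfolding S_def using finR by simp
    have sub: "p \<in> S" if "(p, q) \<in> sols w" for p q
    proof -
      have "p \<notin> Sp" using that fibSp by auto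
      then have ns: "nonsp p" using nonsp_iff by simp
      have "finite {q. (p, q) \<in> sols w}" unfolding fib[OF ns]
        by (rule finite_subset[OF _ poly_roots_finite[OF gp_nz[OF ns]]]) auto
      then have "m p \<noteq> 0" unfolding m_def using that by (simp add: card_eq_0_iff) blast
      then have "poly R p = 0" using nsp[OF ns] R0 by (simp add: order_root)
      then show ?thesis unfolding S_def using \<open>p \<notin> Sp\<close> by simp
    qed
    have solsS: "sols w = Sigma S (\<lambda>p. {q. (p, q) \<in> sols w})" using sub by auto
    have finF: "finite {q. (p, q) \<in> sols w}" if "p \<in> S" for p
    proof -
      have ns: "nonsp p" using that unfolding S_def nonsp_iff by blast
      show ?thesis unfolding fib[OF ns]
        by (rule finite_subset[OF _ poly_roots_finite[OF gp_nz[OF ns]]]) auto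
    qed
    have fin: "finite (sols w)" by (subst solsS) (intro finite_SigmaI finS finF)
    have "card (sols w) = (\<Sum>p\<in>S. m p)"
      by (subst solsS) (simp add: card_SigmaI finS finF m_def)
    also have "\<dots> = (\<Sum>p\<in>S. order p R)" by (rule sum.cong) (auto simp: S_def nonsp_iff nsp)
    finally have cs: "card (sols w) = (\<Sum>p\<in>S. order p R)" .
    have degR: "degree R = (\<Sum>p\<in>S. order p R) + (\<Sum>p\<in>Sp. order p R)"
    proof -
      have "degree R = (\<Sum>p | poly R p = 0. order p R)" by (rule sum_order_degree_complex[OF R0, symmetric])
      also have "\<dots> = (\<Sum>p\<in>S \<union> Sp. order p R)"
        by (rule sum.mono_neutral_left) (use finS finite_Sp R0 in \<open>auto simp: S_def order_root\<close>)
      also have "\<dots> = (\<Sum>p\<in>S. order p R) + (\<Sum>p\<in>Sp. order p R)"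
        by (rule sum.union_disjoint) (use finS finite_Sp in \<open>auto simp: S_def\<close>)
      finally show ?thesis .
    qed
    have degE: "degree E = (\<Sum>p\<in>Sp. order p E)"
    proof -
      have "degree E = (\<Sum>p | poly E p = 0. order p E)" by (rule sum_order_degree_complex[OF E0, symmetric])
      also have "\<dots> = (\<Sum>p\<in>Sp. order p E)"
      proof (rule sum.mono_neutral_left[OF finite_Sp])
        show "{p. poly E p = 0} \<subseteq> Sp"
        proof
          fix p assume "p \<in> {p. poly E p = 0}"
          then have "order p E \<noteq> 0" using E0 by (simp add: order_root)
          then have "\<not> nonsp p" using Ens[of p] by auto
          then show "p \<in> Sp" unfolding nonsp_iff by simp
        qed
        show "\<forall>p\<in>Sp - {p. poly E p = 0}. order p E = 0" by (intro ballI order_0I) blast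
      qed
      finally show ?thesis .
    qed
    \<comment> \<open>The special points are pairwise distinct, so the sum splits into cameras and
      pairs of cameras.\<close>
    have Spsum: "(\<Sum>p\<in>Sp. f p) = (\<Sum>i<n. f (pc i)) + (\<Sum>(i,j)\<in>Pr. f (pl i j))" for f :: "complex \<Rightarrow> nat"
    proof -
      have i1: "inj_on pc {..<n}" using pc_inj by (auto simp: inj_on_def)
      have i2: "inj_on (\<lambda>(i,j). pl i j) Pr" using pl_inj unfolding Pr_def inj_on_def by auto
      have "pc ` {..<n} \<inter> (\<lambda>(i,j). pl i j) ` Pr = {}"
        using pc_neq_pl unfolding Pr_def by fastforce
      then have "(\<Sum>p\<in>Sp. f p) = (\<Sum>p\<in>pc ` {..<n}. f p) + (\<Sum>p\<in>(\<lambda>(i,j). pl i j) ` Pr. f p)"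
        unfolding Sp_def Pr_def[symmetric] using finPr by (intro sum.union_disjoint) auto
      also have "(\<Sum>p\<in>pc ` {..<n}. f p) = (\<Sum>i<n. f (pc i))" by (simp add: sum.reindex[OF i1])
      also have "(\<Sum>p\<in>(\<lambda>(i,j). pl i j) ` Pr. f p) = (\<Sum>(i,j)\<in>Pr. f (pl i j))"
        unfolding sum.reindex[OF i2] by (rule sum.cong) auto
      finally show ?thesis .
    qed
    have "(\<Sum>p\<in>Sp. order p E) = (\<Sum>i<n. order (pc i) E) + (\<Sum>(i,j)\<in>Pr. order (pl i j) E)"
      by (rule Spsum)
    also have "(\<Sum>i<n. order (pc i) E) = (\<Sum>i<n. order (pc i) R + 1)"
      by (rule sum.cong) (use spc in auto)
    also have "(\<Sum>(i,j)\<in>Pr. order (pl i j) E) = (\<Sum>(i,j)\<in>Pr. order (pl i j) R + 9)"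
      by (rule sum.cong) (use spl in auto)
    also have "(\<Sum>i<n. order (pc i) R + 1) + (\<Sum>(i,j)\<in>Pr. order (pl i j) R + 9) = (\<Sum>p\<in>Sp. order p R) + n + 9 * card Pr"
      unfolding Spsum split_beta sum.distrib sum_constant by simp
    finally have "degree E = (\<Sum>p\<in>Sp. order p R) + n + 9 * card Pr" using degE by simp
    moreover have "degree R = degree E + (3 * n - 2)"
      by (rule degree_at_infinity[OF spec[OF R] R0 spec[OF E] E0])
    ultimately have "card (sols w) = 3 * n - 2 + n + 9 * card Pr" using cs degR by linarith
    then show ?thesis using fin by simp
  qed
  ultimately show ?thesis unfolding Pr_def by blast
qed

end

subsection \<open>Generic constancy of the number of solutions\<close>

context cams
begin

text \<open>\<open>GL\<close> and \<open>HL\<close> are the two numerators on the line p = P - c q,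
  as polynomials in q. Their resultant \<open>RL\<close>, seen as a polynomial in P, vanishes at the
  images of the common zeros under the projection p + c q.\<close>

definition GL where "GL c P = Nf {..<n}
  (\<lambda>i. [:be i * P + ga i, - (c * be i):] * ([:v i:] * [:- (la i * P + mu i), 1 + c * la i:] - [:be i * P + ga i, - (c * be i):]))
  (\<lambda>i. [:- (la i * P + mu i), 1 + c * la i:])"
definition HL where "HL w c P = [:w - P, c:] * (\<Prod>i<n. [:- (la i * P + mu i), 1 + c * la i:] ^ 3) + Nf {..<n}
  (\<lambda>i. ([:v i:] * [:- (la i * P + mu i), 1 + c * la i:] - [:be i * P + ga i, - (c * be i):]) *
     ([:be i:] * [:- (la i * P + mu i), 1 + c * la i:] + [:la i:] * [:be i * P + ga i, - (c * be i):]))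
  (\<lambda>i. [:- (la i * P + mu i), 1 + c * la i:])"
definition RL where "RL w c P = res (3 * n - 1) (3 * n + 1) (GL c P) (HL w c P)"
text \<open>The points with q = l_i are included, since elimination does not tell them apart;
  \<open>CZ_sols\<close> subtracts them.\<close>

definition CZ where "CZ w = {(p, q). poly (gp p) q = 0 \<and> poly (hp w p) q = 0}"

lemma line_s: "poly [:be i * P + ga i, - (c * be i):] q = s i (P - c * q)"
  unfolding s_def by (simp add: algebra_simps)

lemma line_d: "poly [:- (la i * P + mu i), 1 + c * la i:] q = q - l i (P - c * q)"
  unfolding l_def by (simp add: algebra_simps)

lemma poly_GL: "poly (GL c P) q = poly (gp (P - c * q)) q"
  unfolding GL_def gp_def poly_Kp poly_Nf
proof (rule Nf_cong)
  fix i
  show "poly ([:be i * P + ga i, - (c * be i):] * ([:v i:] * [:- (la i * P + mu i), 1 + c * la i:] - [:be i * P + ga i, - (c * be i):])) q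
      = s i (P - c * q) * v i * (q - l i (P - c * q)) - (s i (P - c * q))\<^sup>2"
    unfolding poly_mult poly_diff line_s line_d by (simp add: algebra_simps power2_eq_square)
  show "poly [:- (la i * P + mu i), 1 + c * la i:] q = q - l i (P - c * q)" by (rule line_d)
qed

lemma poly_hp_raw: "poly (hp w p) q = (w - p) * (\<Prod>i<n. (q - l i p) ^ 3)
   + Nf {..<n} (\<lambda>i. (v i * (q - l i p) - s i p) * (be i * (q - l i p) + la i * s i p)) (\<lambda>i. q - l i p)"
proof -
  have "poly (Nf {..<n} (\<lambda>i. [:- (v i * l i p) - s i p, v i:] * [:la i * s i p - be i * l i p, be i:]) (\<lambda>i. [:- l i p, 1:])) q
     = Nf {..<n} (\<lambda>i. (v i * (q - l i p) - s i p) * (be i * (q - l i p) + la i * s i p)) (\<lambda>i. q - l i p)"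
    unfolding poly_Nf by (rule Nf_cong) (simp_all add: algebra_simps)
  then show ?thesis unfolding hp_def by (simp add: poly_prod)
qed

lemma poly_HL: "poly (HL w c P) q = poly (hp w (P - c * q)) q"
proof -
  have "poly [:w - P, c:] q = w - (P - c * q)" by (simp add: algebra_simps)
  then show ?thesis
    unfolding HL_def poly_hp_raw poly_add poly_mult poly_diff poly_Nf poly_prod poly_power line_s line_d by simp
qed

lemma degree_line_le: "degree [:a, b::complex:] \<le> 1"
  by simp

lemma degree_GL: "n \<ge> 1 \<Longrightarrow> degree (GL c P) \<le> 3 * n - 1"
proof -
  assume n: "n \<ge> 1"
  have "degree (GL c P) \<le> 2 + 3 * (card {..<n} - 1)"
    unfolding GL_def
  proof (rule degree_Nf)
    fix i
    have "degree ([:v i:] * [:- (la i * P + mu i), 1 + c * la i:] - [:be i * P + ga i, - (c * be i):]) \<le> 1"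
      by (rule degree_diff_le) (auto intro: order_trans[OF degree_mult_le])
    then show "degree ([:be i * P + ga i, - (c * be i):] * ([:v i:] * [:- (la i * P + mu i), 1 + c * la i:] - [:be i * P + ga i, - (c * be i):])) \<le> 2"
      using degree_mult_le[of "[:be i * P + ga i, - (c * be i):]" "[:v i:] * [:- (la i * P + mu i), 1 + c * la i:] - [:be i * P + ga i, - (c * be i):]"]
        degree_line_le[of "be i * P + ga i" "- (c * be i)"] by linarith
  qed auto
  then show ?thesis using n by simp
qed

text \<open>The top coefficient depends on the slope \<open>c\<close> and on \<open>la\<close> only.
  For all but finitely many slopes it is nonzero, and then the resultant detects exactly the affine
  common zeros, whatever P and w are.\<close>

lemma HL_parts:
  assumes "n \<ge> 1"
  shows "degree (HL w c P) \<le> 3 * n + 1" "coeff (HL w c P) (3 * n + 1) = c * (\<Prod>i<n. (1 + c * la i) ^ 3)"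
proof -
  define D where "D = (\<lambda>i. [:- (la i * P + mu i), 1 + c * la i:])"
  define A where "A = (\<Prod>i<n. D i ^ 3)"
  define B where "B = Nf {..<n} (\<lambda>i. ([:v i:] * D i - [:be i * P + ga i, - (c * be i):]) *
     ([:be i:] * D i + [:la i:] * [:be i * P + ga i, - (c * be i):])) D"
  have HL: "HL w c P = [:w - P, c:] * A + B" unfolding HL_def A_def B_def D_def ..
  have "degree B \<le> 2 + 3 * (card {..<n} - 1)"
    unfolding B_def
  proof (rule degree_Nf)
    fix i
    have "degree ([:v i:] * D i - [:be i * P + ga i, - (c * be i):]) \<le> 1"
      by (rule degree_diff_le) (auto intro: order_trans[OF degree_mult_le] simp: D_def)
    moreover have "degree ([:be i:] * D i + [:la i:] * [:be i * P + ga i, - (c * be i):]) \<le> 1"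
      by (rule degree_add_le) (auto intro: order_trans[OF degree_mult_le] simp: D_def)
    ultimately show "degree (([:v i:] * D i - [:be i * P + ga i, - (c * be i):]) * ([:be i:] * D i + [:la i:] * [:be i * P + ga i, - (c * be i):])) \<le> 2"
      using degree_mult_le[of "[:v i:] * D i - [:be i * P + ga i, - (c * be i):]" "[:be i:] * D i + [:la i:] * [:be i * P + ga i, - (c * be i):]"] by linarith
  qed (auto simp: D_def)
  then have dB: "degree B < 3 * n" using assms by simp
  have dA: "degree A \<le> 3 * n" unfolding A_def using degree_prod_cube_le[of "{..<n}" D] by (simp add: D_def)
  show "degree (HL w c P) \<le> 3 * n + 1"
    unfolding HL using dB dA degree_mult_le[of "[:w - P, c:]" A] degree_line_le[of "w - P" c]
    by (intro degree_add_le) linarith+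
  have cA: "coeff (\<Prod>i<k. D i ^ 3) (3 * k) = (\<Prod>i<k. (1 + c * la i) ^ 3)" for k
  proof (induction k)
    case (Suc k)
    have dk: "degree (\<Prod>i<k. D i ^ 3) \<le> 3 * k" using degree_prod_cube_le[of "{..<k}" D] by (simp add: D_def)
    have c1: "coeff (p * D k) (Suc m) = coeff p m * (1 + c * la k)" if "degree p \<le> m" for p m
    proof -
      have "p * D k = Polynomial.smult (- (la k * P + mu k)) p + pCons 0 (Polynomial.smult (1 + c * la k) p)"
        unfolding D_def by (subst mult.commute) simp
      moreover have "coeff p (Suc m) = 0" using that by (intro coeff_eq_0) simp
      ultimately show ?thesis by simp
    qed
    have dp: "degree (p * D k) \<le> Suc m" if "degree p \<le> m" for p m
      using degree_mult_le[of p "D k"] that degree_line_le[of "- (la k * P + mu k)" "1 + c * la k"] unfolding D_def by linarith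
    have e1: "(\<Prod>i<Suc k. D i ^ 3) = (\<Prod>i<k. D i ^ 3) * D k * D k * D k" by (simp add: power3_eq_cube mult_ac)
    have e2: "coeff ((\<Prod>i<k. D i ^ 3) * D k * D k * D k) (Suc (Suc (Suc (3 * k)))) = coeff (\<Prod>i<k. D i ^ 3) (3 * k) * (1 + c * la k) * (1 + c * la k) * (1 + c * la k)"
      using c1[OF dp[OF dp[OF dk]]] c1[OF dp[OF dk]] c1[OF dk] by simp
    have e3: "3 * Suc k = Suc (Suc (Suc (3 * k)))" by simp
    show ?case unfolding e3 e1 e2 Suc.IH by (simp add: power3_eq_cube mult_ac)
  qed simp
  have "coeff ([:w - P, c:] * A) (Suc (3 * n)) = c * coeff A (3 * n)"
  proof -
    have "coeff A (Suc (3 * n)) = 0" using dA by (intro coeff_eq_0) simp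
    then show ?thesis by simp
  qed
  moreover have "coeff B (Suc (3 * n)) = 0" using dB by (intro coeff_eq_0) simp
  ultimately show "coeff (HL w c P) (3 * n + 1) = c * (\<Prod>i<n. (1 + c * la i) ^ 3)"
    unfolding HL using cA[of n] unfolding A_def by simp
qed

lemma RL_zero_iff:
  assumes "n \<ge> 1" "c \<noteq> 0" "\<And>i. i < n \<Longrightarrow> 1 + c * la i \<noteq> 0"
  shows "RL w c P = 0 \<longleftrightarrow> (\<exists>pq\<in>CZ w. P = fst pq + c * snd pq)"
proof -
  have "RL w c P = 0 \<longleftrightarrow> (\<exists>q. poly (GL c P) q = 0 \<and> poly (HL w c P) q = 0)"
  proof
    assume r: "RL w c P = 0"
    have "coeff (HL w c P) (3 * n + 1) \<noteq> 0" unfolding HL_parts(2)[OF assms(1)] using assms(2,3) by simp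
    then have lc: "coeff (GL c P) (3 * n - 1) \<noteq> 0 \<or> coeff (HL w c P) (3 * n + 1) \<noteq> 0" by (rule disjI2)
    show "\<exists>q. poly (GL c P) q = 0 \<and> poly (HL w c P) q = 0"
      by (rule res_eq_0_imp_root[OF degree_GL[OF assms(1)] HL_parts(1)[OF assms(1)] lc r[unfolded RL_def]])
  next
    assume "\<exists>q. poly (GL c P) q = 0 \<and> poly (HL w c P) q = 0"
    then obtain q where "poly (GL c P) q = 0" "poly (HL w c P) q = 0" by blast
    then show "RL w c P = 0" unfolding RL_def
      by (rule res_eq_0_if_root[OF degree_GL[OF assms(1)] HL_parts(1)[OF assms(1)]]) (use assms(1) in simp)
  qed
  also have "\<dots> \<longleftrightarrow> (\<exists>pq\<in>CZ w. P = fst pq + c * snd pq)"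
    unfolding poly_GL poly_HL CZ_def
  proof
    assume "\<exists>q. poly (gp (P - c * q)) q = 0 \<and> poly (hp w (P - c * q)) q = 0"
    then obtain q where "poly (gp (P - c * q)) q = 0" "poly (hp w (P - c * q)) q = 0" by blast
    then show "\<exists>pq\<in>{(p, q). poly (gp p) q = 0 \<and> poly (hp w p) q = 0}. P = fst pq + c * snd pq"
      by (intro bexI[of _ "(P - c * q, q)"]) auto
  next
    assume "\<exists>pq\<in>{(p, q). poly (gp p) q = 0 \<and> poly (hp w p) q = 0}. P = fst pq + c * snd pq"
    then obtain p q where "poly (gp p) q = 0" "poly (hp w p) q = 0" "P = p + c * q" by auto
    then show "\<exists>q. poly (gp (P - c * q)) q = 0 \<and> poly (hp w (P - c * q)) q = 0"
      by (intro exI[of _ q]) simp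
  qed
  finally show ?thesis .
qed

end

text \<open>Layout of the parameter vector: four entries per camera, then the \<open>n\<close> data,
  then w at 5n, the slope at 5n + 1 and the value P of the projection at 5n + 2. The value 0 beyond
  \<open>n\<close> makes vectors with equal relevant entries yield equal functions.\<close>

definition Be :: "nat \<Rightarrow> (nat \<Rightarrow> complex) \<Rightarrow> nat \<Rightarrow> complex" where "Be n x i = (if i < n then x (4 * i) else 0)"
definition Ga :: "nat \<Rightarrow> (nat \<Rightarrow> complex) \<Rightarrow> nat \<Rightarrow> complex" where "Ga n x i = (if i < n then x (4 * i + 1) else 0)"
definition La :: "nat \<Rightarrow> (nat \<Rightarrow> complex) \<Rightarrow> nat \<Rightarrow> complex" where "La n x i = (if i < n then x (4 * i + 2) else 0)"
definition Mu :: "nat \<Rightarrow> (nat \<Rightarrow> complex) \<Rightarrow> nat \<Rightarrow> complex" where "Mu n x i = (if i < n then x (4 * i + 3) else 0)"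
definition Ve :: "nat \<Rightarrow> (nat \<Rightarrow> complex) \<Rightarrow> nat \<Rightarrow> complex" where "Ve n x i = (if i < n then x (4 * n + i) else 0)"

lemmas par_defs = Be_def Ga_def La_def Mu_def Ve_def

lemma par_poly_fun:
  assumes "4 * n \<le> M"
  shows "(\<lambda>x. Be n x i) \<in> poly_fun M" "(\<lambda>x. Ga n x i) \<in> poly_fun M"
    "(\<lambda>x. La n x i) \<in> poly_fun M" "(\<lambda>x. Mu n x i) \<in> poly_fun M"
  unfolding par_defs using assms by (cases "i < n"; auto intro: poly_fun.intros)+

lemma Ve_poly_fun: "5 * n \<le> M \<Longrightarrow> (\<lambda>x. Ve n x i) \<in> poly_fun M"
  unfolding par_defs by (cases "i < n") (auto intro: poly_fun.intros)

lemma RL_poly_fun: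
  "(\<lambda>x. cams.RL n (Be n x) (Ga n x) (La n x) (Mu n x) (Ve n x) (x (5 * n)) (x (5 * n + 1)) (x (5 * n + 2))) \<in> poly_fun (5 * n + 3)"
  unfolding cams.RL_def
proof (rule res_poly_fun)
  have D: "pfam (5 * n + 3) (\<lambda>x. [:- (La n x i * x (5 * n + 2) + Mu n x i), 1 + x (5 * n + 1) * La n x i:])" if "i < n" for i
    by (intro pfam_linear poly_fun_intros par_poly_fun) auto
  have S: "pfam (5 * n + 3) (\<lambda>x. [:Be n x i * x (5 * n + 2) + Ga n x i, - (x (5 * n + 1) * Be n x i):])" if "i < n" for i
    by (intro pfam_linear poly_fun_intros par_poly_fun) auto
  have V: "pfam (5 * n + 3) (\<lambda>x. [:Ve n x i:])" "pfam (5 * n + 3) (\<lambda>x. [:Be n x i:])" "pfam (5 * n + 3) (\<lambda>x. [:La n x i:])" if "i < n" for i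
    by (intro pfam_scalar par_poly_fun Ve_poly_fun; simp)+
  show "pfam (5 * n + 3) (\<lambda>x. cams.GL n (Be n x) (Ga n x) (La n x) (Mu n x) (Ve n x) (x (5 * n + 1)) (x (5 * n + 2)))"
    unfolding cams.GL_def by (intro pfam_Nf pfam_mult pfam_diff D S V) auto
  show "pfam (5 * n + 3) (\<lambda>x. cams.HL n (Be n x) (Ga n x) (La n x) (Mu n x) (Ve n x) (x (5 * n)) (x (5 * n + 1)) (x (5 * n + 2)))"
    unfolding cams.HL_def
    by (intro pfam_add pfam_mult pfam_prod pfam_power pfam_Nf pfam_diff D S V pfam_linear poly_fun_intros) auto
qed

lemma zgen_last_finite:
  assumes "zgen (Suc k) (\<lambda>y. P (y k))"
  shows "finite {c. \<not> P c}"
proof -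
  obtain f y where f: "f \<in> poly_fun (Suc k)" "f y \<noteq> 0" "\<And>y. f y \<noteq> 0 \<Longrightarrow> P (y k)"
    using assms unfolding zgen_def by blast
  obtain F where F: "pfam k F" "\<And>x. poly (F x) (x k) = f x" using poly_fun_Suc_pfam[OF f(1)] by blast
  have eq: "poly (F y) c = f (y(k := c))" for c
    using F(2)[of "y(k := c)"] pfam_cong[OF F(1), of y "y(k := c)"] by simp
  have "F y \<noteq> 0" using F(2)[of y] f(2) by auto
  moreover have "{c. \<not> P c} \<subseteq> {c. poly (F y) c = 0}"
  proof safe
    fix c assume c: "\<not> P c"
    show "poly (F y) c = 0"
    proof (rule ccontr)
      assume "poly (F y) c \<noteq> 0"
      then show False using f(3)[of "y(k := c)"] c eq by simp
    qed
  qed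
  ultimately show ?thesis using poly_roots_finite finite_subset by blast
qed

text \<open>\<open>F x\<close> is the resultant as a polynomial in P, with the slope c at entry
  \<open>M\<close> of \<open>x\<close>. For generic other parameters its number of distinct roots is
  the maximal one for all but finitely many c, and some such c is injective on any given finite set
  of common zeros. Hence that maximum is the number of common zeros itself. Finiteness at the one
  parameter \<open>a\<close> keeps \<open>F\<close> from vanishing identically.\<close>

lemma generic_constant_CZ:
  assumes n: "n \<ge> 1"
    and ex: "finite (cams.CZ n (Be n a) (Ga n a) (La n a) (Mu n a) (Ve n a) (a (5 * n)))"
  shows "\<exists>K. zgen (5 * n + 1) (\<lambda>x. finite (cams.CZ n (Be n x) (Ga n x) (La n x) (Mu n x) (Ve n x) (x (5 * n))) \<and>
     card (cams.CZ n (Be n x) (Ga n x) (La n x) (Mu n x) (Ve n x) (x (5 * n))) = K)"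
proof -
  define C where "C = (\<lambda>x. cams.CZ n (Be n x) (Ga n x) (La n x) (Mu n x) (Ve n x) (x (5 * n)))"
  define f where "f = (\<lambda>x. cams.RL n (Be n x) (Ga n x) (La n x) (Mu n x) (Ve n x) (x (5 * n)) (x (5 * n + 1)) (x (5 * n + 2)))"
  define M where "M = 5 * n + 1"
  have f: "f \<in> poly_fun (Suc (Suc M))" unfolding f_def M_def by (rule poly_fun_mono[OF RL_poly_fun]) simp
  obtain F where F: "pfam (Suc M) F" "\<And>x. poly (F x) (x (Suc M)) = f x" using poly_fun_Suc_pfam[OF f] by blast
  define nd where "nd = (\<lambda>x. x M \<noteq> 0 \<and> (\<forall>i<n. 1 + x M * La n x i \<noteq> 0))"
  have root_iff: "poly (F x) P = 0 \<longleftrightarrow> (\<exists>pq\<in>C x. P = fst pq + x M * snd pq)" if "nd x" for x P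
  proof -
    let ?y = "x(Suc M := P)"
    have "F ?y = F x" by (rule pfam_cong[OF F(1)]) simp
    then have "poly (F x) P = f ?y" using F(2)[of ?y] by simp
    moreover have "Be n ?y = Be n x" "Ga n ?y = Ga n x" "La n ?y = La n x" "Mu n ?y = Mu n x" "Ve n ?y = Ve n x"
      unfolding par_defs M_def by (auto simp: fun_eq_iff)
    then have "f ?y = cams.RL n (Be n x) (Ga n x) (La n x) (Mu n x) (Ve n x) (x (5 * n)) (x M) P"
      unfolding f_def M_def by simp
    ultimately show ?thesis using that cams.RL_zero_iff[OF n, of "x M" "La n x"] unfolding nd_def C_def by simp
  qed
  have Clow: "C (\<lambda>i. if i < M then x i else y i) = C x" for x y
  proof -
    let ?z = "\<lambda>i. if i < M then x i else y i"
    have "Be n ?z = Be n x" "Ga n ?z = Ga n x" "La n ?z = La n x" "Mu n ?z = Mu n x" "Ve n ?z = Ve n x" "?z (5 * n) = x (5 * n)"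
      unfolding par_defs M_def by (auto simp: fun_eq_iff)
    then show ?thesis unfolding C_def by simp
  qed
  have ndz: "zgen (Suc M) nd"
    unfolding nd_def
  proof (intro zgen_conj zgen_all_less)
    show "zgen (Suc M) (\<lambda>x. x M \<noteq> 0)" by (rule zgen_neq[where x = "\<lambda>_. 1"]) (auto intro: pvar)
    fix i assume "i < n"
    then show "zgen (Suc M) (\<lambda>x. 1 + x M * La n x i \<noteq> 0)"
      by (intro zgen_neq[where x = "\<lambda>_. 0"]) (auto simp: M_def intro!: poly_fun_intros par_poly_fun)
  qed
  have Fnz: "\<exists>x. F x \<noteq> 0"
  proof -
    have fin: "finite ({0} \<union> (\<lambda>i. - 1 / La n a i) ` {..<n})" by simp
    obtain c where c: "c \<notin> {0} \<union> (\<lambda>i. - 1 / La n a i) ` {..<n}" using ex_new_if_finite[OF infinite_UNIV_char_0 fin] by blast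
    define x where "x = (\<lambda>i. if i < M then a i else c)"
    have La: "La n x i = La n a i" if "i < n" for i using that unfolding x_def La_def M_def by simp
    have "nd x" unfolding nd_def
    proof (intro conjI allI impI)
      show "x M \<noteq> 0" using c unfolding x_def by simp
      fix i assume i: "i < n"
      show "1 + x M * La n x i \<noteq> 0"
      proof
        assume "1 + x M * La n x i = 0"
        then have "c * La n a i = -1" unfolding La[OF i] by (simp add: x_def add_eq_0_iff)
        then have "c = - 1 / La n a i" by (metis nonzero_mult_div_cancel_right mult_zero_right zero_neq_neg_one)
        then show False using c i by blast
      qed
    qed
    have "C x = C a" unfolding x_def by (rule Clow)
    moreover have "finite (C a)" unfolding C_def by (rule ex)
    ultimately have "finite ((\<lambda>pq. fst pq + x M * snd pq) ` C x)" by simp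
    from ex_new_if_finite[OF infinite_UNIV_char_0 this]
    obtain P where P: "P \<notin> (\<lambda>pq. fst pq + x M * snd pq) ` C x" by blast
    have "poly (F x) P \<noteq> 0"
    proof
      assume "poly (F x) P = 0"
      then obtain pq where "pq \<in> C x" "P = fst pq + x M * snd pq" using root_iff[OF \<open>nd x\<close>, of P] by blast
      then show False using P by blast
    qed
    then show ?thesis by (intro exI[of _ x]) auto
  qed
  define N where "N = (\<lambda>x. card {t. poly (F x) t = 0})"
  obtain D where D: "\<And>x. degree (F x) \<le> D" using F(1) unfolding pfam_def by blast
  have ND: "N x \<le> D" if "F x \<noteq> 0" for x unfolding N_def using card_poly_roots_bound[OF that] D[of x] by linarith
  \<comment> \<open>The uniform degree bound makes the maximum exist, and
    \<open>zgen_card_roots\<close> makes it generic.\<close>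
  define K where "K = Max (N ` {x. F x \<noteq> 0})"
  have finN: "finite (N ` {x. F x \<noteq> 0})" by (rule finite_subset[of _ "{..D}"]) (use ND in auto)
  have "K \<in> N ` {x. F x \<noteq> 0}" unfolding K_def using finN Fnz by (intro Max_in) auto
  then obtain z where z: "F z \<noteq> 0" "N z = K" by auto
  have NK: "N x \<le> K" if "F x \<noteq> 0" for x unfolding K_def using finN that by (intro Max_ge) auto
  have "zgen (Suc M) (\<lambda>x. F x \<noteq> 0 \<and> K \<le> card {t. poly (F x) t = 0})"
    by (rule zgen_card_roots[OF F(1) z(1)]) (use z(2) in \<open>simp add: N_def\<close>)
  from zgen_conj[OF this ndz] have "zgen (Suc M) (\<lambda>x. N x = K \<and> F x \<noteq> 0 \<and> nd x)"
    by (rule zgen_mono) (use NK in \<open>auto simp: N_def intro: antisym\<close>)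
  from zgen_fix[OF this, of M]
  have "zgen M (\<lambda>x. zgen (Suc M) (\<lambda>y. (\<lambda>z. N z = K \<and> F z \<noteq> 0 \<and> nd z) (\<lambda>i. if i < M then x i else y i)))" by simp
  then have "zgen M (\<lambda>x. finite (C x) \<and> card (C x) = K)"
  proof (rule zgen_mono)
    fix x assume g: "zgen (Suc M) (\<lambda>y. (\<lambda>z. N z = K \<and> F z \<noteq> 0 \<and> nd z) (\<lambda>i. if i < M then x i else y i))"
    \<comment> \<open>Once the entries below \<open>M\<close> are fixed, only the slope is
      free.\<close>
    have FM: "F (\<lambda>i. if i < M then x i else y i) = F (\<lambda>i. if i < M then x i else y M)" for y
      by (rule pfam_cong[OF F(1)]) (auto simp: less_Suc_eq)
    have ndM: "nd (\<lambda>i. if i < M then x i else y i) = nd (\<lambda>i. if i < M then x i else y M)" for y :: "nat \<Rightarrow> complex"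
      unfolding nd_def La_def M_def by simp
    let ?x = "\<lambda>c i. if i < M then x i else c"
    have "zgen (Suc M) (\<lambda>y. N (?x (y M)) = K \<and> F (?x (y M)) \<noteq> 0 \<and> nd (?x (y M)))"
      using g
    proof (rule zgen_mono)
      fix y :: "nat \<Rightarrow> complex"
      let ?y = "\<lambda>i. if i < M then x i else y i"
      assume h: "N ?y = K \<and> F ?y \<noteq> 0 \<and> nd ?y"
      have e2: "F ?y = F (?x (y M))" by (rule FM)
      have e3: "nd ?y = nd (?x (y M))" by (rule ndM)
      have e1: "N ?y = N (?x (y M))" unfolding N_def e2 ..
      show "N (?x (y M)) = K \<and> F (?x (y M)) \<noteq> 0 \<and> nd (?x (y M))"
        using h unfolding e1 e2 e3 .
    qed
    from zgen_last_finite[of M "\<lambda>c. N (?x c) = K \<and> F (?x c) \<noteq> 0 \<and> nd (?x c)", OF this]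
    have fin: "finite {c. \<not> (N (?x c) = K \<and> F (?x c) \<noteq> 0 \<and> nd (?x c))}" .
    have image: "K = card ((\<lambda>pq. fst pq + c * snd pq) ` C x) \<and> finite ((\<lambda>pq. fst pq + c * snd pq) ` C x)"
      if "N (?x c) = K \<and> F (?x c) \<noteq> 0 \<and> nd (?x c)" for c
    proof -
      have "{t. poly (F (?x c)) t = 0} = (\<lambda>pq. fst pq + c * snd pq) ` C x"
      proof (rule Set.set_eqI)
        fix t
        have "?x c M = c" by simp
        then have "poly (F (?x c)) t = 0 \<longleftrightarrow> (\<exists>pq\<in>C x. t = fst pq + c * snd pq)"
          using root_iff[of "?x c" t] that Clow[of x "\<lambda>_. c"] by simp
        then show "t \<in> {t. poly (F (?x c)) t = 0} \<longleftrightarrow> t \<in> (\<lambda>pq. fst pq + c * snd pq) ` C x" by blast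
      qed
      moreover have "finite {t. poly (F (?x c)) t = 0}" using that by (intro poly_roots_finite) blast
      ultimately show ?thesis using that unfolding N_def by simp
    qed
    \<comment> \<open>Two points of \<open>T\<close> have equal projections for at most one slope
      unless their q-coordinates agree, in which case equal projections make the points equal; so a
      slope separating \<open>T\<close> exists.\<close>
    have bound: "card T \<le> K" if T: "T \<subseteq> C x" "finite T" for T :: "(complex \<times> complex) set"
    proof -
      have "finite ((\<lambda>(a,b). - (fst a - fst b) / (snd a - snd b)) ` (T \<times> T))" using T by simp
      with fin have "finite ({c. \<not> (N (?x c) = K \<and> F (?x c) \<noteq> 0 \<and> nd (?x c))} \<union> (\<lambda>(a,b). - (fst a - fst b) / (snd a - snd b)) ` (T \<times> T))" by simp
      from ex_new_if_finite[OF infinite_UNIV_char_0 this] obtain c where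
        c: "N (?x c) = K \<and> F (?x c) \<noteq> 0 \<and> nd (?x c)" "c \<notin> (\<lambda>(a,b). - (fst a - fst b) / (snd a - snd b)) ` (T \<times> T)" by blast
      have "inj_on (\<lambda>pq. fst pq + c * snd pq) T"
      proof (rule inj_onI)
        fix a b :: "complex \<times> complex" assume ab: "a \<in> T" "b \<in> T" "fst a + c * snd a = fst b + c * snd b"
        show "a = b"
        proof (cases "snd a = snd b")
          case True
          then show ?thesis using ab by (simp add: prod_eq_iff)
        next
          case False
          have "c * (snd a - snd b) = - (fst a - fst b)" using ab(3) by (simp add: algebra_simps)
          then have "c = - (fst a - fst b) / (snd a - snd b)" using False by (simp add: eq_divide_eq)
          then have "c \<in> (\<lambda>(a,b). - (fst a - fst b) / (snd a - snd b)) ` (T \<times> T)"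
            using ab by (intro image_eqI[of _ _ "(a, b)"]) auto
          then show ?thesis using c(2) by blast
        qed
      qed
      then have "card T = card ((\<lambda>pq. fst pq + c * snd pq) ` T)" by (simp add: card_image)
      also have "\<dots> \<le> card ((\<lambda>pq. fst pq + c * snd pq) ` C x)"
        using image[OF c(1)] T(1) by (intro card_mono) auto
      also have "\<dots> = K" using image[OF c(1)] by simp
      finally show ?thesis .
    qed
    have finC: "finite (C x)"
    proof (rule ccontr)
      assume "infinite (C x)"
      then obtain T where "finite T" "card T = Suc K" "T \<subseteq> C x" using infinite_arbitrarily_large by blast
      then show False using bound[of T] by simp
    qed
    obtain c where c: "N (?x c) = K \<and> F (?x c) \<noteq> 0 \<and> nd (?x c)"
      using ex_new_if_finite[OF infinite_UNIV_char_0 fin] by blast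
    have "K \<le> card (C x)" using image[OF c] card_image_le[OF finC] by simp
    then show "finite (C x) \<and> card (C x) = K" using finC bound[of "C x"] by simp
  qed
  then show ?thesis unfolding C_def M_def by blast
qed

subsection \<open>The exceptional common zeros\<close>

context tcams
begin

lemma disjoint_if_image_disjoint: "f ` A \<inter> f ` B = {} \<Longrightarrow> A \<inter> B = {}"
  by blast

text \<open>At a node \<open>gp p\<close> equals - s_i^2 \<Prod> (l_i - l_j)^3, so a common zero on
  a node lies over some \<open>pc i\<close> or \<open>pl i j\<close>. There both numerators vanish
  whatever the data are, so these points are always present.\<close>

lemma CZ_decomp:
  "CZ w = sols w \<union> ((\<lambda>i. (pc i, l i (pc i))) ` {..<n} \<union> (\<lambda>(i,j). (pl i j, l i (pl i j))) ` {(i,j). i < j \<and> j < n})"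
  (is "_ = _ \<union> (?A \<union> ?B)")
proof (intro equalityI subsetI)
  fix pq assume pq: "pq \<in> CZ w"
  obtain p q where e: "pq = (p, q)" by (cases pq)
  have g: "poly (gp p) q = 0" and h: "poly (hp w p) q = 0" using pq unfolding CZ_def e by auto
  show "pq \<in> sols w \<union> (?A \<union> ?B)"
  proof (cases "\<forall>i<n. q \<noteq> l i p")
    case True
    then show ?thesis using g h unfolding e sols_def by simp
  next
    case False
    then obtain i where i: "i < n" "q = l i p" by blast
    have "poly (gp p) (l i p) = - (s i p)\<^sup>2 * (\<Prod>j\<in>{..<n}-{i}. (l i p - l j p) ^ 3)"
      unfolding gp_def by (rule poly_Kp_node) (use i in auto)
    then consider "s i p = 0" | j where "j \<in> {..<n} - {i}" "l i p = l j p" using g i(2) by auto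
    then show ?thesis
    proof cases
      case 1
      then have "p = pc i" using s_zero_iff[OF i(1)] by simp
      then show ?thesis using i unfolding e by auto
    next
      case 2
      then have p: "p = pl i j" using l_eq_iff[of i j p] i by auto
      consider "i < j" | "j < i" using 2(1) by force
      then show ?thesis
      proof cases
        case 1
        then have "(p, q) = (\<lambda>(i,j). (pl i j, l i (pl i j))) (i, j)" using p i(2) by simp
        then show ?thesis using 1 2 unfolding e by (intro UnI2 image_eqI[of _ _ "(i, j)"]) auto
      next
        case ji: 2
        then have "(p, q) = (\<lambda>(i,j). (pl i j, l i (pl i j))) (j, i)" using p i(2) 2(2) pl_sym[of i j] by simp
        then show ?thesis using ji i 2 unfolding e by (intro UnI2 image_eqI[of _ _ "(j, i)"]) auto
      qed
    qed
  qed
next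
  fix pq assume "pq \<in> sols w \<union> (?A \<union> ?B)"
  then consider "pq \<in> sols w" | i where "i < n" "pq = (pc i, l i (pc i))" | i j where "i < j" "j < n" "pq = (pl i j, l i (pl i j))"
    by auto
  then show "pq \<in> CZ w"
  proof cases
    case 1
    then show ?thesis unfolding sols_def CZ_def by auto
  next
    case (2 i)
    have z: "s i (pc i) = 0" using s_zero_iff[OF 2(1)] by simp
    have "(\<Prod>k<n. (l i (pc i) - l k (pc i)) ^ 3) = 0" using 2(1) by (intro prod_zero) auto
    then have "poly (hp w (pc i)) (l i (pc i)) = 0"
      unfolding poly_hp_raw using 2(1) z by (subst Nf_remove[of _ i]) auto
    moreover have "poly (gp (pc i)) (l i (pc i)) = 0"
      unfolding gp_def poly_Kp using 2(1) z by (subst Nf_remove[of _ i]) auto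
    ultimately show ?thesis unfolding 2(2) CZ_def by simp
  next
    case (3 i j)
    have z: "l i (pl i j) = l j (pl i j)" using l_eq_iff[of i j "pl i j"] 3 by simp
    have p0: "(\<Prod>k\<in>{..<n}-{i}. (l i (pl i j) - l k (pl i j)) ^ 3) = 0"
      by (rule prod_zero) (use 3 z in auto)
    have P0: "(\<Prod>k<n. (l i (pl i j) - l k (pl i j)) ^ 3) = 0" using 3 by (intro prod_zero) auto
    have i: "i \<in> {..<n}" using 3 by simp
    have "poly (hp w (pl i j)) (l i (pl i j)) = 0"
      unfolding poly_hp_raw Nf_remove[OF finite_lessThan i] p0 P0 by simp
    moreover have "poly (gp (pl i j)) (l i (pl i j)) = 0"
      unfolding gp_def poly_Kp using 3 p0 by (subst Nf_remove[of _ i]) auto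
    ultimately show ?thesis unfolding 3(3) CZ_def by simp
  qed
qed

lemma CZ_sols:
  "finite (CZ w) \<longleftrightarrow> finite (sols w)"
  "finite (sols w) \<Longrightarrow> card (CZ w) = card (sols w) + n + card {(i,j). i < j \<and> j < n}"
proof -
  let ?Pr = "{(i,j). i < j \<and> j < n}"
  let ?A = "(\<lambda>i. (pc i, l i (pc i))) ` {..<n}" and ?B = "(\<lambda>(i,j). (pl i j, l i (pl i j))) ` ?Pr"
  have finPr: "finite ?Pr" by (rule finite_subset[of _ "{..<n} \<times> {..<n}"]) auto
  show "finite (CZ w) \<longleftrightarrow> finite (sols w)" unfolding CZ_decomp using finPr by simp
  assume fin: "finite (sols w)"
  have i1: "inj_on (\<lambda>i. (pc i, l i (pc i))) {..<n}" using pc_inj by (auto simp: inj_on_def)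
  have i2: "inj_on (\<lambda>(i,j). (pl i j, l i (pl i j))) ?Pr" using pl_inj unfolding inj_on_def by auto
  have fA: "fst ` ?A = pc ` {..<n}" and fB: "fst ` ?B = (\<lambda>(i,j). pl i j) ` ?Pr"
    unfolding image_image by (rule image_cong; auto)+
  have pcpl: "pc ` {..<n} \<inter> (\<lambda>(i,j). pl i j) ` ?Pr = {}"
  proof (rule equals0I)
    fix x assume x: "x \<in> pc ` {..<n} \<inter> (\<lambda>(i,j). pl i j) ` ?Pr"
    obtain i where i: "i < n" "x = pc i" using IntD1[OF x] by (elim imageE) simp
    obtain j k where jk: "j < k" "k < n" "x = pl j k" using IntD2[OF x] by (elim imageE) (auto simp: split_beta)
    have "j < n" "j \<noteq> k" using jk by auto
    then show False using pc_neq_pl[OF i(1) _ jk(2), of j] i(2) jk(3) by simp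
  qed
  have dAB: "?A \<inter> ?B = {}"
    by (rule disjoint_if_image_disjoint[of fst]) (simp only: fA fB pcpl)
  have nA: "\<forall>x\<in>?A. \<exists>i<n. snd x = l i (fst x)"
    unfolding ball_simps
  proof
    fix i assume "i \<in> {..<n}"
    then show "\<exists>j<n. snd (pc i, l i (pc i)) = l j (fst (pc i, l i (pc i)))" by (intro exI[of _ i]) simp
  qed
  have nB: "\<forall>x\<in>?B. \<exists>i<n. snd x = l i (fst x)"
  proof
    fix x assume "x \<in> ?B"
    then obtain ij where ij: "ij \<in> ?Pr" "x = (case ij of (i, j) \<Rightarrow> (pl i j, l i (pl i j)))"
      by (elim imageE)
    then have "fst ij < n \<and> snd x = l (fst ij) (fst x)" by (simp add: split_beta)
    then show "\<exists>k<n. snd x = l k (fst x)" by (rule exI)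
  qed
  have node: "\<exists>i<n. snd x = l i (fst x)" if "x \<in> ?A \<union> ?B" for x
    using that by (rule UnE) (rule nA[rule_format], assumption, rule nB[rule_format])
  have off: "\<forall>i<n. snd x \<noteq> l i (fst x)" if "x \<in> sols w" for x
    using that unfolding sols_def by (cases x) simp
  have dS: "sols w \<inter> (?A \<union> ?B) = {}"
  proof (rule equals0I)
    fix x assume x: "x \<in> sols w \<inter> (?A \<union> ?B)"
    from node[OF IntD2[OF x]] obtain i where i: "i < n" "snd x = l i (fst x)" by (elim exE conjE)
    from off[OF IntD1[OF x]] i(1) have "snd x \<noteq> l i (fst x)" by (elim allE impE)
    then show False using i(2) by (rule notE)
  qed
  have "card (CZ w) = card (sols w) + card (?A \<union> ?B)"
    unfolding CZ_decomp by (rule card_Un_disjoint) (use fin finPr dS in auto)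
  also have "card (?A \<union> ?B) = card ?A + card ?B"
    by (rule card_Un_disjoint) (use finPr dAB in auto)
  finally show "card (CZ w) = card (sols w) + n + card ?Pr"
    using card_image[OF i1] card_image[OF i2] by simp
qed

end

section \<open>Existence of cameras and data in general position\<close>

lemma Kp_value_nz:
  assumes I: "finite I" "k \<in> I" and q: "\<And>i. i \<in> I \<Longrightarrow> q \<noteq> l i"
  shows "\<exists>x. poly (Kp I (\<lambda>i. if i = k then x else 0) t l) q \<noteq> 0"
proof -
  let ?V = "\<lambda>x. poly (Kp I (\<lambda>i. if i = k then x else 0) t l) q"
  have V: "?V x = (x * (q - l k) - t k) * (\<Prod>j\<in>I-{k}. (q - l j) ^ 3) + (q - l k) ^ 3 * Nf (I - {k}) (\<lambda>i. - t i) (\<lambda>i. q - l i)" for x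
  proof -
    have "Nf (I - {k}) (\<lambda>i. (if i = k then x else 0) * (q - l i) - t i) (\<lambda>i. q - l i) = Nf (I - {k}) (\<lambda>i. - t i) (\<lambda>i. q - l i)"
      by (rule Nf_cong) auto
    then show ?thesis unfolding poly_Kp Nf_remove[OF I] by simp
  qed
  have "?V 1 - ?V 0 = (q - l k) * (\<Prod>j\<in>I-{k}. (q - l j) ^ 3)"
    unfolding V by (simp add: algebra_simps)
  moreover have "(q - l k) * (\<Prod>j\<in>I-{k}. (q - l j) ^ 3) \<noteq> 0" using I q by simp
  ultimately have "?V 1 \<noteq> 0 \<or> ?V 0 \<noteq> 0" by auto
  then show ?thesis by blast
qed

lemma pfam_Kp: "(\<And>i. i \<in> I \<Longrightarrow> w i \<in> poly_fun M) \<Longrightarrow> pfam M (\<lambda>y. Kp I (\<lambda>i. w i y) t l)"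
  unfolding Kp_def by (intro pfam_Nf pfam_linear poly_fun_intros) auto

text \<open>\<open>y x\<close> are parameters for which the weights are concentrated at node
  \<open>k\<close> with value \<open>x\<close>, the situation of \<open>Kp_generic_roots\<close>;
  semicontinuity carries the root count to generic parameters.\<close>

lemma zgen_Kp_roots:
  assumes I: "finite I" "k \<in> I" "inj_on l I" "\<And>i. i \<in> I \<Longrightarrow> t i \<noteq> 0"
    and w: "\<And>i. i \<in> I \<Longrightarrow> w i \<in> poly_fun M" and y: "\<And>x i. i \<in> I \<Longrightarrow> w i (y x) = (if i = k then x else 0)"
  shows "zgen M (\<lambda>y. Kp I (\<lambda>i. w i y) t l \<noteq> 0 \<and> 1 + 3 * (card I - 1) \<le> card {q. poly (Kp I (\<lambda>i. w i y) t l) q = 0})"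
proof -
  obtain x where x: "Kp I (\<lambda>i. if i = k then x else 0) t l \<noteq> 0"
    "card {q. poly (Kp I (\<lambda>i. if i = k then x else 0) t l) q = 0} = 1 + 3 * (card I - 1)"
    using Kp_generic_roots[where I = I and k = k and l = l and t = t, OF I] by blast
  have "Kp I (\<lambda>i. w i (y x)) t l = Kp I (\<lambda>i. if i = k then x else 0) t l"
    by (rule Kp_cong) (use y in auto)
  then show ?thesis
    by (intro zgen_card_roots[where z = "y x"] pfam_Kp w) (use x in auto)
qed

lemma zgen_Kp_value:
  assumes I: "finite I" "k \<in> I" and q: "\<And>i. i \<in> I \<Longrightarrow> q \<noteq> l i"
    and w: "\<And>i. i \<in> I \<Longrightarrow> w i \<in> poly_fun M" and y: "\<And>x i. i \<in> I \<Longrightarrow> w i (y x) = (if i = k then x else 0)"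
  shows "zgen M (\<lambda>y. poly (Kp I (\<lambda>i. w i y) t l) q \<noteq> 0)"
proof -
  obtain x where x: "poly (Kp I (\<lambda>i. if i = k then x else 0) t l) q \<noteq> 0"
    using Kp_value_nz[where I = I and k = k and q = q and l = l and t = t, OF I q] by blast
  have eq: "Kp I (\<lambda>i. w i (y x)) t l = Kp I (\<lambda>i. if i = k then x else 0) t l"
    by (rule Kp_cong) (use y in auto)
  show ?thesis
    by (rule zgen_neq[where x = "y x"], rule pfam_poly[OF pfam_Kp[OF w] pconst], assumption) (use x eq in simp)
qed

context tcams
begin

text \<open>In each condition some \<open>s k\<close> or \<open>be k\<close> is nonzero, so data
  supported on the single camera \<open>k\<close> realise a weight concentrated at one node.\<close>

lemma gcams_generic:
  assumes M: "k0 + n \<le> M"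
  shows "zgen M (\<lambda>y. gcams n be ga la mu (\<lambda>i. if i < n then y (k0 + i) else 0))"
proof -
  define V where "V = (\<lambda>y::nat \<Rightarrow> complex. \<lambda>i. if i < n then y (k0 + i) else 0)"
  have Vp: "(\<lambda>y. V y i) \<in> poly_fun M" for i
    unfolding V_def using M by (cases "i < n") (auto intro: poly_fun.intros)
  \<comment> \<open>Data supported on camera \<open>k\<close>, divided by the coefficient
    \<open>c\<close> so that the weight becomes \<open>x\<close>.\<close>
  define e where "e = (\<lambda>(k::nat) (c::complex) x m. if m = k0 + k then x / c else (0::complex))"
  have e: "c \<noteq> 0 \<Longrightarrow> k < n \<Longrightarrow> c * V (e k c x) k = x" "i \<noteq> k \<Longrightarrow> V (e k c x) i = 0" for c k x i
    unfolding V_def e_def by auto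
  have Z1: "zgen M (\<lambda>y. \<forall>i<n. V y i \<noteq> 0)"
    by (intro zgen_all_less zgen_neq[where x = "\<lambda>_. 1"] Vp) (simp add: V_def)
  have "zgen M (\<lambda>y. Kp {..<n} (\<lambda>i. be i * V y i) (\<lambda>i. (be i)\<^sup>2) la \<noteq> 0 \<and>
     1 + 3 * (card {..<n} - 1) \<le> card {q. poly (Kp {..<n} (\<lambda>i. be i * V y i) (\<lambda>i. (be i)\<^sup>2) la) q = 0})"
  proof (rule zgen_Kp_roots[where k = 0 and y = "e 0 (be 0)" and w = "\<lambda>i y. be i * V y i"])
    show "inj_on la {..<n}" using la_inj by (auto simp: inj_on_def)
    show "be i * V (e 0 (be 0) x) i = (if i = 0 then x else 0)" if "i \<in> {..<n}" for x i
      using e(1)[of "be 0" 0 x] e(2)[of i 0 "be 0" x] be_nz[of 0] n2 by auto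
  qed (use be_nz n2 Vp in \<open>auto intro: poly_fun_intros\<close>)
  moreover have "1 + 3 * (card {..<n} - 1) = 3 * n - 2" unfolding card_lessThan using n2 by arith
  ultimately have Z2: "zgen M (\<lambda>y. Kp {..<n} (\<lambda>i. be i * V y i) (\<lambda>i. (be i)\<^sup>2) la \<noteq> 0 \<and>
     3 * n - 2 \<le> card {q. poly (Kp {..<n} (\<lambda>i. be i * V y i) (\<lambda>i. (be i)\<^sup>2) la) q = 0})" by simp
  have ca: "1 + 3 * (card ({..<n} - {i}) - 1) = 3 * n - 5" if "i < n" for i
  proof -
    have "card ({..<n} - {i}) = n - 1" using that by simp
    then show ?thesis using n2 by arith
  qed
  have Z3: "zgen M (\<lambda>y. \<forall>i<n. (Kp ({..<n} - {i}) (\<lambda>j. s j (pc i) * V y j) (\<lambda>j. (s j (pc i))\<^sup>2) (\<lambda>j. l j (pc i)) \<noteq> 0 \<and>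
      3 * n - 5 \<le> card {q. poly (Kp ({..<n} - {i}) (\<lambda>j. s j (pc i) * V y j) (\<lambda>j. (s j (pc i))\<^sup>2) (\<lambda>j. l j (pc i))) q = 0}) \<and>
      poly (Kp ({..<n} - {i}) (\<lambda>j. s j (pc i) * V y j) (\<lambda>j. (s j (pc i))\<^sup>2) (\<lambda>j. l j (pc i))) (l i (pc i)) \<noteq> 0)"
  proof (intro zgen_all_less; rule zgen_conj)
    fix i assume i: "i < n"
    define k where "k = (if i = 0 then 1 else 0 :: nat)"
    have k: "k \<in> {..<n} - {i}" using n2 i unfolding k_def by auto
    have sj: "s j (pc i) \<noteq> 0" if "j \<in> {..<n} - {i}" for j
      using that s_zero_iff[of j "pc i"] pc_inj[of i j] i by auto
    have lj: "l j (pc i) \<noteq> l j' (pc i)" if "j < n" "j' < n" "j \<noteq> j'" for j j'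
      using l_eq_iff[OF that, of "pc i"] pc_neq_pl[OF i that] by simp
    have ey: "s j (pc i) * V (e k (s k (pc i)) x) j = (if j = k then x else 0)" for x j
      using e(1)[of "s k (pc i)" k x] e(2)[of j k "s k (pc i)" x] sj[OF k] k by auto
    have wp: "(\<lambda>y. s j (pc i) * V y j) \<in> poly_fun M" for j by (intro pmult pconst Vp)
    have "zgen M (\<lambda>y. Kp ({..<n} - {i}) (\<lambda>j. s j (pc i) * V y j) (\<lambda>j. (s j (pc i))\<^sup>2) (\<lambda>j. l j (pc i)) \<noteq> 0 \<and>
      1 + 3 * (card ({..<n} - {i}) - 1) \<le> card {q. poly (Kp ({..<n} - {i}) (\<lambda>j. s j (pc i) * V y j) (\<lambda>j. (s j (pc i))\<^sup>2) (\<lambda>j. l j (pc i))) q = 0})"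
      by (rule zgen_Kp_roots[where k = k and y = "e k (s k (pc i))" and w = "\<lambda>j y. s j (pc i) * V y j"])
        (use k sj lj ey wp in \<open>auto simp: inj_on_def\<close>)
    then show "zgen M (\<lambda>y. Kp ({..<n} - {i}) (\<lambda>j. s j (pc i) * V y j) (\<lambda>j. (s j (pc i))\<^sup>2) (\<lambda>j. l j (pc i)) \<noteq> 0 \<and>
      3 * n - 5 \<le> card {q. poly (Kp ({..<n} - {i}) (\<lambda>j. s j (pc i) * V y j) (\<lambda>j. (s j (pc i))\<^sup>2) (\<lambda>j. l j (pc i))) q = 0})"
      unfolding ca[OF i] .
    show "zgen M (\<lambda>y. poly (Kp ({..<n} - {i}) (\<lambda>j. s j (pc i) * V y j) (\<lambda>j. (s j (pc i))\<^sup>2) (\<lambda>j. l j (pc i))) (l i (pc i)) \<noteq> 0)"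
      by (rule zgen_Kp_value[where k = k and y = "e k (s k (pc i))" and w = "\<lambda>j y. s j (pc i) * V y j"])
        (use k i lj ey wp in auto)
  qed
  let ?Pr = "{(i,j). i < j \<and> j < n}"
  have finPr: "finite ?Pr" by (rule finite_subset[of _ "{..<n} \<times> {..<n}"]) auto
  have Z4: "zgen M (\<lambda>y. \<forall>ij\<in>?Pr. (\<lambda>(i,j). Kp ({..<n} - {j}) (\<lambda>k. s k (pl i j) * V y k + (if k = i then s j (pl i j) * V y j else 0))
           (\<lambda>k. (s k (pl i j))\<^sup>2 + (if k = i then (s j (pl i j))\<^sup>2 else 0)) (\<lambda>k. l k (pl i j)) \<noteq> 0 \<and>
      3 * n - 5 \<le> card {q. poly (Kp ({..<n} - {j}) (\<lambda>k. s k (pl i j) * V y k + (if k = i then s j (pl i j) * V y j else 0))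
           (\<lambda>k. (s k (pl i j))\<^sup>2 + (if k = i then (s j (pl i j))\<^sup>2 else 0)) (\<lambda>k. l k (pl i j))) q = 0}) ij)"
  proof (rule zgen_ball[OF finPr])
    fix ij assume "ij \<in> ?Pr"
    then obtain i j where ij: "ij = (i, j)" "i < j" "j < n" by auto
    define z where "z = pl i j"
    have sk: "s k z \<noteq> 0" if "k < n" for k using s_pl[OF ij(2,3) that] z_def by simp
    have sq: "(s i z)\<^sup>2 + (s j z)\<^sup>2 \<noteq> 0" using sq_pl[OF ij(2,3)] z_def by simp
    have lk: "l a z \<noteq> l b z" if H: "a < n" "b < n" "a \<noteq> b" "a \<noteq> j" "b \<noteq> j" for a b
    proof
      assume "l a z = l b z"
      then have ez: "z = pl a b" using l_eq_iff[OF H(1-3)] by simp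
      consider "a < b" | "b < a" using H(3) by linarith
      then show False
      proof cases
        case 1
        then show False using pl_inj[OF ij(2,3) 1 H(2)] ez H(4,5) unfolding z_def by auto
      next
        case 2
        then show False using pl_inj[OF ij(2,3) 2 H(1)] ez H(4,5) pl_sym[of a b] unfolding z_def by auto
      qed
    qed
    have ey: "s k z * V (e i (s i z) x) k + (if k = i then s j z * V (e i (s i z) x) j else 0) = (if k = i then x else 0)"
      if "k \<in> {..<n} - {j}" for x k
      using e(1)[of "s i z" i x] e(2)[of k i "s i z" x] e(2)[of j i "s i z" x] sk[of i] ij by auto
    have wp: "(\<lambda>y. s k z * V y k + (if k = i then s j z * V y j else 0)) \<in> poly_fun M" for k
      by (cases "k = i") (auto intro!: poly_fun_intros Vp)
    have "zgen M (\<lambda>y. Kp ({..<n} - {j}) (\<lambda>k. s k z * V y k + (if k = i then s j z * V y j else 0))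
           (\<lambda>k. (s k z)\<^sup>2 + (if k = i then (s j z)\<^sup>2 else 0)) (\<lambda>k. l k z) \<noteq> 0 \<and>
      1 + 3 * (card ({..<n} - {j}) - 1) \<le> card {q. poly (Kp ({..<n} - {j}) (\<lambda>k. s k z * V y k + (if k = i then s j z * V y j else 0))
           (\<lambda>k. (s k z)\<^sup>2 + (if k = i then (s j z)\<^sup>2 else 0)) (\<lambda>k. l k z)) q = 0})"
    proof (rule zgen_Kp_roots[where k = i and y = "e i (s i z)" and w = "\<lambda>k y. s k z * V y k + (if k = i then s j z * V y j else 0)"])
      show "inj_on (\<lambda>k. l k z) ({..<n} - {j})" using lk unfolding inj_on_def by auto
      show "i \<in> {..<n} - {j}" using ij by auto
      show "(s k z)\<^sup>2 + (if k = i then (s j z)\<^sup>2 else 0) \<noteq> 0" if "k \<in> {..<n} - {j}" for k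
        using sq sk[of k] that by auto
    qed (use ey wp in auto)
    then show "zgen M (\<lambda>y. (\<lambda>(i,j). Kp ({..<n} - {j}) (\<lambda>k. s k (pl i j) * V y k + (if k = i then s j (pl i j) * V y j else 0))
           (\<lambda>k. (s k (pl i j))\<^sup>2 + (if k = i then (s j (pl i j))\<^sup>2 else 0)) (\<lambda>k. l k (pl i j)) \<noteq> 0 \<and>
      3 * n - 5 \<le> card {q. poly (Kp ({..<n} - {j}) (\<lambda>k. s k (pl i j) * V y k + (if k = i then s j (pl i j) * V y j else 0))
           (\<lambda>k. (s k (pl i j))\<^sup>2 + (if k = i then (s j (pl i j))\<^sup>2 else 0)) (\<lambda>k. l k (pl i j))) q = 0}) ij)"
      unfolding ca[OF ij(3)] ij(1) z_def prod.case .
  qed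
  have tc: "tcams n be ga la mu" by (rule tcams_axioms)
  from zgen_conj[OF Z1 zgen_conj[OF Z2 zgen_conj[OF Z3 Z4]]]
  have "zgen M (\<lambda>y. gcams n be ga la mu (V y))"
  proof (rule zgen_mono)
    fix y assume H: "(\<forall>i<n. V y i \<noteq> 0) \<and> (Kp {..<n} (\<lambda>i. be i * V y i) (\<lambda>i. (be i)\<^sup>2) la \<noteq> 0 \<and>
     3 * n - 2 \<le> card {q. poly (Kp {..<n} (\<lambda>i. be i * V y i) (\<lambda>i. (be i)\<^sup>2) la) q = 0}) \<and>
     (\<forall>i<n. (Kp ({..<n} - {i}) (\<lambda>j. s j (pc i) * V y j) (\<lambda>j. (s j (pc i))\<^sup>2) (\<lambda>j. l j (pc i)) \<noteq> 0 \<and>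
      3 * n - 5 \<le> card {q. poly (Kp ({..<n} - {i}) (\<lambda>j. s j (pc i) * V y j) (\<lambda>j. (s j (pc i))\<^sup>2) (\<lambda>j. l j (pc i))) q = 0}) \<and>
      poly (Kp ({..<n} - {i}) (\<lambda>j. s j (pc i) * V y j) (\<lambda>j. (s j (pc i))\<^sup>2) (\<lambda>j. l j (pc i))) (l i (pc i)) \<noteq> 0) \<and>
     (\<forall>ij\<in>?Pr. (\<lambda>(i,j). Kp ({..<n} - {j}) (\<lambda>k. s k (pl i j) * V y k + (if k = i then s j (pl i j) * V y j else 0))
           (\<lambda>k. (s k (pl i j))\<^sup>2 + (if k = i then (s j (pl i j))\<^sup>2 else 0)) (\<lambda>k. l k (pl i j)) \<noteq> 0 \<and>
      3 * n - 5 \<le> card {q. poly (Kp ({..<n} - {j}) (\<lambda>k. s k (pl i j) * V y k + (if k = i then s j (pl i j) * V y j else 0))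
           (\<lambda>k. (s k (pl i j))\<^sup>2 + (if k = i then (s j (pl i j))\<^sup>2 else 0)) (\<lambda>k. l k (pl i j))) q = 0}) ij)"
    show "gcams n be ga la mu (V y)"
    proof (rule gcams.intro[OF tc], rule gcams_axioms.intro)
      fix i j assume "i < j" "j < n"
      then have ij: "(i, j) \<in> ?Pr" by simp
      from H have "\<forall>ij\<in>?Pr. (\<lambda>(i,j). Kp ({..<n} - {j}) (\<lambda>k. s k (pl i j) * V y k + (if k = i then s j (pl i j) * V y j else 0))
           (\<lambda>k. (s k (pl i j))\<^sup>2 + (if k = i then (s j (pl i j))\<^sup>2 else 0)) (\<lambda>k. l k (pl i j)) \<noteq> 0 \<and>
      3 * n - 5 \<le> card {q. poly (Kp ({..<n} - {j}) (\<lambda>k. s k (pl i j) * V y k + (if k = i then s j (pl i j) * V y j else 0))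
           (\<lambda>k. (s k (pl i j))\<^sup>2 + (if k = i then (s j (pl i j))\<^sup>2 else 0)) (\<lambda>k. l k (pl i j))) q = 0}) ij" by (elim conjE)
      from bspec[OF this ij, unfolded prod.case]
      show "Kp ({..<n} - {j}) (\<lambda>k. s k (pl i j) * V y k + (if k = i then s j (pl i j) * V y j else 0))
           (\<lambda>k. (s k (pl i j))\<^sup>2 + (if k = i then (s j (pl i j))\<^sup>2 else 0)) (\<lambda>k. l k (pl i j)) \<noteq> 0"
        "3 * n - 5 \<le> card {q. poly (Kp ({..<n} - {j}) (\<lambda>k. s k (pl i j) * V y k + (if k = i then s j (pl i j) * V y j else 0))
           (\<lambda>k. (s k (pl i j))\<^sup>2 + (if k = i then (s j (pl i j))\<^sup>2 else 0)) (\<lambda>k. l k (pl i j))) q = 0}"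
        by (rule conjunct1, rule conjunct2)
    qed (use H in blast)+
  qed
  then show ?thesis unfolding V_def .
qed

end

text \<open>Multiplied by the differences of the \<open>la\<close>, or by the \<open>be\<close>,
  every condition becomes a polynomial one and needs a single witness; \<open>X\<close> assembles
  parameter vectors from prescribed \<open>be\<close>, \<open>ga\<close>, \<open>la\<close>,
  \<open>mu\<close>.\<close>

lemma tcams_generic:
  assumes n: "n \<ge> 2" and M: "4 * n \<le> M"
  shows "zgen M (\<lambda>x. tcams n (Be n x) (Ga n x) (La n x) (Mu n x))"
proof -
  let ?Pr = "{(i,j). i < j \<and> j < n}"
  have finPr: "finite ?Pr" by (rule finite_subset[of _ "{..<n} \<times> {..<n}"]) auto
  note pp = par_poly_fun[OF M]
  define X where "X = (\<lambda>b g a u m::nat. if m mod 4 = 0 then b (m div 4) else if m mod 4 = 1 then g (m div 4)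
    else if m mod 4 = 2 then a (m div 4) else (u (m div 4) :: complex))"
  have X: "Be n (X b g a u) i = b i" "Ga n (X b g a u) i = g i" "La n (X b g a u) i = a i" "Mu n (X b g a u) i = u i" if "i < n" for b g a u i
  proof -
    have "(4 * i + 3) mod 4 = 3" "(4 * i + 3) div 4 = i" "(4 * i + 2) mod 4 = 2" "(4 * i + 2) div 4 = i"
      "(4 * i + 1) mod 4 = 1" "(4 * i + 1) div 4 = i" by presburger+
    then show "Be n (X b g a u) i = b i" "Ga n (X b g a u) i = g i" "La n (X b g a u) i = a i" "Mu n (X b g a u) i = u i"
      unfolding par_defs X_def using that by simp_all
  qed
  have A: "zgen M (\<lambda>x. \<forall>i<n. Be n x i \<noteq> 0)"
    by (intro zgen_all_less zgen_neq[where x = "\<lambda>_. 1"] pp) (simp add: par_defs)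
  have B: "zgen M (\<lambda>x. \<forall>i<n. \<forall>j<n. i \<noteq> j \<longrightarrow> La n x i \<noteq> La n x j)"
  proof (intro zgen_all_less zgen_imp)
    fix i j assume "i < n" "j < n" "i \<noteq> j"
    then show "zgen M (\<lambda>x. La n x i \<noteq> La n x j)"
      by (intro zgen_neq2[where x = "X (\<lambda>_. 0) (\<lambda>_. 0) (\<lambda>k. if k = i then 1 else 0) (\<lambda>_. 0)"] pp) (simp add: X)
  qed
  have C: "zgen M (\<lambda>x. \<forall>i<n. \<forall>j<n. i \<noteq> j \<longrightarrow> Ga n x i * Be n x j \<noteq> Ga n x j * Be n x i)"
  proof (intro zgen_all_less zgen_imp)
    fix i j assume "i < n" "j < n" "i \<noteq> j"
    then show "zgen M (\<lambda>x. Ga n x i * Be n x j \<noteq> Ga n x j * Be n x i)"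
      by (intro zgen_neq2[where x = "X (\<lambda>_. 1) (\<lambda>k. if k = i then 1 else 0) (\<lambda>_. 0) (\<lambda>_. 0)"] poly_fun_intros pp) (simp add: X)
  qed
  have D: "zgen M (\<lambda>x. \<forall>ij\<in>?Pr. \<forall>k<n. Be n x k * (Mu n x (snd ij) - Mu n x (fst ij)) + Ga n x k * (La n x (fst ij) - La n x (snd ij)) \<noteq> 0)"
  proof (intro zgen_ball[OF finPr] zgen_all_less)
    fix ij k assume "ij \<in> ?Pr" "k < n"
    then show "zgen M (\<lambda>x. Be n x k * (Mu n x (snd ij) - Mu n x (fst ij)) + Ga n x k * (La n x (fst ij) - La n x (snd ij)) \<noteq> 0)"
      by (intro zgen_neq[where x = "X (\<lambda>_. 0) (\<lambda>_. 1) (\<lambda>k. if k = fst ij then 1 else 0) (\<lambda>_. 0)"] poly_fun_intros pp) (auto simp: X)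
  qed
  have E: "zgen M (\<lambda>x. \<forall>ij\<in>?Pr. \<forall>km\<in>?Pr. ij \<noteq> km \<longrightarrow>
     (Mu n x (snd ij) - Mu n x (fst ij)) * (La n x (fst km) - La n x (snd km)) \<noteq> (Mu n x (snd km) - Mu n x (fst km)) * (La n x (fst ij) - La n x (snd ij)))"
  proof (intro zgen_ball[OF finPr] zgen_imp)
    fix ij km assume H: "ij \<in> ?Pr" "km \<in> ?Pr" "ij \<noteq> km"
    \<comment> \<open>Two different pairs leave an index of \<open>ij\<close> outside
      \<open>km\<close>. With \<open>mu\<close> supported there and \<open>la\<close> supported at
      the first index of \<open>km\<close>, the left side is nonzero and the right side is
      0.\<close>
    obtain a where a: "a = fst ij \<or> a = snd ij" "a \<noteq> fst km" "a \<noteq> snd km"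
    proof -
      have "(fst ij \<noteq> fst km \<and> fst ij \<noteq> snd km) \<or> (snd ij \<noteq> fst km \<and> snd ij \<noteq> snd km)"
        using H by (auto simp: split_beta prod_eq_iff)
      then show ?thesis using that by blast
    qed
    let ?x = "X (\<lambda>_. 0) (\<lambda>_. 0) (\<lambda>k. if k = fst km then 1 else 0) (\<lambda>k. if k = a then 1 else 0)"
    have "(Mu n ?x (snd ij) - Mu n ?x (fst ij)) * (La n ?x (fst km) - La n ?x (snd km)) \<noteq> (Mu n ?x (snd km) - Mu n ?x (fst km)) * (La n ?x (fst ij) - La n ?x (snd ij))"
      using H a by (auto simp: X)
    then show "zgen M (\<lambda>x. (Mu n x (snd ij) - Mu n x (fst ij)) * (La n x (fst km) - La n x (snd km)) \<noteq> (Mu n x (snd km) - Mu n x (fst km)) * (La n x (fst ij) - La n x (snd ij)))"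
      by (intro zgen_neq2[where x = ?x] poly_fun_intros pp)
  qed
  have F: "zgen M (\<lambda>x. \<forall>ij\<in>?Pr. (Be n x (fst ij) * (Mu n x (snd ij) - Mu n x (fst ij)) + Ga n x (fst ij) * (La n x (fst ij) - La n x (snd ij)))\<^sup>2
     + (Be n x (snd ij) * (Mu n x (snd ij) - Mu n x (fst ij)) + Ga n x (snd ij) * (La n x (fst ij) - La n x (snd ij)))\<^sup>2 \<noteq> 0)"
  proof (intro zgen_ball[OF finPr])
    fix ij assume H: "ij \<in> ?Pr"
    then show "zgen M (\<lambda>x. (Be n x (fst ij) * (Mu n x (snd ij) - Mu n x (fst ij)) + Ga n x (fst ij) * (La n x (fst ij) - La n x (snd ij)))\<^sup>2
     + (Be n x (snd ij) * (Mu n x (snd ij) - Mu n x (fst ij)) + Ga n x (snd ij) * (La n x (fst ij) - La n x (snd ij)))\<^sup>2 \<noteq> 0)"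
      by (intro zgen_neq[where x = "X (\<lambda>_. 0) (\<lambda>k. if k = fst ij then 1 else 0) (\<lambda>k. if k = fst ij then 1 else 0) (\<lambda>_. 0)"] poly_fun_intros pp)
        (auto simp: X)
  qed
  from zgen_conj[OF A zgen_conj[OF B zgen_conj[OF C zgen_conj[OF D zgen_conj[OF E F]]]]]
  show ?thesis
  proof (rule zgen_mono, elim conjE)
    fix x
    assume A: "\<forall>i<n. Be n x i \<noteq> 0" and B: "\<forall>i<n. \<forall>j<n. i \<noteq> j \<longrightarrow> La n x i \<noteq> La n x j"
      and C: "\<forall>i<n. \<forall>j<n. i \<noteq> j \<longrightarrow> Ga n x i * Be n x j \<noteq> Ga n x j * Be n x i"
      and D: "\<forall>ij\<in>?Pr. \<forall>k<n. Be n x k * (Mu n x (snd ij) - Mu n x (fst ij)) + Ga n x k * (La n x (fst ij) - La n x (snd ij)) \<noteq> 0"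
      and E: "\<forall>ij\<in>?Pr. \<forall>km\<in>?Pr. ij \<noteq> km \<longrightarrow>
     (Mu n x (snd ij) - Mu n x (fst ij)) * (La n x (fst km) - La n x (snd km)) \<noteq> (Mu n x (snd km) - Mu n x (fst km)) * (La n x (fst ij) - La n x (snd ij))"
      and F: "\<forall>ij\<in>?Pr. (Be n x (fst ij) * (Mu n x (snd ij) - Mu n x (fst ij)) + Ga n x (fst ij) * (La n x (fst ij) - La n x (snd ij)))\<^sup>2
     + (Be n x (snd ij) * (Mu n x (snd ij) - Mu n x (fst ij)) + Ga n x (snd ij) * (La n x (fst ij) - La n x (snd ij)))\<^sup>2 \<noteq> 0"
    have Lnz: "La n x i - La n x j \<noteq> 0" if "i < j" "j < n" for i j using B that by auto
    have sv: "cams.s (Be n x) (Ga n x) k (cams.pl (La n x) (Mu n x) i j) * (La n x i - La n x j)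
       = Be n x k * (Mu n x j - Mu n x i) + Ga n x k * (La n x i - La n x j)" if "i < j" "j < n" for i j k
      unfolding cams.s_def cams.pl_def using Lnz[OF that] by (simp add: distrib_right)
    show "tcams n (Be n x) (Ga n x) (La n x) (Mu n x)"
    proof (unfold_locales)
      show "2 \<le> n" by (rule n)
      show "Be n x i \<noteq> 0" if "i < n" for i using A that by blast
      show "La n x i \<noteq> La n x j" if "i < n" "j < n" "i \<noteq> j" for i j using B that by blast
      show "cams.pc (Be n x) (Ga n x) i \<noteq> cams.pc (Be n x) (Ga n x) j" if "i < n" "j < n" "i \<noteq> j" for i j
      proof
        assume "cams.pc (Be n x) (Ga n x) i = cams.pc (Be n x) (Ga n x) j"
        then have "Ga n x i * Be n x j = Ga n x j * Be n x i"
          using A that unfolding cams.pc_def by (simp add: frac_eq_eq)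
        then show False using C that by blast
      qed
      show "cams.s (Be n x) (Ga n x) k (cams.pl (La n x) (Mu n x) i j) \<noteq> 0" if "i < j" "j < n" "k < n" for i j k
      proof
        assume "cams.s (Be n x) (Ga n x) k (cams.pl (La n x) (Mu n x) i j) = 0"
        then have "Be n x k * (Mu n x j - Mu n x i) + Ga n x k * (La n x i - La n x j) = 0" using sv[OF that(1,2), of k] by simp
        moreover have "(i, j) \<in> ?Pr" using that by simp
        ultimately show False using D that(3) by fastforce
      qed
      show "i = k \<and> j = m" if H: "i < j" "j < n" "k < m" "m < n" "cams.pl (La n x) (Mu n x) i j = cams.pl (La n x) (Mu n x) k m" for i j k m
      proof (rule ccontr)
        assume "\<not> (i = k \<and> j = m)"
        then have "(i, j) \<noteq> (k, m)" by simp
        moreover have "(i, j) \<in> ?Pr" "(k, m) \<in> ?Pr" using H by simp_all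
        ultimately have "(Mu n x j - Mu n x i) * (La n x k - La n x m) \<noteq> (Mu n x m - Mu n x k) * (La n x i - La n x j)"
          using E by fastforce
        then show False using H(5) Lnz[OF H(1,2)] Lnz[OF H(3,4)] unfolding cams.pl_def by (simp add: frac_eq_eq)
      qed
      show "(cams.s (Be n x) (Ga n x) i (cams.pl (La n x) (Mu n x) i j))\<^sup>2 + (cams.s (Be n x) (Ga n x) j (cams.pl (La n x) (Mu n x) i j))\<^sup>2 \<noteq> 0"
        if "i < j" "j < n" for i j
      proof
        let ?S = "\<lambda>k. cams.s (Be n x) (Ga n x) k (cams.pl (La n x) (Mu n x) i j)"
        assume "(?S i)\<^sup>2 + (?S j)\<^sup>2 = 0"
        then have "(?S i * (La n x i - La n x j))\<^sup>2 + (?S j * (La n x i - La n x j))\<^sup>2 = 0"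
          by (simp add: power_mult_distrib distrib_right[symmetric])
        moreover have "(i, j) \<in> ?Pr" using that by simp
        ultimately show False using F unfolding sv[OF that] by fastforce
      qed
    qed
  qed
qed

definition nsol :: "nat \<Rightarrow> nat" where "nsol n = 3 * n - 2 + n + 9 * card {(i,j). i < j \<and> j < n}"

text \<open>The number of common zeros is a generic constant \<open>K\<close>. For suitable cameras
  and data the count of \<open>card_sols\<close> holds for all but countably many w, and
  \<open>K\<close> is attained for all but finitely many w, so some w satisfies both and determines
  \<open>K\<close>.\<close>

theorem card_sols_generic:
  assumes n: "n \<ge> 2"
  shows "zgen (5 * n + 1) (\<lambda>x. tcams n (Be n x) (Ga n x) (La n x) (Mu n x) \<and>
     finite (cams.sols n (Be n x) (Ga n x) (La n x) (Mu n x) (Ve n x) (x (5 * n))) \<and>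
     card (cams.sols n (Be n x) (Ga n x) (La n x) (Mu n x) (Ve n x) (x (5 * n))) = nsol n)"
proof -
  define M where "M = 5 * n + 1"
  define T where "T = (\<lambda>x. tcams n (Be n x) (Ga n x) (La n x) (Mu n x))"
  define S where "S = (\<lambda>x. cams.sols n (Be n x) (Ga n x) (La n x) (Mu n x) (Ve n x) (x (5 * n)))"
  define C where "C = (\<lambda>x. cams.CZ n (Be n x) (Ga n x) (La n x) (Mu n x) (Ve n x) (x (5 * n)))"
  define mix where "mix = (\<lambda>k (x::nat \<Rightarrow> complex) y i. if i < k then x i else y i)"
  have Tz: "zgen M T" unfolding T_def M_def by (rule tcams_generic[OF n]) simp
  have low: "Be n (mix k x y) = Be n x" "Ga n (mix k x y) = Ga n x" "La n (mix k x y) = La n x" "Mu n (mix k x y) = Mu n x" if "4 * n \<le> k" for k x y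
    using that unfolding par_defs mix_def by (auto simp: fun_eq_iff)
  have Vlow: "Ve n (mix (5 * n) x y) = Ve n x" "Ve n (mix (4 * n) x y) = Ve n y" for x y
    unfolding par_defs mix_def by (auto simp: fun_eq_iff)
  have Tmix: "T (mix k x y) = T x" if "4 * n \<le> k" for k x y unfolding T_def low[OF that] ..
  have Gz: "zgen M (\<lambda>y. gcams n (Be n x) (Ga n x) (La n x) (Mu n x) (Ve n y))" if "T x" for x
  proof -
    have "zgen M (\<lambda>y. gcams n (Be n x) (Ga n x) (La n x) (Mu n x) (\<lambda>i. if i < n then y (4 * n + i) else 0))"
      by (rule tcams.gcams_generic) (use that in \<open>simp_all add: T_def M_def\<close>)
    then show ?thesis unfolding Ve_def by simp
  qed
  have CS: "card (C x) = card (S x) + n + card {(i,j). i < j \<and> j < n}" "finite (C x)" if "T x" "finite (S x)" for x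
    using tcams.CZ_sols[of n "Be n x" "Ga n x" "La n x" "Mu n x"] that unfolding T_def C_def S_def by blast+
  have CS': "finite (S x)" if "T x" "finite (C x)" for x
    using tcams.CZ_sols(1)[of n "Be n x" "Ga n x" "La n x" "Mu n x"] that unfolding T_def C_def S_def by blast
  have count: "\<exists>W. countable W \<and> (\<forall>w. w \<notin> W \<longrightarrow> finite (cams.sols n (Be n x) (Ga n x) (La n x) (Mu n x) (Ve n y) w) \<and>
      card (cams.sols n (Be n x) (Ga n x) (La n x) (Mu n x) (Ve n y) w) = nsol n)"
    if "gcams n (Be n x) (Ga n x) (La n x) (Mu n x) (Ve n y)" for x y
    unfolding nsol_def by (rule gcams.card_sols[OF that])
  have uncount: "\<exists>w. w \<notin> W" if "countable W" for W :: "complex set"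
    using that uncountable_UNIV_complex by (metis UNIV_eq_I)
  \<comment> \<open>The first witness only supplies a parameter with finitely many common zeros,
    which \<open>generic_constant_CZ\<close> requires.\<close>
  obtain x0 where x0: "T x0" using zgen_ex[OF Tz] by blast
  obtain y0 where y0: "gcams n (Be n x0) (Ga n x0) (La n x0) (Mu n x0) (Ve n y0)" using zgen_ex[OF Gz[OF x0]] by blast
  obtain W0 where W0: "countable W0" "\<forall>w. w \<notin> W0 \<longrightarrow> finite (cams.sols n (Be n x0) (Ga n x0) (La n x0) (Mu n x0) (Ve n y0) w) \<and>
      card (cams.sols n (Be n x0) (Ga n x0) (La n x0) (Mu n x0) (Ve n y0) w) = nsol n" using count[OF y0] by blast
  obtain w0 where w0: "w0 \<notin> W0" using uncount[OF W0(1)] by blast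
  define a where "a = mix (5 * n) (mix (4 * n) x0 y0) (\<lambda>_. w0)"
  have a: "Be n a = Be n x0" "Ga n a = Ga n x0" "La n a = La n x0" "Mu n a = Mu n x0" "Ve n a = Ve n y0" "a (5 * n) = w0"
    unfolding a_def using low[of "5 * n"] low[of "4 * n"] Vlow by (simp_all add: mix_def)
  have "finite (S a)" unfolding S_def a using W0(2) w0 by blast
  moreover have "T a" unfolding T_def a using x0 unfolding T_def .
  ultimately have "finite (C a)" using CS(2) by blast
  then obtain K where K: "zgen M (\<lambda>x. finite (C x) \<and> card (C x) = K)"
    using generic_constant_CZ[of n a] n unfolding C_def M_def by auto
  define P where "P = (\<lambda>x. (finite (C x) \<and> card (C x) = K) \<and> T x)"
  have Pz: "zgen M P" unfolding P_def by (rule zgen_conj[OF K Tz])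
  \<comment> \<open>The second witness lies in the generic set: cameras, data and w are chosen one
    after the other, each leaving a generic condition on the rest.\<close>
  have "zgen (4 * n) (\<lambda>x. zgen M (\<lambda>y. P (mix (4 * n) x y)))"
    unfolding mix_def by (rule zgen_fix[OF Pz]) (simp add: M_def)
  then obtain x1 where x1: "zgen M (\<lambda>y. P (mix (4 * n) x1 y))" using zgen_ex by blast
  have Tx1: "T x1" using zgen_ex[OF x1] Tmix[of "4 * n"] unfolding P_def by auto
  have "zgen (5 * n) (\<lambda>y. zgen M (\<lambda>z. P (mix (4 * n) x1 (mix (5 * n) y z)) \<and> gcams n (Be n x1) (Ga n x1) (La n x1) (Mu n x1) (Ve n (mix (5 * n) y z))))"
    unfolding mix_def by (rule zgen_fix[OF zgen_conj[OF x1[unfolded mix_def] Gz[OF Tx1]]]) (simp add: M_def)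
  then obtain y1 where y1: "zgen M (\<lambda>z. P (mix (4 * n) x1 (mix (5 * n) y1 z)) \<and> gcams n (Be n x1) (Ga n x1) (La n x1) (Mu n x1) (Ve n (mix (5 * n) y1 z)))"
    using zgen_ex by blast
  have g1: "gcams n (Be n x1) (Ga n x1) (La n x1) (Mu n x1) (Ve n y1)" using zgen_ex[OF y1] Vlow by auto
  have Pdep: "P (mix (4 * n) x1 (mix (5 * n) y1 z)) = P (mix (4 * n) x1 (mix (5 * n) y1 (\<lambda>_. z (5 * n))))" for z
  proof -
    have 1: "Ve n (mix (4 * n) x1 (mix (5 * n) y1 z)) = Ve n y1" for z using Vlow by simp
    have 2: "mix (4 * n) x1 (mix (5 * n) y1 z) (5 * n) = z (5 * n)" for z using n unfolding mix_def by simp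
    show ?thesis unfolding P_def T_def C_def 1 2 low[OF order.refl] ..
  qed
  have "zgen (Suc (5 * n)) (\<lambda>z. P (mix (4 * n) x1 (mix (5 * n) y1 (\<lambda>_. z (5 * n)))))"
    using zgen_mono[OF y1, of "\<lambda>z. P (mix (4 * n) x1 (mix (5 * n) y1 (\<lambda>_. z (5 * n))))"] Pdep unfolding M_def by auto
  from zgen_last_finite[of "5 * n" "\<lambda>c. P (mix (4 * n) x1 (mix (5 * n) y1 (\<lambda>_. c)))", OF this]
  have fin: "finite {c. \<not> P (mix (4 * n) x1 (mix (5 * n) y1 (\<lambda>_. c)))}" .
  obtain W1 where W1: "countable W1" "\<forall>w. w \<notin> W1 \<longrightarrow> finite (cams.sols n (Be n x1) (Ga n x1) (La n x1) (Mu n x1) (Ve n y1) w) \<and>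
      card (cams.sols n (Be n x1) (Ga n x1) (La n x1) (Mu n x1) (Ve n y1) w) = nsol n" using count[OF g1] by blast
  have "countable (W1 \<union> {c. \<not> P (mix (4 * n) x1 (mix (5 * n) y1 (\<lambda>_. c)))})" using W1(1) fin by (simp add: countable_finite)
  from uncount[OF this] obtain w1 where w1: "w1 \<notin> W1" "P (mix (4 * n) x1 (mix (5 * n) y1 (\<lambda>_. w1)))" by blast
  define b where "b = mix (4 * n) x1 (mix (5 * n) y1 (\<lambda>_. w1))"
  have b: "Be n b = Be n x1" "Ga n b = Ga n x1" "La n b = La n x1" "Mu n b = Mu n x1" "Ve n b = Ve n y1" "b (5 * n) = w1"
    unfolding b_def using low[of "4 * n"] Vlow n by (simp_all add: mix_def)
  have "finite (S b)" "card (S b) = nsol n" unfolding S_def b using W1(2) w1(1) by blast+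
  moreover have "P b" using w1(2) unfolding b_def .
  ultimately have Keq: "K = nsol n + n + card {(i,j). i < j \<and> j < n}" using CS(1)[of b] unfolding P_def by simp
  show ?thesis
    using Pz unfolding M_def
  proof (rule zgen_mono)
    fix x assume p: "P x"
    then have t: "T x" and c: "finite (C x)" "card (C x) = K" unfolding P_def by auto
    have f: "finite (S x)" by (rule CS'[OF t c(1)])
    have "card (S x) = nsol n" using CS(1)[OF t f] c(2) Keq by linarith
    then show "tcams n (Be n x) (Ga n x) (La n x) (Mu n x) \<and>
     finite (cams.sols n (Be n x) (Ga n x) (La n x) (Mu n x) (Ve n x) (x (5 * n))) \<and>
     card (cams.sols n (Be n x) (Ga n x) (La n x) (Mu n x) (Ve n x) (x (5 * n))) = nsol n"
      using t f unfolding T_def S_def by blast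
  qed
qed

section \<open>Tangents, normals and critical points\<close>

lemma poly_fun_partial:
  assumes "f \<in> poly_fun m"
  shows "((\<lambda>t. f (z(i := t))) has_field_derivative partial f i z) (at (z i))"
proof -
  have "(\<lambda>t. f (z(i := t))) field_differentiable (at (z i))"
    using assms
  proof induction
    case (pconst c)
    show ?case by (rule field_differentiable_const)
  next
    case (pvar k)
    show ?case by (cases "k = i") (simp_all add: field_differentiable_ident field_differentiable_const)
  next
    case (padd f g)
    show ?case by (rule field_differentiable_add[OF padd.IH])
  next
    case (pmult f g)
    show ?case by (rule field_differentiable_mult[OF pmult.IH])
  qed
  then show ?thesis unfolding partial_def by (rule field_differentiable_derivI)
qed

lemma partial_const: "partial (\<lambda>x. c) i z = 0"
  unfolding partial_def by simp

lemma partial_var: "partial (\<lambda>x. x k) i z = (if k = i then 1 else 0)"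
  unfolding partial_def by (cases "k = i") simp_all

lemma partial_add:
  assumes "f \<in> poly_fun m" "g \<in> poly_fun m"
  shows "partial (\<lambda>x. f x + g x) i z = partial f i z + partial g i z"
  unfolding partial_def[of "\<lambda>x. f x + g x"]
  by (rule DERIV_imp_deriv[OF DERIV_add[OF assms[THEN poly_fun_partial]]])

lemma partial_mult:
  assumes "f \<in> poly_fun m" "g \<in> poly_fun m"
  shows "partial (\<lambda>x. f x * g x) i z = partial f i z * g z + partial g i z * f z"
  unfolding partial_def[of "\<lambda>x. f x * g x"]
  using DERIV_imp_deriv[OF DERIV_mult[OF poly_fun_partial[OF assms(1), of z i] poly_fun_partial[OF assms(2), of z i]]] by simp

lemma poly_fun_chain:
  assumes f: "f \<in> poly_fun m" and x: "\<And>i. i < m \<Longrightarrow> ((\<lambda>t. x t i) has_field_derivative \<tau> i) (at b)"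
  shows "((\<lambda>t. f (x t)) has_field_derivative (\<Sum>i<m. partial f i (x b) * \<tau> i)) (at b)"
  using f
proof induction
  case (pconst c)
  show ?case by (simp add: partial_const)
next
  case (pvar k)
  have "(\<Sum>i<m. partial (\<lambda>x. x k) i (x b) * \<tau> i) = (\<Sum>i<m. if i = k then \<tau> i else 0)"
    by (rule sum.cong) (auto simp: partial_var)
  then show ?case using x[OF pvar] pvar by simp
next
  case (padd f g)
  have "(\<Sum>i<m. partial (\<lambda>x. f x + g x) i (x b) * \<tau> i) = (\<Sum>i<m. partial f i (x b) * \<tau> i) + (\<Sum>i<m. partial g i (x b) * \<tau> i)"
    by (simp add: partial_add[OF padd.hyps] distrib_right sum.distrib)
  then show ?case using DERIV_add[OF padd.IH] by simp
next
  case (pmult f g)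
  have "(\<Sum>i<m. partial (\<lambda>x. f x * g x) i (x b) * \<tau> i) =
      (\<Sum>i<m. partial f i (x b) * \<tau> i) * g (x b) + (\<Sum>i<m. partial g i (x b) * \<tau> i) * f (x b)"
    unfolding sum_distrib_right sum.distrib[symmetric]
    by (rule sum.cong) (simp_all add: partial_mult[OF pmult.hyps] algebra_simps)
  then show ?case using DERIV_mult[OF pmult.IH] by simp
qed

lemma zclosure_iff:
  assumes "S \<subseteq> cspace m"
  shows "x \<in> zariski_closure m S \<longleftrightarrow> x \<in> cspace m \<and> (\<forall>f\<in>vanishing_ideal m S. f x = 0)"
proof
  assume x: "x \<in> zariski_closure m S"
  have "zariski_closed m {x \<in> cspace m. \<forall>f\<in>vanishing_ideal m S. f x = 0}"
    unfolding zariski_closed_def by (rule exI[of _ "vanishing_ideal m S"]) (auto simp: vanishing_ideal_def)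
  moreover have "S \<subseteq> {x \<in> cspace m. \<forall>f\<in>vanishing_ideal m S. f x = 0}"
    using assms by (auto simp: vanishing_ideal_def)
  ultimately show "x \<in> cspace m \<and> (\<forall>f\<in>vanishing_ideal m S. f x = 0)"
    using x unfolding zariski_closure_def by blast
next
  assume x: "x \<in> cspace m \<and> (\<forall>f\<in>vanishing_ideal m S. f x = 0)"
  show "x \<in> zariski_closure m S"
    unfolding zariski_closure_def
  proof (rule InterI, elim CollectE conjE)
    fix A assume "zariski_closed m A" "S \<subseteq> A"
    then obtain F where F: "F \<subseteq> poly_fun m" "A = {x \<in> cspace m. \<forall>f\<in>F. f x = 0}"
      unfolding zariski_closed_def by blast
    have "F \<subseteq> vanishing_ideal m S" using F \<open>S \<subseteq> A\<close> unfolding vanishing_ideal_def by blast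
    then show "x \<in> A" using x F(2) by blast
  qed
qed

lemma zclosure_superset: "S \<subseteq> zariski_closure m S"
  unfolding zariski_closure_def by blast

lemma vanishing_zclosure:
  assumes "S \<subseteq> cspace m" "f \<in> poly_fun m" "\<And>x. x \<in> S \<Longrightarrow> f x = 0"
  shows "f \<in> vanishing_ideal m (zariski_closure m S)"
  using assms(2,3) zclosure_iff[OF assms(1)] unfolding vanishing_ideal_def by auto

definition nspace :: "nat \<Rightarrow> (nat \<Rightarrow> complex) set \<Rightarrow> (nat \<Rightarrow> complex) \<Rightarrow> (nat \<Rightarrow> complex) set" where
  "nspace m V z = {y. \<exists>(k::nat) fs c. (\<forall>j<k. fs j \<in> vanishing_ideal m V) \<and>
     (\<forall>i<m. y i = (\<Sum>j<k. c j * partial (fs j) i z))}"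

lemma ed_crit_nspace: "ed_crit m V u z \<longleftrightarrow> smooth_point m V z \<and> (\<lambda>i. u i - z i) \<in> nspace m V z"
  unfolding ed_crit_def nspace_def by simp

lemma nspace_tangent:
  assumes y: "y \<in> nspace m V (x b)" and x: "\<And>i. i < m \<Longrightarrow> ((\<lambda>t. x t i) has_field_derivative \<tau> i) (at b)"
    and V: "\<forall>\<^sub>F t in at b. x t \<in> V"
  shows "(\<Sum>i<m. y i * \<tau> i) = 0"
proof -
  obtain k :: nat and fs c where fs: "\<And>j. j < k \<Longrightarrow> fs j \<in> vanishing_ideal m V"
    and yc: "\<And>i. i < m \<Longrightarrow> y i = (\<Sum>j<k. c j * partial (fs j) i (x b))"
    using y unfolding nspace_def by blast
  have z: "(\<Sum>i<m. partial f i (x b) * \<tau> i) = 0" if f: "f \<in> vanishing_ideal m V" for f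
  proof -
    have D: "((\<lambda>t. f (x t)) has_field_derivative (\<Sum>i<m. partial f i (x b) * \<tau> i)) (at b)"
      by (rule poly_fun_chain) (use f x in \<open>auto simp: vanishing_ideal_def\<close>)
    have ev: "\<forall>\<^sub>F t in at b. f (x t) = 0"
      using V by eventually_elim (use f in \<open>auto simp: vanishing_ideal_def\<close>)
    have "((\<lambda>t. f (x t)) \<longlongrightarrow> 0) (at b)" by (rule tendsto_eventually[OF ev])
    moreover have "((\<lambda>t. f (x t)) \<longlongrightarrow> f (x b)) (at b)" using DERIV_isCont[OF D] by (simp add: isCont_def)
    ultimately have "f (x b) = 0" using tendsto_unique[OF trivial_limit_at] by blast
    then have ev0: "\<forall>\<^sub>F t in nhds b. f (x t) = 0" using ev by (simp add: eventually_nhds_conv_at)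
    have "((\<lambda>t. 0) has_field_derivative (\<Sum>i<m. partial f i (x b) * \<tau> i)) (at b)"
      using D DERIV_cong_ev[OF refl ev0 refl] by blast
    then show ?thesis by (rule DERIV_unique) (rule DERIV_const)
  qed
  have "(\<Sum>i<m. y i * \<tau> i) = (\<Sum>i<m. \<Sum>j<k. c j * (partial (fs j) i (x b) * \<tau> i))"
    by (rule sum.cong) (simp_all add: yc sum_distrib_right mult.assoc)
  also have "\<dots> = (\<Sum>j<k. \<Sum>i<m. c j * (partial (fs j) i (x b) * \<tau> i))" by (rule sum.swap)
  also have "\<dots> = (\<Sum>j<k. c j * (\<Sum>i<m. partial (fs j) i (x b) * \<tau> i))" by (simp add: sum_distrib_left)
  also have "\<dots> = 0" by (rule sum.neutral) (use z fs in simp)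
  finally show ?thesis .
qed

text \<open>If a normal vector is determined by its coordinates in \<open>J\<close>, independent
  gradients stay independent when restricted to \<open>J\<close>. Exhibiting tangent vectors thus
  bounds the rank from above.\<close>

lemma indep_grads_le:
  assumes J: "finite J" and det: "\<And>y. y \<in> nspace m V w \<Longrightarrow> \<forall>i\<in>J. y i = 0 \<Longrightarrow> \<forall>i<m. y i = 0"
    and g: "indep_grads m V w k"
  shows "k \<le> card J"
proof (rule ccontr)
  assume less: "\<not> k \<le> card J"
  obtain fs where fs: "\<forall>j<k. fs j \<in> vanishing_ideal m V"
    and ind: "\<And>c. (\<forall>i<m. (\<Sum>j<k. c j * partial (fs j) i w) = 0) \<Longrightarrow> \<forall>j<k. c j = 0"
    using g unfolding indep_grads_def by blast
  obtain h where h: "bij_betw h {0..<card J} J" using ex_bij_betw_nat_finite[OF J] by blast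
  \<comment> \<open>The restricted gradients padded with a zero row to a square matrix, which is
    therefore singular.\<close>
  define M where "M = (\<lambda>i j. if i < card J then partial (fs j) (h i) w else 0)"
  have "(\<Sum>i<k. (if i = card J then 1 else 0) * M i j) = 0" for j
    by (rule sum.neutral) (auto simp: M_def)
  then have "dt k M = 0"
    unfolding dt_eq_0_iff_left
    by (intro exI[of _ "\<lambda>i. if i = card J then 1 else 0"] conjI exI[of _ "card J"]) (use less in auto)
  then obtain v where v: "\<exists>j<k. v j \<noteq> 0" "\<forall>i<k. (\<Sum>j<k. M i j * v j) = 0" unfolding dt_eq_0_iff by blast
  define y where "y = (\<lambda>i. \<Sum>j<k. v j * partial (fs j) i w)"
  have "y \<in> nspace m V w" unfolding nspace_def y_def using fs by blast
  moreover have "\<forall>i\<in>J. y i = 0"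
  proof
    fix i assume "i \<in> J"
    then have "i \<in> h ` {0..<card J}" using h unfolding bij_betw_def by simp
    then obtain a where a: "a < card J" "h a = i" by auto
    have "(\<Sum>j<k. M a j * v j) = 0" using v(2) a(1) less by simp
    then show "y i = 0" unfolding y_def M_def using a by (simp add: mult.commute)
  qed
  ultimately have "\<forall>i<m. y i = 0" by (rule det)
  then have "\<forall>j<k. v j = 0" by (intro ind) (simp add: y_def)
  then show False using v(1) by blast
qed

lemma indep_grads_mono:
  assumes "indep_grads m V z r" "k \<le> r"
  shows "indep_grads m V z k"
proof -
  obtain fs where fs: "\<forall>j<r. fs j \<in> vanishing_ideal m V"
    and ind: "\<And>c. (\<forall>i<m. (\<Sum>j<r. c j * partial (fs j) i z) = 0) \<Longrightarrow> \<forall>j<r. c j = 0"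
    using assms(1) unfolding indep_grads_def by blast
  show ?thesis unfolding indep_grads_def
  proof (intro exI[of _ fs] conjI allI impI)
    fix c j assume c: "\<forall>i<m. (\<Sum>j<k. c j * partial (fs j) i z) = 0" and j: "j < k"
    have "(\<Sum>j<r. (if j < k then c j else 0) * partial (fs j) i z) = (\<Sum>j<k. c j * partial (fs j) i z)" for i
      by (rule sum.mono_neutral_cong_right) (use assms(2) in auto)
    then have "\<forall>j<r. (if j < k then c j else 0) = 0" using c by (intro ind) simp
    then show "c j = 0" using j assms(2) by (metis order.strict_trans2)
  qed (use fs assms(2) in auto)
qed

lemma smooth_pointI:
  assumes "z \<in> V" "\<And>w k. w \<in> V \<Longrightarrow> indep_grads m V w k \<Longrightarrow> k \<le> r" "indep_grads m V z r"
  shows "smooth_point m V z"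
  unfolding smooth_point_def using assms indep_grads_mono by blast

lemma one_tangent:
  fixes m :: nat
  assumes "a < m" "\<tau> a \<noteq> (0::complex)" "(\<Sum>i<m. y i * \<tau> i) = 0" "\<forall>i\<in>{..<m} - {a}. y i = 0"
  shows "\<forall>i<m. y i = 0"
proof -
  have "(\<Sum>i<m. y i * \<tau> i) = (\<Sum>i\<in>{a}. y i * \<tau> i)"
    by (rule sum.mono_neutral_right) (use assms in auto)
  then have "y a = 0" using assms by simp
  then show ?thesis using assms(4) by auto
qed

text \<open>Triangular elimination: \<sigma> has no component at \<open>b\<close>, so first
  \<open>y a\<close> vanishes and then \<open>y b\<close>.\<close>

lemma two_tangents:
  fixes m :: nat
  assumes "a < m" "b < m" "a \<noteq> b" "\<sigma> b = (0::complex)" "\<sigma> a \<noteq> 0" "\<tau> b \<noteq> 0"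
    and "(\<Sum>i<m. y i * \<sigma> i) = 0" "(\<Sum>i<m. y i * \<tau> i) = 0" "\<forall>i\<in>{..<m} - {a, b}. y i = 0"
  shows "\<forall>i<m. y i = 0"
proof -
  have "(\<Sum>i<m. y i * \<sigma> i) = (\<Sum>i\<in>{a}. y i * \<sigma> i)"
    by (rule sum.mono_neutral_right) (use assms in auto)
  then have "y a = 0" using assms by simp
  then show ?thesis using assms by (intro one_tangent[of b m \<tau>]) auto
qed

lemma zgen_zariski:
  assumes "zgen m P"
  shows "\<exists>Z. zariski_closed m Z \<and> Z \<noteq> cspace m \<and> (\<forall>u\<in>cspace m - Z. P u)"
proof -
  obtain f x where f: "f \<in> poly_fun m" "f x \<noteq> 0" "\<And>x. f x \<noteq> 0 \<Longrightarrow> P x" using assms unfolding zgen_def by blast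
  let ?Z = "{x \<in> cspace m. \<forall>f\<in>{f}. f x = 0}" and ?x = "\<lambda>i. if i < m then x i else 0"
  have "zariski_closed m ?Z" unfolding zariski_closed_def using f(1) by blast
  moreover have "f ?x = f x" by (rule poly_fun_cong[OF f(1)]) simp
  then have "?x \<in> cspace m - ?Z" using f(2) by (simp add: cspace_def)
  then have "?Z \<noteq> cspace m" by blast
  ultimately show ?thesis using f(3) by blast
qed

lemma has_EDD_I: "zgen m (\<lambda>u. finite {z. ed_crit m V u z} \<and> card {z. ed_crit m V u z} = d) \<Longrightarrow> has_EDD m V (real d)"
  unfolding has_EDD_def by (drule zgen_zariski) auto

lemma generic_arrangementI: "zgen (2*k*m) P \<Longrightarrow> generic_arrangement k m P"
  unfolding generic_arrangement_def by (drule zgen_zariski) blast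

section \<open>Curves: normal form of one-dimensional arrangements\<close>

locale bcams =
  fixes n :: nat and e s y :: "nat \<Rightarrow> complex"
  assumes n1: "n \<ge> 1" and s_nz: "\<And>i. i < n \<Longrightarrow> s i \<noteq> 0" and y_inj: "inj_on y {..<n}"
begin

definition X where "X q = (\<lambda>i. case i of 0 \<Rightarrow> q | Suc j \<Rightarrow> if j < n then e j + s j / (q - y j) else 0)"
definition S where "S = {X q |q. \<forall>i<n. q \<noteq> y i}"
definition V where "V = zariski_closure (Suc n) S"
definition g where "g i x = (x (Suc i) - e i) * (x 0 - y i) - s i" for i and x :: "nat \<Rightarrow> complex"
definition \<tau> where "\<tau> q = (\<lambda>i. case i of 0 \<Rightarrow> 1 | Suc j \<Rightarrow> - s j / (q - y j)\<^sup>2)"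
text \<open>The numerator of the product of the residual u - X q with the tangent vector. The first
  camera dominates with degree 3n + 1, the others reach at most 3n - 2.\<close>

definition R where "R u = [:u 0, - 1:] * (\<Prod>i<n. [:- y i, 1:] ^ 3) - Kp {..<n} (\<lambda>i. s i * (u (Suc i) - e i)) (\<lambda>i. (s i)\<^sup>2) y"

lemma X_simps: "X q 0 = q" "j < n \<Longrightarrow> X q (Suc j) = e j + s j / (q - y j)"
  unfolding X_def by simp_all

lemma S_cspace: "S \<subseteq> cspace (Suc n)"
  unfolding S_def cspace_def X_def by (auto split: nat.split)

lemma g_vanishing: "i < n \<Longrightarrow> g i \<in> vanishing_ideal (Suc n) V"
  unfolding V_def
proof (rule vanishing_zclosure[OF S_cspace])
  assume "i < n"
  then show "g i \<in> poly_fun (Suc n)" unfolding g_def by (intro poly_fun_intros) auto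
  show "g i x = 0" if "x \<in> S" for x using that \<open>i < n\<close> unfolding S_def g_def by (auto simp: X_simps)
qed

text \<open>The curve is already closed: (x_(i+1) - e_i)(x_0 - y_i) = s_i with s_i \<noteq> 0 forces
  x_0 \<noteq> y_i and determines every coordinate from x_0.\<close>

lemma V_eq: "V = S"
proof
  show "S \<subseteq> V" unfolding V_def by (rule zclosure_superset)
  show "V \<subseteq> S"
  proof
    fix x assume x: "x \<in> V"
    have gx: "(x (Suc i) - e i) * (x 0 - y i) = s i" if "i < n" for i
      using g_vanishing[OF that] x unfolding vanishing_ideal_def g_def by simp
    have ne: "x 0 \<noteq> y i" if "i < n" for i using gx[OF that] s_nz[OF that] by auto
    have "x i = X (x 0) i" for i
    proof (cases i)
      case (Suc j)
      show ?thesis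
      proof (cases "j < n")
        case True
        have "x (Suc j) - e j = s j / (x 0 - y j)" using gx[OF True] ne[OF True] by (simp add: eq_divide_eq)
        then show ?thesis using True Suc by (simp add: X_simps algebra_simps)
      next
        case False
        have "x \<in> cspace (Suc n)" using x zclosure_iff[OF S_cspace] unfolding V_def by blast
        then show ?thesis using False Suc by (simp add: cspace_def X_def)
      qed
    qed (simp add: X_simps)
    then have "x = X (x 0)" by blast
    then show "x \<in> S" unfolding S_def using ne by blast
  qed
qed

lemma partial_g: "partial (g i) (Suc b) z = (if b = i then z 0 - y i else 0)"
  unfolding partial_def g_def
  by (rule DERIV_imp_deriv) (cases "b = i"; auto intro!: derivative_eq_intros)

lemma X_deriv:
  assumes "\<forall>i<n. q \<noteq> y i" "i < Suc n"
  shows "((\<lambda>t. X t i) has_field_derivative \<tau> q i) (at q)"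
proof (cases i)
  case 0
  then show ?thesis by (simp add: X_simps \<tau>_def)
next
  case (Suc j)
  then have j: "j < n" "q - y j \<noteq> 0" using assms by auto
  show ?thesis unfolding Suc using j
    by (auto simp: X_simps \<tau>_def power2_eq_square intro!: derivative_eq_intros)
qed

text \<open>The gradients of the \<open>g i\<close> realise arbitrary coordinates from 1 on, and the
  tangent vector, whose first entry is 1, fixes coordinate 0. So the normal space is the whole
  orthogonal complement of the tangent.\<close>

lemma nspace_iff:
  assumes q: "\<forall>i<n. q \<noteq> y i"
  shows "w \<in> nspace (Suc n) V (X q) \<longleftrightarrow> (\<Sum>i<Suc n. w i * \<tau> q i) = 0"
proof
  have "\<forall>\<^sub>F t in at q. t \<notin> y ` {..<n}" by (rule eventually_at_not_in_finite) simp
  then have ev: "\<forall>\<^sub>F t in at q. X t \<in> V" unfolding V_eq S_def by eventually_elim blast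
  have perp: "(\<Sum>i<Suc n. w i * \<tau> q i) = 0" if "w \<in> nspace (Suc n) V (X q)" for w
    by (rule nspace_tangent[OF that X_deriv[OF q] ev])
  then show "(\<Sum>i<Suc n. w i * \<tau> q i) = 0" if "w \<in> nspace (Suc n) V (X q)" using that .
  assume w: "(\<Sum>i<Suc n. w i * \<tau> q i) = 0"
  define c where "c = (\<lambda>j. w (Suc j) / (q - y j))"
  define w' where "w' = (\<lambda>i. \<Sum>j<n. c j * partial (g j) i (X q))"
  have w': "w' \<in> nspace (Suc n) V (X q)" unfolding nspace_def w'_def using g_vanishing by blast
  have eq: "w' (Suc b) = w (Suc b)" if "b < n" for b
  proof -
    have "w' (Suc b) = (\<Sum>j<n. if j = b then w (Suc j) else 0)" unfolding w'_def
      by (rule sum.cong) (use q in \<open>auto simp: c_def partial_g X_simps\<close>)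
    then show ?thesis using that by simp
  qed
  have "\<forall>i<Suc n. w i - w' i = 0"
  proof (rule one_tangent[of 0 _ "\<tau> q"])
    show "(\<Sum>i<Suc n. (w i - w' i) * \<tau> q i) = 0"
      using w perp[OF w'] by (simp only: left_diff_distrib sum_subtractf diff_zero)
    show "\<forall>i\<in>{..<Suc n} - {0}. w i - w' i = 0"
    proof
      fix i assume "i \<in> {..<Suc n} - {0}"
      then obtain b where "i = Suc b" "b < n" by (cases i) auto
      then show "w i - w' i = 0" using eq by simp
    qed
  qed (simp_all add: \<tau>_def)
  then have "\<forall>i<Suc n. w i = w' i" by simp
  then show "w \<in> nspace (Suc n) V (X q)" using w' unfolding nspace_def by auto
qed

lemma smooth:
  assumes q: "\<forall>i<n. q \<noteq> y i"
  shows "smooth_point (Suc n) V (X q)"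
proof (rule smooth_pointI[where r = n])
  show "X q \<in> V" unfolding V_eq S_def using q by blast
  show "k \<le> n" if w: "w \<in> V" and k: "indep_grads (Suc n) V w k" for w k
  proof -
    obtain q' where q': "\<forall>i<n. q' \<noteq> y i" "w = X q'" using w unfolding V_eq S_def by blast
    have "k \<le> card ({..<Suc n} - {0})"
    proof (rule indep_grads_le[OF _ _ k])
      fix z assume z: "z \<in> nspace (Suc n) V w" "\<forall>i\<in>{..<Suc n} - {0}. z i = 0"
      show "\<forall>i<Suc n. z i = 0"
      proof (rule one_tangent[of 0 _ "\<tau> q'"])
        show "(\<Sum>i<Suc n. z i * \<tau> q' i) = 0" using z(1) unfolding q'(2) nspace_iff[OF q'(1)] .
      qed (use z(2) in \<open>simp_all add: \<tau>_def\<close>)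
    qed simp
    then show ?thesis by simp
  qed
  show "indep_grads (Suc n) V (X q) n"
    unfolding indep_grads_def
  proof (intro exI[of _ g] conjI allI impI)
    show "g j \<in> vanishing_ideal (Suc n) V" if "j < n" for j by (rule g_vanishing[OF that])
    fix c j assume c: "\<forall>i<Suc n. (\<Sum>j<n. c j * partial (g j) i (X q)) = 0" and j: "j < n"
    have "(\<Sum>k<n. c k * partial (g k) (Suc j) (X q)) = (\<Sum>k<n. if k = j then c k * (q - y k) else 0)"
      by (rule sum.cong) (auto simp: partial_g X_simps)
    moreover have "(\<Sum>k<n. c k * partial (g k) (Suc j) (X q)) = 0" using c j by blast
    ultimately show "c j = 0" using j q[rule_format, OF j] by simp
  qed
qed

lemma poly_R_node: "i < n \<Longrightarrow> poly (R u) (y i) \<noteq> 0"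
proof -
  assume i: "i < n"
  have P: "(\<Prod>j<n. poly [:- y j, 1:] (y i) ^ 3) = 0" using i by (intro prod_zero bexI[of _ i]) auto
  have "poly (Kp {..<n} (\<lambda>i. s i * (u (Suc i) - e i)) (\<lambda>i. (s i)\<^sup>2) y) (y i) \<noteq> 0"
    by (rule poly_Kp_node_nz) (use i s_nz[OF i] y_inj in auto)
  then show ?thesis unfolding R_def poly_diff poly_mult poly_prod poly_power P by simp
qed

lemma R_root_iff:
  assumes q: "\<forall>i<n. q \<noteq> y i"
  shows "poly (R u) q = 0 \<longleftrightarrow> (\<Sum>i<Suc n. (u i - X q i) * \<tau> q i) = 0"
proof -
  let ?P = "\<Prod>i<n. (q - y i) ^ 3"
  have "poly (R u) q = (u 0 - q) * ?P - ?P * (\<Sum>i<n. (s i * (u (Suc i) - e i) * (q - y i) - (s i)\<^sup>2) / (q - y i) ^ 3)"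
    unfolding R_def poly_diff poly_mult poly_Kp
    by (subst Nf_divide) (use q in \<open>auto simp: poly_prod\<close>)
  also have "(\<Sum>i<n. (s i * (u (Suc i) - e i) * (q - y i) - (s i)\<^sup>2) / (q - y i) ^ 3) = - (\<Sum>i<n. (u (Suc i) - X q (Suc i)) * \<tau> q (Suc i))"
    unfolding sum_negf[symmetric]
  proof (rule sum.cong[OF refl])
    fix i assume "i \<in> {..<n}"
    then have i: "i < n" and d: "q - y i \<noteq> 0" using q by auto
    have "(s * v * d - s\<^sup>2) / d ^ 3 = - ((v - s / d) * (- s / d\<^sup>2))" if "d \<noteq> 0" for s v d :: complex
      using that by (simp add: field_simps power2_eq_square power3_eq_cube)
    from this[OF d, of "s i" "u (Suc i) - e i"]
    show "(s i * (u (Suc i) - e i) * (q - y i) - (s i)\<^sup>2) / (q - y i) ^ 3 = - ((u (Suc i) - X q (Suc i)) * \<tau> q (Suc i))"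
      by (simp add: X_simps(2)[OF i] \<tau>_def diff_diff_eq)
  qed
  also have "(u 0 - q) * ?P - ?P * - (\<Sum>i<n. (u (Suc i) - X q (Suc i)) * \<tau> q (Suc i)) = ?P * (\<Sum>i<Suc n. (u i - X q i) * \<tau> q i)"
    unfolding sum.lessThan_Suc_shift by (simp add: X_simps \<tau>_def algebra_simps)
  finally have "poly (R u) q = ?P * (\<Sum>i<Suc n. (u i - X q i) * \<tau> q i)" .
  moreover have "?P \<noteq> 0" using q by simp
  ultimately show ?thesis by simp
qed

lemma crit_eq: "{z. ed_crit (Suc n) V u z} = X ` {q. poly (R u) q = 0}"
proof (intro equalityI subsetI)
  fix z assume "z \<in> {z. ed_crit (Suc n) V u z}"
  then have z: "smooth_point (Suc n) V z" "(\<lambda>i. u i - z i) \<in> nspace (Suc n) V z" unfolding ed_crit_nspace by auto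
  have "z \<in> V" using z(1) unfolding smooth_point_def by blast
  then obtain q where q: "\<forall>i<n. q \<noteq> y i" "z = X q" unfolding V_eq S_def by blast
  have "poly (R u) q = 0" using z(2) unfolding R_root_iff[OF q(1)] q(2) nspace_iff[OF q(1)] .
  then show "z \<in> X ` {q. poly (R u) q = 0}" using q(2) by blast
next
  fix z assume "z \<in> X ` {q. poly (R u) q = 0}"
  then obtain q where q: "poly (R u) q = 0" "z = X q" by blast
  have qy: "\<forall>i<n. q \<noteq> y i" using poly_R_node q(1) by auto
  have "(\<lambda>i. u i - X q i) \<in> nspace (Suc n) V (X q)" using q(1) unfolding R_root_iff[OF qy] nspace_iff[OF qy] .
  then show "z \<in> {z. ed_crit (Suc n) V u z}" unfolding q(2) using smooth[OF qy] by (simp add: ed_crit_nspace)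
qed

lemma pfam_R: "pfam (Suc n) R"
  unfolding R_def
  by (intro pfam_diff pfam_mult pfam_linear pfam_prod pfam_power pfam_Kp poly_fun_intros) auto

lemma degree_R: "degree (R u) = 3 * n + 1" "R u \<noteq> 0"
proof -
  let ?A = "\<Prod>i<n. [:- y i, 1:] ^ 3" and ?K = "Kp {..<n} (\<lambda>i. s i * (u (Suc i) - e i)) (\<lambda>i. (s i)\<^sup>2) y"
  have A: "degree ?A = 3 * n" using conjunct1[OF coeff_prod_monic[of "{..<n}" y]] by simp
  have A0: "?A \<noteq> 0" by simp
  have "degree ([:u 0, - 1:] * ?A) = 3 * n + 1"
    using A A0 by (subst degree_mult_eq) auto
  moreover have "degree (- ?K) < 3 * n + 1" using degree_Kp[of "{..<n}" "\<lambda>i. s i * (u (Suc i) - e i)" "\<lambda>i. (s i)\<^sup>2" y] n1 by simp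
  ultimately show "degree (R u) = 3 * n + 1" unfolding R_def diff_conv_add_uminus by (subst degree_add_eq_left) simp_all
  then show "R u \<noteq> 0" by auto
qed

text \<open>With u_(i+1) = e_i the polynomials R form a pencil in u_0. Its Wronskian is A' K - A K'
  - A^2, where A^2 dominates by degree.\<close>

lemma ex_simple: "\<exists>u. 3 * n + 1 \<le> card {q. poly (R u) q = 0}"
proof -
  define A where "A = (\<Prod>i<n. [:- y i, 1:] ^ 3)"
  define K where "K = Kp {..<n} (\<lambda>i. 0) (\<lambda>i. (s i)\<^sup>2) y"
  define B where "B = [:0, - 1:] * A - K"
  have A: "degree A = 3 * n" unfolding A_def using conjunct1[OF coeff_prod_monic[of "{..<n}" y]] by simp
  have A0: "A \<noteq> 0" unfolding A_def by simp
  have K: "degree K \<le> 3 * n - 2" unfolding K_def using degree_Kp[of "{..<n}" "\<lambda>i. 0" "\<lambda>i. (s i)\<^sup>2" y] n1 by simp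
  have "A * pderiv B - pderiv A * B = (pderiv A * K - A * pderiv K) - A * A"
    unfolding B_def by (simp add: pderiv_diff pderiv_mult pderiv_pCons pderiv_minus algebra_simps)
  moreover have "(pderiv A * K - A * pderiv K) - A * A \<noteq> 0"
  proof
    assume "(pderiv A * K - A * pderiv K) - A * A = 0"
    then have "degree (A * A) = degree (pderiv A * K - A * pderiv K)" by simp
    also have "\<dots> \<le> 3 * n + (3 * n - 2)"
    proof (rule degree_diff_le)
      show "degree (pderiv A * K) \<le> 3 * n + (3 * n - 2)"
        using degree_mult_le[of "pderiv A" K] K A by (simp add: degree_pderiv)
      show "degree (A * pderiv K) \<le> 3 * n + (3 * n - 2)"
        using degree_mult_le[of A "pderiv K"] K A by (simp add: degree_pderiv)
    qed
    finally show False using A A0 n1 by (simp add: degree_mult_eq)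
  qed
  ultimately have W: "A * pderiv B - pderiv A * B \<noteq> 0" by simp
  have "poly B q \<noteq> 0" if "poly A q = 0" for q
  proof -
    have "(\<Prod>i<n. (q - y i) ^ 3) = 0" using that unfolding A_def by (simp add: poly_prod)
    then obtain i where i: "i < n" "q = y i" unfolding prod_zero_iff[OF finite_lessThan] by auto
    have "poly K (y i) \<noteq> 0" unfolding K_def by (rule poly_Kp_node_nz) (use i s_nz y_inj in auto)
    then show ?thesis using that i unfolding B_def by simp
  qed
  from ex_new_if_finite[OF infinite_UNIV_char_0 pencil_simple[OF W this]] obtain w where
    "w \<notin> {x. \<exists>q. poly (Polynomial.smult x A + B) q = 0 \<and> poly (pderiv (Polynomial.smult x A + B)) q = 0}" ..
  then have w: "poly (pderiv (Polynomial.smult w A + B)) q \<noteq> 0" if "poly (Polynomial.smult w A + B) q = 0" for q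
    using that by blast
  let ?u = "\<lambda>i. case i of 0 \<Rightarrow> w | Suc j \<Rightarrow> e j"
  have "R ?u = Polynomial.smult w A + B"
    unfolding R_def B_def A_def K_def by (simp add: algebra_simps)
  then have "card {q. poly (R ?u) q = 0} = degree (R ?u)"
    using w degree_R(2)[of ?u] by (intro card_roots_simple) auto
  then show ?thesis unfolding degree_R by (intro exI[of _ ?u]) simp
qed

theorem EDD: "zgen (Suc n) (\<lambda>u. finite {z. ed_crit (Suc n) V u z} \<and> card {z. ed_crit (Suc n) V u z} = 3 * n + 1)"
proof -
  obtain u0 where u0: "3 * n + 1 \<le> card {q. poly (R u0) q = 0}" using ex_simple by blast
  from zgen_card_roots[OF pfam_R degree_R(2) u0] show ?thesis
  proof (rule zgen_mono)
    fix u assume u: "R u \<noteq> 0 \<and> 3 * n + 1 \<le> card {q. poly (R u) q = 0}"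
    have "card {q. poly (R u) q = 0} = 3 * n + 1"
      using card_poly_roots_bound[OF degree_R(2)[of u]] u unfolding degree_R by linarith
    moreover have "inj X" by (rule injI) (metis X_simps(1))
    then have "inj_on X {q. poly (R u) q = 0}" by (rule inj_on_subset) simp
    moreover have "finite {q. poly (R u) q = 0}" by (rule poly_roots_finite[OF degree_R(2)])
    ultimately show "finite {z. ed_crit (Suc n) V u z} \<and> card {z. ed_crit (Suc n) V u z} = 3 * n + 1"
      unfolding crit_eq by (simp add: card_image)
  qed
qed

end

section \<open>Surfaces: normal form of two-dimensional arrangements\<close>

lemma quot_deriv:
  assumes "(F has_field_derivative D) (at t)" "(G has_field_derivative E) (at t)" "G t \<noteq> (0::complex)"
  shows "((\<lambda>t. c + F t / G t) has_field_derivative (D * G t - F t * E) / (G t)\<^sup>2) (at t)"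
  using DERIV_add[OF DERIV_const DERIV_divide[OF assms]] by (simp add: power2_eq_square)

lemma poly_fun_divide_const: "f \<in> poly_fun n \<Longrightarrow> (\<lambda>x. f x / c) \<in> poly_fun n"
  unfolding divide_inverse by (intro poly_fun_intros)

lemma quot_identity: "A \<noteq> 0 \<Longrightarrow> B \<noteq> 0 \<Longrightarrow> (b / B) * a - (a / A) * b + (a / A) * (b / B) * (B - A) = (0::complex)"
  by (simp add: field_simps)

context tcams
begin

definition X where "X e p q = (\<lambda>i. case i of 0 \<Rightarrow> p | Suc j \<Rightarrow> if j < n then e j + s j p / (q - l j p) else 0)"
definition S where "S e = {X e p q |p q. \<forall>i<n. q \<noteq> l i p}"
definition V where "V e = zariski_closure (Suc n) (S e)"
text \<open>The result of eliminating q from (x_(i+1) - e_i)(q - l_i) = s_i and the same relation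
  for j.\<close>

definition g where "g e i j x = (x (Suc j) - e j) * s i (x 0) - (x (Suc i) - e i) * s j (x 0)
  + (x (Suc i) - e i) * (x (Suc j) - e j) * (l i (x 0) - l j (x 0))" for x :: "nat \<Rightarrow> complex"
text \<open>The derivative of the parametrisation at (p, q) in the direction (a, b).\<close>

definition T where "T p q a b = (\<lambda>i. case i of 0 \<Rightarrow> a | Suc j \<Rightarrow> (be j * a * (q - l j p) - s j p * (b - la j * a)) / (q - l j p)\<^sup>2)"

text \<open>The points of the closure that are not images of a point of the plane: the exceptional lines over
  the points with \<open>s\<^sub>j = 0 = q - l\<^sub>j\<close>, and the image of the points with \<open>q = \<infinity>\<close>.\<close>

definition Xj where "Xj e j \<rho> = (\<lambda>i. case i of 0 \<Rightarrow> pc j | Suc k \<Rightarrow> if k < n then e k +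
  (if k = j then be j * \<rho> else s k (pc j) / (l j (pc j) - l k (pc j))) else 0)"
definition Tj where "Tj j \<rho> = (\<lambda>i. case i of 0 \<Rightarrow> \<rho> | Suc k \<Rightarrow> if k = j then 0 else
  (be k * \<rho> * (l j (pc j) - l k (pc j)) - s k (pc j) * (la j * \<rho> + 1 - la k * \<rho>)) / (l j (pc j) - l k (pc j))\<^sup>2)"
definition X0 where "X0 e p = (\<lambda>i. case i of 0 \<Rightarrow> p | Suc k \<Rightarrow> if k < n then e k else 0)"
definition T0 where "T0 p = (\<lambda>i. case i of 0 \<Rightarrow> 0 | Suc k \<Rightarrow> s k p)"

lemma X_simps: "X e p q 0 = p" "j < n \<Longrightarrow> X e p q (Suc j) = e j + s j p / (q - l j p)"
  unfolding X_def by simp_all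

lemma S_cspace: "S e \<subseteq> cspace (Suc n)"
  unfolding S_def cspace_def X_def by (auto split: nat.split)

lemma g_vanishing:
  assumes "i < n" "j < n"
  shows "g e i j \<in> vanishing_ideal (Suc n) (V e)"
  unfolding V_def
proof (rule vanishing_zclosure[OF S_cspace])
  show "g e i j \<in> poly_fun (Suc n)" unfolding g_def s_def l_def using assms by (intro poly_fun_intros) auto
  fix x assume "x \<in> S e"
  then obtain p q where x: "x = X e p q" "\<forall>i<n. q \<noteq> l i p" unfolding S_def by blast
  have d: "q - l i p \<noteq> 0" "q - l j p \<noteq> 0" using x(2) assms by auto
  have eq: "l i p - l j p = (q - l j p) - (q - l i p)" by simp
  show "g e i j x = 0"
    unfolding g_def x(1) X_simps(1) X_simps(2)[OF assms(1)] X_simps(2)[OF assms(2)] add_diff_cancel_left' eq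
    by (rule quot_identity[OF d])
qed

lemma pc_node: "j < n \<Longrightarrow> k < n \<Longrightarrow> k \<noteq> j \<Longrightarrow> l j (pc j) - l k (pc j) \<noteq> 0"
  using l_eq_iff[of j k "pc j"] pc_neq_pl[of j j k] by auto

lemma s_pc_nz: "j < n \<Longrightarrow> k < n \<Longrightarrow> k \<noteq> j \<Longrightarrow> s k (pc j) \<noteq> 0"
  using s_zero_iff[of k "pc j"] pc_inj[of j k] by auto

text \<open>Let \<xi>_i = x_(i+1) - e_i. If some \<xi>_a is nonzero, q = l_a + s_a/\<xi>_a is
  defined and the equations \<open>g\<close> give \<xi>_i (q - l_i) = s_i for all i. A coincidence q
  = l_j then forces s_j = 0, so p = \<open>pc j\<close> and \<xi>_j is unconstrained.\<close>

lemma V_cases: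
  assumes x: "x \<in> V e"
  obtains p q where "\<forall>i<n. q \<noteq> l i p" "x = X e p q" | j \<rho> where "j < n" "x = Xj e j \<rho>" | p where "x = X0 e p"
proof -
  define p where "p = x 0"
  define \<xi> where "\<xi> = (\<lambda>i. x (Suc i) - e i)"
  have cs: "x k = 0" if "k \<ge> Suc n" for k
    using x zclosure_iff[OF S_cspace] that unfolding V_def cspace_def by blast
  have gx: "\<xi> j * s i p - \<xi> i * s j p + \<xi> i * \<xi> j * (l i p - l j p) = 0" if "i < n" "j < n" for i j
    using g_vanishing[OF that] x unfolding vanishing_ideal_def g_def p_def \<xi>_def by blast
  show thesis
  proof (cases "\<forall>i<n. \<xi> i = 0")
    case True
    have "x k = X0 e p k" for k
      using True cs[of k] unfolding X0_def p_def \<xi>_def by (cases k) (auto simp: not_less)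
    then show thesis using that(3) by blast
  next
    case False
    then obtain a where a: "a < n" "\<xi> a \<noteq> 0" by blast
    define q where "q = l a p + s a p / \<xi> a"
    have key: "\<xi> i * (q - l i p) = s i p" if "i < n" for i
    proof -
      have "\<xi> a * (\<xi> i * (q - l i p) - s i p) = \<xi> i * s a p - \<xi> a * s i p + \<xi> a * \<xi> i * (l a p - l i p)"
        unfolding q_def using a(2) by (simp add: algebra_simps)
      then show ?thesis using gx[OF a(1) that] a(2) by simp
    qed
    have quot: "\<xi> i = s i p / (q - l i p)" if "i < n" "q \<noteq> l i p" for i
      using key[OF that(1)] that(2) by (simp add: eq_divide_eq)
    show thesis
    proof (cases "\<forall>i<n. q \<noteq> l i p")
      case True
      have "x k = X e p q k" for k
      proof (cases k)
        case (Suc j)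
        show ?thesis
        proof (cases "j < n")
          case j: True
          have "x (Suc j) = e j + \<xi> j" unfolding \<xi>_def by simp
          then show ?thesis using quot[OF j] True j Suc by (simp add: X_simps)
        qed (use Suc cs in \<open>simp add: X_def\<close>)
      qed (simp add: X_simps p_def)
      then show thesis using that(1) True by blast
    next
      case False
      then obtain j where j: "j < n" "q = l j p" by blast
      have "s j p = 0" using key[OF j(1)] j(2) by simp
      then have p: "p = pc j" using s_zero_iff[OF j(1)] by simp
      have "x k = Xj e j (\<xi> j / be j) k" for k
      proof (cases k)
        case (Suc i)
        show ?thesis
        proof (cases "i < n")
          case i: True
          have xi: "x (Suc i) = e i + \<xi> i" unfolding \<xi>_def by simp
          show ?thesis
          proof (cases "i = j")
            case True
            then show ?thesis unfolding Suc xi using j be_nz[OF j(1)] by (simp add: Xj_def)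
          next
            case False
            have qi: "q \<noteq> l i p" using pc_node[OF j(1) i False] j(2) p by simp
            then show ?thesis unfolding Suc xi quot[OF i qi] using i False j(2) p by (simp add: Xj_def)
          qed
        qed (use Suc cs in \<open>simp add: Xj_def\<close>)
      qed (simp add: Xj_def p p_def[symmetric])
      then show thesis using that(2)[OF j(1)] by blast
    qed
  qed
qed

lemma DERIV_s: "(P has_field_derivative D) (at t) \<Longrightarrow> ((\<lambda>t. s j (P t)) has_field_derivative be j * D) (at t)"
  using DERIV_add[OF DERIV_cmult[of P D t UNIV "be j"] DERIV_const[of "ga j"]] unfolding s_def by simp

lemma DERIV_l: "(P has_field_derivative D) (at t) \<Longrightarrow> ((\<lambda>t. l j (P t)) has_field_derivative la j * D) (at t)"
  using DERIV_add[OF DERIV_cmult[of P D t UNIV "la j"] DERIV_const[of "mu j"]] unfolding l_def by simp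

lemma eventually_all_less:
  assumes "\<And>i. i < n \<Longrightarrow> \<forall>\<^sub>F t in F. Q i t"
  shows "\<forall>\<^sub>F t in F. \<forall>i<n. Q i t"
proof -
  have "\<forall>\<^sub>F t in F. \<forall>i\<in>{..<n}. Q i t" by (rule eventually_ball_finite) (use assms in auto)
  then show ?thesis by eventually_elim simp
qed

lemma perp_X:
  assumes y: "y \<in> nspace (Suc n) (V e) (X e p q)" and q: "\<forall>i<n. q \<noteq> l i p"
  shows "(\<Sum>i<Suc n. y i * T p q a b i) = 0"
proof (rule nspace_tangent[where x = "\<lambda>t. X e (p + a * t) (q + b * t)" and b = 0 and V = "V e"])
  show "y \<in> nspace (Suc n) (V e) (X e (p + a * 0) (q + b * 0))" using y by simp
  have P: "((\<lambda>t. p + a * t) has_field_derivative a) (at 0)" for p a :: complex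
    by (auto intro!: derivative_eq_intros)
  have "\<forall>\<^sub>F t in at 0. \<forall>i<n. q + b * t \<noteq> l i (p + a * t)"
  proof (rule eventually_all_less)
    fix i assume i: "i < n"
    have "((\<lambda>t. q + b * t) \<longlongrightarrow> q + b * 0) (at 0)" "((\<lambda>t. l i (p + a * t)) \<longlongrightarrow> l i (p + a * 0)) (at 0)"
      unfolding l_def by (intro tendsto_intros)+
    then show "\<forall>\<^sub>F t in at 0. q + b * t \<noteq> l i (p + a * t)"
      by (rule tendsto_eventually_neq) (use q[rule_format, OF i] in simp)
  qed
  then show "\<forall>\<^sub>F t in at 0. X e (p + a * t) (q + b * t) \<in> V e"
    by eventually_elim (use zclosure_superset[of "S e" "Suc n"] in \<open>auto simp: V_def S_def\<close>)
  fix i assume i: "i < Suc n"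
  show "((\<lambda>t. X e (p + a * t) (q + b * t) i) has_field_derivative T p q a b i) (at 0)"
  proof (cases i)
    case 0
    then show ?thesis using P by (simp add: X_simps T_def)
  next
    case (Suc j)
    then have j: "j < n" using i by simp
    have "((\<lambda>t. e j + s j (p + a * t) / (q + b * t - l j (p + a * t))) has_field_derivative
      (be j * a * (q + b * 0 - l j (p + a * 0)) - s j (p + a * 0) * (b - la j * a)) / (q + b * 0 - l j (p + a * 0))\<^sup>2) (at 0)"
      by (rule quot_deriv) (use q[rule_format, OF j] in \<open>auto intro!: DERIV_s DERIV_l DERIV_diff P\<close>)
    then show ?thesis unfolding Suc X_simps(2)[OF j] T_def by simp
  qed
qed

text \<open>The curve p = pc_j + (\<rho> + \<kappa> t) t, q = l_j(p) + t satisfies s_j/(q - l_j) =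
  be_j (\<rho> + \<kappa> t), so it runs into the given point of the exceptional line with arbitrary
  speed \<kappa> along that line. Comparing \<kappa> = 0 and \<kappa> = 1 yields the two tangent
  vectors.\<close>

lemma perp_Xj:
  assumes j: "j < n" and y: "y \<in> nspace (Suc n) (V e) (Xj e j \<rho>)"
  shows "(\<Sum>i<Suc n. y i * (if i = Suc j then be j else 0)) = 0" "(\<Sum>i<Suc n. y i * Tj j \<rho> i) = 0"
proof -
  have main: "(\<Sum>i<Suc n. y i * (Tj j \<rho> i + \<kappa> * (if i = Suc j then be j else 0))) = 0" for \<kappa>
  proof -
    define P where "P = (\<lambda>t. pc j + (\<rho> + \<kappa> * t) * t)"
    define x where "x = (\<lambda>t i. case i of 0 \<Rightarrow> P t | Suc k \<Rightarrow> if k < n then e k +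
      (if k = j then be j * (\<rho> + \<kappa> * t) else s k (P t) / (l j (P t) + t - l k (P t))) else 0)"
    have P0: "P 0 = pc j" unfolding P_def by simp
    have x0: "x 0 = Xj e j \<rho>" unfolding x_def Xj_def P0 by (auto split: nat.split)
    have DP: "(P has_field_derivative \<rho>) (at 0)" unfolding P_def by (auto intro!: derivative_eq_intros)
    show ?thesis
    proof (rule nspace_tangent[where x = x and b = 0 and V = "V e"])
      show "y \<in> nspace (Suc n) (V e) (x 0)" unfolding x0 by (rule y)
      have "\<forall>\<^sub>F t in at 0. \<forall>k<n. l j (P t) + t \<noteq> l k (P t)"
      proof (rule eventually_all_less)
        fix k assume k: "k < n"
        show "\<forall>\<^sub>F t in at 0. l j (P t) + t \<noteq> l k (P t)"
        proof (cases "k = j")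
          case True
          then show ?thesis using eventually_neq_at_within[of 0 0 UNIV] by (auto elim: eventually_mono)
        next
          case False
          have "((\<lambda>t. l j (P t) + t) \<longlongrightarrow> l j (P 0) + 0) (at 0)" "((\<lambda>t. l k (P t)) \<longlongrightarrow> l k (P 0)) (at 0)"
            unfolding l_def P_def by (intro tendsto_intros)+
          then show ?thesis
            by (rule tendsto_eventually_neq) (use pc_node[OF j k False] in \<open>simp add: P0\<close>)
        qed
      qed
      moreover have "\<forall>\<^sub>F t in at 0. t \<noteq> (0::complex)" by (rule eventually_neq_at_within)
      ultimately show "\<forall>\<^sub>F t in at 0. x t \<in> V e"
      proof eventually_elim
        case (elim t)
        have "s j (P t) = be j * ((\<rho> + \<kappa> * t) * t)" unfolding s_pc[OF j] P_def by simp
        then have "s j (P t) / t = be j * (\<rho> + \<kappa> * t)" using elim(2) by simp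
        then have "x t i = X e (P t) (l j (P t) + t) i" for i
          unfolding x_def X_def by (auto split: nat.split)
        then have "x t = X e (P t) (l j (P t) + t)" by blast
        then have "x t \<in> S e" unfolding S_def using elim(1) by blast
        then show ?case unfolding V_def using zclosure_superset by blast
      qed
      fix i assume i: "i < Suc n"
      show "((\<lambda>t. x t i) has_field_derivative Tj j \<rho> i + \<kappa> * (if i = Suc j then be j else 0)) (at 0)"
      proof (cases i)
        case 0
        then show ?thesis using DP by (simp add: x_def Tj_def)
      next
        case (Suc k)
        then have k: "k < n" using i by simp
        show ?thesis
        proof (cases "k = j")
          case True
          have "((\<lambda>t. e j + be j * (\<rho> + \<kappa> * t)) has_field_derivative \<kappa> * be j) (at 0)"
            by (auto intro!: derivative_eq_intros)
          then show ?thesis using j unfolding Suc True by (simp add: x_def Tj_def)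
        next
          case False
          have "((\<lambda>t. e k + s k (P t) / (l j (P t) + t - l k (P t))) has_field_derivative
             (be k * \<rho> * (l j (P 0) + 0 - l k (P 0)) - s k (P 0) * (la j * \<rho> + 1 - la k * \<rho>)) / (l j (P 0) + 0 - l k (P 0))\<^sup>2) (at 0)"
            by (rule quot_deriv) (use pc_node[OF j k False] in \<open>auto simp: P0 intro!: DERIV_s DERIV_l DERIV_diff DERIV_add DERIV_ident DP\<close>)
          then show ?thesis using k False unfolding Suc by (simp add: x_def Tj_def P0)
        qed
      qed
    qed
  qed
  have split: "(\<Sum>i<Suc n. y i * (Tj j \<rho> i + \<kappa> * (if i = Suc j then be j else 0))) =
    (\<Sum>i<Suc n. y i * Tj j \<rho> i) + \<kappa> * (\<Sum>i<Suc n. y i * (if i = Suc j then be j else 0))" for \<kappa>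
    unfolding sum_distrib_left sum.distrib[symmetric] by (rule sum.cong) (simp_all only: distrib_left mult.left_commute)
  show 0: "(\<Sum>i<Suc n. y i * Tj j \<rho> i) = 0" using main[of 0] unfolding split by simp
  show "(\<Sum>i<Suc n. y i * (if i = Suc j then be j else 0)) = 0" using main[of 1] unfolding split 0 by simp
qed

text \<open>Approach along q = 1/t while p moves with speed \<kappa>; the coordinates become s_k t /
  (1 - l_k t), which is regular at t = 0.\<close>

lemma perp_X0:
  assumes y: "y \<in> nspace (Suc n) (V e) (X0 e p)"
  shows "(\<Sum>i<Suc n. y i * (if i = 0 then 1 else 0)) = 0" "(\<Sum>i<Suc n. y i * T0 p i) = 0"
proof -
  have main: "(\<Sum>i<Suc n. y i * (T0 p i + \<kappa> * (if i = 0 then 1 else 0))) = 0" for \<kappa>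
  proof -
    define P where "P = (\<lambda>t. p + \<kappa> * t)"
    define x where "x = (\<lambda>t i. case i of 0 \<Rightarrow> P t | Suc k \<Rightarrow> if k < n then e k + s k (P t) * t / (1 - l k (P t) * t) else 0)"
    have P0: "P 0 = p" unfolding P_def by simp
    have x0: "x 0 = X0 e p" unfolding x_def X0_def P0 by (auto split: nat.split)
    have DP: "(P has_field_derivative \<kappa>) (at 0)" unfolding P_def by (auto intro!: derivative_eq_intros)
    show ?thesis
    proof (rule nspace_tangent[where x = x and b = 0 and V = "V e"])
      show "y \<in> nspace (Suc n) (V e) (x 0)" unfolding x0 by (rule y)
      have "\<forall>\<^sub>F t in at 0. \<forall>k<n. l k (P t) * t \<noteq> 1"
      proof (rule eventually_all_less)
        fix k assume k: "k < n"
        have "((\<lambda>t. l k (P t) * t) \<longlongrightarrow> l k (P 0) * 0) (at 0)"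
          unfolding l_def P_def by (intro tendsto_intros)
        then show "\<forall>\<^sub>F t in at 0. l k (P t) * t \<noteq> 1" by (rule tendsto_imp_eventually_ne) simp
      qed
      moreover have "\<forall>\<^sub>F t in at 0. t \<noteq> (0::complex)" by (rule eventually_neq_at_within)
      ultimately show "\<forall>\<^sub>F t in at 0. x t \<in> V e"
      proof eventually_elim
        case (elim t)
        have d: "1 / t - l k (P t) = (1 - l k (P t) * t) / t" for k using elim(2) by (simp add: diff_divide_distrib)
        have "x t i = X e (P t) (1 / t) i" for i
          unfolding x_def X_def d by (auto split: nat.split)
        then have "x t = X e (P t) (1 / t)" by blast
        moreover have "1 / t \<noteq> l k (P t)" if "k < n" for k using elim(1) elim(2) that by (metis nonzero_eq_divide_eq)
        ultimately have "x t \<in> S e" unfolding S_def by blast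
        then show ?case unfolding V_def using zclosure_superset by blast
      qed
      fix i assume i: "i < Suc n"
      show "((\<lambda>t. x t i) has_field_derivative T0 p i + \<kappa> * (if i = 0 then 1 else 0)) (at 0)"
      proof (cases i)
        case 0
        then show ?thesis using DP by (simp add: x_def T0_def)
      next
        case (Suc k)
        then have k: "k < n" using i by simp
        have "((\<lambda>t. e k + s k (P t) * t / (1 - l k (P t) * t)) has_field_derivative
           ((be k * \<kappa> * 0 + 1 * s k (P 0)) * (1 - l k (P 0) * 0) - s k (P 0) * 0 * (0 - (la k * \<kappa> * 0 + 1 * l k (P 0)))) / (1 - l k (P 0) * 0)\<^sup>2) (at 0)"
          by (intro quot_deriv DERIV_mult DERIV_diff DERIV_const DERIV_s DERIV_l DERIV_ident DP) simp
        then show ?thesis using k unfolding Suc by (simp add: x_def T0_def P0)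
      qed
    qed
  qed
  have split: "(\<Sum>i<Suc n. y i * (T0 p i + \<kappa> * (if i = 0 then 1 else 0))) =
    (\<Sum>i<Suc n. y i * T0 p i) + \<kappa> * (\<Sum>i<Suc n. y i * (if i = 0 then 1 else 0))" for \<kappa>
    unfolding sum_distrib_left sum.distrib[symmetric] by (rule sum.cong) (simp_all only: distrib_left mult.left_commute)
  show 0: "(\<Sum>i<Suc n. y i * T0 p i) = 0" using main[of 0] unfolding split by simp
  show "(\<Sum>i<Suc n. y i * (if i = 0 then 1 else 0)) = 0" using main[of 1] unfolding split 0 by simp
qed

lemma ex_s_nz: "\<exists>a<n. s a p \<noteq> 0"
proof (cases "s 0 p = 0")
  case True
  then have "p = pc 0" using s_zero_iff[of 0] n2 by simp
  then show ?thesis using s_pc_nz[of 0 1] n2 by (intro exI[of _ 1]) simp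
next
  case False
  then show ?thesis using n2 by (intro exI[of _ 0]) simp
qed

lemma ex_other: "j < n \<Longrightarrow> \<exists>i<n. i \<noteq> j"
  using n2 by (intro exI[of _ "if j = 0 then 1 else 0"]) auto

lemma Tj_0_nz: "j < n \<Longrightarrow> i < n \<Longrightarrow> i \<noteq> j \<Longrightarrow> Tj j 0 (Suc i) \<noteq> 0"
  using s_pc_nz[of j i] pc_node[of j i] by (simp add: Tj_def)

text \<open>Smoothness is defined by comparison with all points of \<open>V\<close>, so the rank
  must be bounded on the exceptional points too. At each kind of point two independent tangent
  vectors leave at most n - 1.\<close>

lemma rank_le:
  assumes w: "w \<in> V e" and k: "indep_grads (Suc n) (V e) w k"
  shows "k \<le> n - 1"
proof -
  have main: ?thesis if ab: "a < Suc n" "b < Suc n" "a \<noteq> b" "\<sigma> b = 0" "\<sigma> a \<noteq> 0" "\<tau> b \<noteq> 0"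
    and perp: "\<And>y. y \<in> nspace (Suc n) (V e) w \<Longrightarrow> (\<Sum>i<Suc n. y i * \<sigma> i) = 0"
      "\<And>y. y \<in> nspace (Suc n) (V e) w \<Longrightarrow> (\<Sum>i<Suc n. y i * \<tau> i) = 0" for a b \<sigma> \<tau>
  proof -
    have "k \<le> card ({..<Suc n} - {a, b})"
    proof (rule indep_grads_le[OF _ _ k])
      fix y assume "y \<in> nspace (Suc n) (V e) w" "\<forall>i\<in>{..<Suc n} - {a, b}. y i = 0"
      then show "\<forall>i<Suc n. y i = 0" using perp ab by (intro two_tangents[of a "Suc n" b \<sigma> \<tau>]) auto
    qed simp
    also have "card ({..<Suc n} - {a, b}) = n - 1" using ab by (simp add: card_Diff_subset)
    finally show ?thesis .
  qed
  from w show ?thesis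
  proof (cases rule: V_cases)
    case (1 p q)
    obtain a where a: "a < n" "s a p \<noteq> 0" using ex_s_nz by blast
    show ?thesis
      by (rule main[of "Suc a" 0 "T p q 0 1" "T p q 1 0"])
        (use a 1 perp_X[of _ e p q] in \<open>auto simp: T_def\<close>)
  next
    case (2 j \<rho>)
    obtain i where i: "i < n" "i \<noteq> j" using ex_other[OF 2(1)] by blast
    \<comment> \<open>The second tangent vector has entry \<rho> at coordinate 0; when that
      vanishes, another camera supplies a nonzero entry.\<close>
    let ?b = "if \<rho> = 0 then Suc i else 0"
    show ?thesis
    proof (rule main[of "Suc j" ?b "\<lambda>i. if i = Suc j then be j else 0" "Tj j \<rho>"])
      show "Suc j < Suc n" "?b < Suc n" "Suc j \<noteq> ?b" "(if ?b = Suc j then be j else 0) = 0" using 2(1) i by auto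
      show "(if Suc j = Suc j then be j else 0) \<noteq> 0" using be_nz[OF 2(1)] by simp
      show "Tj j \<rho> ?b \<noteq> 0"
      proof (cases "\<rho> = 0")
        case True
        then show ?thesis using Tj_0_nz[OF 2(1) i] by simp
      next
        case False
        then show ?thesis by (simp add: Tj_def)
      qed
    qed (unfold 2(2), (rule perp_Xj[OF 2(1)], assumption)+)
  next
    case (3 p)
    obtain a where a: "a < n" "s a p \<noteq> 0" using ex_s_nz by blast
    show ?thesis
      by (rule main[of 0 "Suc a" "\<lambda>i. if i = 0 then 1 else 0" "T0 p"])
        (use a 3 perp_X0[of _ e p] in \<open>auto simp: T0_def\<close>)
  qed
qed

lemma partial_g: "b \<noteq> i \<Longrightarrow> partial (g e i j) (Suc b) z =
  (if b = j then s i (z 0) + (z (Suc i) - e i) * (l i (z 0) - l j (z 0)) else 0)"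
  unfolding partial_def g_def
  by (rule DERIV_imp_deriv) (cases "b = j"; auto intro!: derivative_eq_intros)

lemma partial_g_X:
  assumes q: "\<forall>i<n. q \<noteq> l i p" and ij: "i < n" "b < n" "b \<noteq> i"
  shows "partial (g e i j) (Suc b) (X e p q) = (if b = j then s i p / (q - l i p) * (q - l j p) else 0)"
proof -
  have "s i p + s i p / (q - l i p) * (l i p - l j p) = s i p / (q - l i p) * (q - l j p)"
  proof -
    have d: "q - l i p \<noteq> 0" using q ij(1) by simp
    have e: "l i p - l j p = (q - l j p) - (q - l i p)" by simp
    have "x + x / A * (B - A) = x / A * B" if "A \<noteq> 0" for x A B :: complex
      using that by (simp add: right_diff_distrib)
    then show ?thesis unfolding e using d .
  qed
  then show ?thesis using partial_g[OF ij(3)] ij by (simp add: X_simps)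
qed

text \<open>Fix a camera \<open>a\<close> with s_a \<noteq> 0. On the coordinates of the other
  cameras the gradients of the \<open>g e a j\<close> are diagonal with nonzero entries, and the two
  tangent vectors determine the two remaining coordinates.\<close>

lemma nspace_iff:
  assumes q: "\<forall>i<n. q \<noteq> l i p"
  shows "w \<in> nspace (Suc n) (V e) (X e p q) \<longleftrightarrow>
    (\<Sum>i<Suc n. w i * T p q 0 1 i) = 0 \<and> (\<Sum>i<Suc n. w i * T p q 1 0 i) = 0"
proof
  show "(\<Sum>i<Suc n. w i * T p q 0 1 i) = 0 \<and> (\<Sum>i<Suc n. w i * T p q 1 0 i) = 0"
    if "w \<in> nspace (Suc n) (V e) (X e p q)" using perp_X[OF that q] by blast
  assume w: "(\<Sum>i<Suc n. w i * T p q 0 1 i) = 0 \<and> (\<Sum>i<Suc n. w i * T p q 1 0 i) = 0"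
  obtain a where a: "a < n" "s a p \<noteq> 0" using ex_s_nz by blast
  define D where "D = (\<lambda>j. s a p / (q - l a p) * (q - l j p))"
  have D: "D j \<noteq> 0" if "j < n" for j unfolding D_def using a q[rule_format, OF a(1)] q[rule_format, OF that] by simp
  define c where "c = (\<lambda>j. if j = a then 0 else w (Suc j) / D j)"
  define w' where "w' = (\<lambda>i. \<Sum>j<n. c j * partial (g e a j) i (X e p q))"
  have w': "w' \<in> nspace (Suc n) (V e) (X e p q)"
    unfolding nspace_def w'_def using g_vanishing[OF a(1)] by blast
  have eq: "w' (Suc b) = w (Suc b)" if b: "b < n" "b \<noteq> a" for b
  proof -
    have "w' (Suc b) = (\<Sum>j<n. if j = b then w (Suc j) else 0)" unfolding w'_def
      by (rule sum.cong) (use D b in \<open>auto simp: c_def partial_g_X[OF q a(1) b] D_def\<close>)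
    then show ?thesis using b by simp
  qed
  have "\<forall>i<Suc n. w i - w' i = 0"
  proof (rule two_tangents[of "Suc a" _ 0 "T p q 0 1" "T p q 1 0"])
    show "(\<Sum>i<Suc n. (w i - w' i) * T p q 0 1 i) = 0" "(\<Sum>i<Suc n. (w i - w' i) * T p q 1 0 i) = 0"
      using w perp_X[OF w' q] by (simp_all only: left_diff_distrib sum_subtractf diff_zero)
    show "\<forall>i\<in>{..<Suc n} - {Suc a, 0}. w i - w' i = 0"
    proof
      fix i assume "i \<in> {..<Suc n} - {Suc a, 0}"
      then obtain b where "i = Suc b" "b < n" "b \<noteq> a" by (cases i) auto
      then show "w i - w' i = 0" using eq by simp
    qed
    show "T p q 0 1 (Suc a) \<noteq> 0" using a q[rule_format, OF a(1)] by (simp add: T_def)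
  qed (use a in \<open>simp_all add: T_def\<close>)
  then have "\<forall>i<Suc n. w i = w' i" by simp
  then show "w \<in> nspace (Suc n) (V e) (X e p q)" using w' unfolding nspace_def by auto
qed

lemma X_in_V: "\<forall>i<n. q \<noteq> l i p \<Longrightarrow> X e p q \<in> V e"
  unfolding V_def by (rule subsetD[OF zclosure_superset]) (auto simp: S_def)

lemma smooth:
  assumes q: "\<forall>i<n. q \<noteq> l i p"
  shows "smooth_point (Suc n) (V e) (X e p q)"
proof (rule smooth_pointI[where r = "n - 1"])
  show "X e p q \<in> V e" by (rule X_in_V[OF q])
  show "k \<le> n - 1" if "w \<in> V e" "indep_grads (Suc n) (V e) w k" for w k by (rule rank_le[OF that])
  obtain a where a: "a < n" "s a p \<noteq> 0" using ex_s_nz by blast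
  define sk where "sk = (\<lambda>j. if j < a then j else Suc j)"
  have sk: "sk j < n" "sk j \<noteq> a" if "j < n - 1" for j using that a(1) unfolding sk_def by auto
  have sk_inj: "sk i = sk j \<longleftrightarrow> i = j" for i j unfolding sk_def by auto
  show "indep_grads (Suc n) (V e) (X e p q) (n - 1)"
    unfolding indep_grads_def
  proof (intro exI[of _ "\<lambda>j. g e a (sk j)"] conjI allI impI)
    show "g e a (sk j) \<in> vanishing_ideal (Suc n) (V e)" if "j < n - 1" for j by (rule g_vanishing[OF a(1) sk(1)[OF that]])
    fix c j assume c: "\<forall>i<Suc n. (\<Sum>j<n - 1. c j * partial (g e a (sk j)) i (X e p q)) = 0" and j: "j < n - 1"
    have "(\<Sum>k<n - 1. c k * partial (g e a (sk k)) (Suc (sk j)) (X e p q)) =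
      (\<Sum>k<n - 1. if k = j then c k * (s a p / (q - l a p) * (q - l (sk k) p)) else 0)"
      by (rule sum.cong) (auto simp: partial_g_X[OF q a(1) sk[OF j]] sk_inj)
    moreover have "(\<Sum>k<n - 1. c k * partial (g e a (sk k)) (Suc (sk j)) (X e p q)) = 0" using c sk(1)[OF j] by blast
    ultimately show "c j = 0" using j q[rule_format, OF sk(1)[OF j]] q[rule_format, OF a(1)] a(2) by simp
  qed
qed

text \<open>Up to sign and the product of the cubed denominators, \<open>gp\<close> and
  \<open>hp\<close> are the products of the residual with the tangent vectors in the directions q
  and p.\<close>

lemma sols_iff:
  assumes v: "\<forall>i<n. v i = u (Suc i) - e i" and q: "\<forall>i<n. q \<noteq> l i p"
  shows "(p, q) \<in> sols (u 0) \<longleftrightarrow>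
    (\<Sum>i<Suc n. (u i - X e p q i) * T p q 0 1 i) = 0 \<and> (\<Sum>i<Suc n. (u i - X e p q i) * T p q 1 0 i) = 0"
proof -
  let ?P = "\<Prod>i<n. (q - l i p) ^ 3"
  have P: "?P \<noteq> 0" using q by simp
  have d: "q - l i p \<noteq> 0" if "i < n" for i using q[rule_format, OF that] by simp
  have y: "u (Suc i) - X e p q (Suc i) = v i - s i p / (q - l i p)" if "i < n" for i
    by (simp add: X_simps(2)[OF that] v[rule_format, OF that] diff_diff_eq)
  have "poly (gp p) q = ?P * (\<Sum>i<n. (s i p * v i * (q - l i p) - (s i p)\<^sup>2) / (q - l i p) ^ 3)"
    unfolding gp_def poly_Kp by (rule Nf_divide) (use d in auto)
  also have "(\<Sum>i<n. (s i p * v i * (q - l i p) - (s i p)\<^sup>2) / (q - l i p) ^ 3) = - (\<Sum>i<Suc n. (u i - X e p q i) * T p q 0 1 i)"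
    unfolding sum.lessThan_Suc_shift
  proof (simp add: T_def sum_negf[symmetric], rule sum.cong[OF refl])
    fix i assume "i \<in> {..<n}"
    then have i: "i < n" by simp
    have "(s * v * d - s\<^sup>2) / d ^ 3 = (v - s / d) * s / d\<^sup>2" if "d \<noteq> 0" for s v d :: complex
      using that by (simp add: field_simps power2_eq_square power3_eq_cube)
    from this[OF d[OF i], of "s i p" "v i"]
    show "(s i p * v i * (q - l i p) - (s i p)\<^sup>2) / (q - l i p) ^ 3 = (u (Suc i) - X e p q (Suc i)) * s i p / (q - l i p)\<^sup>2"
      unfolding y[OF i] .
  qed
  finally have g: "poly (gp p) q = 0 \<longleftrightarrow> (\<Sum>i<Suc n. (u i - X e p q i) * T p q 0 1 i) = 0" using P by (simp del: sum.lessThan_Suc)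
  have "poly (hp (u 0) p) q = (u 0 - p) * ?P + ?P * (\<Sum>i<n. (v i * (q - l i p) - s i p) * (be i * (q - l i p) + la i * s i p) / (q - l i p) ^ 3)"
    unfolding poly_hp_raw by (subst Nf_divide) (use d in auto)
  also have "(\<Sum>i<n. (v i * (q - l i p) - s i p) * (be i * (q - l i p) + la i * s i p) / (q - l i p) ^ 3) =
     (\<Sum>i<n. (u (Suc i) - X e p q (Suc i)) * T p q 1 0 (Suc i))"
  proof (rule sum.cong[OF refl])
    fix i assume "i \<in> {..<n}"
    then have i: "i < n" by simp
    have "(v * d - s) * (b * d + a * s) / d ^ 3 = (v - s / d) * ((b * 1 * d - s * (0 - a * 1)) / d\<^sup>2)" if "d \<noteq> 0" for s v d a b :: complex
      using that by (simp add: field_simps power2_eq_square power3_eq_cube)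
    from this[OF d[OF i], of "v i" "s i p" "be i" "la i"]
    show "(v i * (q - l i p) - s i p) * (be i * (q - l i p) + la i * s i p) / (q - l i p) ^ 3 = (u (Suc i) - X e p q (Suc i)) * T p q 1 0 (Suc i)"
      unfolding y[OF i] T_def nat.case .
  qed
  also have "(u 0 - p) * ?P + ?P * (\<Sum>i<n. (u (Suc i) - X e p q (Suc i)) * T p q 1 0 (Suc i)) = ?P * (\<Sum>i<Suc n. (u i - X e p q i) * T p q 1 0 i)"
    unfolding sum.lessThan_Suc_shift by (simp add: X_simps T_def algebra_simps)
  finally have h: "poly (hp (u 0) p) q = 0 \<longleftrightarrow> (\<Sum>i<Suc n. (u i - X e p q i) * T p q 1 0 i) = 0" using P by (simp del: sum.lessThan_Suc)
  show ?thesis unfolding sols_def using g h q by auto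
qed

text \<open>Orthogonality to the exceptional line forces \<rho> = (u_(j+1) - e_j)/be_j. What remains
  is one polynomial condition on u, violated for generic u. \<open>bad_0\<close> is the analogue for
  the points with q at infinity, where p = u_0 is forced.\<close>

definition bad_j where "bad_j e j u = (\<Sum>i<Suc n. (u i - Xj e j ((u (Suc j) - e j) / be j) i) * Tj j ((u (Suc j) - e j) / be j) i)"
definition bad_0 where "bad_0 e u = (\<Sum>i<Suc n. (u i - X0 e (u 0) i) * T0 (u 0) i)"

lemma zgen_bad_j:
  assumes j: "j < n"
  shows "zgen (Suc n) (\<lambda>u. bad_j e j u \<noteq> 0)"
proof -
  obtain i where i: "i < n" "i \<noteq> j" using ex_other[OF j] by blast
  \<comment> \<open>The residual is a unit vector at a camera other than \<open>j\<close>, which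
    picks out a nonzero entry of \<open>Tj j 0\<close>.\<close>
  let ?u = "\<lambda>k. Xj e j 0 k + (if k = Suc i then 1 else 0)"
  have "?u (Suc j) - e j = 0" using j i by (simp add: Xj_def)
  then have "bad_j e j ?u = (\<Sum>k<Suc n. (if k = Suc i then 1 else 0) * Tj j 0 k)"
    unfolding bad_j_def by (simp only: div_0 add_diff_cancel_left')
  also have "\<dots> = (\<Sum>k<Suc n. if k = Suc i then Tj j 0 k else 0)" by (rule sum.cong) auto
  also have "\<dots> = Tj j 0 (Suc i)" using i by (simp del: sum.lessThan_Suc)
  finally have nz: "bad_j e j ?u \<noteq> 0" using Tj_0_nz[OF j i] by simp
  have r: "(\<lambda>u. (u (Suc j) - e j) / be j) \<in> poly_fun (Suc n)" using j by (intro poly_fun_divide_const poly_fun_intros) auto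
  have "(\<lambda>u. bad_j e j u) \<in> poly_fun (Suc n)"
    unfolding bad_j_def
  proof (intro poly_fun_sum pmult poly_fun_diff)
    fix k assume k: "k \<in> {..<Suc n}"
    then show "(\<lambda>u. u k) \<in> poly_fun (Suc n)" by (intro pvar) simp
    show "(\<lambda>u. Xj e j ((u (Suc j) - e j) / be j) k) \<in> poly_fun (Suc n)"
    proof (cases k)
      case (Suc m)
      have "(\<lambda>u. e j + be j * r u) \<in> poly_fun (Suc n)" if "r \<in> poly_fun (Suc n)" for r
        using that by (intro poly_fun_intros)
      note lin = this[OF r]
      show ?thesis
      proof (cases "m = j")
        case True
        then show ?thesis unfolding Suc using lin by (simp only: Xj_def nat.case j if_True simp_thms)
      next
        case False
        then show ?thesis unfolding Suc by (cases "m < n") (simp_all add: Xj_def pconst)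
      qed
    qed (simp add: Xj_def pconst)
    show "(\<lambda>u. Tj j ((u (Suc j) - e j) / be j) k) \<in> poly_fun (Suc n)"
    proof (cases k)
      case (Suc m)
      show ?thesis
      proof (cases "m = j")
        case False
        have "(\<lambda>u. (be m * r u * (l j (pc j) - l m (pc j)) - s m (pc j) * (la j * r u + 1 - la m * r u)) / (l j (pc j) - l m (pc j))\<^sup>2) \<in> poly_fun (Suc n)"
          if "r \<in> poly_fun (Suc n)" for r using that by (intro poly_fun_divide_const poly_fun_intros)
        from this[OF r] show ?thesis using Suc False by (simp add: Tj_def)
      qed (simp add: Suc Tj_def pconst)
    qed (use r in \<open>simp add: Tj_def\<close>)
  qed
  then show ?thesis using nz by (rule zgen_neq)
qed

lemma zgen_bad_0: "zgen (Suc n) (\<lambda>u. bad_0 e u \<noteq> 0)"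
proof -
  obtain a where a: "a < n" "s a 0 \<noteq> 0" using ex_s_nz by blast
  let ?u = "\<lambda>k. X0 e 0 k + (if k = Suc a then 1 else 0)"
  have "?u 0 = 0" by (simp add: X0_def)
  then have "bad_0 e ?u = (\<Sum>k<Suc n. (if k = Suc a then 1 else 0) * T0 0 k)"
    unfolding bad_0_def by (simp only: add_diff_cancel_left')
  also have "\<dots> = (\<Sum>k<Suc n. if k = Suc a then T0 0 k else 0)" by (rule sum.cong) auto
  also have "\<dots> = T0 0 (Suc a)" using a by (simp del: sum.lessThan_Suc)
  finally have nz: "bad_0 e ?u \<noteq> 0" using a by (simp add: T0_def)
  have "(\<lambda>u. bad_0 e u) \<in> poly_fun (Suc n)"
    unfolding bad_0_def
  proof (intro poly_fun_sum pmult poly_fun_diff)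
    fix k assume k: "k \<in> {..<Suc n}"
    then show "(\<lambda>u. u k) \<in> poly_fun (Suc n)" by (intro pvar) simp
    show "(\<lambda>u. X0 e (u 0) k) \<in> poly_fun (Suc n)" by (cases k) (auto simp: X0_def intro: poly_fun.intros)
    show "(\<lambda>u. T0 (u 0) k) \<in> poly_fun (Suc n)" by (cases k) (auto simp: T0_def s_def intro!: poly_fun.intros)
  qed
  then show ?thesis using nz by (rule zgen_neq)
qed

text \<open>Whether exceptional points are smooth is left open: for such u they fail the
  orthogonality conditions in any case.\<close>

lemma crit_eq:
  assumes v: "\<forall>i<n. v i = u (Suc i) - e i" and bj: "\<And>j. j < n \<Longrightarrow> bad_j e j u \<noteq> 0" and b0: "bad_0 e u \<noteq> 0"
  shows "{z. ed_crit (Suc n) (V e) u z} = (\<lambda>pq. X e (fst pq) (snd pq)) ` sols (u 0)"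
proof (intro equalityI subsetI)
  fix z assume "z \<in> {z. ed_crit (Suc n) (V e) u z}"
  then have z: "smooth_point (Suc n) (V e) z" "(\<lambda>i. u i - z i) \<in> nspace (Suc n) (V e) z" unfolding ed_crit_nspace by auto
  have "z \<in> V e" using z(1) unfolding smooth_point_def by blast
  then show "z \<in> (\<lambda>pq. X e (fst pq) (snd pq)) ` sols (u 0)"
  proof (cases rule: V_cases)
    case (1 p q)
    have "(p, q) \<in> sols (u 0)" using z(2) unfolding sols_iff[OF v 1(1)] 1(2) nspace_iff[OF 1(1)] .
    then show ?thesis unfolding 1(2) by (intro image_eqI[of _ _ "(p, q)"]) simp_all
  next
    case (2 j \<rho>)
    note perp = perp_Xj[OF 2(1) z(2)[unfolded 2(2)]]
    have "(\<Sum>i<Suc n. (u i - Xj e j \<rho> i) * (if i = Suc j then be j else 0)) = (\<Sum>i<Suc n. if i = Suc j then (u i - Xj e j \<rho> i) * be j else 0)"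
      by (rule sum.cong) auto
    also have "\<dots> = (u (Suc j) - Xj e j \<rho> (Suc j)) * be j" using 2(1) by (simp del: sum.lessThan_Suc)
    finally have "u (Suc j) - Xj e j \<rho> (Suc j) = 0" using perp(1) be_nz[OF 2(1)] by simp
    then have "u (Suc j) - e j = be j * \<rho>" using 2(1) by (simp add: Xj_def algebra_simps)
    then have "\<rho> = (u (Suc j) - e j) / be j" using be_nz[OF 2(1)] by simp
    then show ?thesis using perp(2) bj[OF 2(1)] unfolding bad_j_def by simp
  next
    case (3 p)
    note perp = perp_X0[OF z(2)[unfolded 3]]
    have "u 0 - X0 e p 0 = 0" using perp(1) unfolding sum.lessThan_Suc_shift by simp
    then have "p = u 0" by (simp add: X0_def)
    then show ?thesis using perp(2) b0 unfolding bad_0_def by simp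
  qed
next
  fix z assume "z \<in> (\<lambda>pq. X e (fst pq) (snd pq)) ` sols (u 0)"
  then obtain p q where pq: "(p, q) \<in> sols (u 0)" "z = X e p q" by auto
  have q: "\<forall>i<n. q \<noteq> l i p" using pq(1) unfolding sols_def by auto
  have "(\<lambda>i. u i - X e p q i) \<in> nspace (Suc n) (V e) (X e p q)" using pq(1) unfolding sols_iff[OF v q] nspace_iff[OF q] .
  then show "z \<in> {z. ed_crit (Suc n) (V e) u z}" unfolding pq(2) using smooth[OF q] by (simp add: ed_crit_nspace)
qed

lemma X_inj: "inj_on (\<lambda>pq. X e (fst pq) (snd pq)) (sols w)"
proof (rule inj_onI)
  fix x y assume xy: "x \<in> sols w" "y \<in> sols w" "X e (fst x) (snd x) = X e (fst y) (snd y)"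
  obtain p q where x: "x = (p, q)" by (cases x)
  obtain p' q' where y: "y = (p', q')" by (cases y)
  have eq: "X e p q i = X e p' q' i" for i using xy(3) unfolding x y by simp
  have p: "p' = p" using eq[of 0] by (simp add: X_simps)
  obtain a where a: "a < n" "s a p \<noteq> 0" using ex_s_nz by blast
  have d: "q - l a p \<noteq> 0" "q' - l a p \<noteq> 0" using xy(1,2) a(1) unfolding x y p sols_def by auto
  have "s a p / (q - l a p) = s a p / (q' - l a p)" using eq[of "Suc a"] a(1) by (simp add: X_simps p)
  then have "q - l a p = q' - l a p" using a(2) d by (simp add: frac_eq_eq)
  then show "x = y" unfolding x y p by simp
qed

end

theorem tcams_EDD:
  assumes tc: "tcams n be ga la mu"
    and gen: "zgen (5 * n + 1) (\<lambda>y. finite (cams.sols n be ga la mu (Ve n y) (y (5 * n))) \<and>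
      card (cams.sols n be ga la mu (Ve n y) (y (5 * n))) = N)"
  shows "zgen (Suc n) (\<lambda>u. finite {z. ed_crit (Suc n) (tcams.V n be ga la mu e) u z} \<and>
    card {z. ed_crit (Suc n) (tcams.V n be ga la mu e) u z} = N)"
proof -
  define v where "v = (\<lambda>u::nat \<Rightarrow> complex. \<lambda>i. if i < n then u (Suc i) - e i else 0)"
  obtain f z where f: "f \<in> poly_fun (5 * n + 1)" "f z \<noteq> 0"
    and fN: "\<And>y. f y \<noteq> 0 \<Longrightarrow> finite (cams.sols n be ga la mu (Ve n y) (y (5 * n))) \<and> card (cams.sols n be ga la mu (Ve n y) (y (5 * n))) = N"
    using gen unfolding zgen_def by blast
  \<comment> \<open>The entries of the camera part are frozen at those of the witness
    \<open>z\<close>; the others are the data shifted by the offsets, followed by w = u_0.\<close>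
  define h where "h = (\<lambda>(u::nat \<Rightarrow> complex) i. if i < 4 * n then z i else if i < 5 * n then u (Suc (i - 4 * n)) - e (i - 4 * n) else u 0)"
  have hp: "(\<lambda>u. f (\<lambda>i. h u i)) \<in> poly_fun (Suc n)"
  proof (rule poly_fun_subst[OF f(1)])
    fix i assume "i < 5 * n + 1"
    then show "(\<lambda>u. h u i) \<in> poly_fun (Suc n)"
      by (cases "i < 4 * n"; cases "i < 5 * n") (auto simp: h_def intro!: poly_fun_intros)
  qed
  let ?u = "\<lambda>i. case i of 0 \<Rightarrow> z (5 * n) | Suc j \<Rightarrow> z (4 * n + j) + e j"
  have "f (h ?u) = f z"
    by (rule poly_fun_cong[OF f(1)]) (auto simp: h_def not_less le_antisym less_Suc_eq)
  then have nz: "f (\<lambda>i. h ?u i) \<noteq> 0" using f(2) by simp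
  have hV: "Ve n (h u) = v u" "h u (5 * n) = u 0" for u unfolding Ve_def h_def v_def by (auto simp: fun_eq_iff)
  have "zgen (Suc n) (\<lambda>u. finite (cams.sols n be ga la mu (v u) (u 0)) \<and> card (cams.sols n be ga la mu (v u) (u 0)) = N)"
  proof (rule zgen_mono[OF zgen_neq[OF hp nz]])
    fix u assume "f (\<lambda>i. h u i) \<noteq> 0"
    from fN[OF this] show "finite (cams.sols n be ga la mu (v u) (u 0)) \<and> card (cams.sols n be ga la mu (v u) (u 0)) = N"
      unfolding hV .
  qed
  moreover have "zgen (Suc n) (\<lambda>u. \<forall>j<n. tcams.bad_j n be ga la mu e j u \<noteq> 0)"
    by (intro zgen_all_less tcams.zgen_bad_j[OF tc])
  moreover have "zgen (Suc n) (\<lambda>u. tcams.bad_0 n be ga e u \<noteq> 0)" by (rule tcams.zgen_bad_0[OF tc])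
  ultimately have "zgen (Suc n) (\<lambda>u. (finite (cams.sols n be ga la mu (v u) (u 0)) \<and> card (cams.sols n be ga la mu (v u) (u 0)) = N) \<and>
     (\<forall>j<n. tcams.bad_j n be ga la mu e j u \<noteq> 0) \<and> tcams.bad_0 n be ga e u \<noteq> 0)" by (rule zgen_conj[OF _ zgen_conj])
  then show ?thesis
  proof (rule zgen_mono, elim conjE)
    fix u assume H: "finite (cams.sols n be ga la mu (v u) (u 0))" "card (cams.sols n be ga la mu (v u) (u 0)) = N"
      "\<forall>j<n. tcams.bad_j n be ga la mu e j u \<noteq> 0" "tcams.bad_0 n be ga e u \<noteq> 0"
    have eq: "{z. ed_crit (Suc n) (tcams.V n be ga la mu e) u z} = (\<lambda>pq. tcams.X n be ga la mu e (fst pq) (snd pq)) ` cams.sols n be ga la mu (v u) (u 0)"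
      by (rule tcams.crit_eq[OF tc]) (use H(3,4) in \<open>auto simp: v_def\<close>)
    show "finite {z. ed_crit (Suc n) (tcams.V n be ga la mu e) u z} \<and> card {z. ed_crit (Suc n) (tcams.V n be ga la mu e) u z} = N"
      unfolding eq using H(1,2) card_image[OF tcams.X_inj[OF tc]] by auto
  qed
qed

section \<open>Reduction of generic arrangements to normal form\<close>

text \<open>The normal form depends rationally on the matrix entries. The point \<open>a\<close>,
  where the denominator survives, will later show that pulled-back conditions are not identically
  violated.\<close>

definition rat_at :: "nat \<Rightarrow> (nat \<Rightarrow> complex) \<Rightarrow> ((nat \<Rightarrow> complex) \<Rightarrow> complex) \<Rightarrow> bool" where
  "rat_at M a g \<longleftrightarrow> (\<exists>P\<in>poly_fun M. \<exists>Q\<in>poly_fun M. Q a \<noteq> 0 \<and> (\<forall>x. Q x \<noteq> 0 \<longrightarrow> g x = P x / Q x))"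

lemma rat_poly: "f \<in> poly_fun M \<Longrightarrow> rat_at M a f"
  unfolding rat_at_def by (rule bexI[of _ f], rule bexI[of _ "\<lambda>_. 1"]) (auto intro: pconst)

lemma rat_add:
  assumes "rat_at M a g" "rat_at M a h"
  shows "rat_at M a (\<lambda>x. g x + h x)"
proof -
  obtain P Q where 1: "P \<in> poly_fun M" "Q \<in> poly_fun M" "Q a \<noteq> 0" "\<And>x. Q x \<noteq> 0 \<Longrightarrow> g x = P x / Q x"
    using assms(1) unfolding rat_at_def by blast
  obtain P' Q' where 2: "P' \<in> poly_fun M" "Q' \<in> poly_fun M" "Q' a \<noteq> 0" "\<And>x. Q' x \<noteq> 0 \<Longrightarrow> h x = P' x / Q' x"
    using assms(2) unfolding rat_at_def by blast
  show ?thesis unfolding rat_at_def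
  proof (rule bexI[of _ "(\<lambda>x. P x * Q' x + P' x * Q x)"], rule bexI[of _ "\<lambda>x. Q x * Q' x"], intro conjI allI impI)
    show "(\<lambda>x. P x * Q' x + P' x * Q x) \<in> poly_fun M" "(\<lambda>x. Q x * Q' x) \<in> poly_fun M"
      using 1 2 by (auto intro: poly_fun_intros)
    show "Q a * Q' a \<noteq> 0" using 1 2 by simp
    show "g x + h x = (P x * Q' x + P' x * Q x) / (Q x * Q' x)" if "Q x * Q' x \<noteq> 0" for x
      using 1(4)[of x] 2(4)[of x] that by (simp add: add_frac_eq)
  qed
qed

lemma rat_mult:
  assumes "rat_at M a g" "rat_at M a h"
  shows "rat_at M a (\<lambda>x. g x * h x)"
proof -
  obtain P Q where 1: "P \<in> poly_fun M" "Q \<in> poly_fun M" "Q a \<noteq> 0" "\<And>x. Q x \<noteq> 0 \<Longrightarrow> g x = P x / Q x"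
    using assms(1) unfolding rat_at_def by blast
  obtain P' Q' where 2: "P' \<in> poly_fun M" "Q' \<in> poly_fun M" "Q' a \<noteq> 0" "\<And>x. Q' x \<noteq> 0 \<Longrightarrow> h x = P' x / Q' x"
    using assms(2) unfolding rat_at_def by blast
  show ?thesis unfolding rat_at_def
  proof (rule bexI[of _ "(\<lambda>x. P x * P' x)"], rule bexI[of _ "\<lambda>x. Q x * Q' x"], intro conjI allI impI)
    show "(\<lambda>x. P x * P' x) \<in> poly_fun M" "(\<lambda>x. Q x * Q' x) \<in> poly_fun M"
      using 1 2 by (auto intro: poly_fun_intros)
    show "Q a * Q' a \<noteq> 0" using 1 2 by simp
    show "g x * h x = (P x * P' x) / (Q x * Q' x)" if "Q x * Q' x \<noteq> 0" for x
      using 1(4)[of x] 2(4)[of x] that by simp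
  qed
qed

lemma rat_inverse:
  assumes "rat_at M a h" "h a \<noteq> 0"
  shows "rat_at M a (\<lambda>x. 1 / h x)"
proof -
  obtain P Q where 1: "P \<in> poly_fun M" "Q \<in> poly_fun M" "Q a \<noteq> 0" "\<And>x. Q x \<noteq> 0 \<Longrightarrow> h x = P x / Q x"
    using assms(1) unfolding rat_at_def by blast
  show ?thesis unfolding rat_at_def
  proof (rule bexI[of _ "(\<lambda>x. Q x * Q x)"], rule bexI[of _ "\<lambda>x. Q x * P x"], intro conjI allI impI)
    show "(\<lambda>x. Q x * Q x) \<in> poly_fun M" "(\<lambda>x. Q x * P x) \<in> poly_fun M" using 1 by (auto intro: poly_fun_intros)
    show "Q a * P a \<noteq> 0" using 1 assms(2) by auto
    show "1 / h x = (Q x * Q x) / (Q x * P x)" if "Q x * P x \<noteq> 0" for x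
      using 1(4)[of x] that by simp
  qed
qed

lemma rat_divide: "rat_at M a g \<Longrightarrow> rat_at M a h \<Longrightarrow> h a \<noteq> 0 \<Longrightarrow> rat_at M a (\<lambda>x. g x / h x)"
  using rat_mult[OF _ rat_inverse, of M a g h] by simp

lemma rat_uminus: "rat_at M a g \<Longrightarrow> rat_at M a (\<lambda>x. - g x)"
  using rat_mult[OF rat_poly[OF pconst[of "-1"]], of M a g] by simp

lemma rat_diff: "rat_at M a g \<Longrightarrow> rat_at M a h \<Longrightarrow> rat_at M a (\<lambda>x. g x - h x)"
  using rat_add[OF _ rat_uminus, of M a g h] by simp

lemmas rat_intros = rat_add rat_mult rat_diff rat_uminus rat_divide

lemma zgen_rat:
  assumes "rat_at M a g" "g a \<noteq> 0"
  shows "zgen M (\<lambda>x. g x \<noteq> 0)"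
proof -
  obtain P Q where 1: "P \<in> poly_fun M" "Q \<in> poly_fun M" "Q a \<noteq> 0" "\<And>x. Q x \<noteq> 0 \<Longrightarrow> g x = P x / Q x"
    using assms(1) unfolding rat_at_def by blast
  show ?thesis
    by (rule zgenI[of "\<lambda>x. Q x * P x" _ a]) (use 1 assms(2) in \<open>auto intro: pmult\<close>)
qed

lemma rat_comp:
  assumes "f \<in> poly_fun N" "\<And>i. i < N \<Longrightarrow> rat_at M a (G i)"
  shows "rat_at M a (\<lambda>x. f (\<lambda>i. G i x))"
  using assms(1)
proof induction
  case (pconst c)
  show ?case by (rule rat_poly[OF poly_fun.pconst])
next
  case (pvar i)
  then show ?case by (rule assms(2))
next
  case (padd f g)
  then show ?case by (intro rat_add)
next
  case (pmult f g)
  then show ?case by (intro rat_mult)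
qed

text \<open>A point with nonzero \<open>f\<close> is the value of the rational map \<open>G\<close>
  at some point of regularity, so \<open>f\<close> pulls back to a rational function that is not
  identically 0.\<close>

lemma zgen_pullback:
  assumes P: "zgen N P" and G: "\<And>z. \<exists>a. \<forall>i<N. rat_at M a (G i) \<and> G i a = z i"
  shows "zgen M (\<lambda>x. P (\<lambda>i. G i x))"
proof -
  obtain f z where f: "f \<in> poly_fun N" "f z \<noteq> 0" "\<And>x. f x \<noteq> 0 \<Longrightarrow> P x" using P unfolding zgen_def by blast
  obtain a where a: "\<forall>i<N. rat_at M a (G i) \<and> G i a = z i" using G by blast
  have "f (\<lambda>i. G i a) = f z" by (rule poly_fun_cong[OF f(1)]) (use a in simp)
  then have "zgen M (\<lambda>x. f (\<lambda>i. G i x) \<noteq> 0)"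
    using f(2) a by (intro zgen_rat[where a = a] rat_comp[OF f(1)]) auto
  then show ?thesis by (rule zgen_mono) (rule f(3))
qed

lemma sum_two: "(\<Sum>c<2. f c) = f 0 + f (1::nat)" and sum_three: "(\<Sum>c<3. f c) = f 0 + f (1::nat) + f 2"
  by (simp_all add: numeral_2_eq_2 numeral_3_eq_3)

subsection \<open>Arrangements of \<open>2 \<times> 2\<close> matrices\<close>

text \<open>Coordinates of a linear form with respect to the two rows of the first camera.\<close>

definition de2 where "de2 A = ent 2 A 0 1 0 * ent 2 A 0 0 1 - ent 2 A 0 1 1 * ent 2 A 0 0 0"
definition co20 where "co20 i r A = (ent 2 A i r 0 * ent 2 A 0 0 1 - ent 2 A i r 1 * ent 2 A 0 0 0) / de2 A"
definition co21 where "co21 i r A = (ent 2 A i r 1 * ent 2 A 0 1 0 - ent 2 A i r 0 * ent 2 A 0 1 1) / de2 A"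
definition y2 where "y2 i A = - co20 (Suc i) 1 A / co21 (Suc i) 1 A"
definition e2 where "e2 i A = co21 (Suc i) 0 A / co21 (Suc i) 1 A"
definition s2 where "s2 i A = (co20 (Suc i) 0 A + co21 (Suc i) 0 A * y2 i A) / co21 (Suc i) 1 A"

lemma form_decomp2:
  assumes "de2 A \<noteq> 0"
  shows "ent 2 A i r 0 * Y 0 + ent 2 A i r 1 * Y 1 =
    co20 i r A * (ent 2 A 0 1 0 * Y 0 + ent 2 A 0 1 1 * Y 1) + co21 i r A * (ent 2 A 0 0 0 * Y 0 + ent 2 A 0 0 1 * Y (1::nat))"
proof -
  have "((r0 * a1 - r1 * a0) * (b0 * Y0 + b1 * Y1) + (r1 * b0 - r0 * b1) * (a0 * Y0 + a1 * Y1)) = (b0 * a1 - b1 * a0) * (r0 * Y0 + r1 * Y1)"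
    for r0 r1 a0 a1 b0 b1 Y0 Y1 :: complex by (simp add: algebra_simps)
  from this[of "ent 2 A i r 0" "ent 2 A 0 0 1" "ent 2 A i r 1" "ent 2 A 0 0 0" "ent 2 A 0 1 0" "Y 0" "ent 2 A 0 1 1" "Y 1", folded de2_def]
  show ?thesis using assms unfolding co20_def co21_def
    by (simp add: divide_simps)
qed

text \<open>In the coordinate q = N_0/D_0 given by the first camera, every other camera is a Moebius
  map e + s/(q - y). Conversely each admissible q comes from a point.\<close>

lemma normal_form2:
  assumes de: "de2 A \<noteq> 0" and b: "\<forall>i<n. co21 (Suc i) 1 A \<noteq> 0" and loc: "bcams n (\<lambda>i. s2 i A) (\<lambda>i. y2 i A)" and n: "n \<ge> 1"
  shows "multiview_affine 2 (Suc n) A = bcams.V n (\<lambda>i. e2 i A) (\<lambda>i. s2 i A) (\<lambda>i. y2 i A)"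
proof -
  let ?N = "\<lambda>i Y. ent 2 A i 0 0 * Y 0 + ent 2 A i 0 1 * Y (1::nat)" and ?D = "\<lambda>i Y. ent 2 A i 1 0 * Y 0 + ent 2 A i 1 1 * Y (1::nat)"
  have D: "?D (Suc i) Y = co21 (Suc i) 1 A * (q - y2 i A) * ?D 0 Y" and N: "?N (Suc i) Y = co21 (Suc i) 1 A * (e2 i A * (q - y2 i A) + s2 i A) * ?D 0 Y"
    if "i < n" "?N 0 Y = q * ?D 0 Y" for i q Y
  proof -
    have b2: "co21 (Suc i) 1 A \<noteq> 0" using b that(1) by blast
    have y: "co20 (Suc i) 1 A = - (co21 (Suc i) 1 A * y2 i A)" and e: "co21 (Suc i) 0 A = co21 (Suc i) 1 A * e2 i A"
      using b2 unfolding y2_def e2_def by simp_all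
    have s: "co20 (Suc i) 0 A = co21 (Suc i) 1 A * s2 i A - co21 (Suc i) 1 A * e2 i A * y2 i A"
      using b2 unfolding s2_def e[symmetric] by simp
    show "?D (Suc i) Y = co21 (Suc i) 1 A * (q - y2 i A) * ?D 0 Y"
      unfolding form_decomp2[OF de, of "Suc i" 1] that(2) y by (simp add: algebra_simps)
    show "?N (Suc i) Y = co21 (Suc i) 1 A * (e2 i A * (q - y2 i A) + s2 i A) * ?D 0 Y"
      unfolding form_decomp2[OF de, of "Suc i" 0] that(2) s e by (simp add: algebra_simps)
  qed
  have quot: "?N (Suc i) Y / ?D (Suc i) Y = e2 i A + s2 i A / (q - y2 i A)"
    if "i < n" "?N 0 Y = q * ?D 0 Y" "?D 0 Y \<noteq> 0" "q \<noteq> y2 i A" for i q Y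
  proof -
    have b2: "co21 (Suc i) 1 A \<noteq> 0" using b that(1) by blast
    have "?N (Suc i) Y / ?D (Suc i) Y = (e2 i A * (q - y2 i A) + s2 i A) / (q - y2 i A)"
      unfolding D[OF that(1,2)] N[OF that(1,2)] using b2 that(3) by simp
    then show ?thesis using that(4) by (simp add: add_divide_distrib)
  qed
  let ?S = "{x \<in> cspace (Suc n). \<exists>Y. \<forall>i<Suc n. ?D i Y \<noteq> 0 \<and> x i = ?N i Y / ?D i Y}"
  let ?X = "bcams.X n (\<lambda>i. e2 i A) (\<lambda>i. s2 i A) (\<lambda>i. y2 i A)"
  have X: "?X q 0 = q" "?X q (Suc j) = (if j < n then e2 j A + s2 j A / (q - y2 j A) else 0)" for q j
    unfolding bcams.X_def[OF loc] by simp_all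
  have "?S = bcams.S n (\<lambda>i. e2 i A) (\<lambda>i. s2 i A) (\<lambda>i. y2 i A)"
    unfolding bcams.S_def[OF loc]
  proof (intro equalityI subsetI)
    fix x assume "x \<in> ?S"
    then obtain Y where c: "x \<in> cspace (Suc n)" and Y: "\<forall>i<Suc n. ?D i Y \<noteq> 0 \<and> x i = ?N i Y / ?D i Y" by blast
    define q where "q = x 0"
    have Y0: "?D 0 Y \<noteq> 0" "x 0 = ?N 0 Y / ?D 0 Y" using Y by blast+
    have q: "?N 0 Y = q * ?D 0 Y" unfolding q_def Y0(2) using Y0(1) by simp
    have ne: "q \<noteq> y2 i A" if "i < n" for i
    proof
      assume "q = y2 i A"
      then have "?D (Suc i) Y = 0" using D[OF that q] by simp
      then show False using Y that by (meson Suc_less_eq)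
    qed
    have "x k = ?X q k" for k
    proof (cases k)
      case (Suc j)
      show ?thesis
      proof (cases "j < n")
        case True
        have "x (Suc j) = ?N (Suc j) Y / ?D (Suc j) Y" using Y True by (meson Suc_less_eq)
        then show ?thesis unfolding Suc X using quot[OF True q Y0(1) ne[OF True]] True by simp
      qed (use c Suc X in \<open>simp add: cspace_def\<close>)
    qed (simp add: X q_def)
    then have "x = ?X q" by blast
    then show "x \<in> {?X q |q. \<forall>i<n. q \<noteq> y2 i A}" using ne by blast
  next
    fix x assume "x \<in> {?X q |q. \<forall>i<n. q \<noteq> y2 i A}"
    then obtain q where q: "x = ?X q" "\<forall>i<n. q \<noteq> y2 i A" by blast
    \<comment> \<open>Cramer's rule for D_0 = 1 and N_0 = q.\<close>
    define Y where "Y = (\<lambda>c::nat. if c = 0 then (ent 2 A 0 0 1 - ent 2 A 0 1 1 * q) / de2 A else (ent 2 A 0 1 0 * q - ent 2 A 0 0 0) / de2 A)"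
    have "b0 * ((a1 - b1 * q) / d) + b1 * ((b0 * q - a0) / d) = (b0 * a1 - b1 * a0) / d" "a0 * ((a1 - b1 * q) / d) + a1 * ((b0 * q - a0) / d) = q * ((b0 * a1 - b1 * a0) / d)"
      for a0 a1 b0 b1 d :: complex
      unfolding times_divide_eq_right add_divide_distrib[symmetric] by (simp_all add: algebra_simps)
    note this[of "ent 2 A 0 1 0" "ent 2 A 0 0 1" "ent 2 A 0 1 1" "de2 A" "ent 2 A 0 0 0", folded de2_def]
      this[of "ent 2 A 0 0 0" "ent 2 A 0 0 1" "ent 2 A 0 1 1" "de2 A" "ent 2 A 0 1 0", folded de2_def]
    then have D0: "?D 0 Y = 1" and N0: "?N 0 Y = q" using de unfolding Y_def by simp_all
    have NN: "?N 0 Y = q * ?D 0 Y" and DD: "?D 0 Y \<noteq> 0" unfolding D0 N0 by simp_all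
    have "\<forall>i<Suc n. ?D i Y \<noteq> 0 \<and> x i = ?N i Y / ?D i Y"
    proof (intro allI impI)
      fix i assume i: "i < Suc n"
      show "?D i Y \<noteq> 0 \<and> x i = ?N i Y / ?D i Y"
      proof (cases i)
        case 0
        show ?thesis unfolding 0 D0 N0 q(1) X by simp
      next
        case (Suc j)
        then have j: "j < n" using i by simp
        have nz: "co21 (Suc j) 1 A \<noteq> 0" "q - y2 j A \<noteq> 0" using b q(2) j by auto
        then have "?D (Suc j) Y \<noteq> 0" unfolding D[OF j NN] D0 by simp
        moreover have "x (Suc j) = ?N (Suc j) Y / ?D (Suc j) Y"
          using quot[OF j NN DD] nz(2) j unfolding q(1) X by simp
        ultimately show ?thesis unfolding Suc by blast
      qed
    qed
    moreover have "x \<in> cspace (Suc n)"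
      unfolding q(1) using subsetD[OF bcams.S_cspace[OF loc]] q(2) unfolding bcams.S_def[OF loc] by blast
    ultimately show "x \<in> ?S" by blast
  qed
  then show ?thesis unfolding multiview_affine_def bcams.V_def[OF loc] sum_two by simp
qed

lemma ent_poly: "2 * k * i + k * r + c < M \<Longrightarrow> rat_at M a (\<lambda>A. ent k A i r c)"
  unfolding ent_def by (intro rat_poly pvar)

theorem generic2:
  assumes n: "n \<ge> 1"
  shows "generic_arrangement 2 (Suc n) (\<lambda>A. has_EDD (Suc n) (multiview_affine 2 (Suc n) A) (real (3 * n + 1)))"
proof (rule generic_arrangementI)
  define M where "M = 2 * 2 * Suc n"
  \<comment> \<open>The witness: the first camera exchanges the coordinates, and camera i has rows
    (1, 0) and (-i, 1), which gives s = 1 and the distinct poles 1, 2, 3 and so on.\<close>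
  define a :: "nat \<Rightarrow> complex" where "a = (\<lambda>k. if k < 4 then (if k = 1 \<or> k = 2 then 1 else 0)
    else if k mod 4 = 0 then 1 else if k mod 4 = 1 then 0 else if k mod 4 = 2 then - of_nat (k div 4) else 1)"
  have a0: "ent 2 a 0 0 0 = 0" "ent 2 a 0 0 1 = 1" "ent 2 a 0 1 0 = 1" "ent 2 a 0 1 1 = 0" by (simp_all add: ent_def a_def)
  have ar: "(4 * i + 2) mod 4 = 2" "(4 * i + 2) div 4 = i" "(4 * i + 3) mod 4 = 3" "(4 * i + 1) mod 4 = 1" for i :: nat by presburger+
  have ai: "ent 2 a (Suc i) 0 0 = 1" "ent 2 a (Suc i) 0 1 = 0" "ent 2 a (Suc i) 1 0 = - of_nat (Suc i)" "ent 2 a (Suc i) 1 1 = 1" for i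
    using ar[of "Suc i"] by (simp_all add: ent_def a_def)
  have de: "de2 a = 1" unfolding de2_def a0 by simp
  have co: "co20 (Suc i) 0 a = 1" "co21 (Suc i) 0 a = 0" "co20 (Suc i) 1 a = - of_nat (Suc i)" "co21 (Suc i) 1 a = 1" for i
    unfolding co20_def co21_def de a0 ai by simp_all
  have ya: "y2 i a = of_nat (Suc i)" and sa: "s2 i a = 1" for i unfolding y2_def s2_def co by simp_all
  have re: "rat_at M a (\<lambda>A. ent 2 A i r c)" if "i < Suc n" "r < 2" "c < 2" for i r c
    by (rule ent_poly) (use that in \<open>simp add: M_def\<close>)
  have rde: "rat_at M a de2" unfolding de2_def by (intro rat_intros re) simp_all
  have rco: "rat_at M a (co20 i r)" "rat_at M a (co21 i r)" if "i < Suc n" "r < 2" for i r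
    unfolding co20_def co21_def by (intro rat_intros re rde; use that de in simp)+
  have ry: "rat_at M a (y2 i)" if "i < n" for i
    unfolding y2_def by (intro rat_intros rco) (use that co in simp_all)
  have rs: "rat_at M a (s2 i)" if "i < n" for i
    unfolding s2_def by (intro rat_intros rco ry) (use that co in simp_all)
  have "zgen M (\<lambda>A. de2 A \<noteq> 0)" by (rule zgen_rat[OF rde]) (simp add: de)
  moreover have "zgen M (\<lambda>A. \<forall>i<n. co21 (Suc i) 1 A \<noteq> 0)"
    by (intro zgen_all_less zgen_rat[where a = a] rco) (use co in simp_all)
  moreover have "zgen M (\<lambda>A. \<forall>i<n. s2 i A \<noteq> 0)"
    by (intro zgen_all_less zgen_rat[where a = a] rs) (simp_all add: sa)
  moreover have "zgen M (\<lambda>A. \<forall>i<n. \<forall>j<n. i \<noteq> j \<longrightarrow> y2 i A - y2 j A \<noteq> 0)"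
    by (intro zgen_all_less zgen_imp zgen_rat[where a = a] rat_diff ry) (simp_all add: ya)
  ultimately have "zgen M (\<lambda>A. de2 A \<noteq> 0 \<and> (\<forall>i<n. co21 (Suc i) 1 A \<noteq> 0) \<and> (\<forall>i<n. s2 i A \<noteq> 0) \<and>
      (\<forall>i<n. \<forall>j<n. i \<noteq> j \<longrightarrow> y2 i A - y2 j A \<noteq> 0))" by (intro zgen_conj)
  then show "zgen (2 * 2 * Suc n) (\<lambda>A. has_EDD (Suc n) (multiview_affine 2 (Suc n) A) (real (3 * n + 1)))"
    unfolding M_def
  proof (rule zgen_mono, elim conjE)
    fix A assume H: "de2 A \<noteq> 0" "\<forall>i<n. co21 (Suc i) 1 A \<noteq> 0" "\<forall>i<n. s2 i A \<noteq> 0" "\<forall>i<n. \<forall>j<n. i \<noteq> j \<longrightarrow> y2 i A - y2 j A \<noteq> 0"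
    have loc: "bcams n (\<lambda>i. s2 i A) (\<lambda>i. y2 i A)"
      by unfold_locales (use n H(3,4) in \<open>auto simp: inj_on_def\<close>)
    show "has_EDD (Suc n) (multiview_affine 2 (Suc n) A) (real (3 * n + 1))"
      unfolding normal_form2[OF H(1,2) loc n] by (rule has_EDD_I[OF bcams.EDD[OF loc]])
  qed
qed

subsection \<open>Arrangements of \<open>2 \<times> 3\<close> matrices\<close>

text \<open>Coordinates of a linear form with respect to the two rows of the first camera and the last coordinate.\<close>

definition de3 where "de3 A = ent 3 A 0 1 0 * ent 3 A 0 0 1 - ent 3 A 0 1 1 * ent 3 A 0 0 0"
definition co30 where "co30 i r A = (ent 3 A i r 0 * ent 3 A 0 0 1 - ent 3 A i r 1 * ent 3 A 0 0 0) / de3 A"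
definition co31 where "co31 i r A = (ent 3 A i r 1 * ent 3 A 0 1 0 - ent 3 A i r 0 * ent 3 A 0 1 1) / de3 A"
definition co32 where "co32 i r A = ent 3 A i r 2 - (co30 i r A * ent 3 A 0 1 2 + co31 i r A * ent 3 A 0 0 2)"
definition la3 where "la3 i A = - co31 (Suc i) 1 A / co32 (Suc i) 1 A"
definition mu3 where "mu3 i A = - co30 (Suc i) 1 A / co32 (Suc i) 1 A"
definition e3 where "e3 i A = co32 (Suc i) 0 A / co32 (Suc i) 1 A"
definition be3 where "be3 i A = (co31 (Suc i) 0 A + co32 (Suc i) 0 A * la3 i A) / co32 (Suc i) 1 A"
definition ga3 where "ga3 i A = (co30 (Suc i) 0 A + co32 (Suc i) 0 A * mu3 i A) / co32 (Suc i) 1 A"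

lemma form_decomp3:
  assumes "de3 A \<noteq> 0"
  shows "ent 3 A i r 0 * Y 0 + ent 3 A i r 1 * Y 1 + ent 3 A i r 2 * Y 2 =
    co30 i r A * (ent 3 A 0 1 0 * Y 0 + ent 3 A 0 1 1 * Y 1 + ent 3 A 0 1 2 * Y 2) +
    co31 i r A * (ent 3 A 0 0 0 * Y 0 + ent 3 A 0 0 1 * Y 1 + ent 3 A 0 0 2 * Y 2) + co32 i r A * Y (2::nat)"
proof -
  have "((r0 * a1 - r1 * a0) * (b0 * Y0 + b1 * Y1) + (r1 * b0 - r0 * b1) * (a0 * Y0 + a1 * Y1)) = (b0 * a1 - b1 * a0) * (r0 * Y0 + r1 * Y1)"
    for r0 r1 a0 a1 b0 b1 Y0 Y1 :: complex by (simp add: algebra_simps)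
  from this[of "ent 3 A i r 0" "ent 3 A 0 0 1" "ent 3 A i r 1" "ent 3 A 0 0 0" "ent 3 A 0 1 0" "Y 0" "ent 3 A 0 1 1" "Y 1", folded de3_def]
  have "ent 3 A i r 0 * Y 0 + ent 3 A i r 1 * Y 1 =
    co30 i r A * (ent 3 A 0 1 0 * Y 0 + ent 3 A 0 1 1 * Y 1) + co31 i r A * (ent 3 A 0 0 0 * Y 0 + ent 3 A 0 0 1 * Y (1::nat))"
    using assms unfolding co30_def co31_def by (simp add: divide_simps)
  then show ?thesis unfolding co32_def by (simp add: algebra_simps)
qed

text \<open>The plane coordinates are p = N_0/D_0 from the first camera and q = Y_2/D_0. In them
  every other camera is a quotient of affine-linear functions, and dividing numerator by denominator
  with respect to q leaves e + s/(q - l).\<close>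

lemma normal_form3:
  assumes de: "de3 A \<noteq> 0" and b: "\<forall>i<n. co32 (Suc i) 1 A \<noteq> 0"
    and par: "\<forall>i<n. be i = be3 i A \<and> ga i = ga3 i A \<and> la i = la3 i A \<and> mu i = mu3 i A"
    and loc: "tcams n be ga la mu"
  shows "multiview_affine 3 (Suc n) A = tcams.V n be ga la mu (\<lambda>i. e3 i A)"
proof -
  let ?N = "\<lambda>i Y. ent 3 A i 0 0 * Y 0 + ent 3 A i 0 1 * Y 1 + ent 3 A i 0 2 * Y (2::nat)"
    and ?D = "\<lambda>i Y. ent 3 A i 1 0 * Y 0 + ent 3 A i 1 1 * Y 1 + ent 3 A i 1 2 * Y (2::nat)"
  let ?l = "cams.l la mu" and ?s = "cams.s be ga"
  have D: "?D (Suc i) Y = co32 (Suc i) 1 A * (q - ?l i p) * ?D 0 Y" and N: "?N (Suc i) Y = co32 (Suc i) 1 A * (e3 i A * (q - ?l i p) + ?s i p) * ?D 0 Y"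
    if "i < n" "?N 0 Y = p * ?D 0 Y" "Y 2 = q * ?D 0 Y" for i p q Y
  proof -
    have b2: "co32 (Suc i) 1 A \<noteq> 0" using b that(1) by blast
    have la: "la i = - co31 (Suc i) 1 A / co32 (Suc i) 1 A" and mu: "mu i = - co30 (Suc i) 1 A / co32 (Suc i) 1 A"
      and be: "be i = (co31 (Suc i) 0 A + co32 (Suc i) 0 A * la i) / co32 (Suc i) 1 A"
      and ga: "ga i = (co30 (Suc i) 0 A + co32 (Suc i) 0 A * mu i) / co32 (Suc i) 1 A"
      using par[rule_format, OF that(1)] unfolding la3_def mu3_def be3_def ga3_def by argo+
    have c1: "co31 (Suc i) 1 A = - (co32 (Suc i) 1 A * la i)" "co30 (Suc i) 1 A = - (co32 (Suc i) 1 A * mu i)"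
      unfolding la mu using b2 by simp_all
    have c0: "co32 (Suc i) 0 A = co32 (Suc i) 1 A * e3 i A" unfolding e3_def using b2 by simp
    have c2: "co31 (Suc i) 0 A = co32 (Suc i) 1 A * be i - co32 (Suc i) 1 A * e3 i A * la i"
      "co30 (Suc i) 0 A = co32 (Suc i) 1 A * ga i - co32 (Suc i) 1 A * e3 i A * mu i"
      unfolding be ga c0[symmetric] using b2 by simp_all
    have alg1: "d' = c * (q - (a * p + m)) * k" if "d' = x0 * k + x1 * nn + c * yy" "nn = p * k" "yy = q * k" "x1 = - (c * a)" "x0 = - (c * m)"
      for d' c a m k nn yy x0 x1 :: complex
      unfolding that by (simp add: algebra_simps)
    have alg2: "d' = c * (e * (q - (a * p + m)) + (bb * p + g)) * k"
      if "d' = x0 * k + x1 * nn + x2 * yy" "nn = p * k" "yy = q * k" "x2 = c * e" "x1 = c * bb - c * e * a" "x0 = c * g - c * e * m"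
      for d' c a m k nn yy x0 x1 x2 e bb g :: complex
      unfolding that by (simp add: algebra_simps)
    show "?D (Suc i) Y = co32 (Suc i) 1 A * (q - ?l i p) * ?D 0 Y"
      unfolding cams.l_def by (rule alg1[OF form_decomp3[OF de] that(2,3) c1])
    show "?N (Suc i) Y = co32 (Suc i) 1 A * (e3 i A * (q - ?l i p) + ?s i p) * ?D 0 Y"
      unfolding cams.l_def cams.s_def by (rule alg2[OF form_decomp3[OF de] that(2,3) c0 c2])
  qed
  have quot: "?N (Suc i) Y / ?D (Suc i) Y = e3 i A + ?s i p / (q - ?l i p)"
    if "i < n" "?N 0 Y = p * ?D 0 Y" "Y 2 = q * ?D 0 Y" "?D 0 Y \<noteq> 0" "q \<noteq> ?l i p" for i p q Y
  proof -
    have b2: "co32 (Suc i) 1 A \<noteq> 0" using b that(1) by blast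
    have "?N (Suc i) Y / ?D (Suc i) Y = (e3 i A * (q - ?l i p) + ?s i p) / (q - ?l i p)"
      unfolding D[OF that(1-3)] N[OF that(1-3)] using b2 that(4) by simp
    then show ?thesis using that(5) by (simp add: add_divide_distrib)
  qed
  let ?S = "{x \<in> cspace (Suc n). \<exists>Y. \<forall>i<Suc n. ?D i Y \<noteq> 0 \<and> x i = ?N i Y / ?D i Y}"
  let ?X = "tcams.X n be ga la mu (\<lambda>i. e3 i A)"
  have X: "?X p q 0 = p" "?X p q (Suc j) = (if j < n then e3 j A + ?s j p / (q - ?l j p) else 0)" for p q j
    unfolding tcams.X_def[OF loc] by simp_all
  have "?S = tcams.S n be ga la mu (\<lambda>i. e3 i A)"
    unfolding tcams.S_def[OF loc]
  proof (intro equalityI subsetI)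
    fix x assume "x \<in> ?S"
    then obtain Y where c: "x \<in> cspace (Suc n)" and Y: "\<forall>i<Suc n. ?D i Y \<noteq> 0 \<and> x i = ?N i Y / ?D i Y" by blast
    define p where "p = x 0"
    define q where "q = Y 2 / ?D 0 Y"
    have Y0: "?D 0 Y \<noteq> 0" "x 0 = ?N 0 Y / ?D 0 Y" using Y by blast+
    have p: "?N 0 Y = p * ?D 0 Y" unfolding p_def Y0(2) using Y0(1) by simp
    have q: "Y 2 = q * ?D 0 Y" unfolding q_def using Y0(1) by simp
    have ne: "q \<noteq> ?l i p" if "i < n" for i
    proof
      assume "q = ?l i p"
      then have "?D (Suc i) Y = 0" using D[OF that p q] by simp
      then show False using Y that by (meson Suc_less_eq)
    qed
    have "x k = ?X p q k" for k
    proof (cases k)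
      case (Suc j)
      show ?thesis
      proof (cases "j < n")
        case True
        have "x (Suc j) = ?N (Suc j) Y / ?D (Suc j) Y" using Y True by (meson Suc_less_eq)
        then show ?thesis unfolding Suc X using quot[OF True p q Y0(1) ne[OF True]] True by simp
      qed (use c Suc X in \<open>simp add: cspace_def\<close>)
    qed (simp add: X p_def)
    then have "x = ?X p q" by blast
    then show "x \<in> {?X p q |p q. \<forall>i<n. q \<noteq> ?l i p}" using ne by blast
  next
    fix x assume "x \<in> {?X p q |p q. \<forall>i<n. q \<noteq> ?l i p}"
    then obtain p q where q: "x = ?X p q" "\<forall>i<n. q \<noteq> ?l i p" by blast
    \<comment> \<open>With the last coordinate set to q, the requirements D_0 = 1 and N_0 = p are
      two linear equations with right-hand sides \<open>B\<close> and \<open>C\<close>.\<close>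
    define B where "B = 1 - ent 3 A 0 1 2 * q"
    define C where "C = p - ent 3 A 0 0 2 * q"
    define Y where "Y = (\<lambda>c::nat. if c = 0 then (B * ent 3 A 0 0 1 - ent 3 A 0 1 1 * C) / de3 A
      else if c = 1 then (ent 3 A 0 1 0 * C - B * ent 3 A 0 0 0) / de3 A else q)"
    have cr: "b0 * ((B * a1 - b1 * C) / d) + b1 * ((b0 * C - B * a0) / d) = B * ((b0 * a1 - b1 * a0) / d)"
      "a0 * ((B * a1 - b1 * C) / d) + a1 * ((b0 * C - B * a0) / d) = C * ((b0 * a1 - b1 * a0) / d)"
      for a0 a1 b0 b1 d :: complex
      unfolding times_divide_eq_right add_divide_distrib[symmetric] by (simp_all add: algebra_simps)
    note cr(1)[of "ent 3 A 0 1 0" "ent 3 A 0 0 1" "ent 3 A 0 1 1" "de3 A" "ent 3 A 0 0 0", folded de3_def]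
      cr(2)[of "ent 3 A 0 0 0" "ent 3 A 0 0 1" "ent 3 A 0 1 1" "de3 A" "ent 3 A 0 1 0", folded de3_def]
    then have D0: "?D 0 Y = 1" and N0: "?N 0 Y = p" using de unfolding Y_def by (simp_all add: B_def C_def)
    have NN: "?N 0 Y = p * ?D 0 Y" and DD: "?D 0 Y \<noteq> 0" and QQ: "Y 2 = q * ?D 0 Y" unfolding D0 N0 by (simp_all add: Y_def)
    have "\<forall>i<Suc n. ?D i Y \<noteq> 0 \<and> x i = ?N i Y / ?D i Y"
    proof (intro allI impI)
      fix i assume i: "i < Suc n"
      show "?D i Y \<noteq> 0 \<and> x i = ?N i Y / ?D i Y"
      proof (cases i)
        case 0
        show ?thesis unfolding 0 D0 N0 q(1) X by simp
      next
        case (Suc j)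
        then have j: "j < n" using i by simp
        have nz: "co32 (Suc j) 1 A \<noteq> 0" "q - ?l j p \<noteq> 0" using b q(2) j by auto
        then have "?D (Suc j) Y \<noteq> 0" unfolding D[OF j NN QQ] D0 by simp
        moreover have "x (Suc j) = ?N (Suc j) Y / ?D (Suc j) Y"
          using quot[OF j NN QQ DD] nz(2) j unfolding q(1) X by simp
        ultimately show ?thesis unfolding Suc by blast
      qed
    qed
    moreover have "x \<in> cspace (Suc n)"
      unfolding q(1) using subsetD[OF tcams.S_cspace[OF loc]] q(2) unfolding tcams.S_def[OF loc] by blast
    ultimately show "x \<in> ?S" by blast
  qed
  then show ?thesis unfolding multiview_affine_def tcams.V_def[OF loc] sum_three by simp
qed

definition par3 where "par3 k A = (if k mod 4 = 0 then be3 (k div 4) A else if k mod 4 = 1 then ga3 (k div 4) A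
  else if k mod 4 = 2 then la3 (k div 4) A else mu3 (k div 4) A)"

lemma par3:
  assumes "i < n"
  shows "Be n (\<lambda>k. par3 k A) i = be3 i A" "Ga n (\<lambda>k. par3 k A) i = ga3 i A" "La n (\<lambda>k. par3 k A) i = la3 i A" "Mu n (\<lambda>k. par3 k A) i = mu3 i A"
proof -
  have "(4 * i + 3) mod 4 = 3" "(4 * i + 3) div 4 = i" "(4 * i + 2) mod 4 = 2" "(4 * i + 2) div 4 = i"
    "(4 * i + 1) mod 4 = 1" "(4 * i + 1) div 4 = i" by presburger+
  then show "Be n (\<lambda>k. par3 k A) i = be3 i A" "Ga n (\<lambda>k. par3 k A) i = ga3 i A" "La n (\<lambda>k. par3 k A) i = la3 i A" "Mu n (\<lambda>k. par3 k A) i = mu3 i A"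
    unfolding par_defs par3_def using assms by simp_all
qed

text \<open>An arrangement with prescribed normal form.\<close>

definition sec3 :: "(nat \<Rightarrow> complex) \<Rightarrow> nat \<Rightarrow> complex" where
  "sec3 z k = (let i = k div 6 - 1; t = k mod 6 in if k < 6 then (if t = 1 \<or> t = 3 then 1 else 0)
    else if t = 0 then z (4 * i + 1) else if t = 1 then z (4 * i) else if t = 2 then 0
    else if t = 3 then - z (4 * i + 3) else if t = 4 then - z (4 * i + 2) else 1)"

lemma sec3:
  "ent 3 (sec3 z) 0 0 0 = 0" "ent 3 (sec3 z) 0 0 1 = 1" "ent 3 (sec3 z) 0 0 2 = 0"
  "ent 3 (sec3 z) 0 1 0 = 1" "ent 3 (sec3 z) 0 1 1 = 0" "ent 3 (sec3 z) 0 1 2 = 0"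
  "ent 3 (sec3 z) (Suc i) 0 0 = z (4 * i + 1)" "ent 3 (sec3 z) (Suc i) 0 1 = z (4 * i)" "ent 3 (sec3 z) (Suc i) 0 2 = 0"
  "ent 3 (sec3 z) (Suc i) 1 0 = - z (4 * i + 3)" "ent 3 (sec3 z) (Suc i) 1 1 = - z (4 * i + 2)" "ent 3 (sec3 z) (Suc i) 1 2 = 1"
proof -
  have r: "(6 * j + t) mod 6 = t" "(6 * j + t) div 6 = j" if "t < 6" for j t :: nat using that by auto
  have E: "ent 3 (sec3 z) i r c = sec3 z (6 * i + (3 * r + c))" for i r c unfolding ent_def by (simp add: add.assoc)
  have sec0: "sec3 z (6 * 0 + t) = (if t = 1 \<or> t = 3 then 1 else 0)" if "t < 6" for t
    using that unfolding sec3_def Let_def by simp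
  have sec: "sec3 z (6 * Suc i + t) = (if t = 0 then z (4 * i + 1) else if t = 1 then z (4 * i) else if t = 2 then 0
    else if t = 3 then - z (4 * i + 3) else if t = 4 then - z (4 * i + 2) else 1)" if "t < 6" for t
    unfolding sec3_def Let_def r[OF that] by simp
  show "ent 3 (sec3 z) 0 0 0 = 0" "ent 3 (sec3 z) 0 0 1 = 1" "ent 3 (sec3 z) 0 0 2 = 0"
    "ent 3 (sec3 z) 0 1 0 = 1" "ent 3 (sec3 z) 0 1 1 = 0" "ent 3 (sec3 z) 0 1 2 = 0"
    unfolding E by (subst sec0; simp)+
  show "ent 3 (sec3 z) (Suc i) 0 0 = z (4 * i + 1)" "ent 3 (sec3 z) (Suc i) 0 1 = z (4 * i)" "ent 3 (sec3 z) (Suc i) 0 2 = 0"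
    "ent 3 (sec3 z) (Suc i) 1 0 = - z (4 * i + 3)" "ent 3 (sec3 z) (Suc i) 1 1 = - z (4 * i + 2)" "ent 3 (sec3 z) (Suc i) 1 2 = 1"
    unfolding E by (subst sec; simp)+
qed

lemma sec3_co:
  "de3 (sec3 z) = 1" "co30 (Suc i) 0 (sec3 z) = z (4 * i + 1)" "co31 (Suc i) 0 (sec3 z) = z (4 * i)" "co32 (Suc i) 0 (sec3 z) = 0"
  "co30 (Suc i) 1 (sec3 z) = - z (4 * i + 3)" "co31 (Suc i) 1 (sec3 z) = - z (4 * i + 2)" "co32 (Suc i) 1 (sec3 z) = 1"
  unfolding co32_def co30_def co31_def de3_def sec3 by simp_all

lemma sec3_par:
  "be3 i (sec3 z) = z (4 * i)" "ga3 i (sec3 z) = z (4 * i + 1)" "la3 i (sec3 z) = z (4 * i + 2)" "mu3 i (sec3 z) = z (4 * i + 3)"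
  unfolding be3_def ga3_def la3_def mu3_def sec3_co by simp_all

lemma rat3:
  assumes i: "i < n" and M: "M = 2 * 3 * Suc n"
  shows "rat_at M (sec3 z) de3" "rat_at M (sec3 z) (co32 (Suc i) 1)" "rat_at M (sec3 z) (be3 i)" "rat_at M (sec3 z) (ga3 i)"
    "rat_at M (sec3 z) (la3 i)" "rat_at M (sec3 z) (mu3 i)"
proof -
  let ?a = "sec3 z"
  have re: "rat_at M ?a (\<lambda>A. ent 3 A i r c)" if "i < Suc n" "r < 2" "c < 3" for i r c
    by (rule ent_poly) (use that in \<open>simp add: M\<close>)
  show rde: "rat_at M ?a de3" unfolding de3_def by (intro rat_intros re) simp_all
  have rco: "rat_at M ?a (co30 i r)" "rat_at M ?a (co31 i r)" if "i < Suc n" "r < 2" for i r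
    unfolding co30_def co31_def by (intro rat_intros re rde; use that sec3_co in simp)+
  have rco2: "rat_at M ?a (co32 i r)" if "i < Suc n" "r < 2" for i r
    unfolding co32_def by (intro rat_intros re rco) (use that in simp_all)
  show "rat_at M ?a (co32 (Suc i) 1)" by (rule rco2) (use i in simp_all)
  show rla: "rat_at M ?a (la3 i)" unfolding la3_def by (intro rat_intros rco rco2) (use i sec3_co in simp_all)
  show rmu: "rat_at M ?a (mu3 i)" unfolding mu3_def by (intro rat_intros rco rco2) (use i sec3_co in simp_all)
  show "rat_at M ?a (be3 i)" unfolding be3_def by (intro rat_intros rco rco2 rla) (use i sec3_co in simp_all)
  show "rat_at M ?a (ga3 i)" unfolding ga3_def by (intro rat_intros rco rco2 rmu) (use i sec3_co in simp_all)
qed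

text \<open>\<open>zgen_fix\<close> separates the cameras from the data in
  \<open>card_sols_generic\<close>. The condition on the cameras is pulled back along the normal
  form, for which \<open>sec3\<close> provides a preimage of every parameter vector.\<close>

theorem generic3:
  assumes n: "n \<ge> 2"
  shows "generic_arrangement 3 (Suc n) (\<lambda>A. has_EDD (Suc n) (multiview_affine 3 (Suc n) A) (real (nsol n)))"
proof (rule generic_arrangementI)
  define M where "M = 2 * 3 * Suc n"
  define Q where "Q = (\<lambda>x. tcams n (Be n x) (Ga n x) (La n x) (Mu n x) \<and>
    zgen (5 * n + 1) (\<lambda>y. finite (cams.sols n (Be n x) (Ga n x) (La n x) (Mu n x) (Ve n y) (y (5 * n))) \<and>
      card (cams.sols n (Be n x) (Ga n x) (La n x) (Mu n x) (Ve n y) (y (5 * n))) = nsol n))"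
  have "zgen (4 * n) Q"
  proof (rule zgen_mono[OF zgen_fix[OF card_sols_generic[OF n], of "4 * n"]])
    fix x
    let ?m = "\<lambda>y::nat \<Rightarrow> complex. \<lambda>i. if i < 4 * n then x i else y i"
    have low: "Be n (?m y) = Be n x" "Ga n (?m y) = Ga n x" "La n (?m y) = La n x" "Mu n (?m y) = Mu n x" "Ve n (?m y) = Ve n y" "?m y (5 * n) = y (5 * n)" for y
      using n unfolding par_defs by (auto simp: fun_eq_iff)
    assume "zgen (5 * n + 1) (\<lambda>y. tcams n (Be n (?m y)) (Ga n (?m y)) (La n (?m y)) (Mu n (?m y)) \<and>
      finite (cams.sols n (Be n (?m y)) (Ga n (?m y)) (La n (?m y)) (Mu n (?m y)) (Ve n (?m y)) (?m y (5 * n))) \<and>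
      card (cams.sols n (Be n (?m y)) (Ga n (?m y)) (La n (?m y)) (Mu n (?m y)) (Ve n (?m y)) (?m y (5 * n))) = nsol n)"
    then have z: "zgen (5 * n + 1) (\<lambda>y. tcams n (Be n x) (Ga n x) (La n x) (Mu n x) \<and>
      finite (cams.sols n (Be n x) (Ga n x) (La n x) (Mu n x) (Ve n y) (y (5 * n))) \<and>
      card (cams.sols n (Be n x) (Ga n x) (La n x) (Mu n x) (Ve n y) (y (5 * n))) = nsol n)"
      unfolding low .
    show "Q x" unfolding Q_def
    proof (rule conjI)
      from zgen_ex[OF z] show "tcams n (Be n x) (Ga n x) (La n x) (Mu n x)" by (elim exE conjE)
      show "zgen (5 * n + 1) (\<lambda>y. finite (cams.sols n (Be n x) (Ga n x) (La n x) (Mu n x) (Ve n y) (y (5 * n))) \<and>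
        card (cams.sols n (Be n x) (Ga n x) (La n x) (Mu n x) (Ve n y) (y (5 * n))) = nsol n)"
        using z by (rule zgen_mono) (erule conjunct2)
    qed
  qed simp
  then have "zgen M (\<lambda>A. Q (\<lambda>k. par3 k A))"
  proof (rule zgen_pullback)
    fix z :: "nat \<Rightarrow> complex"
    show "\<exists>a. \<forall>k<4 * n. rat_at M a (par3 k) \<and> par3 k a = z k"
    proof (intro exI[of _ "sec3 z"] allI impI)
      fix k assume "k < 4 * n"
      then have i: "k div 4 < n" by simp
      have R: "rat_at M (sec3 z) (be3 (k div 4))" "rat_at M (sec3 z) (ga3 (k div 4))" "rat_at M (sec3 z) (la3 (k div 4))" "rat_at M (sec3 z) (mu3 (k div 4))"
        by (rule rat3[OF i M_def])+
      have "k mod 4 = 0 \<or> k mod 4 = 1 \<or> k mod 4 = 2 \<or> k mod 4 = 3" by presburger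
      then consider "k mod 4 = 0" | "k mod 4 = 1" | "k mod 4 = 2" | "k mod 4 = 3" by (elim disjE)
      then show "rat_at M (sec3 z) (par3 k) \<and> par3 k (sec3 z) = z k"
      proof cases
        case 1
        have "par3 k = be3 (k div 4)" unfolding par3_def using 1 by simp
        moreover have "4 * (k div 4) + 0 = k" using mult_div_mod_eq[of 4 k] 1 by simp
        ultimately show ?thesis using R(1) sec3_par(1)[of "k div 4" z] by simp
      next
        case 2
        have "par3 k = ga3 (k div 4)" unfolding par3_def using 2 by simp
        moreover have "4 * (k div 4) + 1 = k" using mult_div_mod_eq[of 4 k] 2 by simp
        ultimately show ?thesis using R(2) sec3_par(2)[of "k div 4" z] by simp
      next
        case 3
        have "par3 k = la3 (k div 4)" unfolding par3_def using 3 by simp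
        moreover have "4 * (k div 4) + 2 = k" using mult_div_mod_eq[of 4 k] 3 by simp
        ultimately show ?thesis using R(3) sec3_par(3)[of "k div 4" z] by simp
      next
        case 4
        have "par3 k = mu3 (k div 4)" unfolding par3_def using 4 by simp
        moreover have "4 * (k div 4) + 3 = k" using mult_div_mod_eq[of 4 k] 4 by simp
        ultimately show ?thesis using R(4) sec3_par(4)[of "k div 4" z] by simp
      qed
    qed
  qed
  moreover have "zgen M (\<lambda>A. de3 A \<noteq> 0)"
    by (rule zgen_rat[OF rat3(1)[OF _ M_def, of 0]]) (use n sec3_co in simp_all)
  moreover have "zgen M (\<lambda>A. \<forall>i<n. co32 (Suc i) 1 A \<noteq> 0)"
    by (intro zgen_all_less zgen_rat[OF rat3(2)[OF _ M_def]]) (use sec3_co in simp_all)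
  ultimately have "zgen M (\<lambda>A. Q (\<lambda>k. par3 k A) \<and> de3 A \<noteq> 0 \<and> (\<forall>i<n. co32 (Suc i) 1 A \<noteq> 0))" by (intro zgen_conj)
  then show "zgen (2 * 3 * Suc n) (\<lambda>A. has_EDD (Suc n) (multiview_affine 3 (Suc n) A) (real (nsol n)))"
    unfolding M_def
  proof (rule zgen_mono, elim conjE)
    fix A assume H: "Q (\<lambda>k. par3 k A)" "de3 A \<noteq> 0" "\<forall>i<n. co32 (Suc i) 1 A \<noteq> 0"
    let ?x = "\<lambda>k. par3 k A"
    have tc: "tcams n (Be n ?x) (Ga n ?x) (La n ?x) (Mu n ?x)" using H(1) unfolding Q_def by (rule conjunct1)
    have gen: "zgen (5 * n + 1) (\<lambda>y. finite (cams.sols n (Be n ?x) (Ga n ?x) (La n ?x) (Mu n ?x) (Ve n y) (y (5 * n))) \<and>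
      card (cams.sols n (Be n ?x) (Ga n ?x) (La n ?x) (Mu n ?x) (Ve n y) (y (5 * n))) = nsol n)" using H(1) unfolding Q_def by (rule conjunct2)
    have eq: "multiview_affine 3 (Suc n) A = tcams.V n (Be n ?x) (Ga n ?x) (La n ?x) (Mu n ?x) (\<lambda>i. e3 i A)"
      by (rule normal_form3[OF H(2,3) _ tc]) (simp add: par3)
    show "has_EDD (Suc n) (multiview_affine 3 (Suc n) A) (real (nsol n))"
      unfolding eq by (rule has_EDD_I[OF tcams_EDD[OF tc gen]])
  qed
qed

lemma nsol_eq:
  assumes "n \<ge> 2"
  shows "real (nsol n) = 9/2 * (real (Suc n))^2 - 19/2 * real (Suc n) + 3"
proof -
  have "{(i,j). i < j \<and> j < n} = (\<lambda>(j,i). (i,j)) ` (SIGMA j:{..<n}. {..<j})" by (auto simp: image_iff)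
  moreover have "inj_on (\<lambda>(j,i). (i,j)) (SIGMA j:{..<n}. {..<j})" by (auto simp: inj_on_def)
  ultimately have c: "card {(i,j). i < j \<and> j < n} = (\<Sum>j<n. j)" by (simp add: card_image card_SigmaI)
  have "2 * real (\<Sum>j<k. j) = real k * (real k - 1)" for k by (induction k) (simp_all add: algebra_simps)
  then have c2: "2 * real (card {(i,j). i < j \<and> j < n}) = real n * real n - real n"
    unfolding c by (simp add: algebra_simps)
  have "real (nsol n) = 3 * real n - 2 + real n + 9 * real (card {(i,j). i < j \<and> j < n})"
    unfolding nsol_def using assms by (simp add: of_nat_diff)
  moreover have "9/2 * (real (Suc n))^2 - 19/2 * real (Suc n) + 3 = 9/2 * (real n * real n) - 1/2 * real n - 2"
    by (simp add: power2_eq_square field_simps)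
  ultimately show ?thesis using c2 by linarith
qed

theorem theorem1p9:
  fixes m :: nat
  shows "(m \<ge> 2 \<longrightarrow> generic_arrangement 2 m
            (\<lambda>A. has_EDD m (multiview_affine 2 m A) (3 * real m - 2)))
       \<and> (m \<ge> 3 \<longrightarrow> generic_arrangement 3 m
            (\<lambda>A. has_EDD m (multiview_affine 3 m A) (9/2 * (real m)^2 - 19/2 * real m + 3)))"
proof (intro conjI impI)
  assume "m \<ge> 2"
  then obtain n where m: "m = Suc n" and n: "n \<ge> 1" by (cases m) auto
  have "real (3 * n + 1) = 3 * real m - 2" unfolding m by simp
  then show "generic_arrangement 2 m (\<lambda>A. has_EDD m (multiview_affine 2 m A) (3 * real m - 2))"
    using generic2[OF n] unfolding m by simp
next
  assume "m \<ge> 3"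
  then obtain n where m: "m = Suc n" and n: "n \<ge> 2" by (cases m) auto
  show "generic_arrangement 3 m (\<lambda>A. has_EDD m (multiview_affine 3 m A) (9/2 * (real m)^2 - 19/2 * real m + 3))"
    using generic3[OF n] unfolding nsol_eq[OF n] m .
qed

end
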